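(* Let $T>0$. Let $\varphi\in C([0,\infty))$, $\varphi(0)=0$, $\varphi'\in L^\infty(0,\infty)$, with $C_\varphi:=\lim_{u\to\infty}\varphi(u)/u$ existing in $\mathbb{R}$, and let $u\mapsto\varphi(u)-C_\varphi u$ be bounded and monotonic in $(0,\infty)$. Let $u_0\in\mathcal{M}^+(\mathbb{R})$ satisfy $u_{0s}=\sum_{l=1}^Nc_l\delta_{x_l}$ with $N\in\mathbb{N}$, $x_l\in\mathbb{R}$, $c_l\in[0,\infty)$. If $u\mapsto\varphi(u)-C_\varphi u$ is nondecreasing, there exists at most one entropy solution $u$ of problem $(P)$ which satisfies, for a.e. $t\in(0,T)$ and all $x_0\in\operatorname{supp}\mathcal{T}_{-C_\varphi t}(u_s(\cdot,t))$, $$\operatorname*{ess\,lim}_{x\to x_0^+}u_r(x+C_\varphi t,t)=\infty,$$ together with the condition $$\operatorname*{ess\,lim}_{t\to0^+}\|u_r(\cdot,t)-u_{0r}\|_{L^1(\mathbb{R})}=0 .$$ If $u\mapsto\varphi(u)-C_\varphi u$ is nonincreasing, the same holds with the first condition replaced by $\operatorname{ess\,lim}_{x\to x_0^-}u_r(x+C_\varphi t,t)=\infty$ for a.e. $t\in(0,T)$ and all $x_0\in\operatorname{supp}\mathcal{T}_{-C_\varphi t}(u_s(\cdot,t))$.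
   Context: Problem $(P)$ is the Cauchy problem $u_t+[\varphi(u)]_x=0$ in $S:=\mathbb{R}\times(0,T)$, $u=u_0$ in $\mathbb{R}\times\{0\}$. Measures. $\mathcal{M}(\mathbb{R})$ is the space of finite Radon measures on $\mathbb{R}$ with norm $\|\mu\|_{\mathcal{M}(\mathbb{R})}=|\mu|(\mathbb{R})$, $\mathcal{M}^+(\mathbb{R})$ the cone of nonnegative ones, and $\langle\mu,\rho\rangle_{\mathbb{R}}=\int\rho\,d\mu$. Each $\mu$ decomposes as $\mu=\mu_{ac}+\mu_s$ with respect to Lebesgue measure; $\mu_r\in L^1(\mathbb{R})$ is the density of $\mu_{ac}$. The translate $\mathcal{T}_a(\mu)$ is defined by $\langle\mathcal{T}_a(\mu),\rho\rangle_{\mathbb{R}}=\int\rho(x+a)\,d\mu(x)$. $L^\infty(0,T;\mathcal{M}^+(\mathbb{R}))$ is the set of finite nonnegative Radon measures $u$ on $S$ such that for a.e. $t\in(0,T)$ there is $u(\cdot,t)\in\mathcal{M}^+(\mathbb{R})$ with: for $\zeta\in C([0,T];C_c(\mathbb{R}))$, $t\mapsto\langle u(\cdot,t),\zeta(\cdot,t)\rangle_{\mathbb{R}}$ is in $L^1(0,T)$ and $\int_S\zeta\,du=\int_0^T\langle u(\cdot,t),\zeta(\cdot,t)\rangle_{\mathbb{R}}dt$; and $t\mapsto\|u(\cdot,t)\|_{\mathcal{M}(\mathbb{R})}$ is in $L^\infty(0,T)$. For such $u$, $u_s(\cdot,t)=[u(\cdot,t)]_s$ and $u_r(\cdot,t)=[u(\cdot,t)]_r$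 for a.e. $t$. $\operatorname{ess\,lim}$ denotes the limit taken along arguments outside a suitable Lebesgue-null set. Solution: $u\in L^\infty(0,T;\mathcal{M}^+(\mathbb{R}))$ is a solution of $(P)$ if for all $\zeta\in C^1([0,T];C^1_c(\mathbb{R}))$ with $\zeta(\cdot,T)=0$, $$\iint_S[u_r\zeta_t+\varphi(u_r)\zeta_x]dxdt+\int_0^T\langle u_s(\cdot,t),\zeta_t(\cdot,t)+C_\varphi\zeta_x(\cdot,t)\rangle_{\mathbb{R}}dt=-\langle u_0,\zeta(\cdot,0)\rangle_{\mathbb{R}}.$$ It is an entropy solution if moreover, for all such $\zeta\ge0$ and all $E,F:[0,\infty)\to\mathbb{R}$ with $E$ convex, $E',F'\in L^\infty(0,\infty)$, $F'=E'\varphi'$ and existing limits $C_E=\lim_{u\to\infty}E(u)/u$, $C_F=\lim_{u\to\infty}F(u)/u$, $$\iint_S[E(u_r)\zeta_t+F(u_r)\zeta_x]dxdt+\int_0^T\langle u_s(\cdot,t),C_E\zeta_t(\cdot,t)+C_F\zeta_x(\cdot,t)\rangle_{\mathbb{R}}dt\ge-\int_{\mathbb{R}}E(u_{0r})\zeta(x,0)dx-C_E\langle u_{0s},\zeta(\cdot,0)\rangle_{\mathbb{R}}.$$ *)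

theory Defs
  imports "HOL-Probability.Probability"
begin

section \<open>Lebesgue decomposition\<close>

definition mutually_singular :: "'a measure \<Rightarrow> 'a measure \<Rightarrow> bool" where
  "mutually_singular L \<sigma> \<longleftrightarrow> (\<exists>A\<in>null_sets L. emeasure \<sigma> (space L - A) = 0)"

definition lebesgue_decomposition ::
  "'a measure \<Rightarrow> 'a measure \<Rightarrow> 'a measure \<Rightarrow> 'a measure \<Rightarrow> bool" where
  "lebesgue_decomposition L \<mu> \<alpha> \<sigma> \<longleftrightarrow>
     sets \<alpha> = sets \<mu> \<and> sets \<sigma> = sets \<mu> \<and>
     absolutely_continuous L \<alpha> \<and> mutually_singular L \<sigma> \<and>
     (\<forall>X\<in>sets \<mu>. emeasure \<mu> X = emeasure \<alpha> X + emeasure \<sigma> X)"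

definition ac_part :: "'a measure \<Rightarrow> 'a measure \<Rightarrow> 'a measure" where
  "ac_part L \<mu> = (THE \<alpha>. \<exists>\<sigma>. lebesgue_decomposition L \<mu> \<alpha> \<sigma>)"

definition sing_part :: "'a measure \<Rightarrow> 'a measure \<Rightarrow> 'a measure" where
  "sing_part L \<mu> = (THE \<sigma>. \<exists>\<alpha>. lebesgue_decomposition L \<mu> \<alpha> \<sigma>)"

definition reg_part :: "'a measure \<Rightarrow> 'a measure \<Rightarrow> 'a \<Rightarrow> real" where
  "reg_part L \<mu> x = enn2real (RN_deriv L (ac_part L \<mu>) x)"

lemma lebesgue_decomposition_exists:
  assumes "finite_measure \<mu>" and sets_eq: "sets \<mu> = sets L"
  shows "\<exists>\<alpha> \<sigma>. lebesgue_decomposition L \<mu> \<alpha> \<sigma>"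
proof -
  interpret finite_measure \<mu> by fact
  have sp: "space \<mu> = space L" using sets_eq by (rule sets_eq_imp_space_eq)
  have ne: "null_sets L \<noteq> {}" by auto
  obtain f :: "nat \<Rightarrow> _" where f: "range f \<subseteq> emeasure \<mu> ` null_sets L"
      "(SUP N\<in>null_sets L. emeasure \<mu> N) = Sup (range f)"
    using ennreal_Sup_countable_SUP[of "emeasure \<mu> ` null_sets L"] ne by (metis image_is_empty)
  have "\<forall>n. \<exists>N. N \<in> null_sets L \<and> f n = emeasure \<mu> N" using f(1) by blast
  then obtain N where N: "\<And>n. N n \<in> null_sets L" "\<And>n. f n = emeasure \<mu> (N n)" by metis
  define Z where "Z = (\<Union>n. N n)"
  have Z: "Z \<in> null_sets L" unfolding Z_def using N by auto
  then have Zm[measurable]: "Z \<in> sets \<mu>" using sets_eq by auto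
  have "Sup (range f) \<le> emeasure \<mu> Z"
    unfolding N(2) Z_def
    using N(1) Zm[unfolded Z_def] by (intro SUP_least emeasure_mono) auto
  then have max: "emeasure \<mu> A \<le> emeasure \<mu> Z" if "A \<in> null_sets L" for A
    using f(2) that by (metis SUP_upper order_trans)
  have zero: "emeasure \<mu> (A - Z) = 0" if A: "A \<in> null_sets L" for A
  proof -
    have Am: "A \<in> sets \<mu>" using A sets_eq by auto
    have "emeasure \<mu> Z + emeasure \<mu> (A - Z) = emeasure \<mu> (Z \<union> (A - Z))"
      using Am Zm by (intro plus_emeasure) auto
    also have "\<dots> = emeasure \<mu> (Z \<union> A)" by (simp add: Un_Diff_cancel)
    also have "\<dots> \<le> emeasure \<mu> Z" using A Z by (intro max) auto
    finally have "emeasure \<mu> Z + emeasure \<mu> (A - Z) \<le> emeasure \<mu> Z + 0" by simp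
    then have "emeasure \<mu> (A - Z) \<le> 0"
      unfolding ennreal_add_left_cancel_le using emeasure_finite[of Z] by auto
    then show ?thesis by simp
  qed
  let ?\<alpha> = "density \<mu> (indicator (space \<mu> - Z))" and ?\<sigma> = "density \<mu> (indicator Z)"
  have dens: "emeasure (density \<mu> (indicator Y)) X = emeasure \<mu> (Y \<inter> X)"
    if "X \<in> sets \<mu>" "Y \<in> sets \<mu>" for X Y
    using that by (intro emeasure_restricted) auto
  have ea: "emeasure ?\<alpha> X = emeasure \<mu> (X - Z)" if "X \<in> sets \<mu>" for X
  proof -
    have "(space \<mu> - Z) \<inter> X = X - Z" using sets.sets_into_space[OF that] by auto
    then show ?thesis using dens[OF that, of "space \<mu> - Z"] Zm by (metis sets.compl_sets)
  qed
  have es: "emeasure ?\<sigma> X = emeasure \<mu> (X \<inter> Z)" if "X \<in> sets \<mu>" for X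
    using dens[OF that Zm] by (simp add: Int_commute)
  have "lebesgue_decomposition L \<mu> ?\<alpha> ?\<sigma>"
    unfolding lebesgue_decomposition_def mutually_singular_def absolutely_continuous_def
  proof (intro conjI ballI)
    show "null_sets L \<subseteq> null_sets ?\<alpha>"
    proof
      fix A assume A: "A \<in> null_sets L"
      then have "A \<in> sets \<mu>" using sets_eq by auto
      then show "A \<in> null_sets ?\<alpha>" using zero[OF A] ea[of A] by (auto simp: null_sets_def)
    qed
    have "emeasure ?\<sigma> (space L - Z) = emeasure \<mu> ((space L - Z) \<inter> Z)"
      using es[of "space L - Z"] Zm sp by (metis sets.compl_sets)
    also have "(space L - Z) \<inter> Z = {}" by auto
    finally show "\<exists>A\<in>null_sets L. emeasure ?\<sigma> (space L - A) = 0" using Z by auto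
    fix X assume X: "X \<in> sets \<mu>"
    have "emeasure \<mu> X = emeasure \<mu> ((X - Z) \<union> (X \<inter> Z))" by (rule arg_cong[of _ _ "emeasure \<mu>"]) auto
    also have "\<dots> = emeasure \<mu> (X - Z) + emeasure \<mu> (X \<inter> Z)"
      using X Zm by (intro plus_emeasure[symmetric]) auto
    finally show "emeasure \<mu> X = emeasure ?\<alpha> X + emeasure ?\<sigma> X"
      using ea[OF X] es[OF X] by simp
  qed simp_all
  then show ?thesis by blast
qed

lemma lebesgue_decomposition_unique:
  assumes d: "lebesgue_decomposition L \<mu> \<alpha> \<sigma>" and d': "lebesgue_decomposition L \<mu> \<alpha>' \<sigma>'"
    and sets_eq: "sets \<mu> = sets L"
  shows "\<alpha> = \<alpha>'" "\<sigma> = \<sigma>'"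
proof -
  obtain A A' where A: "A \<in> null_sets L" "emeasure \<sigma> (space L - A) = 0"
      and A': "A' \<in> null_sets L" "emeasure \<sigma>' (space L - A') = 0"
    using d d' unfolding lebesgue_decomposition_def mutually_singular_def by blast
  define B where "B = A \<union> A'"
  have B: "B \<in> null_sets L" using A A' by (auto simp: B_def)
  have key: "emeasure a X = emeasure \<mu> (X - B) \<and> emeasure s X = emeasure \<mu> (X \<inter> B)"
    if X: "X \<in> sets \<mu>" and D: "lebesgue_decomposition L \<mu> a s"
      and C: "C \<in> null_sets L" "emeasure s (space L - C) = 0" "C \<subseteq> B" for X a s C
  proof -
    have ss: "sets a = sets \<mu>" "sets s = sets \<mu>"
      and ac: "null_sets L \<subseteq> null_sets a"
      and sum: "\<And>Y. Y \<in> sets \<mu> \<Longrightarrow> emeasure \<mu> Y = emeasure a Y + emeasure s Y"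
      using D by (auto simp: lebesgue_decomposition_def absolutely_continuous_def)
    have Bm: "B \<in> sets \<mu>" using B sets_eq by auto
    have 1: "X - B \<in> sets \<mu>" "X \<inter> B \<in> sets \<mu>" using X Bm by auto
    have Xs: "X \<subseteq> space L" using X sets_eq by (metis sets.sets_into_space)
    have "emeasure s (X - B) \<le> emeasure s (space L - C)"
      using Xs C ss sets_eq by (intro emeasure_mono) auto
    then have s0: "emeasure s (X - B) = 0" using C by simp
    have "emeasure a (X \<inter> B) \<le> emeasure a B" using Bm ss by (intro emeasure_mono) auto
    moreover have "emeasure a B = 0" using ac B by auto
    ultimately have a0: "emeasure a (X \<inter> B) = 0" by simp
    have sp: "emeasure m X = emeasure m (X - B) + emeasure m (X \<inter> B)" if "sets m = sets \<mu>" for m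
    proof -
      have "emeasure m X = emeasure m ((X - B) \<union> (X \<inter> B))"
        by (rule arg_cong[of _ _ "emeasure m"]) auto
      also have "\<dots> = emeasure m (X - B) + emeasure m (X \<inter> B)"
        using 1 that by (intro plus_emeasure[symmetric]) auto
      finally show ?thesis .
    qed
    show ?thesis using sp[OF ss(1)] sp[OF ss(2)] sum[OF 1(1)] sum[OF 1(2)] s0 a0 by simp
  qed
  have ss: "sets \<alpha> = sets \<mu>" "sets \<sigma> = sets \<mu>" "sets \<alpha>' = sets \<mu>" "sets \<sigma>' = sets \<mu>"
    using d d' by (auto simp: lebesgue_decomposition_def)
  show "\<alpha> = \<alpha>'"
    using key[OF _ d A] key[OF _ d' A'] ss by (intro measure_eqI) (auto simp: B_def)
  show "\<sigma> = \<sigma>'"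
    using key[OF _ d A] key[OF _ d' A'] ss by (intro measure_eqI) (auto simp: B_def)
qed

lemma lebesgue_decomposition_parts:
  assumes "finite_measure \<mu>" "sets \<mu> = sets L"
  shows "lebesgue_decomposition L \<mu> (ac_part L \<mu>) (sing_part L \<mu>)"
proof -
  obtain \<alpha> \<sigma> where D: "lebesgue_decomposition L \<mu> \<alpha> \<sigma>"
    using lebesgue_decomposition_exists[OF assms] by blast
  have "ac_part L \<mu> = \<alpha>"
    unfolding ac_part_def
    by (rule the_equality, use D in blast, elim exE,
        rule lebesgue_decomposition_unique(1)[OF _ D assms(2)])
  moreover have "sing_part L \<mu> = \<sigma>"
    unfolding sing_part_def
    by (rule the_equality, use D in blast, elim exE,
        rule lebesgue_decomposition_unique(2)[OF _ D assms(2)])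
  ultimately show ?thesis using D by simp
qed

section \<open>Finite measures on the line\<close>

(* On the real line and on the open strip every finite Borel measure is Radon. *)
definition finite_radon :: "real measure \<Rightarrow> bool" where
  "finite_radon \<mu> \<longleftrightarrow> sets \<mu> = sets borel \<and> finite_measure \<mu>"

definition translate :: "real \<Rightarrow> real measure \<Rightarrow> real measure" where
  "translate a \<mu> = distr \<mu> borel (\<lambda>x. x + a)"

definition supp_measure :: "real measure \<Rightarrow> real set" where
  "supp_measure \<mu> = {x. \<forall>U. open U \<and> x \<in> U \<longrightarrow> emeasure \<mu> U \<noteq> 0}"

section \<open>Essential bounds, essential limits, Lipschitz functions\<close>

definition L_infty :: "'a measure \<Rightarrow> ('a \<Rightarrow> real) \<Rightarrow> bool" where
  "L_infty M f \<longleftrightarrow> f \<in> borel_measurable M \<and> (\<exists>C. AE x in M. \<bar>f x\<bar> \<le> C)"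

definition ess_filterlim :: "(real \<Rightarrow> 'b) \<Rightarrow> 'b filter \<Rightarrow> real \<Rightarrow> real set \<Rightarrow> bool" where
  "ess_filterlim f G a A \<longleftrightarrow> (\<exists>N. negligible N \<and> filterlim f G (at a within (A - N)))"

(* For f on [0,\<infinity>): f' = g in the weak sense with g in L^\<infinity>(0,\<infinity>), i.e. f is the locally absolutely
   continuous representative of its class on [0,\<infinity>). *)
definition has_L_infty_deriv :: "(real \<Rightarrow> real) \<Rightarrow> (real \<Rightarrow> real) \<Rightarrow> bool" where
  "has_L_infty_deriv f g \<longleftrightarrow> L_infty (lebesgue_on {0<..}) g \<and>
     (\<forall>a b. 0 \<le> a \<and> a \<le> b \<longrightarrow> f b - f a = (\<integral>x. g x \<partial>lebesgue_on {a<..<b}))"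

section \<open>Test functions\<close>

(* Functions of (x,t) are curried, space variable first. The space C_c carries its usual
   inductive-limit topology: the supports of the f(.,t), for t in [0,T], lie in one compact set,
   and t \<mapsto> f(.,t) is continuous for the sup norm. *)
definition C_Cc :: "real \<Rightarrow> (real \<Rightarrow> real \<Rightarrow> real) \<Rightarrow> bool" where
  "C_Cc T f \<longleftrightarrow>
     (\<exists>K. compact K \<and> (\<forall>t\<in>{0..T}. \<forall>x. x \<notin> K \<longrightarrow> f x t = 0)) \<and>
     (\<forall>t\<in>{0..T}. continuous_on UNIV (\<lambda>x. f x t)) \<and>
     (\<forall>t\<in>{0..T}. uniform_limit UNIV (\<lambda>s x. f x s) (\<lambda>x. f x t) (at t within {0..T}))"

(* z is in C^1([0,T]; C^1_c(R)), with partial derivatives zt and zx: the difference quotients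
   in t converge in the C^1 norm, and zt is again a continuous curve in C^1_c. *)
definition C1_C1c ::
  "real \<Rightarrow> (real \<Rightarrow> real \<Rightarrow> real) \<Rightarrow> (real \<Rightarrow> real \<Rightarrow> real) \<Rightarrow> (real \<Rightarrow> real \<Rightarrow> real) \<Rightarrow> bool" where
  "C1_C1c T z zt zx \<longleftrightarrow> C_Cc T z \<and> C_Cc T zx \<and>
     (\<forall>t\<in>{0..T}. \<forall>x. ((\<lambda>y. z y t) has_real_derivative zx x t) (at x)) \<and>
     (\<exists>ztx. C_Cc T zt \<and> C_Cc T ztx \<and>
       (\<forall>t\<in>{0..T}. \<forall>x. ((\<lambda>y. zt y t) has_real_derivative ztx x t) (at x)) \<and>
       (\<forall>t\<in>{0..T}.
          uniform_limit UNIV (\<lambda>s x. (z x s - z x t) / (s - t)) (\<lambda>x. zt x t) (at t within {0..T}) \<and>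
          uniform_limit UNIV (\<lambda>s x. (zx x s - zx x t) / (s - t)) (\<lambda>x. ztx x t) (at t within {0..T})))"

section \<open>Measures on the strip\<close>

definition strip :: "real \<Rightarrow> (real \<times> real) set" where
  "strip T = UNIV \<times> {0<..<T}"

abbreviation lborel_strip :: "real \<Rightarrow> (real \<times> real) measure" where
  "lborel_strip T \<equiv> restrict_space lborel (strip T)"

(* v t plays the role of u(.,t). Integrals and measurability in t refer to the completed
   Lebesgue measure, so that v may be changed on any null set of times. *)
definition time_sections ::
  "real \<Rightarrow> (real \<times> real) measure \<Rightarrow> (real \<Rightarrow> real measure) \<Rightarrow> bool" where
  "time_sections T u v \<longleftrightarrow>
     (AE t in lebesgue_on {0<..<T}. finite_radon (v t)) \<and>
     (\<forall>z. C_Cc T z \<longrightarrow>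
        integrable (lebesgue_on {0<..<T}) (\<lambda>t. \<integral>x. z x t \<partial>v t) \<and>
        (\<integral>p. z (fst p) (snd p) \<partial>u) = (\<integral>t. (\<integral>x. z x t \<partial>v t) \<partial>lebesgue_on {0<..<T})) \<and>
     L_infty (lebesgue_on {0<..<T}) (\<lambda>t. measure (v t) UNIV)"

definition L_infty_meas :: "real \<Rightarrow> (real \<times> real) measure \<Rightarrow> bool" where
  "L_infty_meas T u \<longleftrightarrow> sets u = sets (restrict_space borel (strip T)) \<and> finite_measure u \<and>
     (\<exists>v. time_sections T u v)"

(* Determined for a.e. t. *)
definition section_at :: "real \<Rightarrow> (real \<times> real) measure \<Rightarrow> real \<Rightarrow> real measure" where
  "section_at T u = (SOME v. time_sections T u v)"

definition u_sing :: "real \<Rightarrow> (real \<times> real) measure \<Rightarrow> real \<Rightarrow> real measure" where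
  "u_sing T u t = sing_part lborel (section_at T u t)"

(* u_r is the density of the absolutely continuous part of u on the strip, which makes it jointly
   measurable; for a.e. t its time section is a.e. equal to the density of [u(.,t)]_ac. *)
definition u_reg :: "real \<Rightarrow> (real \<times> real) measure \<Rightarrow> real \<Rightarrow> real \<Rightarrow> real" where
  "u_reg T u x t = reg_part (lborel_strip T) u (x, t)"

section \<open>Solutions\<close>

(* C stands for the limit of \<phi>(u)/u at infinity. *)
definition solution ::
  "real \<Rightarrow> (real \<Rightarrow> real) \<Rightarrow> real \<Rightarrow> real measure \<Rightarrow> (real \<times> real) measure \<Rightarrow> bool" where
  "solution T \<phi> C u0 u \<longleftrightarrow> L_infty_meas T u \<and>
     (\<forall>z zt zx. C1_C1c T z zt zx \<and> (\<forall>x. z x T = 0) \<longrightarrow>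
        (\<integral>(x, t). u_reg T u x t * zt x t + \<phi> (u_reg T u x t) * zx x t \<partial>lborel_strip T)
        + (\<integral>t. (\<integral>x. zt x t + C * zx x t \<partial>u_sing T u t) \<partial>lebesgue_on {0<..<T})
        = - (\<integral>x. z x 0 \<partial>u0))"

(* \<phi>' stands for the derivative of \<phi>; it only matters up to null sets. *)
definition entropy_solution ::
  "real \<Rightarrow> (real \<Rightarrow> real) \<Rightarrow> (real \<Rightarrow> real) \<Rightarrow> real \<Rightarrow> real measure \<Rightarrow> (real \<times> real) measure \<Rightarrow> bool" where
  "entropy_solution T \<phi> \<phi>' C u0 u \<longleftrightarrow> solution T \<phi> C u0 u \<and>
     (\<forall>z zt zx E E' F F' CE CF.
        C1_C1c T z zt zx \<and> (\<forall>x. z x T = 0) \<and> (\<forall>x. \<forall>t\<in>{0..T}. 0 \<le> z x t) \<and>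
        convex_on {0..} E \<and> has_L_infty_deriv E E' \<and> has_L_infty_deriv F F' \<and>
        (AE s in lebesgue_on {0<..}. F' s = E' s * \<phi>' s) \<and>
        ((\<lambda>s. E s / s) \<longlongrightarrow> CE) at_top \<and> ((\<lambda>s. F s / s) \<longlongrightarrow> CF) at_top \<longrightarrow>
        (\<integral>(x, t). E (u_reg T u x t) * zt x t + F (u_reg T u x t) * zx x t \<partial>lborel_strip T)
        + (\<integral>t. (\<integral>x. CE * zt x t + CF * zx x t \<partial>u_sing T u t) \<partial>lebesgue_on {0<..<T})
        \<ge> - (\<integral>x. E (reg_part lborel u0 x) * z x 0 \<partial>lborel)
          - CE * (\<integral>x. z x 0 \<partial>sing_part lborel u0))"

definition initial_trace :: "real \<Rightarrow> real measure \<Rightarrow> (real \<times> real) measure \<Rightarrow> bool" where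
  "initial_trace T u0 u \<longleftrightarrow>
     ess_filterlim (\<lambda>t. \<integral>\<^sup>+x. ennreal \<bar>u_reg T u x t - reg_part lborel u0 x\<bar> \<partial>lborel)
       (nhds 0) 0 {0<..}"

definition right_compat :: "real \<Rightarrow> real \<Rightarrow> (real \<times> real) measure \<Rightarrow> bool" where
  "right_compat T C u \<longleftrightarrow>
     (AE t in lebesgue_on {0<..<T}. \<forall>x0\<in>supp_measure (translate (- C * t) (u_sing T u t)).
        ess_filterlim (\<lambda>x. u_reg T u (x + C * t) t) at_top x0 {x0<..})"

definition left_compat :: "real \<Rightarrow> real \<Rightarrow> (real \<times> real) measure \<Rightarrow> bool" where
  "left_compat T C u \<longleftrightarrow>
     (AE t in lebesgue_on {0<..<T}. \<forall>x0\<in>supp_measure (translate (- C * t) (u_sing T u t)).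
        ess_filterlim (\<lambda>x. u_reg T u (x + C * t) t) at_top x0 {..<x0})"

end

theory Submission
  imports Defs
begin

text \<open>In the moving frame \<open>y = x - C t\<close> the singular part does not travel: testing with the entropies
  \<open>(s - k)\<^sup>+\<close> and letting \<open>k \<rightarrow> \<infinity>\<close> shows that it consists of atoms at the points \<open>x\<^sub>l\<close> whose masses do not
  increase, so that each atom lives on a time interval \<open>(0, \<tau>\<^sub>l)\<close>. The regular part solves an equation with
  the bounded monotone flux \<open>\<psi> s = \<phi> s - C s\<close>.

  Let \<open>u\<close> and \<open>v\<close> be two solutions. Kruzkov's doubling of variables gives
  \<open>\<partial>\<^sub>t \<bar>u\<^sub>r - v\<^sub>r\<bar> + \<partial>\<^sub>y \<bar>\<psi> u\<^sub>r - \<psi> v\<^sub>r\<bar> \<le> 0\<close> away from the atoms. If both solutions have the same atom at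
  \<open>x\<^sub>l\<close>, the compatibility condition makes \<open>\<psi> u\<^sub>r\<close> and \<open>\<psi> v\<^sub>r\<close> tend to \<open>sup \<psi>\<close> on its right, so no mass of
  \<open>\<bar>\<psi> u\<^sub>r - \<psi> v\<^sub>r\<bar>\<close> leaves it and the inequality extends across it. As \<open>\<psi>\<close> is nondecreasing, nothing travels
  to the left; hence \<open>u\<^sub>r = v\<^sub>r\<close> to the left of the first point at which the atoms differ. But then the mass
  balance at this point, with inflow equal for both and outflow \<open>sup \<psi>\<close> as long as an atom is present,
  forces the atoms to agree there too. So there is no such point, and \<open>u = v\<close>. The nonincreasing case
  follows by reflection.\<close>

section \<open>Mollification in \<open>L\<^sup>1\<close>\<close>

text \<open>The obstacle is that atoms enter the entropy inequality through
  \<open>c a t * \<eta>1 a t\<close>, a term of one solution alone with no counterpart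
  \<open>\<bar>c - d\<bar>\<close> after doubling. Doubling is therefore done with test functions
  that vanish along the lines on which an atom lives, and the task is to show that these lines are
  removable. Removal needs infinite right traces of both solutions over the same time interval,
  hence equal extinction times; it cannot be done for all points at once, which is why the points
  are ordered in space. Traces on one side suffice because the Kruzkov flux
  \<open>\<bar>\<psi> u - \<psi> v\<bar>\<close> is nonnegative: what enters an atom from the left
  has the favourable sign. A second difficulty lies in the definitions: \<open>u_reg\<close> comes
  from the decomposition of \<open>u\<close> on the strip, \<open>u_sing\<close> from that of
  sections known only for almost every time and only through continuous test functions.
  Disintegrating \<open>u\<close> over Borel sets identifies the two decompositions and finally
  rebuilds \<open>u\<close> from its sections.\<close>

lemma
  fixes f :: "'a::euclidean_space \<Rightarrow> real"
  assumes "integrable lborel f"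
  shows integrable_lborel_translate: "integrable lborel (\<lambda>x. f (x + h))"
    and integral_lborel_translate: "(\<integral>x. f (x + h) \<partial>lborel) = (\<integral>x. f x \<partial>lborel)"
proof -
  have D: "distr lborel borel (\<lambda>x. x + h) = (lborel :: 'a measure)"
    using lborel_distr_plus[of h] by (subst add.commute)
  have [measurable]: "f \<in> borel_measurable borel"
    using assms by simp
  have "integrable (distr lborel borel (\<lambda>x. x + h)) f"
    unfolding D by fact
  then show "integrable lborel (\<lambda>x. f (x + h))"
    by (subst (asm) integrable_distr_eq) auto
  have "(\<integral>x. f x \<partial>distr lborel borel (\<lambda>x. x + h)) = (\<integral>x. f (x + h) \<partial>lborel)"
    by (intro integral_distr) auto
  then show "(\<integral>x. f (x + h) \<partial>lborel) = (\<integral>x. f x \<partial>lborel)"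
    unfolding D by simp
qed

lemma nn_integral_lborel_translate:
  fixes f :: "'a::euclidean_space \<Rightarrow> ennreal"
  assumes [measurable]: "f \<in> borel_measurable borel"
  shows "(\<integral>\<^sup>+x. f (x + h) \<partial>lborel) = (\<integral>\<^sup>+x. f x \<partial>lborel)"
proof -
  have D: "distr lborel borel (\<lambda>x. x + h) = (lborel :: 'a measure)"
    using lborel_distr_plus[of h] by (subst add.commute)
  have "(\<integral>\<^sup>+x. f x \<partial>distr lborel borel (\<lambda>x. x + h)) = (\<integral>\<^sup>+x. f (x + h) \<partial>lborel)"
    by (intro nn_integral_distr) auto
  then show ?thesis unfolding D by simp
qed

text \<open>By translation invariance \<open>f\<close> and \<open>g\<close> are equally far apart
  before and after the shift, so a good approximant hands its continuity on to \<open>f\<close>. The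
  base case and the limit case of the induction below both rest on this.\<close>

lemma L1_translation_approx:
  fixes f :: "'a::euclidean_space \<Rightarrow> real"
  assumes f: "integrable lborel f" and h: "h \<longlonglongrightarrow> 0"
    and approx: "\<And>e. e > 0 \<Longrightarrow> \<exists>g. integrable lborel g \<and>
      (\<lambda>n. \<integral>x. \<bar>g (x + h n) - g x\<bar> \<partial>lborel) \<longlonglongrightarrow> 0 \<and> (\<integral>x. \<bar>f x - g x\<bar> \<partial>lborel) \<le> e"
  shows "(\<lambda>n::nat. \<integral>x. \<bar>f (x + h n) - f x\<bar> \<partial>lborel) \<longlonglongrightarrow> 0"
proof (rule LIMSEQ_I)
  fix r :: real assume "r > 0"
  then obtain g where g: "integrable lborel g" "(\<lambda>n. \<integral>x. \<bar>g (x + h n) - g x\<bar> \<partial>lborel) \<longlonglongrightarrow> 0"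
    and fg: "(\<integral>x. \<bar>f x - g x\<bar> \<partial>lborel) \<le> r/4"
    using approx[of "r/4"] by auto
  obtain n0 where n0: "\<And>n. n \<ge> n0 \<Longrightarrow> norm ((\<integral>x. \<bar>g (x + h n) - g x\<bar> \<partial>lborel) - 0) < r/4"
    using LIMSEQ_D[OF g(2), of "r/4"] \<open>r > 0\<close> by auto
  note [simp] = f g(1) integrable_lborel_translate[OF f] integrable_lborel_translate[OF g(1)]
  have "norm ((\<integral>x. \<bar>f (x + h n) - f x\<bar> \<partial>lborel) - 0) < r" if "n \<ge> n0" for n
  proof -
    have "(\<integral>x. \<bar>f (x + h n) - f x\<bar> \<partial>lborel)
      \<le> (\<integral>x. \<bar>f (x + h n) - g (x + h n)\<bar> + \<bar>g (x + h n) - g x\<bar> + \<bar>f x - g x\<bar> \<partial>lborel)"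
      by (intro integral_mono) auto
    also have "\<dots> = (\<integral>x. \<bar>f (x + h n) - g (x + h n)\<bar> \<partial>lborel)
       + (\<integral>x. \<bar>g (x + h n) - g x\<bar> \<partial>lborel) + (\<integral>x. \<bar>f x - g x\<bar> \<partial>lborel)"
      by simp
    also have "(\<integral>x. \<bar>f (x + h n) - g (x + h n)\<bar> \<partial>lborel) = (\<integral>x. \<bar>f x - g x\<bar> \<partial>lborel)"
      by (rule integral_lborel_translate[where f = "\<lambda>x. \<bar>f x - g x\<bar>"]) simp
    finally show ?thesis using fg n0[OF that] \<open>r > 0\<close> by simp
  qed
  then show "\<exists>n0. \<forall>n\<ge>n0. norm ((\<integral>x. \<bar>f (x + h n) - f x\<bar> \<partial>lborel) - 0) < r" by blast
qed

text \<open>Openness controls only one half of the difference: a point of \<open>U\<close> stays in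
  \<open>U\<close> under small shifts, whereas boundary points outside may enter. The other half has
  the same integral, because a shift preserves the measure of \<open>U\<close>.\<close>

lemma L1_translation_open:
  fixes U :: "'a::euclidean_space set"
  assumes U: "open U" "emeasure lborel U < \<infinity>" and h: "h \<longlonglongrightarrow> 0"
  shows "(\<lambda>n::nat. \<integral>x. \<bar>indicator U (x + h n) * c - indicator U x * c\<bar> \<partial>lborel) \<longlonglongrightarrow> (0::real)"
proof -
  let ?i = "indicator U :: 'a \<Rightarrow> real"
  have [measurable]: "U \<in> sets borel" using U by auto
  have iU: "integrable lborel ?i" using U by simp
  note [simp] = iU integrable_lborel_translate[OF iU]
  have lim: "(\<lambda>n. \<integral>x. max 0 (?i x - ?i (x + h n)) \<partial>lborel) \<longlonglongrightarrow> (\<integral>x. 0 \<partial>(lborel :: 'a measure))"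
  proof (rule integral_dominated_convergence[where w = ?i])
    show "AE x in lborel. (\<lambda>n. max 0 (?i x - ?i (x + h n))) \<longlonglongrightarrow> 0"
    proof (rule AE_I2)
      fix x
      show "(\<lambda>n. max 0 (?i x - ?i (x + h n))) \<longlonglongrightarrow> 0"
      proof (cases "x \<in> U")
        case True
        have "(\<lambda>n. x + h n) \<longlonglongrightarrow> x + 0" by (intro tendsto_intros h)
        then have "\<forall>\<^sub>F n in sequentially. x + h n \<in> U"
          using U(1) True topological_tendstoD by fastforce
        then show ?thesis
          by (intro tendsto_eventually) (auto elim!: eventually_mono simp: True)
      next
        case False
        then show ?thesis by (simp add: indicator_def)
      qed
    qed
  qed (auto simp: indicator_def)
  have "(\<integral>x. \<bar>?i (x + h n) * c - ?i x * c\<bar> \<partial>lborel)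
      = \<bar>c\<bar> * (2 * (\<integral>x. max 0 (?i x - ?i (x + h n)) \<partial>lborel))" for n
  proof -
    \<comment> \<open>For numbers \<open>a\<close> and \<open>b\<close> one has
      \<open>\<bar>b - a\<bar> = 2 * max 0 (a - b) + (b - a)\<close>, and here the linear term
      integrates to zero.\<close>
    have "(\<integral>x. \<bar>?i (x + h n) * c - ?i x * c\<bar> \<partial>lborel)
      = (\<integral>x. \<bar>c\<bar> * (2 * max 0 (?i x - ?i (x + h n)) + (?i (x + h n) - ?i x)) \<partial>lborel)"
      by (rule Bochner_Integration.integral_cong) (auto simp: indicator_def)
    also have "\<dots> = \<bar>c\<bar> * ((\<integral>x. 2 * max 0 (?i x - ?i (x + h n)) \<partial>lborel) + ((\<integral>x. ?i (x + h n) \<partial>lborel) - (\<integral>x. ?i x \<partial>lborel)))"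
      by simp
    also have "(\<integral>x. ?i (x + h n) \<partial>lborel) = (\<integral>x. ?i x \<partial>lborel)"
      by (rule integral_lborel_translate[OF iU])
    finally show ?thesis by simp
  qed
  then show ?thesis
    using tendsto_mult[OF tendsto_const[of "\<bar>c\<bar>"] tendsto_mult[OF tendsto_const[of 2] lim]] by simp
qed

text \<open>Induction over integrable functions: indicators of measurable sets are approximated from
  outside by open sets, and the property passes to sums and to \<open>L1\<close> limits.\<close>

proposition L1_translation_continuous_seq:
  fixes f :: "'a::euclidean_space \<Rightarrow> real"
  assumes "integrable lborel f" and h: "h \<longlonglongrightarrow> 0"
  shows "(\<lambda>n::nat. \<integral>x. \<bar>f (x + h n) - f x\<bar> \<partial>lborel) \<longlonglongrightarrow> 0"
  using assms(1)
proof (induction rule: integrable_induct)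
  case (base A c)
  have iA: "integrable lborel (\<lambda>x. indicator A x *\<^sub>R c)" using base by simp
  show ?case
  proof (rule L1_translation_approx[OF iA h])
    fix e :: real assume e: "e > 0"
    \<comment> \<open>The set may be exceeded by measure \<open>e'\<close>, since the error is
      multiplied by \<open>\<bar>c\<bar>\<close>; the summand 1 covers \<open>c = 0\<close>.\<close>
    define e' where "e' = e / (\<bar>c\<bar> + 1)"
    have e': "e' > 0" "\<bar>c\<bar> * e' \<le> e" using e by (auto simp: e'_def field_simps)
    have Am: "A \<in> sets borel" using base by simp
    obtain U where U: "open U" "A \<subseteq> U" "emeasure lborel (U - A) < ennreal e'"
      using outer_regular_lborel[OF Am e'(1)] by blast
    have "emeasure lborel U \<le> emeasure lborel A + emeasure lborel (U - A)"
      using U Am by (subst plus_emeasure) (auto intro!: emeasure_mono)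
    also have "\<dots> < \<infinity>"
      using base(2) U(3) ennreal_less_top by (auto simp: less_top intro: order.strict_trans)
    finally have Uf: "emeasure lborel U < \<infinity>" .
    have "(\<integral>x. \<bar>indicator A x *\<^sub>R c - indicator U x * c\<bar> \<partial>lborel) = (\<integral>x. \<bar>c\<bar> * indicator (U - A) x \<partial>lborel)"
      using U(2) by (intro Bochner_Integration.integral_cong) (auto simp: indicator_def)
    also have "\<dots> = \<bar>c\<bar> * measure lborel (U - A)" by simp
    also have "\<dots> \<le> \<bar>c\<bar> * e'"
      using U(3) e'(1) by (intro mult_left_mono) (auto simp: measure_def intro!: enn2real_leI intro: less_imp_le)
    finally have "(\<integral>x. \<bar>indicator A x *\<^sub>R c - indicator U x * c\<bar> \<partial>lborel) \<le> e" using e' by simp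
    moreover have "integrable lborel (\<lambda>x. indicator U x * c)" using U(1) Uf by simp
    ultimately show "\<exists>g. integrable lborel g \<and>
      (\<lambda>n. \<integral>x. \<bar>g (x + h n) - g x\<bar> \<partial>lborel) \<longlonglongrightarrow> 0 \<and> (\<integral>x. \<bar>indicator A x *\<^sub>R c - g x\<bar> \<partial>lborel) \<le> e"
      using L1_translation_open[OF U(1) Uf h, of c] by (intro exI[of _ "\<lambda>x. indicator U x * c"]) simp
  qed
next
  case (add f g)
  note [simp] = add.hyps integrable_lborel_translate[OF add.hyps(1)] integrable_lborel_translate[OF add.hyps(2)]
  show ?case
  proof (rule tendsto_sandwich[OF _ _ tendsto_const])
    show "\<forall>\<^sub>F n in sequentially. (\<integral>x. \<bar>f (x + h n) + g (x + h n) - (f x + g x)\<bar> \<partial>lborel)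
      \<le> (\<integral>x. \<bar>f (x + h n) - f x\<bar> \<partial>lborel) + (\<integral>x. \<bar>g (x + h n) - g x\<bar> \<partial>lborel)"
    proof (rule always_eventually, rule allI)
      fix n
      have "(\<integral>x. \<bar>f (x + h n) + g (x + h n) - (f x + g x)\<bar> \<partial>lborel)
        \<le> (\<integral>x. \<bar>f (x + h n) - f x\<bar> + \<bar>g (x + h n) - g x\<bar> \<partial>lborel)"
        by (intro integral_mono) auto
      then show "(\<integral>x. \<bar>f (x + h n) + g (x + h n) - (f x + g x)\<bar> \<partial>lborel)
      \<le> (\<integral>x. \<bar>f (x + h n) - f x\<bar> \<partial>lborel) + (\<integral>x. \<bar>g (x + h n) - g x\<bar> \<partial>lborel)" by simp
    qed
    show "(\<lambda>n. (\<integral>x. \<bar>f (x + h n) - f x\<bar> \<partial>lborel) + (\<integral>x. \<bar>g (x + h n) - g x\<bar> \<partial>lborel)) \<longlonglongrightarrow> 0"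
      using tendsto_add[OF add.IH] by simp
  qed (auto intro!: always_eventually)
next
  case (lim f s)
  show ?case
  proof (rule L1_translation_approx[OF lim.hyps(4) h])
    fix e :: real assume e: "e > 0"
    \<comment> \<open>The approximants satisfy
      \<open>\<bar>s i x\<bar> \<le> 2 * \<bar>f x\<bar>\<close>, whence the dominating function
      \<open>3 * \<bar>f x\<bar>\<close>.\<close>
    have "(\<lambda>i. \<integral>x. \<bar>f x - s i x\<bar> \<partial>lborel) \<longlonglongrightarrow> (\<integral>x. 0 \<partial>(lborel :: 'a measure))"
    proof (rule integral_dominated_convergence[where w = "\<lambda>x. 3 * \<bar>f x\<bar>"])
      show "AE x in lborel. (\<lambda>i. \<bar>f x - s i x\<bar>) \<longlonglongrightarrow> 0"
      proof (rule AE_I2)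
        fix x :: 'a
        have "(\<lambda>i. \<bar>f x - s i x\<bar>) \<longlonglongrightarrow> \<bar>f x - f x\<bar>" by (intro tendsto_intros lim.hyps) simp
        then show "(\<lambda>i. \<bar>f x - s i x\<bar>) \<longlonglongrightarrow> 0" by simp
      qed
      show "AE x in lborel. norm \<bar>f x - s i x\<bar> \<le> 3 * \<bar>f x\<bar>" for i
        using lim.hyps(3)[of _ i] by (intro AE_I2) (smt (verit) real_norm_def space_lborel UNIV_I)
    qed (use lim.hyps in \<open>auto\<close>)
    then obtain i where "\<bar>(\<integral>x. \<bar>f x - s i x\<bar> \<partial>lborel)\<bar> < e"
      using e by (auto dest!: LIMSEQ_D[where r = e])
    then show "\<exists>g. integrable lborel g \<and>
      (\<lambda>n. \<integral>x. \<bar>g (x + h n) - g x\<bar> \<partial>lborel) \<longlonglongrightarrow> 0 \<and> (\<integral>x. \<bar>f x - g x\<bar> \<partial>lborel) \<le> e"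
      using lim.hyps lim.IH by (intro exI[of _ "s i"]) auto
  qed
qed

text \<open>A failure would yield shifts tending to zero along which the modulus stays above
  \<open>e\<close>, against the sequential version.\<close>

lemma L1_translation_continuous:
  fixes f :: "'a::euclidean_space \<Rightarrow> real"
  assumes f: "integrable lborel f" and e: "e > 0"
  obtains d where "d > 0" "\<And>h. norm h < d \<Longrightarrow> (\<integral>x. \<bar>f (x + h) - f x\<bar> \<partial>lborel) < e"
proof -
  have "\<exists>d>0. \<forall>h. norm h < d \<longrightarrow> (\<integral>x. \<bar>f (x + h) - f x\<bar> \<partial>lborel) < e"
  proof (rule ccontr)
    assume "\<not> ?thesis"
    then have H: "\<exists>h. norm h < d \<and> (\<integral>x. \<bar>f (x + h) - f x\<bar> \<partial>lborel) \<ge> e" if "d > 0" for d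
      using that by (metis linorder_not_less)
    have "\<forall>n. \<exists>h. norm h < 1 / real (Suc n) \<and> (\<integral>x. \<bar>f (x + h) - f x\<bar> \<partial>lborel) \<ge> e"
      by (rule allI, rule H) simp
    then obtain h where h: "\<And>n. norm (h n) < 1 / real (Suc n)" "\<And>n. (\<integral>x. \<bar>f (x + h n) - f x\<bar> \<partial>lborel) \<ge> e"
      by metis
    have "h \<longlonglongrightarrow> 0"
      by (rule Lim_null_comparison[OF _ LIMSEQ_inverse_real_of_nat])
         (use h(1) in \<open>auto intro!: always_eventually less_imp_le simp: inverse_eq_divide\<close>)
    from L1_translation_continuous_seq[OF f this] have "e \<le> 0"
      by (rule LIMSEQ_le_const) (use h(2) in auto)
    then show False using e by simp
  qed
  then show ?thesis using that by blast
qed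

text \<open>With \<open>z = p - q\<close> the double integral averages the translation modulus of
  \<open>V\<close> over shifts in the support of \<open>K\<close>. The radius \<open>d\<close> is
  fixed before \<open>K\<close>: the doubling argument and the monotonicity lemma for distributions
  both choose their kernel after it.\<close>

proposition mollification_error:
  fixes V :: "'a::euclidean_space \<Rightarrow> real"
  assumes V: "integrable lborel V" and e: "e > 0"
  obtains d where "d > 0"
    "\<And>K. K \<in> borel_measurable borel \<Longrightarrow> (\<And>z. 0 \<le> K z) \<Longrightarrow> (\<integral>\<^sup>+z. ennreal (K z) \<partial>lborel) = 1 \<Longrightarrow>
       (\<And>z. norm z \<ge> d \<Longrightarrow> K z = 0) \<Longrightarrow>
       integrable (lborel \<Otimes>\<^sub>M lborel) (\<lambda>(p, q). \<bar>V q - V p\<bar> * K (p - q)) \<and>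
       (\<integral>(p, q). \<bar>V q - V p\<bar> * K (p - q) \<partial>(lborel \<Otimes>\<^sub>M lborel)) \<le> e"
proof -
  obtain d where d: "d > 0" "\<And>h. norm h < d \<Longrightarrow> (\<integral>x. \<bar>V (x + h) - V x\<bar> \<partial>lborel) < e"
    using L1_translation_continuous[OF V e] by blast
  have [measurable]: "V \<in> borel_measurable borel" using V by simp
  show ?thesis
  proof (rule that[OF d(1)])
    fix K :: "'a \<Rightarrow> real"
    assume [measurable]: "K \<in> borel_measurable borel" and K0: "\<And>z. 0 \<le> K z"
      and K1: "(\<integral>\<^sup>+z. ennreal (K z) \<partial>lborel) = 1" and Kd: "\<And>z. norm z \<ge> d \<Longrightarrow> K z = 0"
    let ?F = "\<lambda>(p, q). \<bar>V q - V p\<bar> * K (p - q)"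
    have Fm[measurable]: "?F \<in> borel_measurable (lborel \<Otimes>\<^sub>M lborel)" by measurable
    have "(\<integral>\<^sup>+pq. ennreal (?F pq) \<partial>(lborel \<Otimes>\<^sub>M lborel)) = (\<integral>\<^sup>+q. (\<integral>\<^sup>+p. ennreal (\<bar>V q - V p\<bar> * K (p - q)) \<partial>lborel) \<partial>lborel)"
      by (subst lborel_pair.nn_integral_snd[symmetric]) auto
    also have "\<dots> = (\<integral>\<^sup>+q. (\<integral>\<^sup>+z. ennreal (\<bar>V q - V (z + q)\<bar> * K z) \<partial>lborel) \<partial>lborel)"
    proof (rule nn_integral_cong)
      fix q :: 'a
      have "(\<integral>\<^sup>+z. ennreal (\<bar>V q - V (z + q)\<bar> * K (z + q - q)) \<partial>lborel) = (\<integral>\<^sup>+p. ennreal (\<bar>V q - V p\<bar> * K (p - q)) \<partial>lborel)"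
        by (rule nn_integral_lborel_translate[where f = "\<lambda>p. ennreal (\<bar>V q - V p\<bar> * K (p - q))"]) measurable
      then show "(\<integral>\<^sup>+p. ennreal (\<bar>V q - V p\<bar> * K (p - q)) \<partial>lborel) = (\<integral>\<^sup>+z. ennreal (\<bar>V q - V (z + q)\<bar> * K z) \<partial>lborel)"
        by simp
    qed
    also have "\<dots> = (\<integral>\<^sup>+z. (\<integral>\<^sup>+q. ennreal (\<bar>V q - V (z + q)\<bar> * K z) \<partial>lborel) \<partial>lborel)"
      by (rule lborel_pair.Fubini') measurable
    also have "\<dots> \<le> (\<integral>\<^sup>+z. ennreal e * ennreal (K z) \<partial>lborel)"
    proof (rule nn_integral_mono)
      fix z :: 'a
      have i: "integrable lborel (\<lambda>q. \<bar>V (q + z) - V q\<bar>)" using V integrable_lborel_translate[OF V] by auto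
      show "(\<integral>\<^sup>+q. ennreal (\<bar>V q - V (z + q)\<bar> * K z) \<partial>lborel) \<le> ennreal e * ennreal (K z)"
      proof (cases "norm z < d")
        case True
        have "(\<integral>\<^sup>+q. ennreal (\<bar>V q - V (z + q)\<bar> * K z) \<partial>lborel) = (\<integral>\<^sup>+q. ennreal \<bar>V (q + z) - V q\<bar> * ennreal (K z) \<partial>lborel)"
          by (intro nn_integral_cong) (simp add: ennreal_mult' K0 add.commute abs_minus_commute)
        also have "\<dots> = (\<integral>\<^sup>+q. ennreal \<bar>V (q + z) - V q\<bar> \<partial>lborel) * ennreal (K z)"
          by (rule nn_integral_multc) auto
        also have "(\<integral>\<^sup>+q. ennreal \<bar>V (q + z) - V q\<bar> \<partial>lborel) = ennreal (\<integral>q. \<bar>V (q + z) - V q\<bar> \<partial>lborel)"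
          by (rule nn_integral_eq_integral[OF i]) auto
        also have "\<dots> * ennreal (K z) \<le> ennreal e * ennreal (K z)"
          using d(2)[OF True] by (intro mult_right_mono ennreal_leI) auto
        finally show ?thesis .
      next
        case False
        then show ?thesis using Kd[of z] by simp
      qed
    qed
    also have "\<dots> = ennreal e" by (simp add: nn_integral_cmult K1)
    finally have le: "(\<integral>\<^sup>+pq. ennreal (?F pq) \<partial>(lborel \<Otimes>\<^sub>M lborel)) \<le> ennreal e" .
    have nn: "0 \<le> ?F pq" for pq using K0 by (auto split: prod.split)
    have int: "integrable (lborel \<Otimes>\<^sub>M lborel) ?F"
      by (rule integrableI_nonneg[OF Fm]) (use nn le in \<open>auto simp: le_less_trans[OF _ ennreal_less_top]\<close>)
    have "ennreal (integral\<^sup>L (lborel \<Otimes>\<^sub>M lborel) ?F) \<le> ennreal e"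
      using le nn_integral_eq_integral[OF int] nn by simp
    then show "integrable (lborel \<Otimes>\<^sub>M lborel) ?F \<and> integral\<^sup>L (lborel \<Otimes>\<^sub>M lborel) ?F \<le> e"
      using int e by (simp add: ennreal_le_iff)
  qed
qed

section \<open>Test functions\<close>

definition C2_with_derivs :: "(real \<Rightarrow> real) \<Rightarrow> (real \<Rightarrow> real) \<Rightarrow> (real \<Rightarrow> real) \<Rightarrow> bool" where
  "C2_with_derivs f f' f'' \<longleftrightarrow> (\<forall>x. (f has_real_derivative f' x) (at x)) \<and>
     (\<forall>x. (f' has_real_derivative f'' x) (at x)) \<and> continuous_on UNIV f''"

definition C1_with_deriv :: "(real \<Rightarrow> real) \<Rightarrow> (real \<Rightarrow> real) \<Rightarrow> bool" where
  "C1_with_deriv g g' \<longleftrightarrow> (\<forall>x. (g has_real_derivative g' x) (at x)) \<and> continuous_on UNIV g'"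

lemma DERIV_max_0_power:
  "((\<lambda>x::real. max 0 x ^ Suc (Suc k)) has_real_derivative (real k + 2) * max 0 x ^ Suc k) (at x)"
proof (cases x "0::real" rule: linorder_cases)
  case less
  have "((\<lambda>x::real. max 0 x ^ Suc (Suc k)) has_real_derivative 0) (at x)"
    by (rule has_field_derivative_transform_within_open[of "\<lambda>_. 0" _ _ "{..<0}"]) (use less in auto)
  then show ?thesis using less by simp
next
  case equal
  have "(\<lambda>h::real. max 0 h ^ Suc (Suc k) / h) \<midarrow>0\<rightarrow> 0"
  proof (rule Lim_null_comparison)
    show "\<forall>\<^sub>F h in at 0. norm (max 0 h ^ Suc (Suc k) / h) \<le> \<bar>h\<bar> ^ Suc k"
    proof (intro always_eventually allI)
      fix h :: real
      show "norm (max 0 h ^ Suc (Suc k) / h) \<le> \<bar>h\<bar> ^ Suc k"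
      proof (cases "h > 0")
        case False
        then have "max 0 h = 0" by simp
        then have "max 0 h ^ Suc (Suc k) / h = 0" by (simp only: power_0_Suc div_0)
        then show ?thesis by (simp only: norm_zero zero_le_power abs_ge_zero)
      qed simp
    qed
    have "((\<lambda>h::real. \<bar>h\<bar> ^ Suc k) \<longlongrightarrow> \<bar>0\<bar> ^ Suc k) (at 0)" by (intro tendsto_intros)
    then show "((\<lambda>h::real. \<bar>h\<bar> ^ Suc k) \<longlongrightarrow> 0) (at 0)" by simp
  qed
  then show ?thesis using equal by (simp add: DERIV_def)
next
  case greater
  have "((\<lambda>x::real. x ^ Suc (Suc k)) has_real_derivative (real k + 2) * x ^ Suc k) (at x)"
    using DERIV_pow[of "Suc (Suc k)" x] by (simp add: algebra_simps)
  then have "((\<lambda>x::real. max 0 x ^ Suc (Suc k)) has_real_derivative (real k + 2) * x ^ Suc k) (at x)"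
    by (rule has_field_derivative_transform_within_open[of _ _ _ "{0<..}"]) (use greater in auto)
  then show ?thesis using greater by simp
qed

lemma DERIV_max_0_power_chain:
  assumes "(f has_real_derivative D) (at x)"
  shows "((\<lambda>x. max 0 (f x) ^ Suc (Suc k)) has_real_derivative (real k + 2) * max 0 (f x) ^ Suc k * D) (at x)"
  using DERIV_chain2[OF DERIV_max_0_power assms] by simp

text \<open>The cube is the lowest integer power of the positive part that is twice continuously
  differentiable, as the space factor of a test function has to be.\<close>

definition bump_raw :: "real \<Rightarrow> real" where
  "bump_raw x = max 0 (1 - x\<^sup>2) ^ 3"

lemma bump_raw_C2:
  "C2_with_derivs bump_raw (\<lambda>x. - 6 * x * max 0 (1 - x\<^sup>2) ^ 2)
     (\<lambda>x. - 6 * max 0 (1 - x\<^sup>2) ^ 2 + 24 * x\<^sup>2 * max 0 (1 - x\<^sup>2))"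
  unfolding C2_with_derivs_def bump_raw_def
proof (intro conjI allI)
  fix x :: real
  have "((\<lambda>x. max 0 (1 - x\<^sup>2) ^ Suc (Suc 1)) has_real_derivative (real 1 + 2) * max 0 (1 - x\<^sup>2) ^ Suc 1 * (- (2 * x))) (at x)"
    by (rule DERIV_max_0_power_chain) (auto intro!: derivative_eq_intros)
  then show "((\<lambda>x. max 0 (1 - x\<^sup>2) ^ 3) has_real_derivative - 6 * x * max 0 (1 - x\<^sup>2) ^ 2) (at x)"
    by (simp add: numeral_eq_Suc algebra_simps)
  have d: "((\<lambda>x. max 0 (1 - x\<^sup>2) ^ Suc (Suc 0)) has_real_derivative (real 0 + 2) * max 0 (1 - x\<^sup>2) ^ Suc 0 * (- (2 * x))) (at x)"
    by (rule DERIV_max_0_power_chain) (auto intro!: derivative_eq_intros)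
  have "((\<lambda>x. (- 6 * x) * max 0 (1 - x\<^sup>2) ^ Suc (Suc 0)) has_real_derivative
      (- 6 * x) * ((real 0 + 2) * max 0 (1 - x\<^sup>2) ^ Suc 0 * (- (2 * x))) + (- 6) * max 0 (1 - x\<^sup>2) ^ Suc (Suc 0)) (at x)"
    by (rule DERIV_mult'[OF _ d]) (auto intro!: derivative_eq_intros)
  then show "((\<lambda>x. - 6 * x * max 0 (1 - x\<^sup>2) ^ 2) has_real_derivative
      - 6 * max 0 (1 - x\<^sup>2) ^ 2 + 24 * x\<^sup>2 * max 0 (1 - x\<^sup>2)) (at x)"
    by (simp add: numeral_eq_Suc algebra_simps)
qed (intro continuous_intros)

definition bump_primitive :: "real \<Rightarrow> real" where
  "bump_primitive x = (LBINT y=ereal 0..ereal x. bump_raw y)"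

lemma bump_raw_nonneg: "0 \<le> bump_raw x"
  by (simp add: bump_raw_def)

lemma bump_raw_eq_0: "\<bar>x\<bar> \<ge> 1 \<Longrightarrow> bump_raw x = 0"
  using abs_le_square_iff[of 1 x] by (simp add: bump_raw_def)

lemma DERIV_bump_primitive: "(bump_primitive has_real_derivative bump_raw x) (at x)"
proof -
  have "((\<lambda>u. LBINT y=ereal 0..ereal u. bump_raw y) has_vector_derivative bump_raw x)
      (at x within {min 0 x - 1..max 0 x + 1})"
    by (rule interval_integral_FTC2) (auto simp: bump_raw_def[abs_def] intro!: continuous_intros)
  then show ?thesis
    unfolding bump_primitive_def[abs_def] has_real_derivative_iff_has_vector_derivative
    by (subst (asm) at_within_interior) auto
qed

lemma bump_primitive_cont: "continuous_on A bump_primitive"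
  by (rule DERIV_continuous_on[OF has_field_derivative_at_within[OF DERIV_bump_primitive]])

lemma bump_primitive_mono: "x \<le> y \<Longrightarrow> bump_primitive x \<le> bump_primitive y"
  using DERIV_nonneg_imp_nondecreasing[of x y bump_primitive] DERIV_bump_primitive bump_raw_nonneg by blast

lemma bump_primitive_const:
  assumes "x \<le> y" "y \<le> -1 \<or> 1 \<le> x"
  shows "bump_primitive y = bump_primitive x"
proof (cases "x = y")
  case False
  show ?thesis
  proof (rule DERIV_isconst_end[OF _ bump_primitive_cont])
    fix u assume "x < u" "u < y"
    then have "bump_raw u = 0" using assms by (intro bump_raw_eq_0) auto
    then show "(bump_primitive has_real_derivative 0) (at u)" using DERIV_bump_primitive[of u] by simp
  qed (use False assms in auto)
qed simp

definition bump_mass :: real where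
  "bump_mass = bump_primitive 1 - bump_primitive (-1)"

lemma bump_mass_pos: "bump_mass > 0"
proof -
  have "bump_primitive 0 < bump_primitive (1/2)"
  proof (rule DERIV_pos_imp_increasing_open[where f = bump_primitive])
    fix x :: real assume "0 < x" "x < 1/2"
    then have "x\<^sup>2 < 1" by (simp add: power_less_one_iff abs_square_less_1)
    then show "\<exists>y. (bump_primitive has_real_derivative y) (at x) \<and> y > 0"
      using DERIV_bump_primitive[of x] by (intro exI[of _ "bump_raw x"]) (simp add: bump_raw_def)
  qed (auto intro: bump_primitive_cont)
  then show ?thesis
    using bump_primitive_mono[of "-1" 0] bump_primitive_mono[of "1/2" 1] by (simp add: bump_mass_def)
qed

lemma bump_mass_nz: "bump_mass \<noteq> 0"
  using bump_mass_pos by simp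

text \<open>The antiderivative of the normalised bump, i.e. a mollified Heaviside function: 0 to the
  left of -1 and 1 to the right of 1. All cutoffs in space and time are built from it.\<close>

definition smooth_step :: "real \<Rightarrow> real" where
  "smooth_step x = (bump_primitive x - bump_primitive (-1)) / bump_mass"

definition bump :: "real \<Rightarrow> real" where
  "bump x = bump_raw x / bump_mass"

definition bump' :: "real \<Rightarrow> real" where
  "bump' x = (- 6 * x * max 0 (1 - x\<^sup>2) ^ 2) / bump_mass"

definition bump'' :: "real \<Rightarrow> real" where
  "bump'' x = (- 6 * max 0 (1 - x\<^sup>2) ^ 2 + 24 * x\<^sup>2 * max 0 (1 - x\<^sup>2)) / bump_mass"

lemma DERIV_smooth_step: "(smooth_step has_real_derivative bump x) (at x)"
  unfolding smooth_step_def[abs_def] bump_def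
  using DERIV_cdivide[OF DERIV_diff[OF DERIV_bump_primitive DERIV_const]] by simp

lemma bump_C2: "C2_with_derivs bump bump' bump''"
  using bump_raw_C2 unfolding C2_with_derivs_def bump_def[abs_def] bump'_def[abs_def] bump''_def[abs_def]
  by (intro conjI allI DERIV_cdivide continuous_intros) (use bump_mass_nz in auto)

lemma DERIV_bump: "(bump has_real_derivative bump' x) (at x)"
  and DERIV_bump': "(bump' has_real_derivative bump'' x) (at x)"
  and bump''_cont: "continuous_on A bump''"
  using bump_C2 unfolding C2_with_derivs_def by (auto intro: continuous_on_subset)

lemma bump'_cont: "continuous_on A bump'"
  by (rule DERIV_continuous_on[OF has_field_derivative_at_within[OF DERIV_bump']])

lemma bump_cont: "continuous_on A bump"
  by (rule DERIV_continuous_on[OF has_field_derivative_at_within[OF DERIV_bump]])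

lemma smooth_step_cont: "continuous_on A smooth_step"
  by (rule DERIV_continuous_on[OF has_field_derivative_at_within[OF DERIV_smooth_step]])

lemma bump_nonneg: "0 \<le> bump x"
  using bump_raw_nonneg bump_mass_pos by (simp add: bump_def)

lemma bump_eq_0: "\<bar>x\<bar> \<ge> 1 \<Longrightarrow> bump x = 0"
  by (simp add: bump_def bump_raw_eq_0)

lemma bump'_eq_0: "\<bar>x\<bar> \<ge> 1 \<Longrightarrow> bump' x = 0"
  using abs_le_square_iff[of 1 x] by (simp add: bump'_def)

lemma bump''_eq_0: "\<bar>x\<bar> \<ge> 1 \<Longrightarrow> bump'' x = 0"
  using abs_le_square_iff[of 1 x] by (simp add: bump''_def)

lemma smooth_step_eq_0: "x \<le> -1 \<Longrightarrow> smooth_step x = 0"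
  using bump_primitive_const[of x "-1"] by (simp add: smooth_step_def)

lemma smooth_step_eq_1: "x \<ge> 1 \<Longrightarrow> smooth_step x = 1"
  using bump_primitive_const[of 1 x] bump_mass_pos by (simp add: smooth_step_def bump_mass_def)

lemma smooth_step_mono: "x \<le> y \<Longrightarrow> smooth_step x \<le> smooth_step y"
  using bump_primitive_mono[of x y] bump_mass_pos by (simp add: smooth_step_def divide_right_mono)

lemma smooth_step_bounds: "0 \<le> smooth_step x" "smooth_step x \<le> 1"
  using smooth_step_mono[of "min x (-1)" x] smooth_step_mono[of x "max x 1"]
  by (auto simp: smooth_step_eq_0 smooth_step_eq_1)

lemma bump_pos: "\<bar>x\<bar> < 1 \<Longrightarrow> 0 < bump x"
  using bump_mass_pos by (simp add: bump_def bump_raw_def abs_square_less_1)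

lemma bump_borel[measurable]: "bump \<in> borel_measurable borel"
  and bump'_borel[measurable]: "bump' \<in> borel_measurable borel"
  and smooth_step_borel[measurable]: "smooth_step \<in> borel_measurable borel"
  by (auto intro!: borel_measurable_continuous_onI bump_cont bump'_cont smooth_step_cont)

lemma nn_integral_bump: "(\<integral>\<^sup>+x. ennreal (bump x) \<partial>lborel) = 1"
proof -
  have "(\<integral>\<^sup>+x. ennreal (bump x) * indicator {-1..1} x \<partial>lborel) = ennreal (smooth_step 1 - smooth_step (-1))"
    by (rule nn_integral_FTC_Icc) (auto intro!: DERIV_smooth_step has_field_derivative_at_within bump_nonneg)
  also have "(\<integral>\<^sup>+x. ennreal (bump x) * indicator {-1..1} x \<partial>lborel) = (\<integral>\<^sup>+x. ennreal (bump x) \<partial>lborel)"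
    by (intro nn_integral_cong) (auto simp: indicator_def bump_eq_0)
  finally show ?thesis by (simp add: smooth_step_eq_0 smooth_step_eq_1)
qed

lemma nn_integral_bump_scaled:
  assumes "c > 0"
  shows "(\<integral>\<^sup>+x. ennreal (c * bump (c * x + b)) \<partial>lborel) = 1"
proof -
  have "(\<integral>\<^sup>+x. ennreal (bump x) \<partial>lborel) = ennreal \<bar>c\<bar> * (\<integral>\<^sup>+x. ennreal (bump (b + c * x)) \<partial>lborel)"
    by (rule nn_integral_real_affine) (use assms in auto)
  also have "\<dots> = (\<integral>\<^sup>+x. ennreal \<bar>c\<bar> * ennreal (bump (b + c * x)) \<partial>lborel)"
    by (rule nn_integral_cmult[symmetric]) auto
  finally show ?thesis using assms by (simp add: nn_integral_bump ennreal_mult' add.commute)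
qed

text \<open>Finite sums of products are closed under multiplication and under the Galilean changes of frame used
  below, up to the class of test functions in the notion of solution. The triple is
  \<open>(\<eta>, \<eta>\<^sub>t, \<eta>\<^sub>x)\<close>; the space factor is \<open>C\<^sup>2\<close> because a moving frame turns space derivatives into time derivatives.\<close>

inductive test_fun :: "(real \<Rightarrow> real \<Rightarrow> real) \<Rightarrow> (real \<Rightarrow> real \<Rightarrow> real) \<Rightarrow> (real \<Rightarrow> real \<Rightarrow> real) \<Rightarrow> bool" where
  prod: "C2_with_derivs f f' f'' \<Longrightarrow> \<forall>x. \<bar>x\<bar> \<ge> R \<longrightarrow> f x = 0 \<and> f' x = 0 \<and> f'' x = 0 \<Longrightarrow> C1_with_deriv g g' \<Longrightarrow>
    test_fun (\<lambda>x t. f x * g t) (\<lambda>x t. f x * g' t) (\<lambda>x t. f' x * g t)"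
| add: "test_fun a a1 a2 \<Longrightarrow> test_fun b b1 b2 \<Longrightarrow>
    test_fun (\<lambda>x t. a x t + b x t) (\<lambda>x t. a1 x t + b1 x t) (\<lambda>x t. a2 x t + b2 x t)"

section \<open>Algebra, supports and bounds of test functions\<close>

lemma C2_with_derivs_mult:
  assumes "C2_with_derivs f f' f''" "C2_with_derivs g g' g''"
  shows "C2_with_derivs (\<lambda>x. f x * g x) (\<lambda>x. f x * g' x + f' x * g x) (\<lambda>x. f x * g'' x + f' x * g' x + (f' x * g' x + f'' x * g x))"
proof -
  have d: "(f has_real_derivative f' x) (at x)" "(f' has_real_derivative f'' x) (at x)"
     "(g has_real_derivative g' x) (at x)" "(g' has_real_derivative g'' x) (at x)" for x
    using assms by (auto simp: C2_with_derivs_def)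
  have c: "continuous_on UNIV f''" "continuous_on UNIV g''" using assms by (auto simp: C2_with_derivs_def)
  have c': "continuous_on UNIV f" "continuous_on UNIV f'" "continuous_on UNIV g" "continuous_on UNIV g'"
    by (rule DERIV_continuous_on[OF has_field_derivative_at_within], rule d)+
  show ?thesis
    unfolding C2_with_derivs_def
    by (intro conjI allI DERIV_mult' DERIV_add d continuous_intros c c')
qed

lemma C1_with_deriv_cont:
  assumes "C1_with_deriv g g'"
  shows "continuous_on A g" "continuous_on A g'"
proof -
  have d: "(g has_real_derivative g' x) (at x)" for x using assms by (simp add: C1_with_deriv_def)
  show "continuous_on A g" by (rule DERIV_continuous_on[OF has_field_derivative_at_within[OF d]])
  show "continuous_on A g'" using assms by (auto simp: C1_with_deriv_def intro: continuous_on_subset)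
qed

lemma C2_with_derivs_cont:
  assumes "C2_with_derivs f f' f''"
  shows "continuous_on A f" "continuous_on A f'" "continuous_on A f''"
proof -
  have d: "(f has_real_derivative f' x) (at x)" "(f' has_real_derivative f'' x) (at x)" for x
    using assms by (simp_all add: C2_with_derivs_def)
  show "continuous_on A f" by (rule DERIV_continuous_on[OF has_field_derivative_at_within[OF d(1)]])
  show "continuous_on A f'" by (rule DERIV_continuous_on[OF has_field_derivative_at_within[OF d(2)]])
  show "continuous_on A f''" using assms by (auto simp: C2_with_derivs_def intro: continuous_on_subset)
qed

lemma C1_with_deriv_mult:
  assumes "C1_with_deriv f f'" "C1_with_deriv g g'"
  shows "C1_with_deriv (\<lambda>x. f x * g x) (\<lambda>x. f x * g' x + f' x * g x)"
proof -
  have d: "(f has_real_derivative f' x) (at x)" "(g has_real_derivative g' x) (at x)" for x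
    using assms by (auto simp: C1_with_deriv_def)
  show ?thesis
    unfolding C1_with_deriv_def
    by (intro conjI allI DERIV_mult' d continuous_intros C1_with_deriv_cont[OF assms(1)] C1_with_deriv_cont[OF assms(2)])
qed

text \<open>The second factor needs no compact support because the first already has it. Multiplying
  by a single product is enough: mollifying kernels and cutoffs near an atom are a function of space
  times a function of time.\<close>

lemma test_fun_mult_prod:
  assumes "test_fun a a1 a2" and f: "C2_with_derivs f f' f''" and g: "C1_with_deriv g g'"
  shows "test_fun (\<lambda>x t. a x t * (f x * g t)) (\<lambda>x t. a1 x t * (f x * g t) + a x t * (f x * g' t))
     (\<lambda>x t. a2 x t * (f x * g t) + a x t * (f' x * g t))"
  using assms(1)
proof induction
  case (prod h h' h'' R k k')
  have "test_fun (\<lambda>x t. (h x * f x) * (k t * g t)) (\<lambda>x t. (h x * f x) * (k t * g' t + k' t * g t))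
     (\<lambda>x t. (h x * f' x + h' x * f x) * (k t * g t))"
    by (rule test_fun.prod[OF C2_with_derivs_mult[OF prod(1) f] _ C1_with_deriv_mult[OF prod(3) g], of R])
       (use prod(2) in auto)
  then show ?case by (simp add: algebra_simps)
next
  case (add a a1 a2 b b1 b2)
  from test_fun.add[OF add.IH] show ?case by (simp add: algebra_simps)
qed

lemma test_fun_minus:
  assumes "test_fun a a1 a2" "test_fun b b1 b2"
  shows "test_fun (\<lambda>x t. a x t - b x t) (\<lambda>x t. a1 x t - b1 x t) (\<lambda>x t. a2 x t - b2 x t)"
proof -
  \<comment> \<open>The constant -1 is written as a space factor times a time factor, so that the
    preceding product rule applies.\<close>
  have "test_fun (\<lambda>x t. b x t * (1 * (-1))) (\<lambda>x t. b1 x t * (1 * (-1)) + b x t * (1 * 0)) (\<lambda>x t. b2 x t * (1 * (-1)) + b x t * (0 * (-1)))"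
    by (rule test_fun_mult_prod[OF assms(2), of "\<lambda>_. 1" "\<lambda>_. 0" "\<lambda>_. 0" "\<lambda>_. -1" "\<lambda>_. 0"])
       (auto simp: C2_with_derivs_def C1_with_deriv_def)
  from test_fun.add[OF assms(1) this] show ?thesis by simp
qed

lemma test_fun_support:
  assumes "test_fun a a1 a2"
  obtains R where "R > 0" "\<And>x t. \<bar>x\<bar> \<ge> R \<Longrightarrow> a x t = 0 \<and> a1 x t = 0 \<and> a2 x t = 0"
proof -
  have "\<exists>R>0. \<forall>x t. \<bar>x\<bar> \<ge> R \<longrightarrow> a x t = 0 \<and> a1 x t = 0 \<and> a2 x t = 0"
    using assms
  proof induction
    case (prod f f' f'' R g g')
    then show ?case by (intro exI[of _ "max R 1"]) auto
  next
    case (add a a1 a2 b b1 b2)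
    then obtain R R' where "R > 0" "\<forall>x t. \<bar>x\<bar> \<ge> R \<longrightarrow> a x t = 0 \<and> a1 x t = 0 \<and> a2 x t = 0"
       "R' > 0" "\<forall>x t. \<bar>x\<bar> \<ge> R' \<longrightarrow> b x t = 0 \<and> b1 x t = 0 \<and> b2 x t = 0" by blast
    then show ?case by (intro exI[of _ "max R R'"]) auto
  qed
  then show ?thesis using that by blast
qed

lemma test_fun_cont:
  assumes "test_fun a a1 a2"
  shows "continuous_on A (\<lambda>p. a (fst p) (snd p))" "continuous_on A (\<lambda>p. a1 (fst p) (snd p))"
    "continuous_on A (\<lambda>p. a2 (fst p) (snd p))"
proof -
  have "continuous_on A (\<lambda>p. a (fst p) (snd p)) \<and> continuous_on A (\<lambda>p. a1 (fst p) (snd p))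
    \<and> continuous_on A (\<lambda>p. a2 (fst p) (snd p))"
    using assms
  proof induction
    case (prod f f' f'' R g g')
    have c: "continuous_on A (\<lambda>x. f (fst x))" "continuous_on A (\<lambda>x. f' (fst x))"
       "continuous_on A (\<lambda>x. g (snd x))" "continuous_on A (\<lambda>x. g' (snd x))"
      by (rule continuous_on_compose2[OF _ continuous_on_fst[OF continuous_on_id] subset_UNIV]
            continuous_on_compose2[OF _ continuous_on_snd[OF continuous_on_id] subset_UNIV],
          rule C2_with_derivs_cont[OF prod(1)] C1_with_deriv_cont[OF prod(3)])+
    show ?case by (intro conjI continuous_intros c)
  next
    case (add a a1 a2 b b1 b2)
    then show ?case by (elim conjE) (intro conjI continuous_on_add)
  qed
  then show "continuous_on A (\<lambda>p. a (fst p) (snd p))" "continuous_on A (\<lambda>p. a1 (fst p) (snd p))"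
    "continuous_on A (\<lambda>p. a2 (fst p) (snd p))" by auto
qed

lemma test_fun_borel:
  assumes "test_fun \<eta> \<eta>1 \<eta>2"
  shows "(\<lambda>p. \<eta> (fst p) (snd p)) \<in> borel_measurable borel" "(\<lambda>p. \<eta>1 (fst p) (snd p)) \<in> borel_measurable borel"
    "(\<lambda>p. \<eta>2 (fst p) (snd p)) \<in> borel_measurable borel"
  by (rule borel_measurable_continuous_onI, rule test_fun_cont[OF assms])+

lemma test_fun_slice_cont:
  assumes "test_fun \<eta> \<eta>1 \<eta>2"
  shows "continuous_on UNIV (\<lambda>x. \<eta> x t)" "continuous_on UNIV (\<lambda>t. \<eta>1 a t)"
  using continuous_on_compose2[OF test_fun_cont(1)[OF assms, of UNIV], of UNIV "\<lambda>x. (x, t)"]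
    continuous_on_compose2[OF test_fun_cont(2)[OF assms, of UNIV], of UNIV "\<lambda>t. (a, t)"]
  by (simp_all add: continuous_on_Pair)

lemma test_fun_DERIV:
  assumes "test_fun a a1 a2"
  shows "((\<lambda>x. a x t) has_real_derivative a2 x t) (at x)" "(a x has_real_derivative a1 x t) (at t)"
proof -
  have "((\<lambda>x. a x t) has_real_derivative a2 x t) (at x) \<and> (a x has_real_derivative a1 x t) (at t)"
    using assms
  proof induction
    case (prod f f' f'' R g g')
    have d: "(f has_real_derivative f' x) (at x)" "(g has_real_derivative g' t) (at t)"
      using prod by (simp_all add: C2_with_derivs_def C1_with_deriv_def)
    show ?case using DERIV_cmult_right[OF d(1)] DERIV_cmult[OF d(2)] by simp
  next
    case (add a a1 a2 b b1 b2)
    then show ?case by (auto intro!: DERIV_add)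
  qed
  then show "((\<lambda>x. a x t) has_real_derivative a2 x t) (at x)" "(a x has_real_derivative a1 x t) (at t)" by auto
qed

text \<open>The support is compact in space only; the time factors are arbitrary \<open>C1\<close>
  functions, hence the restriction to a bounded time window.\<close>

lemma test_fun_bounded:
  assumes "test_fun a a1 a2"
  obtains B where "B > 0" "\<And>x t. t \<in> {l..u} \<Longrightarrow> \<bar>a x t\<bar> \<le> B \<and> \<bar>a1 x t\<bar> \<le> B \<and> \<bar>a2 x t\<bar> \<le> B"
proof -
  obtain R where R: "R > 0" "\<And>x t. \<bar>x\<bar> \<ge> R \<Longrightarrow> a x t = 0 \<and> a1 x t = 0 \<and> a2 x t = 0"
    using test_fun_support[OF assms] by blast
  have cpt: "compact ({-R..R} \<times> {l..u})" by (intro compact_Times) auto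
  have "bounded ((\<lambda>p. a (fst p) (snd p)) ` ({-R..R} \<times> {l..u}))"
     "bounded ((\<lambda>p. a1 (fst p) (snd p)) ` ({-R..R} \<times> {l..u}))"
     "bounded ((\<lambda>p. a2 (fst p) (snd p)) ` ({-R..R} \<times> {l..u}))"
    by (intro compact_imp_bounded compact_continuous_image test_fun_cont[OF assms] cpt)+
  then obtain B1 B2 B3 where "\<forall>y\<in>(\<lambda>p. a (fst p) (snd p)) ` ({-R..R} \<times> {l..u}). \<bar>y\<bar> \<le> B1"
     "\<forall>y\<in>(\<lambda>p. a1 (fst p) (snd p)) ` ({-R..R} \<times> {l..u}). \<bar>y\<bar> \<le> B2"
     "\<forall>y\<in>(\<lambda>p. a2 (fst p) (snd p)) ` ({-R..R} \<times> {l..u}). \<bar>y\<bar> \<le> B3"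
    unfolding bounded_real by (elim exE) blast
  then have B: "\<And>p. p \<in> {-R..R} \<times> {l..u} \<Longrightarrow> \<bar>a (fst p) (snd p)\<bar> \<le> B1"
     "\<And>p. p \<in> {-R..R} \<times> {l..u} \<Longrightarrow> \<bar>a1 (fst p) (snd p)\<bar> \<le> B2"
     "\<And>p. p \<in> {-R..R} \<times> {l..u} \<Longrightarrow> \<bar>a2 (fst p) (snd p)\<bar> \<le> B3"
    by (blast intro: imageI)+
  define B where "B = \<bar>B1\<bar> + \<bar>B2\<bar> + \<bar>B3\<bar> + 1"
  show ?thesis
  proof (rule that)
    show "B > 0" by (simp add: B_def)
    fix x t assume t: "t \<in> {l..u}"
    show "\<bar>a x t\<bar> \<le> B \<and> \<bar>a1 x t\<bar> \<le> B \<and> \<bar>a2 x t\<bar> \<le> B"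
    proof (cases "\<bar>x\<bar> \<ge> R")
      case True
      then show ?thesis using R(2)[of x t] by (simp add: B_def)
    next
      case False
      then have p: "(x, t) \<in> {-R..R} \<times> {l..u}" using t by auto
      have "\<bar>a x t\<bar> \<le> B1" "\<bar>a1 x t\<bar> \<le> B2" "\<bar>a2 x t\<bar> \<le> B3"
        using B(1)[OF p] B(2)[OF p] B(3)[OF p] by simp_all
      then show ?thesis unfolding B_def by linarith
    qed
  qed
qed

lemma bump_bounded: obtains B where "B > 0" "\<And>x. bump x \<le> B" "\<And>x. \<bar>bump' x\<bar> \<le> B"
proof -
  have "bounded (bump ` {-1..1})" "bounded (bump' ` {-1..1})"
    by (intro compact_imp_bounded compact_continuous_image bump_cont bump'_cont compact_Icc)+
  then obtain B1 B2 where B: "\<forall>y\<in>bump ` {-1..1}. \<bar>y\<bar> \<le> B1" "\<forall>y\<in>bump' ` {-1..1}. \<bar>y\<bar> \<le> B2"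
    unfolding bounded_real by blast
  show ?thesis
  proof (rule that[of "\<bar>B1\<bar> + \<bar>B2\<bar> + 1"])
    fix x :: real
    show "bump x \<le> \<bar>B1\<bar> + \<bar>B2\<bar> + 1"
    proof (cases "\<bar>x\<bar> \<ge> 1")
      case False
      then have "\<bar>bump x\<bar> \<le> B1" using B(1) by force
      then show ?thesis by linarith
    qed (simp add: bump_eq_0)
    show "\<bar>bump' x\<bar> \<le> \<bar>B1\<bar> + \<bar>B2\<bar> + 1"
    proof (cases "\<bar>x\<bar> \<ge> 1")
      case False
      then have "\<bar>bump' x\<bar> \<le> B2" using B(2) by force
      then show ?thesis by linarith
    qed (simp add: bump'_eq_0)
  qed simp
qed

section \<open>Kernels of unit mass and monotonicity in the sense of distributions\<close>

lemma integrable_bump_scaled: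
  assumes "c > 0"
  shows "integrable lborel (\<lambda>x. c * bump (c * x + b))" "(\<integral>x. c * bump (c * x + b) \<partial>lborel) = 1"
proof -
  have "has_bochner_integral lborel (\<lambda>x. c * bump (c * x + b)) 1"
    by (rule has_bochner_integral_nn_integral)
       (use nn_integral_bump_scaled[OF assms] assms bump_nonneg in auto)
  then show "integrable lborel (\<lambda>x. c * bump (c * x + b))" "(\<integral>x. c * bump (c * x + b) \<partial>lborel) = 1"
    by (auto simp: has_bochner_integral_iff)
qed

lemma integrable_pair_mult:
  fixes f :: "'a::euclidean_space \<Rightarrow> real" and g :: "'b::euclidean_space \<Rightarrow> real"
  assumes f: "integrable lborel f" and g: "integrable lborel g"
  shows "integrable (lborel \<Otimes>\<^sub>M lborel) (\<lambda>(x, y). f x * g y)"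
proof -
  have [measurable]: "f \<in> borel_measurable borel" "g \<in> borel_measurable borel" using f g by auto
  show ?thesis
  proof (rule lborel_pair.Fubini_integrable)
    have "(\<lambda>x. \<integral>y. norm (case (x, y) of (x, y) \<Rightarrow> f x * g y) \<partial>lborel) = (\<lambda>x. \<bar>f x\<bar> * (\<integral>y. \<bar>g y\<bar> \<partial>lborel))"
      by (simp add: abs_mult)
    then show "integrable lborel (\<lambda>x. \<integral>y. norm (case (x, y) of (x, y) \<Rightarrow> f x * g y) \<partial>lborel)"
      using f by simp
  qed (use g in auto)
qed

text \<open>The hypothesis says that the distributional derivative of \<open>g\<close> is
  nonpositive on the open interval. Mollified versions of \<open>g\<close>, tested by differences of
  two smooth steps, are genuinely nonincreasing, and an almost everywhere convergent subsequence
  hands this to \<open>g\<close> off one null set. If \<open>\<alpha>\<close> is negative and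
  \<open>g\<close> vanishes before time 0, the conclusion also bounds \<open>g\<close> by its
  initial value 0.\<close>

lemma weakly_nonincreasing:
  fixes g :: "real \<Rightarrow> real"
  assumes g: "integrable lborel g"
    and weak: "\<And>\<theta> \<theta>' l u. C1_with_deriv \<theta> \<theta>' \<Longrightarrow> (\<And>t. \<theta> t \<ge> 0) \<Longrightarrow> \<alpha> < l \<Longrightarrow> u < \<beta> \<Longrightarrow>
      (\<And>t. t < l \<or> u < t \<Longrightarrow> \<theta> t = 0) \<Longrightarrow> 0 \<le> (\<integral>t. g t * \<theta>' t \<partial>lborel)"
  shows "\<exists>N\<in>null_sets lborel. \<forall>s t. s \<notin> N \<longrightarrow> t \<notin> N \<longrightarrow> \<alpha> < s \<longrightarrow> s < t \<longrightarrow> t < \<beta> \<longrightarrow> g t \<le> g s"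
proof -
  obtain B where B: "B > 0" "\<And>x. bump x \<le> B" using bump_bounded by metis
  have [measurable]: "g \<in> borel_measurable borel" using g by simp
  define K where "K n z = real (Suc n) * bump (real (Suc n) * z)" for n z
  have [measurable]: "K n \<in> borel_measurable borel" for n unfolding K_def by measurable
  have K0: "0 \<le> K n z" for n z by (simp add: K_def bump_nonneg)
  have KB: "K n z \<le> real (Suc n) * B" for n z unfolding K_def using B by (intro mult_left_mono) auto
  have K1: "(\<integral>\<^sup>+z. ennreal (K n z) \<partial>lborel) = 1" for n
    using nn_integral_bump_scaled[of "real (Suc n)" 0] by (simp add: K_def)
  have Kd: "K n z = 0" if "\<bar>z\<bar> \<ge> 1 / real (Suc n)" for n z
  proof -
    have "\<bar>real (Suc n) * z\<bar> \<ge> 1" using that by (simp add: abs_mult field_simps)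
    then show ?thesis by (simp add: K_def bump_eq_0)
  qed
  have Kint: "integrable lborel (\<lambda>r. K n (s - r))" "(\<integral>r. K n (s - r) \<partial>lborel) = 1" for n s
  proof -
    have "has_bochner_integral lborel (\<lambda>z. K n z) 1"
      by (rule has_bochner_integral_nn_integral) (use K1 K0 in auto)
    then have "has_bochner_integral lborel (\<lambda>r. K n (s + (-1) * r)) (1 /\<^sub>R \<bar>-1\<bar>)"
      by (intro lborel_has_bochner_integral_real_affine_iff[THEN iffD1]) auto
    then show "integrable lborel (\<lambda>r. K n (s - r))" "(\<integral>r. K n (s - r) \<partial>lborel) = 1"
      by (auto simp: has_bochner_integral_iff)
  qed
  have gK: "integrable lborel (\<lambda>r. g r * K n (s - r))" for n s
    by (rule Bochner_Integration.integrable_bound[where f = "\<lambda>r. g r * (real (Suc n) * B)"])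
       (use g K0 B(1) in \<open>auto simp: abs_mult intro!: AE_I2 mult_left_mono order_trans[OF KB]\<close>)
  define G where "G n s = (\<integral>r. g r * K n (s - r) \<partial>lborel)" for n s
  have mono: "G n t \<le> G n s" if "s < t" "\<alpha> < s - 1 / real (Suc n)" "t + 1 / real (Suc n) < \<beta>" for n s t
  proof -
    let ?n = "real (Suc n)"
    \<comment> \<open>A smoothed indicator of the interval from \<open>s\<close> to
      \<open>t\<close>. Its derivative is \<open>K n (s - r) - K n (t - r)\<close>, so the weak
      inequality compares the mollifications at \<open>s\<close> and at \<open>t\<close>.\<close>
    let ?\<theta> = "\<lambda>r. smooth_step (?n * (t - r)) - smooth_step (?n * (s - r))"
    let ?\<theta>' = "\<lambda>r. K n (s - r) - K n (t - r)"
    have d: "((\<lambda>r. smooth_step (?n * (a - r))) has_real_derivative - K n (a - r)) (at r)" for a r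
    proof -
      have "((\<lambda>r. ?n * (a - r)) has_real_derivative - ?n) (at r)"
        by (auto intro!: derivative_eq_intros)
      from DERIV_chain2[OF DERIV_smooth_step this] show ?thesis by (simp add: K_def mult.commute del: of_nat_Suc)
    qed
    have "0 \<le> (\<integral>r. g r * ?\<theta>' r \<partial>lborel)"
    proof (rule weak[where \<theta> = ?\<theta>, OF _ _ that(2,3)])
      have "((\<lambda>r. ?\<theta> r) has_real_derivative ?\<theta>' r) (at r)" for r
        using DERIV_diff[OF d[of t r] d[of s r]] by simp
      moreover have "continuous_on UNIV ?\<theta>'"
        unfolding K_def by (intro continuous_intros continuous_on_compose2[OF bump_cont[of UNIV]]) auto
      ultimately show "C1_with_deriv ?\<theta> ?\<theta>'" by (simp add: C1_with_deriv_def)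
      show "0 \<le> ?\<theta> r" for r
        using that(1) smooth_step_mono[of "?n * (s - r)" "?n * (t - r)"] by (simp add: mult_left_mono)
      show "?\<theta> r = 0" if "r < s - 1 / ?n \<or> t + 1 / ?n < r" for r
        using that
      proof
        assume "r < s - 1 / ?n"
        then have "1 \<le> ?n * (s - r)" by (simp add: field_simps)
        moreover from this have "1 \<le> ?n * (t - r)" using \<open>s < t\<close>
          by (smt (verit, best) mult_left_mono of_nat_0_le_iff)
        ultimately show ?thesis by (simp add: smooth_step_eq_1)
      next
        assume "t + 1 / ?n < r"
        then have "?n * (t - r) \<le> -1" by (simp add: field_simps)
        moreover from this have "?n * (s - r) \<le> -1" using \<open>s < t\<close>
          by (smt (verit, best) mult_left_mono of_nat_0_le_iff)
        ultimately show ?thesis by (simp add: smooth_step_eq_0)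
      qed
    qed
    also have "(\<integral>r. g r * ?\<theta>' r \<partial>lborel) = (\<integral>r. g r * K n (s - r) - g r * K n (t - r) \<partial>lborel)"
      by (simp add: algebra_simps)
    also have "\<dots> = G n s - G n t" unfolding G_def by (rule Bochner_Integration.integral_diff[OF gK gK])
    finally show ?thesis by simp
  qed
  \<comment> \<open>The pointwise error of the mollification; \<open>mollification_error\<close>
    controls its \<open>L1\<close> norm.\<close>
  define u where "u n s = (\<integral>r. (g r - g s) * K n (s - r) \<partial>lborel)" for n s
  have uG: "u n s = G n s - g s" for n s
  proof -
    have "u n s = (\<integral>r. g r * K n (s - r) - g s * K n (s - r) \<partial>lborel)"
      by (simp add: u_def algebra_simps)
    also have "\<dots> = G n s - g s * 1"
      unfolding G_def Kint(2)[of n s, symmetric] using Bochner_Integration.integral_diff[OF gK integrable_mult_right[OF Kint(1)]]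
      by simp
    finally show ?thesis by simp
  qed
  have Kab: "((a::real) * K n z = \<bar>a\<bar> * K n z) \<or> (a * K n z = - (\<bar>a\<bar> * K n z))" for a n z by (cases "a \<ge> 0") auto
  have u_small: "\<exists>n0. \<forall>n\<ge>n0. integrable lborel (u n) \<and> (\<integral>s. norm (u n s) \<partial>lborel) \<le> e" if "e > 0" for e
  proof -
    from mollification_error[OF g that] obtain d where d: "d > 0"
      "\<And>K. K \<in> borel_measurable borel \<Longrightarrow> (\<And>z. 0 \<le> K z) \<Longrightarrow> (\<integral>\<^sup>+z. ennreal (K z) \<partial>lborel) = 1 \<Longrightarrow>
       (\<And>z. norm z \<ge> d \<Longrightarrow> K z = 0) \<Longrightarrow>
       integrable (lborel \<Otimes>\<^sub>M lborel) (\<lambda>(p, q). \<bar>g q - g p\<bar> * K (p - q)) \<and>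
       (\<integral>(p, q). \<bar>g q - g p\<bar> * K (p - q) \<partial>(lborel \<Otimes>\<^sub>M lborel)) \<le> e" by blast
    obtain n0 where n0: "1 / real (Suc n0) < d" using d(1) nat_approx_posE by blast
    have "integrable lborel (u n) \<and> (\<integral>s. norm (u n s) \<partial>lborel) \<le> e" if n: "n \<ge> n0" for n
    proof -
      have "1 / real (Suc n) \<le> 1 / real (Suc n0)" using n by (simp add: frac_le)
      then have i: "integrable (lborel \<Otimes>\<^sub>M lborel) (\<lambda>(p, q). \<bar>g q - g p\<bar> * K n (p - q))"
        and le: "(\<integral>(p, q). \<bar>g q - g p\<bar> * K n (p - q) \<partial>(lborel \<Otimes>\<^sub>M lborel)) \<le> e"
        using d(2)[of "K n"] K0 K1 Kd n0 by auto
      have i': "integrable (lborel \<Otimes>\<^sub>M lborel) (\<lambda>(p, q). (g q - g p) * K n (p - q))"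
        by (rule Bochner_Integration.integrable_bound[OF i]) (auto simp: abs_mult K0)
      have iu: "integrable lborel (u n)"
        using lborel_pair.integrable_fst'[OF i'] by (simp add: u_def[abs_def])
      have "(\<integral>s. norm (u n s) \<partial>lborel) \<le> (\<integral>s. (\<integral>r. \<bar>g r - g s\<bar> * K n (s - r) \<partial>lborel) \<partial>lborel)"
      proof (rule integral_mono)
        show "integrable lborel (\<lambda>s. norm (u n s))" using iu by simp
        show "integrable lborel (\<lambda>s. \<integral>r. \<bar>g r - g s\<bar> * K n (s - r) \<partial>lborel)"
          using lborel_pair.integrable_fst'[OF i] by simp
        show "norm (u n s) \<le> (\<integral>r. \<bar>g r - g s\<bar> * K n (s - r) \<partial>lborel)" for s
          unfolding u_def
          using integral_norm_bound[of lborel "\<lambda>r. (g r - g s) * K n (s - r)"] by (simp add: abs_mult K0)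
      qed
      also have "\<dots> = (\<integral>(p, q). \<bar>g q - g p\<bar> * K n (p - q) \<partial>(lborel \<Otimes>\<^sub>M lborel))"
        using lborel_pair.integral_fst'[OF i] by simp
      finally show ?thesis using iu le by simp
    qed
    then show ?thesis by blast
  qed
  \<comment> \<open>Integrability of \<open>u n\<close> is known for large \<open>n\<close> only,
    hence the index shift by \<open>m0\<close> in the subsequence.\<close>
  obtain m0 where m0: "\<And>n. n \<ge> m0 \<Longrightarrow> integrable lborel (u n)" using u_small[of 1] by auto
  have "\<exists>r::nat\<Rightarrow>nat. strict_mono r \<and> (AE x in lborel. (\<lambda>n. u (r n + m0) x) \<longlonglongrightarrow> 0)"
  proof (rule tendsto_L1_AE_subseq)
    show "integrable lborel (u (n + m0))" for n by (rule m0) simp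
    show "(\<lambda>n. \<integral>x. norm (u (n + m0) x) \<partial>lborel) \<longlonglongrightarrow> 0"
    proof (rule LIMSEQ_I)
      fix e :: real assume "e > 0"
      then obtain n0 where n0: "\<forall>n\<ge>n0. (\<integral>s. norm (u n s) \<partial>lborel) \<le> e / 2" using u_small[of "e/2"] by auto
      have "norm ((\<integral>x. norm (u (n + m0) x) \<partial>lborel) - 0) < e" if "n \<ge> n0" for n
      proof -
        have "0 \<le> (\<integral>x. norm (u (n + m0) x) \<partial>lborel)" by simp
        moreover have "(\<integral>x. norm (u (n + m0) x) \<partial>lborel) \<le> e / 2" using n0 that by simp
        ultimately show ?thesis using \<open>e > 0\<close> by simp
      qed
      then show "\<exists>no. \<forall>n\<ge>no. norm ((\<integral>x. norm (u (n + m0) x) \<partial>lborel) - 0) < e" by blast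
    qed
  qed
  then obtain r :: "nat \<Rightarrow> nat" where r: "strict_mono r" "AE x in lborel. (\<lambda>n. u (r n + m0) x) \<longlonglongrightarrow> 0" by blast
  from r(2) obtain N where N: "{x \<in> space lborel. \<not> (\<lambda>n. u (r n + m0) x) \<longlonglongrightarrow> 0} \<subseteq> N" "N \<in> null_sets lborel"
    by (auto elim!: AE_E simp: null_sets_def)
  show ?thesis
  proof (intro bexI[OF _ N(2)] allI impI)
    fix s t assume st: "s \<notin> N" "t \<notin> N" "\<alpha> < s" "s < t" "t < \<beta>"
    have lim: "(\<lambda>n. G (r n + m0) x) \<longlonglongrightarrow> g x" if "x \<notin> N" for x
    proof -
      have "(\<lambda>n. u (r n + m0) x) \<longlonglongrightarrow> 0" using N(1) that by auto
      then show ?thesis unfolding uG using LIM_zero_iff by blast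
    qed
    define \<delta> where "\<delta> = min (s - \<alpha>) (\<beta> - t)"
    have "\<delta> > 0" using st by (simp add: \<delta>_def)
    then obtain k where k: "1 / real (Suc k) < \<delta>" using nat_approx_posE by blast
    show "g t \<le> g s"
    proof (rule LIMSEQ_le[OF lim[OF st(2)] lim[OF st(1)]], intro exI allI impI)
      fix n assume "k \<le> n"
      then have "k \<le> r n + m0" using strict_mono_imp_increasing[OF r(1), of n] by simp
      then have "1 / real (Suc (r n + m0)) \<le> 1 / real (Suc k)" by (simp add: frac_le)
      then have "1 / real (Suc (r n + m0)) < \<delta>" using k by simp
      then show "G (r n + m0) t \<le> G (r n + m0) s"
        by (intro mono) (use st in \<open>auto simp: \<delta>_def\<close>)
    qed
  qed
qed

section \<open>Doubling of variables\<close>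

locale monotone_flux =
  fixes \<psi> :: "real \<Rightarrow> real" and M L :: real
  assumes psi_mono: "mono \<psi>" and psi_0: "\<psi> 0 = 0" and psi_le: "\<psi> s \<le> M"
    and psi_lim: "(\<psi> \<longlongrightarrow> M) at_top" and psi_lipschitz: "\<bar>\<psi> s - \<psi> r\<bar> \<le> L * \<bar>s - r\<bar>" and L_nonneg: "0 \<le> L"
begin

lemma psi_cont: "continuous_on A \<psi>"
proof -
  have "L-lipschitz_on A \<psi>"
    unfolding lipschitz_on_def using psi_lipschitz L_nonneg by (auto simp: dist_real_def)
  then show ?thesis by (rule lipschitz_on_continuous_on)
qed

lemma psi_borel[measurable]: "\<psi> \<in> borel_measurable borel"
  by (rule borel_measurable_continuous_onI[OF psi_cont])

lemma psi_nonneg: "0 \<le> s \<Longrightarrow> 0 \<le> \<psi> s"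
  using monoD[OF psi_mono, of 0 s] psi_0 by simp

text \<open>\<open>Z\<close> is meant to collect the points at which nothing is claimed: times
  outside the strip and the lines occupied by atoms. Nonnegative constants \<open>k\<close> suffice
  for doubling, where \<open>k\<close> is a value of the other, nonnegative solution.\<close>

definition kruzkov_away :: "(real \<times> real) set \<Rightarrow> (real \<times> real \<Rightarrow> real) \<Rightarrow> bool" where
  "kruzkov_away Z U \<longleftrightarrow> (\<forall>k\<ge>0. \<forall>\<eta> \<eta>1 \<eta>2. test_fun \<eta> \<eta>1 \<eta>2 \<longrightarrow> (\<forall>x t. 0 \<le> \<eta> x t) \<longrightarrow> (\<forall>x t. (x, t) \<in> Z \<longrightarrow> \<eta> x t = 0) \<longrightarrow>
     0 \<le> (\<integral>p. \<bar>U p - k\<bar> * \<eta>1 (fst p) (snd p) + \<bar>\<psi> (U p) - \<psi> k\<bar> * \<eta>2 (fst p) (snd p) \<partial>lborel))"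

lemma test_fun_derivs_eq_0:
  assumes "test_fun \<eta> \<eta>1 \<eta>2" and z: "\<And>x t. t \<le> l \<or> t \<ge> u \<Longrightarrow> \<eta> x t = 0" and t: "t < l \<or> t > u"
  shows "\<eta>1 x t = 0" "\<eta>2 x t = 0"
proof -
  have "((\<lambda>x. \<eta> x t) has_real_derivative \<eta>2 x t) (at x)" by (rule test_fun_DERIV(1)[OF assms(1)])
  moreover have "(\<lambda>x. \<eta> x t) = (\<lambda>x. 0)" using z t by auto
  ultimately show "\<eta>2 x t = 0" using DERIV_unique[of "\<lambda>x. 0" "\<eta>2 x t" x 0] by auto
  have "(\<eta> x has_real_derivative 0) (at t)"
  proof (cases "t < l")
    case True
    show ?thesis
      by (rule has_field_derivative_transform_within_open[of "\<lambda>_. 0" _ _ "{..<l}"]) (use True z in auto)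
  next
    case False
    show ?thesis
      by (rule has_field_derivative_transform_within_open[of "\<lambda>_. 0" _ _ "{u<..}"]) (use False t z in auto)
  qed
  then show "\<eta>1 x t = 0" using DERIV_unique[OF test_fun_DERIV(2)[OF assms(1)]] by auto
qed

lemma test_fun_compact_bounded:
  assumes tf: "test_fun \<eta> \<eta>1 \<eta>2" and z: "\<And>x t. t \<le> l \<or> t \<ge> u \<Longrightarrow> \<eta> x t = 0"
  obtains B R where "B > 0" "R > 0" "\<And>x t. \<bar>\<eta> x t\<bar> \<le> B \<and> \<bar>\<eta>1 x t\<bar> \<le> B \<and> \<bar>\<eta>2 x t\<bar> \<le> B"
    "\<And>p. p \<notin> cbox (-R, -R) (R, R) \<Longrightarrow> \<eta> (fst p) (snd p) = 0 \<and> \<eta>1 (fst p) (snd p) = 0 \<and> \<eta>2 (fst p) (snd p) = 0"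
proof -
  obtain R where R: "R > 0" "\<And>x t. \<bar>x\<bar> \<ge> R \<Longrightarrow> \<eta> x t = 0 \<and> \<eta>1 x t = 0 \<and> \<eta>2 x t = 0"
    using test_fun_support[OF tf] by metis
  obtain B where B: "B > 0" "\<And>x t. t \<in> {l..u} \<Longrightarrow> \<bar>\<eta> x t\<bar> \<le> B \<and> \<bar>\<eta>1 x t\<bar> \<le> B \<and> \<bar>\<eta>2 x t\<bar> \<le> B"
    using test_fun_bounded[OF tf, of l u] by metis
  have out: "\<eta> x t = 0 \<and> \<eta>1 x t = 0 \<and> \<eta>2 x t = 0" if "t < l \<or> t > u" for x t
    using test_fun_derivs_eq_0[OF tf z that] z that by auto
  define R' where "R' = max R (max \<bar>l\<bar> \<bar>u\<bar>)"
  show ?thesis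
  proof (rule that[of B R'])
    show "\<bar>\<eta> x t\<bar> \<le> B \<and> \<bar>\<eta>1 x t\<bar> \<le> B \<and> \<bar>\<eta>2 x t\<bar> \<le> B" for x t
      using B out[of t x] by (cases "t \<in> {l..u}") auto
    show "\<eta> (fst p) (snd p) = 0 \<and> \<eta>1 (fst p) (snd p) = 0 \<and> \<eta>2 (fst p) (snd p) = 0"
      if "p \<notin> cbox (-R', -R') (R', R')" for p
    proof -
      obtain x t where p: "p = (x, t)" by (cases p)
      have "\<bar>x\<bar> \<ge> R \<or> t < l \<or> t > u" using that unfolding p R'_def by (auto simp: cbox_Pair_eq)
      then show ?thesis using R(2) out unfolding p by auto
    qed
  qed (use B R in \<open>auto simp: R'_def\<close>)
qed

lemma mult_diff_le:
  fixes a b c d :: real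
  assumes "\<bar>a - b\<bar> \<le> c" "\<bar>d\<bar> \<le> B"
  shows "b * d \<ge> a * d - c * B"
proof -
  have "(a - b) * d \<le> \<bar>a - b\<bar> * \<bar>d\<bar>" by (metis abs_ge_self abs_mult)
  also have "\<dots> \<le> c * B" using assms by (intro mult_mono) auto
  finally show ?thesis by (simp add: algebra_simps)
qed

text \<open>The cutoff \<open>\<eta>\<close> is evaluated at the point of \<open>U\<close> only: the derivatives that fall on the mollifier
  cancel, and the price is one \<open>L\<^sup>1\<close> mollification error for \<open>V\<close>.\<close>

theorem kruzkov_doubling:
  assumes U: "integrable lborel U" "\<And>p. 0 \<le> U p" and V: "integrable lborel V" "\<And>p. 0 \<le> V p"
    and kU: "kruzkov_away Z U" and kV: "kruzkov_away Z V"
    and tf: "test_fun \<eta> \<eta>1 \<eta>2" and nn: "\<And>x t. 0 \<le> \<eta> x t"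
    and cpt: "\<And>x t. t \<le> l \<or> t \<ge> u \<Longrightarrow> \<eta> x t = 0" and e: "e > 0"
    and sep: "\<And>x t y s. (y, s) \<in> Z \<Longrightarrow> \<bar>x - y\<bar> < e \<Longrightarrow> \<bar>t - s\<bar> < e \<Longrightarrow> \<eta> x t = 0"
  shows "0 \<le> (\<integral>p. \<bar>U p - V p\<bar> * \<eta>1 (fst p) (snd p) + \<bar>\<psi> (U p) - \<psi> (V p)\<bar> * \<eta>2 (fst p) (snd p) \<partial>lborel)"
    (is "0 \<le> ?J")
proof -
  have [measurable]: "U \<in> borel_measurable borel" "V \<in> borel_measurable borel" using U V by auto
  obtain B R where B: "B > 0" and R: "R > 0" and bd: "\<And>x t. \<bar>\<eta> x t\<bar> \<le> B \<and> \<bar>\<eta>1 x t\<bar> \<le> B \<and> \<bar>\<eta>2 x t\<bar> \<le> B"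
    and box: "\<And>p. p \<notin> cbox (-R, -R) (R, R) \<Longrightarrow> \<eta> (fst p) (snd p) = 0 \<and> \<eta>1 (fst p) (snd p) = 0 \<and> \<eta>2 (fst p) (snd p) = 0"
    using test_fun_compact_bounded[OF tf cpt] by metis
  obtain B' where B': "B' > 0" "\<And>x. bump x \<le> B'" "\<And>x. \<bar>bump' x\<bar> \<le> B'" using bump_bounded by metis
  define g g1 g2 where "g p = \<eta> (fst p) (snd p)" and "g1 p = \<eta>1 (fst p) (snd p)" and "g2 p = \<eta>2 (fst p) (snd p)" for p
  have [measurable]: "g \<in> borel_measurable borel" "g1 \<in> borel_measurable borel" "g2 \<in> borel_measurable borel"
    unfolding g_def[abs_def] g1_def[abs_def] g2_def[abs_def]
    by (rule borel_measurable_continuous_onI, rule test_fun_cont[OF tf])+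
  have gB: "\<bar>g p\<bar> \<le> B" "\<bar>g1 p\<bar> \<le> B" "\<bar>g2 p\<bar> \<le> B" for p using bd by (auto simp: g_def g1_def g2_def)
  \<comment> \<open>\<open>?C\<close> contains the support of the cutoff in \<open>p\<close>; the
    kernels below have radius less than 1, so that \<open>q\<close> stays in the enlarged box
    \<open>?D\<close>.\<close>
  let ?C = "cbox (-R, -R) (R, R) :: (real \<times> real) set" and ?D = "cbox (-R-1, -R-1) (R+1, R+1) :: (real \<times> real) set"
  have gC: "g p = 0" "g1 p = 0" "g2 p = 0" if "p \<notin> ?C" for p using box[OF that] by (auto simp: g_def g1_def g2_def)
  define Q where "Q p q = \<bar>U p - V q\<bar>" for p q
  define W where "W p q = \<bar>\<psi> (U p) - \<psi> (V q)\<bar>" for p q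
  have [measurable]: "(\<lambda>w. Q (fst w) (snd w)) \<in> borel_measurable (lborel \<Otimes>\<^sub>M lborel)"
     "(\<lambda>w. W (fst w) (snd w)) \<in> borel_measurable (lborel \<Otimes>\<^sub>M lborel)"
    unfolding Q_def W_def by measurable
  have QW: "0 \<le> Q p q" "0 \<le> W p q" "W p q \<le> L * Q p q" "Q p q \<le> U p + V q" for p q
    using psi_lipschitz[of "U p" "V q"] U(2)[of p] V(2)[of q] by (auto simp: Q_def W_def)
  \<comment> \<open>The majorant \<open>U p + V q\<close> is not integrable over the product of two
    planes, but here each summand is multiplied by the indicator of a bounded box in the other
    variable.\<close>
  have dom: "integrable (lborel \<Otimes>\<^sub>M lborel) F"
    if [measurable]: "F \<in> borel_measurable (lborel \<Otimes>\<^sub>M lborel)"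
      and le: "\<And>p q. \<bar>F (p, q)\<bar> \<le> c * Q p q" and out: "\<And>p q. p \<notin> ?C \<or> q \<notin> ?D \<Longrightarrow> F (p, q) = 0" and c: "0 \<le> c" for F c
  proof -
    have iC: "integrable lborel (indicator ?C :: _ \<Rightarrow> real)" and iD: "integrable lborel (indicator ?D :: _ \<Rightarrow> real)"
      by (auto intro!: integrable_real_indicator simp: emeasure_lborel_cbox_eq)
    have "integrable (lborel \<Otimes>\<^sub>M lborel) (\<lambda>w. c * ((case w of (p, q) \<Rightarrow> U p * indicator ?D q) + (case w of (p, q) \<Rightarrow> indicator ?C p * V q)))"
      by (intro integrable_mult_right Bochner_Integration.integrable_add integrable_pair_mult U V iC iD)
    then show ?thesis
    proof (rule Bochner_Integration.integrable_bound)
      show "AE w in lborel \<Otimes>\<^sub>M lborel. norm (F w) \<le> norm (c * ((case w of (p, q) \<Rightarrow> U p * indicator ?D q) + (case w of (p, q) \<Rightarrow> indicator ?C p * V q)))"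
      proof (rule AE_I2)
        fix w :: "(real \<times> real) \<times> (real \<times> real)"
        obtain p q where w: "w = (p, q)" by (cases w)
        show "norm (F w) \<le> norm (c * ((case w of (p, q) \<Rightarrow> U p * indicator ?D q) + (case w of (p, q) \<Rightarrow> indicator ?C p * V q)))"
        proof (cases "p \<in> ?C \<and> q \<in> ?D")
          case True
          have "\<bar>F (p, q)\<bar> \<le> c * (U p + V q)"
            using le[of p q] mult_left_mono[OF QW(4) c] by (rule order_trans)
          also have "\<dots> = \<bar>c * (U p + V q)\<bar>" using c U(2)[of p] V(2)[of q] by simp
          finally show ?thesis using True unfolding w by simp
        next
          case False
          then show ?thesis using out[of p q] unfolding w by auto
        qed
      qed
    qed measurable
  qed
  have main: "?J \<ge> - ((1 + L) * B * \<epsilon>)" if \<epsilon>: "\<epsilon> > 0" for \<epsilon>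
  proof -
    from mollification_error[OF V(1) \<epsilon>] obtain d where d: "d > 0"
      "\<And>K. K \<in> borel_measurable borel \<Longrightarrow> (\<And>z. 0 \<le> K z) \<Longrightarrow> (\<integral>\<^sup>+z. ennreal (K z) \<partial>lborel) = 1 \<Longrightarrow>
       (\<And>z. norm z \<ge> d \<Longrightarrow> K z = 0) \<Longrightarrow>
       integrable (lborel \<Otimes>\<^sub>M lborel) (\<lambda>(p, q). \<bar>V q - V p\<bar> * K (p - q)) \<and>
       (\<integral>(p, q). \<bar>V q - V p\<bar> * K (p - q) \<partial>(lborel \<Otimes>\<^sub>M lborel)) \<le> \<epsilon>"
      by blast
    \<comment> \<open>The three summands secure in turn that the kernel does not reach further than
      \<open>e\<close>, that its support lies in the ball of radius \<open>d\<close> (the norm is at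
      most the sum of the coordinates, hence the 2), and that its radius is below 1.\<close>
    define n where "n = 1 / e + 2 / d + 1"
    have "1 / e > 0" "2 / d > 0" using e d(1) by auto
    then have n1: "n > 1" "n > 1 / e" "n > 2 / d" unfolding n_def by linarith+
    then have n: "n > 1" "1 / n < e" "2 / n < d" using e d(1) by (auto simp: field_simps)
    define \<rho> \<rho>' where "\<rho> z = n * bump (n * z)" and "\<rho>' z = n * (n * bump' (n * z))" for z
    have [measurable]: "\<rho> \<in> borel_measurable borel" "\<rho>' \<in> borel_measurable borel"
      unfolding \<rho>_def[abs_def] \<rho>'_def[abs_def] by measurable
    have \<rho>0: "0 \<le> \<rho> z" for z using n by (simp add: \<rho>_def bump_nonneg)
    have \<rho>z: "\<rho> z = 0" "\<rho>' z = 0" if "\<bar>z\<bar> \<ge> 1 / n" for z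
    proof -
      have "\<bar>n * z\<bar> \<ge> 1" using that n by (simp add: abs_mult field_simps)
      then show "\<rho> z = 0" "\<rho>' z = 0" by (simp_all add: \<rho>_def \<rho>'_def bump_eq_0 bump'_eq_0)
    qed
    define B2 where "B2 = n * n * B'"
    have \<rho>B: "\<bar>\<rho> z\<bar> \<le> B2" "\<bar>\<rho>' z\<bar> \<le> B2" for z
    proof -
      have "\<bar>\<rho> z\<bar> \<le> n * B'" using n B'(2)[of "n * z"] bump_nonneg[of "n * z"] by (simp add: \<rho>_def abs_mult)
      also have "\<dots> \<le> n * (n * B')" using n B'(1) by (intro mult_left_mono) auto
      finally show "\<bar>\<rho> z\<bar> \<le> B2" by (simp add: B2_def)
      show "\<bar>\<rho>' z\<bar> \<le> B2" using n B'(3)[of "n * z"] by (simp add: \<rho>'_def B2_def abs_mult mult.assoc)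
    qed
    define K K1 K2 where "K z = \<rho> (fst z) * \<rho> (snd z)" and "K1 z = \<rho> (fst z) * \<rho>' (snd z)"
      and "K2 z = \<rho>' (fst z) * \<rho> (snd z)" for z :: "real \<times> real"
    have [measurable]: "K \<in> borel_measurable borel" "K1 \<in> borel_measurable borel" "K2 \<in> borel_measurable borel"
      unfolding K_def[abs_def] K1_def[abs_def] K2_def[abs_def] borel_prod[symmetric] by measurable
    have K0: "0 \<le> K z" for z using \<rho>0 by (simp add: K_def)
    have KB: "\<bar>K z\<bar> \<le> B2 * B2" "\<bar>K1 z\<bar> \<le> B2 * B2" "\<bar>K2 z\<bar> \<le> B2 * B2" for z
      unfolding K_def K1_def K2_def abs_mult by (intro mult_mono \<rho>B order_trans[OF abs_ge_zero \<rho>B(1)] abs_ge_zero)+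
    have K_sup: "K z = 0 \<and> K1 z = 0 \<and> K2 z = 0" if "\<bar>fst z\<bar> \<ge> 1 / n \<or> \<bar>snd z\<bar> \<ge> 1 / n" for z
      using that \<rho>z by (auto simp: K_def K1_def K2_def)
    have K_int: "(\<integral>\<^sup>+z. ennreal (K z) \<partial>lborel) = 1"
    proof -
      have i1: "(\<integral>\<^sup>+x. ennreal (\<rho> x) \<partial>lborel) = 1"
        using nn_integral_bump_scaled[of n 0] n by (simp add: \<rho>_def)
      have "(\<integral>\<^sup>+z. ennreal (K z) \<partial>lborel) = (\<integral>\<^sup>+z. ennreal (K z) \<partial>(lborel \<Otimes>\<^sub>M lborel))"
        by (simp add: lborel_prod)
      also have "\<dots> = (\<integral>\<^sup>+x. (\<integral>\<^sup>+y. ennreal (K (x, y)) \<partial>lborel) \<partial>lborel)"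
        by (rule lborel.nn_integral_fst[symmetric]) (simp add: lborel_prod)
      also have "\<dots> = (\<integral>\<^sup>+x. ennreal (\<rho> x) * (\<integral>\<^sup>+y. ennreal (\<rho> y) \<partial>lborel) \<partial>lborel)"
        by (subst nn_integral_cmult[symmetric]) (auto simp: K_def ennreal_mult \<rho>0)
      finally show ?thesis by (simp add: i1)
    qed
    have Kd: "K z = 0" if "norm z \<ge> d" for z :: "real \<times> real"
    proof (rule ccontr)
      assume "K z \<noteq> 0"
      then have "\<bar>fst z\<bar> < 1 / n" "\<bar>snd z\<bar> < 1 / n" using K_sup[of z] by (auto simp: not_le[symmetric])
      moreover have "norm z \<le> \<bar>fst z\<bar> + \<bar>snd z\<bar>" using norm_Pair_le[of "fst z" "snd z"] by simp
      ultimately show False using that n(3) by simp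
    qed
    from d(2)[OF _ K0 K_int Kd]
    have iVV: "integrable (lborel \<Otimes>\<^sub>M lborel) (\<lambda>(p, q). \<bar>V q - V p\<bar> * K (p - q))"
      and VV: "(\<integral>(p, q). \<bar>V q - V p\<bar> * K (p - q) \<partial>(lborel \<Otimes>\<^sub>M lborel)) \<le> \<epsilon>" by auto
    have KD: "K (p - q) = 0 \<and> K1 (p - q) = 0 \<and> K2 (p - q) = 0" if "p \<in> ?C" "q \<notin> ?D" for p q
    proof (rule K_sup, rule ccontr)
      assume "\<not> (1 / n \<le> \<bar>fst (p - q)\<bar> \<or> 1 / n \<le> \<bar>snd (p - q)\<bar>)"
      moreover have "1 / n < 1" using n by simp
      ultimately have "\<bar>fst p - fst q\<bar> < 1" "\<bar>snd p - snd q\<bar> < 1" by auto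
      then show False using that by (cases p; cases q) (auto simp: cbox_Pair_eq)
    qed
    \<comment> \<open>\<open>G1\<close> is the integrand of the inequality for \<open>U\<close> in
      \<open>p\<close> with constant \<open>V q\<close>, and \<open>G2\<close> that for
      \<open>V\<close> in \<open>q\<close> with constant \<open>U p\<close>. The test function is
      \<open>g p * K (p - q)\<close> both times; differentiated in \<open>q\<close>, it yields the
      derivatives of the kernel with reversed sign and nothing else.\<close>
    define G1 G2 where "G1 = (\<lambda>(p, q). Q p q * (g1 p * K (p - q) + g p * K1 (p - q)) + W p q * (g2 p * K (p - q) + g p * K2 (p - q)))"
      and "G2 = (\<lambda>(p, q). Q p q * (g p * - K1 (p - q)) + W p q * (g p * - K2 (p - q)))"
    have mG[measurable]: "G1 \<in> borel_measurable (lborel \<Otimes>\<^sub>M lborel)" "G2 \<in> borel_measurable (lborel \<Otimes>\<^sub>M lborel)"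
      unfolding G1_def G2_def split_beta' by measurable
    have bnd: "\<bar>Q p q * a + W p q * b\<bar> \<le> ((1 + L) * A) * Q p q" if "\<bar>a\<bar> \<le> A" "\<bar>b\<bar> \<le> A" for a b A p q
    proof -
      have "\<bar>Q p q * a + W p q * b\<bar> \<le> \<bar>Q p q * a\<bar> + \<bar>W p q * b\<bar>" by (rule abs_triangle_ineq)
      also have "\<dots> = Q p q * \<bar>a\<bar> + W p q * \<bar>b\<bar>" using QW(1,2)[of p q] by (simp add: abs_mult)
      also have "\<dots> \<le> Q p q * A + (L * Q p q) * A"
        using QW[of p q] that L_nonneg by (intro add_mono mult_mono) auto
      finally show ?thesis by (simp add: algebra_simps)
    qed
    let ?A = "2 * (B * (B2 * B2))"
    have prod_bd: "\<bar>a * b\<bar> \<le> B * (B2 * B2)" if "\<bar>a\<bar> \<le> B" "\<bar>b\<bar> \<le> B2 * B2" for a b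
      unfolding abs_mult using that by (intro mult_mono) (use B in auto)
    have A0: "0 \<le> (1 + L) * ?A" using L_nonneg B by auto
    have iG1: "integrable (lborel \<Otimes>\<^sub>M lborel) G1"
    proof (rule dom[OF mG(1) _ _ A0])
      show "\<bar>G1 (p, q)\<bar> \<le> (1 + L) * ?A * Q p q" for p q
      proof -
        have t: "\<bar>x + y\<bar> \<le> 2 * c" if "\<bar>x\<bar> \<le> c" "\<bar>y\<bar> \<le> c" for x y c :: real using that by linarith
        show ?thesis
          unfolding G1_def prod.case by (rule bnd; rule t; rule prod_bd; rule gB KB)
      qed
      show "G1 (p, q) = 0" if "p \<notin> ?C \<or> q \<notin> ?D" for p q
        using that gC[of p] KD[of p q] by (cases "p \<in> ?C") (auto simp: G1_def)
    qed
    have iG2: "integrable (lborel \<Otimes>\<^sub>M lborel) G2"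
    proof (rule dom[OF mG(2) _ _ A0])
      show "\<bar>G2 (p, q)\<bar> \<le> (1 + L) * ?A * Q p q" for p q
        unfolding G2_def prod.case
      proof (rule bnd)
        have "0 \<le> B * (B2 * B2)" using B by simp
        then show "\<bar>g p * - K1 (p - q)\<bar> \<le> ?A" "\<bar>g p * - K2 (p - q)\<bar> \<le> ?A"
          using prod_bd[OF gB(1)[of p] KB(2)[of "p - q"]] prod_bd[OF gB(1)[of p] KB(3)[of "p - q"]] by simp_all
      qed
      show "G2 (p, q) = 0" if "p \<notin> ?C \<or> q \<notin> ?D" for p q
        using that gC[of p] KD[of p q] by (cases "p \<in> ?C") (auto simp: G2_def)
    qed
    have dr: "((\<lambda>x. \<rho> (x - y)) has_real_derivative \<rho>' (x - y)) (at x)" for x y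
    proof -
      have "((\<lambda>x. n * (x - y)) has_real_derivative n) (at x)" by (auto intro!: derivative_eq_intros)
      from DERIV_cmult[OF DERIV_chain2[OF DERIV_bump this], of n]
      show ?thesis by (simp add: \<rho>_def \<rho>'_def mult_ac)
    qed
    have dr': "((\<lambda>x. \<rho>' (x - y)) has_real_derivative n * (n * (n * bump'' (n * (x - y))))) (at x)" for x y
    proof -
      have "((\<lambda>x. n * (x - y)) has_real_derivative n) (at x)" by (auto intro!: derivative_eq_intros)
      from DERIV_cmult[OF DERIV_cmult[OF DERIV_chain2[OF DERIV_bump' this], of n], of n]
      show ?thesis by (simp add: \<rho>'_def mult_ac)
    qed
    have c2: "C2_with_derivs (\<lambda>x. \<rho> (x - y)) (\<lambda>x. \<rho>' (x - y)) (\<lambda>x. n * (n * (n * bump'' (n * (x - y)))))" for y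
      unfolding C2_with_derivs_def
      by (intro conjI allI dr dr' continuous_intros continuous_on_compose2[OF bump''_cont[of UNIV]]) auto
    have \<rho>'_cont: "continuous_on A (\<lambda>x. \<rho>' (f x))" if "continuous_on A f" for A :: "real set" and f :: "real \<Rightarrow> real"
      unfolding \<rho>'_def by (intro continuous_intros continuous_on_compose2[OF bump'_cont[of UNIV]] that) auto
    have c1: "C1_with_deriv (\<lambda>x. \<rho> (x - y)) (\<lambda>x. \<rho>' (x - y))" for y
      unfolding C1_with_deriv_def by (intro conjI allI dr \<rho>'_cont continuous_intros)
    have fx: "0 \<le> (\<integral>p. G1 (p, q) \<partial>lborel)" for q
    proof -
      obtain y s where q: "q = (y, s)" by (cases q)
      have "test_fun (\<lambda>x t. \<eta> x t * (\<rho> (x - y) * \<rho> (t - s)))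
         (\<lambda>x t. \<eta>1 x t * (\<rho> (x - y) * \<rho> (t - s)) + \<eta> x t * (\<rho> (x - y) * \<rho>' (t - s)))
         (\<lambda>x t. \<eta>2 x t * (\<rho> (x - y) * \<rho> (t - s)) + \<eta> x t * (\<rho>' (x - y) * \<rho> (t - s)))"
        by (rule test_fun_mult_prod[OF tf c2 c1])
      moreover have "\<forall>x t. 0 \<le> \<eta> x t * (\<rho> (x - y) * \<rho> (t - s))" using nn \<rho>0 by simp
      moreover have "\<forall>x t. (x, t) \<in> Z \<longrightarrow> \<eta> x t * (\<rho> (x - y) * \<rho> (t - s)) = 0"
        using sep e by (metis abs_zero diff_self mult_zero_left)
      ultimately have "0 \<le> (\<integral>p. \<bar>U p - V q\<bar> * (\<eta>1 (fst p) (snd p) * (\<rho> (fst p - y) * \<rho> (snd p - s)) + \<eta> (fst p) (snd p) * (\<rho> (fst p - y) * \<rho>' (snd p - s)))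
         + \<bar>\<psi> (U p) - \<psi> (V q)\<bar> * (\<eta>2 (fst p) (snd p) * (\<rho> (fst p - y) * \<rho> (snd p - s)) + \<eta> (fst p) (snd p) * (\<rho>' (fst p - y) * \<rho> (snd p - s))) \<partial>lborel)"
        using kU V(2)[of q] unfolding kruzkov_away_def by blast
      then show ?thesis by (simp add: G1_def Q_def W_def g_def g1_def g2_def K_def K1_def K2_def q)
    qed
    have fy: "0 \<le> (\<integral>q. G2 (p, q) \<partial>lborel)" for p
    proof -
      obtain x t where p: "p = (x, t)" by (cases p)
      have drm: "((\<lambda>y. \<rho> (x - y)) has_real_derivative - \<rho>' (x - y)) (at y)" for x y
      proof -
        have "((\<lambda>y. n * (x - y)) has_real_derivative - n) (at y)" by (auto intro!: derivative_eq_intros)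
        from DERIV_cmult[OF DERIV_chain2[OF DERIV_bump this], of n]
        show ?thesis by (simp add: \<rho>_def \<rho>'_def mult_ac)
      qed
      have drm': "((\<lambda>y. - \<rho>' (x - y)) has_real_derivative n * (n * (n * bump'' (n * (x - y))))) (at y)" for x y
      proof -
        have "((\<lambda>y. n * (x - y)) has_real_derivative - n) (at y)" by (auto intro!: derivative_eq_intros)
        from DERIV_minus[OF DERIV_cmult[OF DERIV_cmult[OF DERIV_chain2[OF DERIV_bump' this], of n], of n]]
        show ?thesis by (simp add: \<rho>'_def mult_ac)
      qed
      have C2': "C2_with_derivs (\<lambda>y. \<eta> x t * \<rho> (x - y)) (\<lambda>y. \<eta> x t * - \<rho>' (x - y)) (\<lambda>y. \<eta> x t * (n * (n * (n * bump'' (n * (x - y))))))"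
        unfolding C2_with_derivs_def
        by (intro conjI allI DERIV_cmult drm drm' continuous_intros continuous_on_compose2[OF bump''_cont[of UNIV]]) auto
      have C1: "C1_with_deriv (\<lambda>s. \<rho> (t - s)) (\<lambda>s. - \<rho>' (t - s))"
        unfolding C1_with_deriv_def by (intro conjI allI drm continuous_intros \<rho>'_cont)
      have "test_fun (\<lambda>y s. (\<eta> x t * \<rho> (x - y)) * \<rho> (t - s))
         (\<lambda>y s. (\<eta> x t * \<rho> (x - y)) * - \<rho>' (t - s)) (\<lambda>y s. (\<eta> x t * - \<rho>' (x - y)) * \<rho> (t - s))"
      proof (rule test_fun.prod[OF C2' _ C1], intro allI impI)
        fix y :: real assume y: "\<bar>x\<bar> + 1 \<le> \<bar>y\<bar>"
        have "1 / n < 1" using n by simp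
        then have "\<bar>x - y\<bar> \<ge> 1 / n" using y by linarith
        moreover from this have "n * \<bar>x - y\<bar> \<ge> 1" using n by (simp add: field_simps)
        then have "\<bar>n * (x - y)\<bar> \<ge> 1" using n by (simp only: abs_mult abs_of_pos)
        ultimately show "\<eta> x t * \<rho> (x - y) = 0 \<and> \<eta> x t * - \<rho>' (x - y) = 0 \<and> \<eta> x t * (n * (n * (n * bump'' (n * (x - y))))) = 0"
          using \<rho>z[of "x - y"] by (simp add: bump''_eq_0)
      qed
      moreover have "\<forall>y s. 0 \<le> (\<eta> x t * \<rho> (x - y)) * \<rho> (t - s)" using nn \<rho>0 by simp
      \<comment> \<open>The cutoff sits at \<open>(x, t)\<close>, yet the test function has to
        vanish at the points \<open>(y, s)\<close> of \<open>Z\<close>; this is where the positive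
        separation \<open>e\<close> enters.\<close>
      moreover have "\<forall>y s. (y, s) \<in> Z \<longrightarrow> (\<eta> x t * \<rho> (x - y)) * \<rho> (t - s) = 0"
      proof (intro allI impI)
        fix y s assume "(y, s) \<in> Z"
        show "(\<eta> x t * \<rho> (x - y)) * \<rho> (t - s) = 0"
        proof (cases "\<bar>x - y\<bar> \<ge> 1 / n \<or> \<bar>t - s\<bar> \<ge> 1 / n")
          case True
          then show ?thesis using \<rho>z(1) by auto
        next
          case False
          then have "\<eta> x t = 0" using n by (intro sep[OF \<open>(y, s) \<in> Z\<close>]) auto
          then show ?thesis by simp
        qed
      qed
      ultimately have "0 \<le> (\<integral>q. \<bar>V q - U p\<bar> * ((\<eta> x t * \<rho> (x - fst q)) * - \<rho>' (t - snd q))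
         + \<bar>\<psi> (V q) - \<psi> (U p)\<bar> * ((\<eta> x t * - \<rho>' (x - fst q)) * \<rho> (t - snd q)) \<partial>lborel)"
        using kV U(2)[of p] unfolding kruzkov_away_def by blast
      then show ?thesis
        by (simp add: G2_def Q_def W_def g_def K1_def K2_def p abs_minus_commute mult.assoc)
    qed
    define H where "H = (\<lambda>(p, q). (Q p q * g1 p + W p q * g2 p) * K (p - q))"
    have HG: "H w = G1 w + G2 w" for w by (cases w) (simp add: H_def G1_def G2_def algebra_simps)
    have iH: "integrable (lborel \<Otimes>\<^sub>M lborel) H" unfolding HG[abs_def] using iG1 iG2 by simp
    have "0 \<le> (\<integral>q. (\<integral>p. G1 (p, q) \<partial>lborel) \<partial>lborel)" by (intro Bochner_Integration.integral_nonneg fx)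
    also have "\<dots> = integral\<^sup>L (lborel \<Otimes>\<^sub>M lborel) G1"
      using lborel_pair.integral_snd[of "\<lambda>p q. G1 (p, q)"] iG1 by simp
    finally have H1: "0 \<le> integral\<^sup>L (lborel \<Otimes>\<^sub>M lborel) G1" .
    have "0 \<le> (\<integral>p. (\<integral>q. G2 (p, q) \<partial>lborel) \<partial>lborel)" by (intro Bochner_Integration.integral_nonneg fy)
    also have "\<dots> = integral\<^sup>L (lborel \<Otimes>\<^sub>M lborel) G2" using lborel_pair.integral_fst'[OF iG2] by simp
    finally have H0: "0 \<le> integral\<^sup>L (lborel \<Otimes>\<^sub>M lborel) H" using H1 iG1 iG2 by (simp add: HG[abs_def])
    define J where "J p = Q p p * g1 p + W p p * g2 p" for p
    have Jm[measurable]: "J \<in> borel_measurable borel" unfolding J_def[abs_def] Q_def W_def by measurable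
    have iJ: "integrable lborel J"
    proof (rule Bochner_Integration.integrable_bound)
      show "integrable lborel (\<lambda>p. (1 + L) * B * (U p + V p))" using U V by simp
      show "AE p in lborel. norm (J p) \<le> norm ((1 + L) * B * (U p + V p))"
      proof (rule AE_I2)
        fix p
        have "\<bar>J p\<bar> \<le> (1 + L) * B * Q p p" unfolding J_def by (intro bnd gB)
        also have "\<dots> \<le> (1 + L) * B * (U p + V p)" using L_nonneg B QW(4)[of p p] by (intro mult_left_mono) auto
        finally show "norm (J p) \<le> norm ((1 + L) * B * (U p + V p))" by simp
      qed
    qed simp
    have Kq: "integrable lborel (\<lambda>q. K (p - q))" "(\<integral>q. K (p - q) \<partial>lborel) = 1" for p
    proof -
      have D: "distr lborel borel (\<lambda>q. p - q) = (lborel :: (real \<times> real) measure)"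
        using lborel_affine[of "-1" p] by (simp add: density_1)
      have "(\<integral>\<^sup>+q. ennreal (K (p - q)) \<partial>lborel) = (\<integral>\<^sup>+z. ennreal (K z) \<partial>distr lborel borel (\<lambda>q. p - q))"
        by (subst nn_integral_distr) auto
      then have "(\<integral>\<^sup>+q. ennreal (K (p - q)) \<partial>lborel) = 1" by (simp add: D K_int)
      then have "has_bochner_integral lborel (\<lambda>q. K (p - q)) 1"
        by (intro has_bochner_integral_nn_integral) (use K0 in auto)
      then show "integrable lborel (\<lambda>q. K (p - q))" "(\<integral>q. K (p - q) \<partial>lborel) = 1"
        by (auto simp: has_bochner_integral_iff)
    qed
    have iJK: "integrable (lborel \<Otimes>\<^sub>M lborel) (\<lambda>(p, q). J p * K (p - q))"
    proof (rule lborel_pair.Fubini_integrable)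
      have "(\<lambda>p. \<integral>q. norm (case (p, q) of (p, q) \<Rightarrow> J p * K (p - q)) \<partial>lborel) = (\<lambda>p. \<bar>J p\<bar>)"
        using Kq by (simp add: abs_mult K0)
      then show "integrable lborel (\<lambda>p. \<integral>q. norm (case (p, q) of (p, q) \<Rightarrow> J p * K (p - q)) \<partial>lborel)"
        using iJ by simp
    qed (use Kq in auto)
    have "?J = (\<integral>p. J p * 1 \<partial>lborel)" by (simp add: J_def Q_def W_def g1_def g2_def)
    also have "\<dots> = (\<integral>p. (\<integral>q. J p * K (p - q) \<partial>lborel) \<partial>lborel)" by (simp add: Kq)
    also have "\<dots> = (\<integral>(p, q). J p * K (p - q) \<partial>(lborel \<Otimes>\<^sub>M lborel))"
      using lborel_pair.integral_fst'[OF iJK] by simp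
    \<comment> \<open>Replacing \<open>V q\<close> by \<open>V p\<close> changes \<open>Q\<close> by
      at most \<open>\<bar>V q - V p\<bar>\<close> and \<open>W\<close> by at most \<open>L\<close>
      times as much; \<open>B\<close> bounds the derivatives of the cutoff.\<close>
    also have "\<dots> \<ge> (\<integral>w. H w - (1 + L) * B * (case w of (p, q) \<Rightarrow> \<bar>V q - V p\<bar> * K (p - q)) \<partial>(lborel \<Otimes>\<^sub>M lborel))"
    proof (rule integral_mono)
      fix w :: "(real \<times> real) \<times> (real \<times> real)"
      obtain p q where w: "w = (p, q)" by (cases w)
      have "\<bar>Q p q - Q p p\<bar> \<le> \<bar>V q - V p\<bar>" unfolding Q_def by linarith
      from mult_diff_le[OF this gB(2)[of p]]
      have a: "Q p q * g1 p - \<bar>V q - V p\<bar> * B \<le> Q p p * g1 p" by simp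
      have "\<bar>W p q - W p p\<bar> \<le> \<bar>\<psi> (V q) - \<psi> (V p)\<bar>" unfolding W_def by linarith
      also have "\<dots> \<le> L * \<bar>V q - V p\<bar>" by (rule psi_lipschitz)
      finally have "\<bar>W p q - W p p\<bar> \<le> L * \<bar>V q - V p\<bar>" .
      from mult_diff_le[OF this gB(3)[of p]]
      have "W p q * g2 p - L * \<bar>V q - V p\<bar> * B \<le> W p p * g2 p" by simp
      with a have "Q p q * g1 p + W p q * g2 p - (1 + L) * B * \<bar>V q - V p\<bar> \<le> J p"
        unfolding J_def by (simp add: algebra_simps)
      from mult_right_mono[OF this K0[of "p - q"]]
      show "H w - (1 + L) * B * (case w of (p, q) \<Rightarrow> \<bar>V q - V p\<bar> * K (p - q)) \<le> (case w of (p, q) \<Rightarrow> J p * K (p - q))"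
        unfolding w H_def by (simp add: algebra_simps)
    qed (use iH iVV iJK in auto)
    also have "(\<integral>w. H w - (1 + L) * B * (case w of (p, q) \<Rightarrow> \<bar>V q - V p\<bar> * K (p - q)) \<partial>(lborel \<Otimes>\<^sub>M lborel))
      = integral\<^sup>L (lborel \<Otimes>\<^sub>M lborel) H - (1 + L) * B * (\<integral>(p, q). \<bar>V q - V p\<bar> * K (p - q) \<partial>(lborel \<Otimes>\<^sub>M lborel))"
      using iH iVV by simp
    also have "\<dots> \<ge> 0 - (1 + L) * B * \<epsilon>"
      using H0 VV L_nonneg B by (intro diff_mono mult_left_mono) auto
    finally show ?thesis by simp
  qed
  show ?thesis
  proof (rule ccontr)
    assume "\<not> 0 \<le> ?J"
    then have neg: "?J < 0" by simp
    \<comment> \<open>Makes the error equal to half of \<open>- ?J\<close>, so that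
      \<open>?J \<ge> ?J / 2\<close> contradicts \<open>?J < 0\<close>.\<close>
    define \<epsilon> where "\<epsilon> = - ?J / (2 * ((1 + L) * B))"
    have pos: "(1 + L) * B > 0" using L_nonneg B by simp
    then have "\<epsilon> > 0" using neg by (simp add: \<epsilon>_def divide_pos_neg field_simps)
    from main[OF this] have "?J \<ge> ?J / 2" using pos L_nonneg B by (simp add: \<epsilon>_def)
    then show False using neg by simp
  qed
qed

end

section \<open>Uniqueness in the moving frame\<close>

text \<open>Equal to 1 within \<open>2 / m\<close> of \<open>a\<close> and to 0 beyond
  \<open>4 / m\<close>. The flanks are centred at distance \<open>3 / m\<close>, so that the
  derivative splits into a rise strictly to the left of \<open>a\<close> and a fall strictly to the
  right, each a kernel of mass 1.\<close>

definition plateau :: "real \<Rightarrow> real \<Rightarrow> real \<Rightarrow> real" where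
  "plateau a m x = smooth_step (m * (x - a) + 3) - smooth_step (m * (x - a) - 3)"

definition plateau_left :: "real \<Rightarrow> real \<Rightarrow> real \<Rightarrow> real" where
  "plateau_left a m x = m * bump (m * (x - a) + 3)"

definition plateau_right :: "real \<Rightarrow> real \<Rightarrow> real \<Rightarrow> real" where
  "plateau_right a m x = m * bump (m * (x - a) - 3)"

lemma C2_with_derivs_diff:
  assumes "C2_with_derivs f f' f''" "C2_with_derivs g g' g''"
  shows "C2_with_derivs (\<lambda>x. f x - g x) (\<lambda>x. f' x - g' x) (\<lambda>x. f'' x - g'' x)"
  using assms unfolding C2_with_derivs_def by (simp add: DERIV_diff continuous_on_diff)

context
  fixes a m :: real assumes m: "m > 0"
begin

lemma DERIV_affine_bump:
  shows "((\<lambda>x. smooth_step (m * (x - a) + b)) has_real_derivative m * bump (m * (x - a) + b)) (at x)"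
    and "((\<lambda>x. m * bump (m * (x - a) + b)) has_real_derivative m * (m * bump' (m * (x - a) + b))) (at x)"
proof -
  have d: "((\<lambda>x. m * (x - a) + b) has_real_derivative m) (at x)" by (auto intro!: derivative_eq_intros)
  show "((\<lambda>x. smooth_step (m * (x - a) + b)) has_real_derivative m * bump (m * (x - a) + b)) (at x)"
    using DERIV_chain2[OF DERIV_smooth_step d] by (simp add: mult.commute)
  show "((\<lambda>x. m * bump (m * (x - a) + b)) has_real_derivative m * (m * bump' (m * (x - a) + b))) (at x)"
    using DERIV_cmult[OF DERIV_chain2[OF DERIV_bump d], of m] by (simp add: mult.commute mult.left_commute)
qed

lemma step_affine_C2:
  "C2_with_derivs (\<lambda>x. smooth_step (m * (x - a) + b)) (\<lambda>x. m * bump (m * (x - a) + b)) (\<lambda>x. m * (m * bump' (m * (x - a) + b)))"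
  unfolding C2_with_derivs_def
  by (intro conjI allI DERIV_affine_bump continuous_intros continuous_on_compose2[OF bump'_cont[of UNIV]]) auto

lemma plateau_C2: "C2_with_derivs (plateau a m) (\<lambda>x. plateau_left a m x - plateau_right a m x)
    (\<lambda>x. m * (m * bump' (m * (x - a) + 3)) - m * (m * bump' (m * (x - a) - 3)))"
  using C2_with_derivs_diff[OF step_affine_C2[of 3] step_affine_C2[of "-3"]]
  by (simp add: plateau_def[abs_def] plateau_left_def[abs_def] plateau_right_def[abs_def])

lemma plateau_eq_1: "\<bar>x - a\<bar> \<le> 2 / m \<Longrightarrow> plateau a m x = 1"
proof -
  assume "\<bar>x - a\<bar> \<le> 2 / m"
  then have "m * \<bar>x - a\<bar> \<le> 2" using m by (simp add: field_simps)
  then have "\<bar>m * (x - a)\<bar> \<le> 2" using m by (simp only: abs_mult abs_of_pos)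
  then show ?thesis unfolding plateau_def using smooth_step_eq_1[of "m * (x - a) + 3"] smooth_step_eq_0[of "m * (x - a) - 3"] by linarith
qed

lemma plateau_eq_0:
  assumes "\<bar>x - a\<bar> \<ge> 4 / m"
  shows "plateau a m x = 0" "plateau_left a m x = 0" "plateau_right a m x = 0"
    "m * (m * bump' (m * (x - a) + 3)) - m * (m * bump' (m * (x - a) - 3)) = 0"
proof -
  have "m * \<bar>x - a\<bar> \<ge> 4" using assms m by (simp add: field_simps)
  then have "\<bar>m * (x - a)\<bar> \<ge> 4" using m by (simp only: abs_mult abs_of_pos)
  then have *: "m * (x - a) \<ge> 4 \<or> m * (x - a) \<le> -4" by linarith
  then have **: "\<bar>m * (x - a) + 3\<bar> \<ge> 1" "\<bar>m * (x - a) - 3\<bar> \<ge> 1" by linarith+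
  show "plateau a m x = 0"
    using * smooth_step_eq_1[of "m * (x - a) + 3"] smooth_step_eq_0[of "m * (x - a) - 3"]
       smooth_step_eq_1[of "m * (x - a) - 3"] smooth_step_eq_0[of "m * (x - a) + 3"]
    unfolding plateau_def by linarith
  show "plateau_left a m x = 0" "plateau_right a m x = 0"
    "m * (m * bump' (m * (x - a) + 3)) - m * (m * bump' (m * (x - a) - 3)) = 0"
    using ** by (simp_all add: plateau_left_def plateau_right_def bump_eq_0 bump'_eq_0)
qed

lemma plateau_bounds: "0 \<le> plateau a m x" "plateau a m x \<le> 1"
  using smooth_step_mono[of "m * (x - a) - 3" "m * (x - a) + 3"] smooth_step_bounds[of "m * (x - a) - 3"] smooth_step_bounds[of "m * (x - a) + 3"]
  unfolding plateau_def by linarith+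

lemma plateau_left_nonneg: "0 \<le> plateau_left a m x" and plateau_right_nonneg: "0 \<le> plateau_right a m x"
  using m bump_nonneg by (simp_all add: plateau_left_def plateau_right_def)

lemma plateau_left_eq_0: "x \<ge> a \<Longrightarrow> plateau_left a m x = 0"
  using m by (auto simp: plateau_left_def intro!: bump_eq_0)

lemma plateau_right_eq_0: "x \<le> a \<Longrightarrow> plateau_right a m x = 0"
proof -
  assume "x \<le> a"
  then have "m * (x - a) \<le> 0" using m by (simp add: mult_le_0_iff)
  then have "\<bar>m * (x - a) - 3\<bar> \<ge> 1" by linarith
  then show ?thesis by (simp add: plateau_right_def bump_eq_0)
qed

lemma plateau_borel[measurable]:
  "plateau a m \<in> borel_measurable borel" "plateau_left a m \<in> borel_measurable borel" "plateau_right a m \<in> borel_measurable borel"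
  unfolding plateau_def[abs_def] plateau_left_def[abs_def] plateau_right_def[abs_def] by measurable

lemma integrable_plateau_right: "integrable lborel (plateau_right a m)" "(\<integral>x. plateau_right a m x \<partial>lborel) = 1"
  using integrable_bump_scaled[OF m, of "- m * a - 3"]
  by (simp_all add: plateau_right_def[abs_def] algebra_simps)

lemma test_fun_plateau:
  assumes "C1_with_deriv \<theta> \<theta>'"
  shows "test_fun (\<lambda>x t. plateau a m x * \<theta> t) (\<lambda>x t. plateau a m x * \<theta>' t)
    (\<lambda>x t. (plateau_left a m x - plateau_right a m x) * \<theta> t)"
proof (rule test_fun.prod[OF plateau_C2 _ assms], intro allI impI)
  fix x assume "\<bar>a\<bar> + 4 / m \<le> \<bar>x\<bar>"
  then have "\<bar>x - a\<bar> \<ge> 4 / m" by linarith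
  from plateau_eq_0[OF this] show "plateau a m x = 0 \<and> plateau_left a m x - plateau_right a m x = 0 \<and>
    m * (m * bump' (m * (x - a) + 3)) - m * (m * bump' (m * (x - a) - 3)) = 0" by simp
qed

end

lemma plateau_tendsto_0:
  assumes "x \<noteq> a"
  shows "(\<lambda>n. plateau a (real (Suc n)) x) \<longlonglongrightarrow> 0"
proof (rule tendsto_eventually)
  obtain k where k: "1 / real (Suc k) < \<bar>x - a\<bar> / 4" using nat_approx_posE[of "\<bar>x - a\<bar> / 4"] assms by auto
  have "plateau a (real (Suc n)) x = 0" if "n \<ge> k" for n
  proof (rule plateau_eq_0)
    have "1 / real (Suc n) \<le> 1 / real (Suc k)" using that by (simp add: frac_le)
    then show "4 / real (Suc n) \<le> \<bar>x - a\<bar>" using k by simp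
  qed simp
  then show "\<forall>\<^sub>F n in sequentially. plateau a (real (Suc n)) x = 0"
    unfolding eventually_sequentially by blast
qed

lemma plateau_compact:
  assumes m: "m > 0" and x: "\<bar>a\<bar> + 4 / m \<le> \<bar>x\<bar>"
  shows "plateau a m x = 0 \<and> plateau_left a m x - plateau_right a m x = 0 \<and>
    m * (m * bump' (m * (x - a) + 3)) - m * (m * bump' (m * (x - a) - 3)) = 0"
proof -
  have "4 / m \<le> \<bar>x - a\<bar>" using x by linarith
  from plateau_eq_0[OF m this] show ?thesis by simp
qed

section \<open>Null sets, essential limits and the choice of good times\<close>

lemma AE_lborel_fst_neq: "AE p in (lborel :: (real \<times> real) measure). fst p \<noteq> a"
proof -
  have "AE x in lborel. AE t in (lborel :: real measure). fst (x, t) \<noteq> a"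
    using AE_lborel_singleton[of a] by eventually_elim simp
  then have "AE p in lborel \<Otimes>\<^sub>M (lborel :: real measure). fst p \<noteq> a"
    by (intro lborel_pair.AE_pair_measure) measurable
  then show ?thesis unfolding lborel_prod .
qed

lemma AE_lborel_snd_neq: "AE p in (lborel :: (real \<times> real) measure). snd p \<noteq> a"
proof -
  have "AE x in (lborel :: real measure). AE t in lborel. snd (x, t) \<noteq> a"
    using AE_lborel_singleton[of a] by simp
  then have "AE p in (lborel :: real measure) \<Otimes>\<^sub>M lborel. snd p \<noteq> a"
    by (intro lborel_pair.AE_pair_measure) measurable
  then show ?thesis unfolding lborel_prod .
qed

text \<open>Fubini with time as the outer variable, applied to a measurable null set containing the
  exceptions, so that \<open>Q\<close> may be any predicate.\<close>

lemma AE_lborel_swap: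
  assumes "AE p in (lborel :: (real \<times> real) measure). Q p"
  shows "AE t in lborel. AE x in lborel. Q (x, t)"
proof -
  obtain N where N: "{p \<in> space lborel. \<not> Q p} \<subseteq> N" "N \<in> null_sets lborel" using assms
    by (auto elim!: AE_E simp: null_sets_def)
  have Nm: "N \<in> sets (lborel \<Otimes>\<^sub>M lborel)" using N(2) by (subst lborel_prod) auto
  have "emeasure (lborel \<Otimes>\<^sub>M lborel) N = 0" using N(2) by (subst lborel_prod) auto
  then have "(\<integral>\<^sup>+t. emeasure lborel ((\<lambda>x. (x, t)) -` N) \<partial>lborel) = 0"
    using lborel_pair.emeasure_pair_measure_alt2[OF Nm] by simp
  then have "AE t in lborel. emeasure lborel ((\<lambda>x. (x, t)) -` N) = 0"
    by (subst (asm) nn_integral_0_iff_AE) (use lborel_pair.measurable_emeasure_Pair2[OF Nm] in auto)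
  then show ?thesis
  proof eventually_elim
    case (elim t)
    have "(\<lambda>x. (x, t)) -` N \<in> sets lborel" using sets_Pair2[OF Nm] by simp
    then have "(\<lambda>x. (x, t)) -` N \<in> null_sets lborel" using elim by auto
    from AE_not_in[OF this] show ?case by eventually_elim (use N(1) in auto)
  qed
qed

lemma ess_filterlimE:
  assumes "ess_filterlim f G a A"
  obtains N where "negligible N" "filterlim f G (at a within (A - N))"
  using assms unfolding ess_filterlim_def by blast

lemma AE_lborel_negligible:
  assumes "negligible N"
  shows "AE x in lborel. x \<notin> N"
proof -
  have "AE x in lebesgue. x \<notin> N"
    using assms AE_not_in by (auto simp: negligible_iff_null_sets)
  then show ?thesis by (rule AE_completion_iff[THEN iffD1])
qed

lemma AE_lborel_interval_obtain:
  assumes "AE t in lborel. Q t" "(l::real) < u"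
  obtains t where "l < t" "t < u" "Q t"
proof -
  have "\<not> (AE t in lborel. \<not> (l < t \<and> t < u))"
  proof
    assume "AE t in lborel. \<not> (l < t \<and> t < u)"
    then have "emeasure lborel {l<..<u} = 0" by (subst (asm) AE_iff_measurable[of "{l<..<u}"]) auto
    then show False using assms(2) by simp
  qed
  moreover have "AE t in lborel. \<not> (l < t \<and> t < u)" if "\<not> (\<exists>t. l < t \<and> t < u \<and> Q t)"
    using assms(1) by eventually_elim (use that in blast)
  ultimately show ?thesis using that by blast
qed

text \<open>\<open>Q\<close> is the set of points whose atoms still obstruct; it shrinks in the
  course of the proof. The number \<open>s a\<close> bounds the time up to which \<open>a\<close>
  obstructs.\<close>

definition away_set :: "real \<Rightarrow> real set \<Rightarrow> (real \<Rightarrow> real) \<Rightarrow> (real \<times> real) set" where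
  "away_set T Q s = {(x, t). t \<le> 0 \<or> T \<le> t \<or> (\<exists>a\<in>Q. x = a \<and> t \<le> s a)}"

text \<open>The regular part is \<open>U\<close>, extended by \<open>0\<close> outside the strip; \<open>c a t\<close> is the mass of the atom at \<open>a\<close> and
  \<open>\<tau> a\<close> its extinction time; \<open>\<Lambda>\<close> is the functional given by the initial measure and \<open>w\<close> its density.\<close>

locale transport_solution = monotone_flux \<psi> M L for \<psi> M L +
  fixes T :: real and P :: "real set" and \<Lambda> :: "(real \<Rightarrow> real) \<Rightarrow> real" and w :: "real \<Rightarrow> real"
    and U :: "real \<times> real \<Rightarrow> real" and c :: "real \<Rightarrow> real \<Rightarrow> real" and \<tau> :: "real \<Rightarrow> real"
  assumes T_pos: "0 < T" and P_finite: "finite P"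
    and U_integrable: "integrable lborel U" and U_nonneg: "0 \<le> U p"
    and U_outside: "t \<le> 0 \<or> T \<le> t \<Longrightarrow> U (x, t) = 0"
    and c_integrable: "a \<in> P \<Longrightarrow> integrable lborel (c a)" and c_nonneg: "0 \<le> c a t"
    and c_outside: "t \<le> 0 \<or> T \<le> t \<Longrightarrow> c a t = 0"
    and tau_bounds: "a \<in> P \<Longrightarrow> 0 \<le> \<tau> a \<and> \<tau> a \<le> T"
    and c_pos: "a \<in> P \<Longrightarrow> AE t in lborel. 0 < t \<and> t < \<tau> a \<longrightarrow> 0 < c a t"
    and c_zero: "a \<in> P \<Longrightarrow> AE t in lborel. \<tau> a < t \<longrightarrow> c a t = 0"
    and weak: "test_fun \<eta> \<eta>1 \<eta>2 \<Longrightarrow> (\<And>x. \<eta> x T = 0) \<Longrightarrow>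
      (\<integral>p. U p * \<eta>1 (fst p) (snd p) + \<psi> (U p) * \<eta>2 (fst p) (snd p) \<partial>lborel)
        + (\<Sum>a\<in>P. \<integral>t. c a t * \<eta>1 a t \<partial>lborel) = \<Lambda> (\<lambda>x. \<eta> x 0)"
    and entropy: "0 \<le> k \<Longrightarrow> test_fun \<eta> \<eta>1 \<eta>2 \<Longrightarrow> (\<And>x t. 0 \<le> \<eta> x t) \<Longrightarrow> (\<And>x t. t \<le> 0 \<or> T \<le> t \<Longrightarrow> \<eta> x t = 0) \<Longrightarrow>
      0 \<le> (\<integral>p. \<bar>U p - k\<bar> * \<eta>1 (fst p) (snd p) + \<bar>\<psi> (U p) - \<psi> k\<bar> * \<eta>2 (fst p) (snd p) \<partial>lborel)
        + (\<Sum>a\<in>P. \<integral>t. c a t * \<eta>1 a t \<partial>lborel)"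
    and trace: "a \<in> P \<Longrightarrow> AE t in lborel. 0 < t \<and> t < \<tau> a \<longrightarrow> ess_filterlim (\<lambda>x. U (x, t)) at_top a {a<..}"
    and w_borel: "w \<in> borel_measurable borel"
    and initial: "ess_filterlim (\<lambda>t. \<integral>\<^sup>+x. ennreal \<bar>U (x, t) - w x\<bar> \<partial>lborel) (nhds 0) 0 {0<..}"
begin

lemma U_borel[measurable]: "U \<in> borel_measurable borel"
  using U_integrable by simp

text \<open>On the line of an atom the test function vanishes as long as the atom lives, and
  afterwards the mass is zero; the atomic term of the entropy inequality thus disappears.\<close>

lemma kruzkov_away_U:
  assumes "\<And>a. a \<in> P \<Longrightarrow> \<tau> a \<le> s a"
  shows "kruzkov_away (away_set T P s) U"
  unfolding kruzkov_away_def
proof (intro allI impI)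
  fix k :: real and \<eta> \<eta>1 \<eta>2 assume k: "0 \<le> k" and tf: "test_fun \<eta> \<eta>1 \<eta>2" and nn: "\<forall>x t. 0 \<le> \<eta> x t"
    and z: "\<forall>x t. (x, t) \<in> away_set T P s \<longrightarrow> \<eta> x t = 0"
  have "(\<integral>t. c a t * \<eta>1 a t \<partial>lborel) = 0" if a: "a \<in> P" for a
  proof (rule integral_eq_zero_AE)
    show "AE t in lborel. c a t * \<eta>1 a t = 0"
      using c_zero[OF a] AE_lborel_singleton[of "\<tau> a"]
    proof eventually_elim
      case (elim t)
      show ?case
      proof (cases "t < \<tau> a")
        case True
        have "(\<eta> a has_real_derivative 0) (at t)"
        proof (rule has_field_derivative_transform_within_open[of "\<lambda>_. 0" _ _ "{..<\<tau> a}"])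
          fix r assume "r \<in> {..<\<tau> a}"
          then have "(a, r) \<in> away_set T P s" using a assms[OF a] by (auto simp: away_set_def)
          then show "0 = \<eta> a r" using z by simp
        qed (use True in auto)
        then have "\<eta>1 a t = 0" using DERIV_unique[OF test_fun_DERIV(2)[OF tf]] by auto
        then show ?thesis by simp
      next
        case False
        then show ?thesis using elim by auto
      qed
    qed
  qed
  moreover have "0 \<le> (\<integral>p. \<bar>U p - k\<bar> * \<eta>1 (fst p) (snd p) + \<bar>\<psi> (U p) - \<psi> k\<bar> * \<eta>2 (fst p) (snd p) \<partial>lborel)
        + (\<Sum>a\<in>P. \<integral>t. c a t * \<eta>1 a t \<partial>lborel)"
    by (rule entropy[OF k tf]) (use nn z in \<open>auto simp: away_set_def\<close>)
  ultimately show "0 \<le> (\<integral>p. \<bar>U p - k\<bar> * \<eta>1 (fst p) (snd p) + \<bar>\<psi> (U p) - \<psi> k\<bar> * \<eta>2 (fst p) (snd p) \<partial>lborel)"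
    by simp
qed

text \<open>The amount by which the outflow through a shrinking window to the right of
  \<open>a\<close> falls short of its maximum \<open>M\<close> over the lifetime of the
  atom.\<close>

definition trace_defect :: "real \<Rightarrow> nat \<Rightarrow> real" where
  "trace_defect a n = (\<integral>p. (M - \<psi> (U p)) * (plateau_right a (real (Suc n)) (fst p) * indicator {0<..<\<tau> a} (snd p)) \<partial>lborel)"

lemma M_nonneg: "0 \<le> M"
  using psi_le[of 0] psi_0 by simp

lemma psi_U_bounds: "0 \<le> \<psi> (U p)" "\<psi> (U p) \<le> M"
  using psi_nonneg[OF U_nonneg[of p]] psi_le[of "U p"] by auto

lemma psi_defect_bounds: "0 \<le> M - \<psi> (U p)" "M - \<psi> (U p) \<le> M" "\<bar>M - \<psi> (U p)\<bar> \<le> M"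
  using psi_U_bounds[of p] by auto

lemma integrable_strip_kernel:
  fixes f g :: "real \<Rightarrow> real"
  assumes "integrable lborel f" "integrable lborel g" and [measurable]: "h \<in> borel_measurable borel" and "\<And>p. \<bar>h p\<bar> \<le> B"
  shows "integrable lborel (\<lambda>p. h p * (f (fst p) * g (snd p)))"
proof (rule Bochner_Integration.integrable_bound)
  have [measurable]: "f \<in> borel_measurable borel" "g \<in> borel_measurable borel" using assms by auto
  show "integrable lborel (\<lambda>p. B * (f (fst p) * g (snd p)))"
    using integrable_pair_mult[OF assms(1,2)] by (simp add: lborel_prod case_prod_beta')
  have "0 \<le> B" using assms(4) abs_ge_zero order_trans by blast
  then show "AE p in lborel. norm (h p * (f (fst p) * g (snd p))) \<le> norm (B * (f (fst p) * g (snd p)))"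
    using assms(4) by (intro AE_I2) (auto simp: abs_mult intro!: mult_right_mono)
  have [measurable]: "h \<in> borel_measurable (borel \<Otimes>\<^sub>M borel)" by (simp add: borel_prod)
  have "(\<lambda>p. h p * (f (fst p) * g (snd p))) \<in> borel_measurable (borel \<Otimes>\<^sub>M borel)" by measurable
  then show "(\<lambda>p. h p * (f (fst p) * g (snd p))) \<in> borel_measurable lborel"
    by (simp add: borel_prod)
qed

lemma integrable_trace_defect:
  assumes "a \<in> P"
  shows "integrable lborel (\<lambda>p. (M - \<psi> (U p)) * (plateau_right a (real (Suc n)) (fst p) * indicator {0<..<\<tau> a} (snd p)))"
proof (rule integrable_strip_kernel[where B = M])
  show "integrable lborel (plateau_right a (real (Suc n)))" by (rule integrable_plateau_right) simp
  show "\<bar>M - \<psi> (U p)\<bar> \<le> M" for p by (rule psi_defect_bounds)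
qed (use tau_bounds[OF assms] in auto)

text \<open>At almost every time of the lifetime \<open>U\<close> tends to infinity from the right,
  so \<open>\<psi> U\<close> tends to \<open>M\<close>, and the kernels \<open>plateau_right\<close>
  average over points ever closer to \<open>a\<close> on that side. In time the constant
  \<open>M\<close> dominates.\<close>

lemma trace_defect_tendsto_0:
  assumes a: "a \<in> P"
  shows "trace_defect a \<longlonglongrightarrow> 0"
proof -
  define I where "I n t = (\<integral>x. (M - \<psi> (U (x, t))) * plateau_right a (real (Suc n)) x \<partial>lborel)" for n t
  have int: "integrable lborel (\<lambda>x. (M - \<psi> (U (x, t))) * plateau_right a (real (Suc n)) x)" for n t
  proof (rule Bochner_Integration.integrable_bound)
    show "integrable lborel (\<lambda>x. M * plateau_right a (real (Suc n)) x)"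
      by (intro integrable_mult_right integrable_plateau_right) simp
    show "AE x in lborel. norm ((M - \<psi> (U (x, t))) * plateau_right a (real (Suc n)) x) \<le> norm (M * plateau_right a (real (Suc n)) x)"
    proof (rule AE_I2)
      fix x
      have "\<bar>M - \<psi> (U (x, t))\<bar> * \<bar>plateau_right a (real (Suc n)) x\<bar> \<le> M * \<bar>plateau_right a (real (Suc n)) x\<bar>"
        by (intro mult_right_mono psi_defect_bounds abs_ge_zero)
      then show "norm ((M - \<psi> (U (x, t))) * plateau_right a (real (Suc n)) x) \<le> norm (M * plateau_right a (real (Suc n)) x)"
        using M_nonneg by (simp add: abs_mult)
    qed
  qed simp
  have I0: "0 \<le> I n t" for n t
    unfolding I_def by (intro Bochner_Integration.integral_nonneg mult_nonneg_nonneg plateau_right_nonneg psi_defect_bounds) simp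
  \<comment> \<open>Only points of the window outside a negligible set matter. The empty set gives
    the crude bound \<open>M\<close>, the exceptional set of the essential limit the small
    one.\<close>
  have I_bd: "I n t \<le> C" if "\<And>x. plateau_right a (real (Suc n)) x \<noteq> 0 \<Longrightarrow> x \<notin> N \<Longrightarrow> M - \<psi> (U (x, t)) \<le> C" "negligible N" for n t C N
  proof -
    from AE_lborel_negligible[OF that(2)] have "AE x in lborel. (M - \<psi> (U (x, t))) * plateau_right a (real (Suc n)) x \<le> C * plateau_right a (real (Suc n)) x"
    proof eventually_elim
      case (elim x)
      show ?case
        using that(1)[OF _ elim] plateau_right_nonneg[of "real (Suc n)" a x]
        by (cases "plateau_right a (real (Suc n)) x = 0") (auto intro!: mult_right_mono)
    qed
    then have "I n t \<le> (\<integral>x. C * plateau_right a (real (Suc n)) x \<partial>lborel)"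
      unfolding I_def by (intro integral_mono_AE int integrable_mult_right integrable_plateau_right) auto
    then show ?thesis by (simp add: integrable_plateau_right)
  qed
  have lim: "(\<lambda>n. I n t) \<longlonglongrightarrow> 0" if ess: "ess_filterlim (\<lambda>x. U (x, t)) at_top a {a<..}" for t
  proof (rule LIMSEQ_I)
    fix r :: real assume r: "r > 0"
    obtain N where N: "negligible N" "filterlim (\<lambda>x. U (x, t)) at_top (at a within ({a<..} - N))"
      by (rule ess_filterlimE[OF ess])
    have "((\<lambda>x. \<psi> (U (x, t))) \<longlongrightarrow> M) (at a within ({a<..} - N))"
      using filterlim_compose[OF psi_lim N(2)] .
    then have "\<forall>\<^sub>F x in at a within ({a<..} - N). M - r / 2 < \<psi> (U (x, t))"
      using r by (intro order_tendstoD) auto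
    then obtain \<delta> where "\<delta> > 0" and "\<forall>x\<in>{a<..} - N. x \<noteq> a \<and> dist x a < \<delta> \<longrightarrow> M - r / 2 < \<psi> (U (x, t))"
      by (auto simp only: eventually_at)
    then have \<delta>: "\<delta> > 0" "\<And>x. x \<in> {a<..} - N \<Longrightarrow> x \<noteq> a \<Longrightarrow> dist x a < \<delta> \<Longrightarrow> M - r / 2 < \<psi> (U (x, t))"
      by auto
    obtain k where k: "1 / real (Suc k) < \<delta> / 4" using nat_approx_posE[of "\<delta> / 4"] \<delta>(1) by auto
    have "norm (I n t - 0) < r" if "n \<ge> k" for n
    proof -
      have n: "4 / real (Suc n) < \<delta>"
      proof -
        have "1 / real (Suc n) \<le> 1 / real (Suc k)" using that by (simp add: frac_le)
        then show ?thesis using k by simp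
      qed
      have "I n t \<le> r / 2"
      proof (rule I_bd[OF _ N(1)])
        fix x assume x: "plateau_right a (real (Suc n)) x \<noteq> 0" "x \<notin> N"
        have "x > a" using plateau_right_eq_0[of "real (Suc n)" x a] x(1) by (auto simp: not_le[symmetric])
        moreover have "\<bar>x - a\<bar> < 4 / real (Suc n)" using plateau_eq_0(3)[of "real (Suc n)" x a] x(1) by (auto simp: not_le[symmetric])
        ultimately show "M - \<psi> (U (x, t)) \<le> r / 2" using \<delta>(2)[of x] n x(2) by (auto simp: dist_real_def)
      qed
      then show ?thesis using I0[of n t] r by simp
    qed
    then show "\<exists>no. \<forall>n\<ge>no. norm (I n t - 0) < r" by blast
  qed
  have eq: "trace_defect a n = (\<integral>t. I n t * indicator {0<..<\<tau> a} t \<partial>lborel)" for n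
  proof -
    have "trace_defect a n = (\<integral>t. (\<integral>x. (M - \<psi> (U (x, t))) * (plateau_right a (real (Suc n)) x * indicator {0<..<\<tau> a} t) \<partial>lborel) \<partial>lborel)"
      using lborel_pair.integral_snd[of "\<lambda>x t. (M - \<psi> (U (x, t))) * (plateau_right a (real (Suc n)) x * indicator {0<..<\<tau> a} t)"]
        integrable_trace_defect[OF a, of n]
      by (simp add: trace_defect_def lborel_prod case_prod_beta')
    then show ?thesis by (simp add: I_def mult.assoc[symmetric])
  qed
  have Im: "(\<lambda>t. I n t) \<in> borel_measurable borel" for n
    unfolding I_def by (simp add: borel_prod[symmetric])
  have "(\<lambda>n. \<integral>t. I n t * indicator {0<..<\<tau> a} t \<partial>lborel) \<longlonglongrightarrow> (\<integral>t. 0 \<partial>(lborel :: real measure))"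
  proof (rule integral_dominated_convergence[where w = "\<lambda>t. M * indicator {0<..<\<tau> a} t"])
    show "AE t in lborel. (\<lambda>n. I n t * indicator {0<..<\<tau> a} t) \<longlonglongrightarrow> 0"
      using trace[OF a]
    proof eventually_elim
      case (elim t)
      show ?case
      proof (cases "t \<in> {0<..<\<tau> a}")
        case True
        then show ?thesis using lim[of t] elim by simp
      qed simp
    qed
    show "AE t in lborel. norm (I n t * indicator {0<..<\<tau> a} t) \<le> M * indicator {0<..<\<tau> a} t" for n
    proof (rule AE_I2)
      fix t
      have "I n t \<le> M" by (rule I_bd[of n "{}"]) (rule psi_defect_bounds, simp)
      then show "norm (I n t * indicator {0<..<\<tau> a} t) \<le> M * indicator {0<..<\<tau> a} t"
        using I0[of n t] by (simp add: indicator_def)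
    qed
  qed (use Im tau_bounds[OF a] in auto)
  then show ?thesis unfolding eq[abs_def] by simp
qed

end

text \<open>A time cutoff equal to 1 up to \<open>s + \<epsilon>\<close> and to 0 from
  \<open>s + 3 * \<epsilon>\<close> on; the shift by -2 puts the fall strictly after
  \<open>s\<close>.\<close>

lemma C1_fall:
  assumes "\<epsilon> > 0"
  shows "C1_with_deriv (\<lambda>t. 1 - smooth_step ((1 / \<epsilon>) * (t - s) + - 2)) (\<lambda>t. - ((1 / \<epsilon>) * bump ((1 / \<epsilon>) * (t - s) + - 2)))"
  unfolding C1_with_deriv_def
proof (intro conjI allI)
  fix t
  have "((\<lambda>t. smooth_step ((1 / \<epsilon>) * (t - s) + - 2)) has_real_derivative (1 / \<epsilon>) * bump ((1 / \<epsilon>) * (t - s) + - 2)) (at t)"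
    by (rule DERIV_affine_bump) (use assms in simp)
  then show "((\<lambda>t. 1 - smooth_step ((1 / \<epsilon>) * (t - s) + - 2)) has_real_derivative - ((1 / \<epsilon>) * bump ((1 / \<epsilon>) * (t - s) + - 2))) (at t)"
    using DERIV_diff[OF DERIV_const] by fastforce
qed (intro continuous_intros continuous_on_compose2[OF bump_cont[of UNIV]]; auto)

section \<open>Comparison of two solutions with the same initial data\<close>

locale transport_pair = U: transport_solution \<psi> M L T P \<Lambda> w U c \<tau> + V: transport_solution \<psi> M L T P \<Lambda> w V d \<sigma>
  for \<psi> M L T P \<Lambda> w U c \<tau> V d \<sigma>
begin

text \<open>Doubling requires a test function that vanishes on a whole neighbourhood of the blocked
  set; its width \<open>e\<close> may depend on the test function.\<close>

definition kruzkov_ineq :: "real set \<Rightarrow> (real \<Rightarrow> real) \<Rightarrow> bool" where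
  "kruzkov_ineq Q s \<longleftrightarrow> (\<forall>\<eta> \<eta>1 \<eta>2. \<forall>e>0. test_fun \<eta> \<eta>1 \<eta>2 \<longrightarrow> (\<forall>x t. 0 \<le> \<eta> x t) \<longrightarrow>
     (\<forall>x t y r. (y, r) \<in> away_set T Q s \<longrightarrow> \<bar>x - y\<bar> < e \<longrightarrow> \<bar>t - r\<bar> < e \<longrightarrow> \<eta> x t = 0) \<longrightarrow>
     0 \<le> (\<integral>p. \<bar>U p - V p\<bar> * \<eta>1 (fst p) (snd p) + \<bar>\<psi> (U p) - \<psi> (V p)\<bar> * \<eta>2 (fst p) (snd p) \<partial>lborel))"

text \<open>The larger of the two extinction times blocks each line for both solutions at
  once.\<close>

lemma kruzkov_ineq_all: "kruzkov_ineq P (\<lambda>a. max (\<tau> a) (\<sigma> a))"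
  unfolding kruzkov_ineq_def
proof (intro allI impI)
  fix \<eta> \<eta>1 \<eta>2 e assume e: "(0::real) < e" and tf: "test_fun \<eta> \<eta>1 \<eta>2" and nn: "\<forall>x t. 0 \<le> \<eta> x t"
    and sep: "\<forall>x t y r. (y, r) \<in> away_set T P (\<lambda>a. max (\<tau> a) (\<sigma> a)) \<longrightarrow> \<bar>x - y\<bar> < e \<longrightarrow> \<bar>t - r\<bar> < e \<longrightarrow> \<eta> x t = 0"
  let ?Z = "away_set T P (\<lambda>a. max (\<tau> a) (\<sigma> a))"
  have kU: "U.kruzkov_away ?Z U" by (rule U.kruzkov_away_U) auto
  have kV: "U.kruzkov_away ?Z V" by (rule V.kruzkov_away_U) auto
  show "0 \<le> (\<integral>p. \<bar>U p - V p\<bar> * \<eta>1 (fst p) (snd p) + \<bar>\<psi> (U p) - \<psi> (V p)\<bar> * \<eta>2 (fst p) (snd p) \<partial>lborel)"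
  proof (rule U.kruzkov_doubling[OF U.U_integrable U.U_nonneg V.U_integrable V.U_nonneg kU kV tf _ _ e, of 0 T])
    show "\<eta> x t = 0" if "t \<le> 0 \<or> T \<le> t" for x t
      using sep[rule_format, of x t x t] that e by (auto simp: away_set_def)
    show "\<eta> x t = 0" if "(y, s) \<in> ?Z" "\<bar>x - y\<bar> < e" "\<bar>t - s\<bar> < e" for x t y s
      using sep that by blast
  qed (use nn in auto)
qed

lemma D_integrable: "integrable lborel (\<lambda>p. \<bar>U p - V p\<bar>)"
  using U.U_integrable V.U_integrable by simp

lemma psi_diff_le: "\<bar>\<psi> (U p) - \<psi> (V p)\<bar> \<le> L * \<bar>U p - V p\<bar>"
  by (rule U.psi_lipschitz)

lemma E_integrable: "integrable lborel (\<lambda>p. \<bar>\<psi> (U p) - \<psi> (V p)\<bar>)"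
proof (rule Bochner_Integration.integrable_bound)
  show "integrable lborel (\<lambda>p. L * \<bar>U p - V p\<bar>)" using D_integrable by simp
qed (use psi_diff_le U.L_nonneg in \<open>auto simp: abs_mult\<close>)

lemma integrable_mult_bounded:
  fixes f g :: "real \<times> real \<Rightarrow> real"
  assumes "integrable lborel f" and [measurable]: "g \<in> borel_measurable borel" and "\<And>p. \<bar>g p\<bar> \<le> B"
  shows "integrable lborel (\<lambda>p. f p * g p)"
proof (rule Bochner_Integration.integrable_bound)
  have [measurable]: "f \<in> borel_measurable borel" using assms by auto
  show "integrable lborel (\<lambda>p. f p * B)" using assms(1) by simp
  have "0 \<le> B" using assms(3) abs_ge_zero order_trans by blast
  then show "AE p in lborel. norm (f p * g p) \<le> norm (f p * B)"
    using assms(3) by (intro AE_I2) (simp add: abs_mult mult_left_mono)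
  have "(\<lambda>p. f p * g p) \<in> borel_measurable borel" by measurable
  then show "(\<lambda>p. f p * g p) \<in> borel_measurable lborel" by simp
qed

lemma integral_mult_tendsto_0:
  fixes f :: "real \<times> real \<Rightarrow> real" and g :: "nat \<Rightarrow> real \<times> real \<Rightarrow> real"
  assumes f: "integrable lborel f" and g[measurable]: "\<And>n. g n \<in> borel_measurable borel" and "\<And>n p. \<bar>g n p\<bar> \<le> B"
    and "AE p in lborel. (\<lambda>n. g n p) \<longlonglongrightarrow> 0"
  shows "(\<lambda>n. \<integral>p. f p * g n p \<partial>lborel) \<longlonglongrightarrow> 0"
proof -
  have [measurable]: "f \<in> borel_measurable borel" using assms by auto
  have "(\<lambda>n. \<integral>p. f p * g n p \<partial>lborel) \<longlonglongrightarrow> (\<integral>p. 0 \<partial>(lborel :: (real \<times> real) measure))"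
  proof (rule integral_dominated_convergence[where w = "\<lambda>p. \<bar>f p\<bar> * B"])
    show "AE p in lborel. (\<lambda>n. f p * g n p) \<longlonglongrightarrow> 0"
      using assms(4) by eventually_elim (metis mult_zero_right tendsto_mult_left)
    show "AE p in lborel. norm (f p * g n p) \<le> \<bar>f p\<bar> * B" for n
      using assms(3) by (intro AE_I2) (simp add: abs_mult mult_left_mono)
  qed (use f in auto)
  then show ?thesis by simp
qed

lemma plateau_fst_measurable[measurable]:
  assumes "m > 0"
  shows "(\<lambda>p. plateau a m (fst p)) \<in> borel_measurable (borel :: (real \<times> real) measure)"
    "(\<lambda>p. plateau_left a m (fst p)) \<in> borel_measurable (borel :: (real \<times> real) measure)"
    "(\<lambda>p. plateau_right a m (fst p)) \<in> borel_measurable (borel :: (real \<times> real) measure)"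
  unfolding borel_prod[symmetric]
  using plateau_borel[OF assms, of a] by measurable

lemma measurable_snd_fun:
  assumes [measurable]: "(f :: real \<Rightarrow> real) \<in> borel_measurable borel"
  shows "(\<lambda>p. f (snd p)) \<in> borel_measurable (borel :: (real \<times> real) measure)"
    "(\<lambda>p. f (fst p)) \<in> borel_measurable (borel :: (real \<times> real) measure)"
  unfolding borel_prod[symmetric] by measurable

text \<open>Cut off a shrinking neighbourhood of the atom. The cutoff rises on the right, where both fluxes tend
  to \<open>M\<close>; its decreasing part on the left contributes with the good sign.\<close>

lemma kruzkov_ineq_remove:
  assumes a: "a \<in> P" and tau: "\<tau> a = \<sigma> a" "s a = \<tau> a" and kr: "kruzkov_ineq (insert a Q) s"
  shows "kruzkov_ineq Q s"
  unfolding kruzkov_ineq_def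
proof (intro allI impI)
  fix \<eta> \<eta>1 \<eta>2 e assume e: "(0::real) < e" and tf: "test_fun \<eta> \<eta>1 \<eta>2" and nn: "\<forall>x t. 0 \<le> \<eta> x t"
    and sep: "\<forall>x t y r. (y, r) \<in> away_set T Q s \<longrightarrow> \<bar>x - y\<bar> < e \<longrightarrow> \<bar>t - r\<bar> < e \<longrightarrow> \<eta> x t = 0"
  let ?D = "\<lambda>p. \<bar>U p - V p\<bar>" and ?E = "\<lambda>p. \<bar>\<psi> (U p) - \<psi> (V p)\<bar>"
  let ?J = "\<integral>p. ?D p * \<eta>1 (fst p) (snd p) + ?E p * \<eta>2 (fst p) (snd p) \<partial>lborel"
  have cpt: "\<eta> x t = 0" if "t \<le> 0 \<or> T \<le> t" for x t
    using sep[rule_format, of x t x t] that e by (auto simp: away_set_def)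
  obtain B where B: "B > 0" and bd: "\<And>x t. \<bar>\<eta> x t\<bar> \<le> B \<and> \<bar>\<eta>1 x t\<bar> \<le> B \<and> \<bar>\<eta>2 x t\<bar> \<le> B"
    using U.test_fun_compact_bounded[OF tf cpt] by metis
  obtain B' where B': "B' > 0" "\<And>x. bump x \<le> B'" using bump_bounded by metis
  have [measurable]: "(\<lambda>p. \<eta> (fst p) (snd p)) \<in> borel_measurable borel" "(\<lambda>p. \<eta>1 (fst p) (snd p)) \<in> borel_measurable borel"
     "(\<lambda>p. \<eta>2 (fst p) (snd p)) \<in> borel_measurable borel"
    by (rule borel_measurable_continuous_onI, rule test_fun_cont[OF tf])+
  have main: "0 \<le> ?J + B * (M * (3 * \<epsilon>))" if \<epsilon>: "\<epsilon> > 0" for \<epsilon>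
  proof -
    \<comment> \<open>The removed neighbourhood has to cover the blocked segment with a margin in
      time. Between \<open>\<tau> a\<close> and \<open>\<tau> a + 3 * \<epsilon>\<close> no trace is
      available, and the flux there costs at most a multiple of
      \<open>M * (3 * \<epsilon>)\<close>.\<close>
    define \<kappa> \<kappa>' where "\<kappa> t = 1 - smooth_step ((1 / \<epsilon>) * (t - \<tau> a) + - 2)"
      and "\<kappa>' t = - ((1 / \<epsilon>) * bump ((1 / \<epsilon>) * (t - \<tau> a) + - 2))" for t
    have k1: "C1_with_deriv \<kappa> \<kappa>'" unfolding \<kappa>_def[abs_def] \<kappa>'_def[abs_def] by (rule C1_fall[OF \<epsilon>])
    have kb: "0 \<le> \<kappa> t" "\<kappa> t \<le> 1" for t unfolding \<kappa>_def using smooth_step_bounds by (auto simp: algebra_simps)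
    have k'b: "\<bar>\<kappa>' t\<bar> \<le> B' / \<epsilon>" for t
      unfolding \<kappa>'_def using B' \<epsilon> bump_nonneg by (simp add: abs_mult divide_right_mono)
    have ke: "\<kappa> t = 1" if "t \<le> \<tau> a + \<epsilon>" for t
    proof -
      have "(1 / \<epsilon>) * (t - \<tau> a) \<le> 1" using that \<epsilon> by (simp add: field_simps)
      then show ?thesis unfolding \<kappa>_def by (subst smooth_step_eq_0) auto
    qed
    have kz: "\<kappa> t = 0" if "t \<ge> \<tau> a + 3 * \<epsilon>" for t
    proof -
      have "(1 / \<epsilon>) * (t - \<tau> a) \<ge> 3" using that \<epsilon> by (simp add: field_simps)
      then show ?thesis unfolding \<kappa>_def by (subst smooth_step_eq_1) auto
    qed
    have [measurable]: "(\<lambda>p. \<kappa> (snd p)) \<in> borel_measurable (borel :: (real \<times> real) measure)"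
      "(\<lambda>p. \<kappa>' (snd p)) \<in> borel_measurable (borel :: (real \<times> real) measure)"
      by (intro measurable_snd_fun borel_measurable_continuous_onI C1_with_deriv_cont[OF k1])+
    \<comment> \<open>The terms in which no space derivative falls on the plateau; they tend to zero
      because the plateau shrinks to the null line over \<open>a\<close>.\<close>
    define A where "A n = (\<integral>p. ?D p * ((\<eta>1 (fst p) (snd p) * \<kappa> (snd p) + \<eta> (fst p) (snd p) * \<kappa>' (snd p)) * plateau a (real (Suc n)) (fst p)) \<partial>lborel)
       + (\<integral>p. ?E p * ((\<eta>2 (fst p) (snd p) * \<kappa> (snd p)) * plateau a (real (Suc n)) (fst p)) \<partial>lborel)" for n
    have pm[measurable]: "(\<lambda>p. plateau a (real (Suc n)) (fst p)) \<in> borel_measurable (borel :: (real \<times> real) measure)"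
       "(\<lambda>p. plateau_left a (real (Suc n)) (fst p)) \<in> borel_measurable (borel :: (real \<times> real) measure)"
       "(\<lambda>p. plateau_right a (real (Suc n)) (fst p)) \<in> borel_measurable (borel :: (real \<times> real) measure)" for n
      by (rule plateau_fst_measurable; simp)+
    have pb: "\<bar>plateau a (real (Suc n)) x\<bar> \<le> 1" for n x
      using plateau_bounds[of "real (Suc n)" a x] by simp
    have g1b: "\<bar>\<eta>1 x t * \<kappa> t + \<eta> x t * \<kappa>' t\<bar> \<le> B + B * (B' / \<epsilon>)" for x t
    proof -
      have "\<bar>\<eta>1 x t * \<kappa> t\<bar> \<le> B * 1" unfolding abs_mult using bd kb[of t] B by (intro mult_mono) auto
      moreover have "\<bar>\<eta> x t * \<kappa>' t\<bar> \<le> B * (B' / \<epsilon>)" unfolding abs_mult using bd k'b[of t] B by (intro mult_mono) auto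
      ultimately show ?thesis by linarith
    qed
    have g2b: "\<bar>\<eta>2 x t * \<kappa> t\<bar> \<le> B" for x t
    proof -
      have "\<bar>\<eta>2 x t\<bar> * \<bar>\<kappa> t\<bar> \<le> B * 1" using bd kb[of t] B by (intro mult_mono) auto
      then show ?thesis by (simp add: abs_mult)
    qed
    have mb: "\<bar>u * v\<bar> \<le> C" if "\<bar>u\<bar> \<le> C" "\<bar>v\<bar> \<le> 1" for u v C :: real
    proof -
      have "\<bar>u\<bar> * \<bar>v\<bar> \<le> C * 1" using that by (intro mult_mono) auto
      then show ?thesis by (simp add: abs_mult)
    qed
    have A_lim: "A \<longlonglongrightarrow> 0"
    proof -
      have ae: "AE p in lborel. (\<lambda>n. g p * plateau a (real (Suc n)) (fst p)) \<longlonglongrightarrow> 0" for g :: "real \<times> real \<Rightarrow> real"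
        using AE_lborel_fst_neq[of a] by eventually_elim (metis mult_zero_right tendsto_mult_left plateau_tendsto_0)
      have "A \<longlonglongrightarrow> 0 + 0"
        unfolding A_def[abs_def]
        by (intro tendsto_add integral_mult_tendsto_0[OF D_integrable _ _ ae] integral_mult_tendsto_0[OF E_integrable _ _ ae])
           (measurable, rule mb[OF g1b pb], measurable, rule mb[OF g2b pb])
      then show ?thesis by simp
    qed
    \<comment> \<open>The contribution of the falling flank of the plateau, that is, of the side on
      which the traces are known.\<close>
    define F where "F n = (\<integral>p. ?E p * (plateau_right a (real (Suc n)) (fst p) * (\<eta> (fst p) (snd p) * \<kappa> (snd p))) \<partial>lborel)" for n
    have step1: "0 \<le> ?J - A n + F n" for n
    proof -
      let ?m = "real (Suc n)"
      let ?l = "plateau_left a ?m" and ?r = "plateau_right a ?m" and ?h = "plateau a ?m"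
      have m: "?m > 0" by simp
      have lrB: "\<bar>?l x\<bar> \<le> ?m * B'" "\<bar>?r x\<bar> \<le> ?m * B'" for x
        unfolding plateau_left_def plateau_right_def abs_mult using B' bump_nonneg by (auto intro!: mult_left_mono)
      have "test_fun (\<lambda>x t. \<eta> x t - \<eta> x t * (?h x * \<kappa> t))
         (\<lambda>x t. \<eta>1 x t - (\<eta>1 x t * (?h x * \<kappa> t) + \<eta> x t * (?h x * \<kappa>' t)))
         (\<lambda>x t. \<eta>2 x t - (\<eta>2 x t * (?h x * \<kappa> t) + \<eta> x t * ((?l x - ?r x) * \<kappa> t)))"
        by (rule test_fun_minus[OF tf test_fun_mult_prod[OF tf plateau_C2[OF m] k1]])
      moreover have "\<forall>x t. 0 \<le> \<eta> x t - \<eta> x t * (?h x * \<kappa> t)"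
      proof (intro allI)
        fix x t
        have "?h x * \<kappa> t \<le> 1 * 1" using plateau_bounds[OF m, of a x] kb[of t] by (intro mult_mono) auto
        then have "\<eta> x t * (?h x * \<kappa> t) \<le> \<eta> x t * 1" using nn by (intro mult_left_mono) auto
        then show "0 \<le> \<eta> x t - \<eta> x t * (?h x * \<kappa> t)" by simp
      qed
      \<comment> \<open>Near the segment of \<open>a\<close> the factor
        \<open>1 - ?h x * \<kappa> t\<close> is zero: the plateau equals 1 up to distance
        \<open>2 / ?m\<close>, and \<open>\<kappa>\<close> equals 1 up to time
        \<open>\<tau> a + \<epsilon>\<close>. Near the other blocked points \<open>\<eta>\<close>
        itself vanishes.\<close>
      moreover define e' where "e' = min e (min (2 / ?m) \<epsilon>)"
      moreover have "e' > 0" using e \<epsilon> by (simp add: e'_def)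
      moreover have "\<forall>x t y r. (y, r) \<in> away_set T (insert a Q) s \<longrightarrow> \<bar>x - y\<bar> < e' \<longrightarrow> \<bar>t - r\<bar> < e' \<longrightarrow> \<eta> x t - \<eta> x t * (?h x * \<kappa> t) = 0"
      proof (intro allI impI)
        fix x t y r assume yr: "(y, r) \<in> away_set T (insert a Q) s" and cl: "\<bar>x - y\<bar> < e'" "\<bar>t - r\<bar> < e'"
        show "\<eta> x t - \<eta> x t * (?h x * \<kappa> t) = 0"
        proof (cases "(y, r) \<in> away_set T Q s")
          case True
          have "\<bar>x - y\<bar> < e" "\<bar>t - r\<bar> < e" using cl unfolding e'_def by linarith+
          then have "\<eta> x t = 0" using sep True by blast
          then show ?thesis by simp
        next
          case False
          then have "y = a" "r \<le> \<tau> a" using yr tau by (auto simp: away_set_def)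
          then have "\<bar>x - a\<bar> \<le> 2 / ?m" "t \<le> \<tau> a + \<epsilon>" using cl unfolding e'_def by linarith+
          then have "?h x = 1" "\<kappa> t = 1" using plateau_eq_1[OF m] ke by blast+
          then show ?thesis by simp
        qed
      qed
      ultimately have "0 \<le> (\<integral>p. ?D p * (\<eta>1 (fst p) (snd p) - (\<eta>1 (fst p) (snd p) * (?h (fst p) * \<kappa> (snd p)) + \<eta> (fst p) (snd p) * (?h (fst p) * \<kappa>' (snd p))))
         + ?E p * (\<eta>2 (fst p) (snd p) - (\<eta>2 (fst p) (snd p) * (?h (fst p) * \<kappa> (snd p)) + \<eta> (fst p) (snd p) * ((?l (fst p) - ?r (fst p)) * \<kappa> (snd p)))) \<partial>lborel)"
        using kr unfolding kruzkov_ineq_def by blast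
      also have "\<dots> \<le> (\<integral>p. (?D p * \<eta>1 (fst p) (snd p) + ?E p * \<eta>2 (fst p) (snd p))
         - (?D p * ((\<eta>1 (fst p) (snd p) * \<kappa> (snd p) + \<eta> (fst p) (snd p) * \<kappa>' (snd p)) * ?h (fst p))
           + ?E p * ((\<eta>2 (fst p) (snd p) * \<kappa> (snd p)) * ?h (fst p)))
         + ?E p * (?r (fst p) * (\<eta> (fst p) (snd p) * \<kappa> (snd p))) \<partial>lborel)" (is "integral\<^sup>L lborel ?f \<le> integral\<^sup>L lborel ?g")
      proof (rule integral_mono)
        have i1: "integrable lborel (\<lambda>p. ?D p * \<eta>1 (fst p) (snd p))" "integrable lborel (\<lambda>p. ?E p * \<eta>2 (fst p) (snd p))"
          using bd by (auto intro!: integrable_mult_bounded[OF D_integrable, of _ B] integrable_mult_bounded[OF E_integrable, of _ B])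
        have i2: "integrable lborel (\<lambda>p. ?D p * ((\<eta>1 (fst p) (snd p) * \<kappa> (snd p) + \<eta> (fst p) (snd p) * \<kappa>' (snd p)) * ?h (fst p)))"
          by (rule integrable_mult_bounded[OF D_integrable]) (measurable, rule mb[OF g1b pb])
        have i3: "integrable lborel (\<lambda>p. ?E p * ((\<eta>2 (fst p) (snd p) * \<kappa> (snd p)) * ?h (fst p)))"
          by (rule integrable_mult_bounded[OF E_integrable]) (measurable, rule mb[OF g2b pb])
        have gk: "\<bar>\<eta> x t * \<kappa> t\<bar> \<le> B" for x t using mb[of "\<eta> x t" B "\<kappa> t"] bd kb[of t] by auto
        have i4: "integrable lborel (\<lambda>p. ?E p * (f (fst p) * (\<eta> (fst p) (snd p) * \<kappa> (snd p))))"
          if [measurable]: "(\<lambda>p. f (fst p)) \<in> borel_measurable (borel :: (real \<times> real) measure)" and "\<And>x. \<bar>f x\<bar> \<le> ?m * B'" for f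
        proof (rule integrable_mult_bounded[OF E_integrable])
          show "\<bar>f (fst p) * (\<eta> (fst p) (snd p) * \<kappa> (snd p))\<bar> \<le> (?m * B') * B" for p :: "real \<times> real"
            unfolding abs_mult[of "f (fst p)"] using that(2) gk B' B by (intro mult_mono) auto
        qed measurable
        show ig: "integrable lborel ?g"
          by (intro Bochner_Integration.integrable_add Bochner_Integration.integrable_diff i1 i2 i3 i4 pm lrB)
        \<comment> \<open>The two integrands differ by the rising flank alone, which enters with a
          minus sign and a nonnegative weight.\<close>
        have feq: "?f p = ?g p - ?E p * (?l (fst p) * (\<eta> (fst p) (snd p) * \<kappa> (snd p)))" for p
          by (simp add: algebra_simps)
        show "integrable lborel ?f"
          unfolding feq[abs_def] by (intro Bochner_Integration.integrable_diff ig i4 pm lrB)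
        show "?f p \<le> ?g p" for p
          unfolding feq[of p] using plateau_left_nonneg[OF m, of a "fst p"] nn kb by simp
      qed
      also have "\<dots> = ?J - A n + F n"
      proof -
        have gk: "\<bar>\<eta> x t * \<kappa> t\<bar> \<le> B" for x t using mb[of "\<eta> x t" B "\<kappa> t"] bd kb[of t] by auto
        have i1: "integrable lborel (\<lambda>p. ?D p * \<eta>1 (fst p) (snd p))" "integrable lborel (\<lambda>p. ?E p * \<eta>2 (fst p) (snd p))"
          using bd by (auto intro!: integrable_mult_bounded[OF D_integrable, of _ B] integrable_mult_bounded[OF E_integrable, of _ B])
        have i2: "integrable lborel (\<lambda>p. ?D p * ((\<eta>1 (fst p) (snd p) * \<kappa> (snd p) + \<eta> (fst p) (snd p) * \<kappa>' (snd p)) * ?h (fst p)))"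
          by (rule integrable_mult_bounded[OF D_integrable]) (measurable, rule mb[OF g1b pb])
        have i3: "integrable lborel (\<lambda>p. ?E p * ((\<eta>2 (fst p) (snd p) * \<kappa> (snd p)) * ?h (fst p)))"
          by (rule integrable_mult_bounded[OF E_integrable]) (measurable, rule mb[OF g2b pb])
        have i4: "integrable lborel (\<lambda>p. ?E p * (?r (fst p) * (\<eta> (fst p) (snd p) * \<kappa> (snd p))))"
        proof (rule integrable_mult_bounded[OF E_integrable])
          show "\<bar>?r (fst p) * (\<eta> (fst p) (snd p) * \<kappa> (snd p))\<bar> \<le> (?m * B') * B" for p :: "real \<times> real"
            unfolding abs_mult[of "?r (fst p)"] using lrB gk B' B by (intro mult_mono) auto
        qed measurable
        show ?thesis
          unfolding A_def F_def
          by (simp only: Bochner_Integration.integral_add Bochner_Integration.integral_diff i1 i2 i3 i4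
              Bochner_Integration.integrable_add Bochner_Integration.integrable_diff)
      qed
      finally show ?thesis .
    qed
    have step2: "F n \<le> B * (U.trace_defect a n + V.trace_defect a n) + B * (M * (3 * \<epsilon>))" for n
    proof -
      let ?m = "real (Suc n)"
      let ?r = "plateau_right a ?m"
      let ?i = "indicator {0<..<\<tau> a} :: real \<Rightarrow> real" and ?j = "indicator {\<tau> a..\<tau> a + 3 * \<epsilon>} :: real \<Rightarrow> real"
      have m: "?m > 0" by simp
      have iU: "integrable lborel (\<lambda>p. (M - \<psi> (U p)) * (?r (fst p) * ?i (snd p)))" by (rule U.integrable_trace_defect[OF a])
      have iV: "integrable lborel (\<lambda>p. (M - \<psi> (V p)) * (?r (fst p) * ?i (snd p)))"
        using V.integrable_trace_defect[OF a, of n] tau by simp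
      have "integrable lborel ?j" by (rule integrable_real_indicator) (simp_all add: emeasure_lborel_Icc_eq)
      then have ij: "integrable lborel (\<lambda>p. ?r (fst p) * ?j (snd p))"
        using integrable_pair_mult[OF integrable_plateau_right(1)[OF m, of a]] by (simp add: lborel_prod case_prod_beta')
      have ij_eq: "(\<integral>p. ?r (fst p) * ?j (snd p) \<partial>lborel) = 3 * \<epsilon>"
      proof -
        have "(\<integral>p. ?r (fst p) * ?j (snd p) \<partial>lborel) = (\<integral>t. (\<integral>x. ?r x * ?j t \<partial>lborel) \<partial>lborel)"
          using lborel_pair.integral_snd[of "\<lambda>x t. ?r x * ?j t"] ij by (simp add: lborel_prod case_prod_beta')
        also have "\<dots> = 3 * \<epsilon>" using integrable_plateau_right(2)[OF m, of a] \<epsilon> by simp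
        finally show ?thesis .
      qed
      have "F n \<le> (\<integral>p. B * ((M - \<psi> (U p)) * (?r (fst p) * ?i (snd p)) + (M - \<psi> (V p)) * (?r (fst p) * ?i (snd p))) + B * (M * (?r (fst p) * ?j (snd p))) \<partial>lborel)"
        unfolding F_def
      proof (rule integral_mono_AE')
        show "integrable lborel (\<lambda>p. B * ((M - \<psi> (U p)) * (?r (fst p) * ?i (snd p)) + (M - \<psi> (V p)) * (?r (fst p) * ?i (snd p))) + B * (M * (?r (fst p) * ?j (snd p))))"
          by (intro Bochner_Integration.integrable_add integrable_mult_right iU iV ij)
        have "?E p * (?r (fst p) * (\<eta> (fst p) (snd p) * \<kappa> (snd p))) \<le> B * ((M - \<psi> (U p)) * (?r (fst p) * ?i (snd p)) + (M - \<psi> (V p)) * (?r (fst p) * ?i (snd p))) + B * (M * (?r (fst p) * ?j (snd p)))" for p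
        proof -
          obtain x t where p: "p = (x, t)" by (cases p)
          have r0: "0 \<le> ?r x" by (rule plateau_right_nonneg[OF m])
          have gk: "\<eta> x t * \<kappa> t \<le> B" "0 \<le> \<eta> x t * \<kappa> t"
            using mb[of "\<eta> x t" B "\<kappa> t"] bd kb[of t] nn by auto
          have "?E p * (?r x * (\<eta> x t * \<kappa> t)) \<le> ?E p * (?r x * B)"
            by (intro mult_left_mono gk r0 abs_ge_zero)
          note E1 = this
          have d1: "0 \<le> M - \<psi> (U p)" "0 \<le> M - \<psi> (V p)" "M - \<psi> (U p) \<le> M" "M - \<psi> (V p) \<le> M"
            by (rule U.psi_defect_bounds V.psi_defect_bounds)+
          consider "t \<le> 0" | "0 < t" "t < \<tau> a" | "0 < t" "\<tau> a \<le> t" "t \<le> \<tau> a + 3 * \<epsilon>" | "t > \<tau> a + 3 * \<epsilon>" by linarith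
          then have "?E p * (?r x * (\<eta> x t * \<kappa> t)) \<le> B * ((M - \<psi> (U p)) * (?r x * ?i t) + (M - \<psi> (V p)) * (?r x * ?i t)) + B * (M * (?r x * ?j t))"
          proof cases
            case 1
            then have "\<eta> x t = 0" using cpt by blast
            then show ?thesis using B d1 r0 U.M_nonneg by (simp add: indicator_def)
          next
            case 2
            \<comment> \<open>Both values lie below \<open>M\<close>, so their distance is at most
              the sum of the defects. Here \<open>\<tau> a = \<sigma> a\<close> is essential: both
              defects are small over the same time interval.\<close>
            have "?E p \<le> (M - \<psi> (U p)) + (M - \<psi> (V p))" using d1 by linarith
            then have "?E p * (?r x * B) \<le> ((M - \<psi> (U p)) + (M - \<psi> (V p))) * (?r x * B)"
              using r0 B by (intro mult_right_mono) auto
            with E1 show ?thesis using 2 by (simp add: indicator_def algebra_simps)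
          next
            case 3
            have "?E p \<le> M" using d1 by linarith
            then have "?E p * (?r x * B) \<le> M * (?r x * B)"
              using r0 B by (intro mult_right_mono) auto
            with E1 show ?thesis using 3 by (simp add: indicator_def algebra_simps)
          next
            case 4
            then have "\<kappa> t = 0" using kz by simp
            then show ?thesis using B d1 r0 U.M_nonneg by (simp add: indicator_def)
          qed
          then show ?thesis by (simp add: p)
        qed
        then show "AE p in lborel. ?E p * (?r (fst p) * (\<eta> (fst p) (snd p) * \<kappa> (snd p))) \<le> B * ((M - \<psi> (U p)) * (?r (fst p) * ?i (snd p)) + (M - \<psi> (V p)) * (?r (fst p) * ?i (snd p))) + B * (M * (?r (fst p) * ?j (snd p)))"
          by (rule AE_I2)
        show "AE p in lborel. 0 \<le> B * ((M - \<psi> (U p)) * (?r (fst p) * ?i (snd p)) + (M - \<psi> (V p)) * (?r (fst p) * ?i (snd p))) + B * (M * (?r (fst p) * ?j (snd p)))"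
          by (intro AE_I2 add_nonneg_nonneg mult_nonneg_nonneg plateau_right_nonneg[OF m] U.psi_defect_bounds V.psi_defect_bounds U.M_nonneg less_imp_le[OF B]) auto
      qed
      also have "\<dots> = B * ((\<integral>p. (M - \<psi> (U p)) * (?r (fst p) * ?i (snd p)) \<partial>lborel) + (\<integral>p. (M - \<psi> (V p)) * (?r (fst p) * ?i (snd p)) \<partial>lborel)) + B * (M * (\<integral>p. ?r (fst p) * ?j (snd p) \<partial>lborel))"
        using iU iV ij by (simp only: Bochner_Integration.integral_add Bochner_Integration.integrable_add integrable_mult_right integral_mult_right_zero)
      also have "\<dots> = B * (U.trace_defect a n + V.trace_defect a n) + B * (M * (3 * \<epsilon>))"
        unfolding ij_eq unfolding U.trace_defect_def V.trace_defect_def tau(1) ..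
      finally show ?thesis .
    qed
    have "(\<lambda>n. ?J - A n + (B * (U.trace_defect a n + V.trace_defect a n) + B * (M * (3 * \<epsilon>)))) \<longlonglongrightarrow> ?J - 0 + (B * (0 + 0) + B * (M * (3 * \<epsilon>)))"
      by (intro tendsto_intros A_lim U.trace_defect_tendsto_0[OF a] V.trace_defect_tendsto_0[OF a])
    moreover have "0 \<le> ?J - A n + (B * (U.trace_defect a n + V.trace_defect a n) + B * (M * (3 * \<epsilon>)))" for n
      using step1[of n] step2[of n] by linarith
    ultimately have "0 \<le> ?J - 0 + (B * (0 + 0) + B * (M * (3 * \<epsilon>)))"
      by (intro LIMSEQ_le_const) auto
    then show ?thesis by simp
  qed
  show "0 \<le> ?J"
  proof (rule field_le_epsilon)
    fix \<delta> :: real assume \<delta>: "\<delta> > 0"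
    \<comment> \<open>The denominator has \<open>M + 1\<close> in place of \<open>M\<close>, which
      may be zero.\<close>
    define \<epsilon> where "\<epsilon> = \<delta> / (3 * B * (M + 1))"
    have pos: "3 * B * (M + 1) > 0" using B U.M_nonneg by simp
    then have "\<epsilon> > 0" using \<delta> by (simp add: \<epsilon>_def)
    from main[OF this] have "0 \<le> ?J + B * (M * (3 * \<epsilon>))" .
    also have "B * (M * (3 * \<epsilon>)) \<le> 3 * B * (M + 1) * \<epsilon>" using B \<open>\<epsilon> > 0\<close> by (simp add: algebra_simps)
    also have "\<dots> = \<delta>"
      unfolding \<epsilon>_def times_divide_eq_right by (rule nonzero_mult_div_cancel_left) (use pos in linarith)
    finally show "0 \<le> ?J + \<delta>" by simp
  qed
qed

end

section \<open>Propagation of equality from left to right\<close>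

lemma C1_compact_bounded:
  assumes \<theta>: "C1_with_deriv \<theta> \<theta>'" and z: "\<And>t. t < l \<or> u < t \<Longrightarrow> \<theta> t = 0"
  obtains B where "B > 0" "\<And>t. \<bar>\<theta> t\<bar> \<le> B" "\<And>t. \<bar>\<theta>' t\<bar> \<le> B"
proof -
  have z': "\<theta>' t = 0" if t: "t < l \<or> u < t" for t
  proof -
    have "(\<theta> has_real_derivative 0) (at t)"
    proof (cases "t < l")
      case True
      show ?thesis
        by (rule has_field_derivative_transform_within_open[of "\<lambda>_. 0" _ _ "{..<l}"]) (use True z in auto)
    next
      case False
      show ?thesis
        by (rule has_field_derivative_transform_within_open[of "\<lambda>_. 0" _ _ "{u<..}"]) (use False t z in auto)
    qed
    moreover have "(\<theta> has_real_derivative \<theta>' t) (at t)" using \<theta> by (simp add: C1_with_deriv_def)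
    ultimately show ?thesis using DERIV_unique by blast
  qed
  have "bounded (\<theta> ` {l..u})" "bounded (\<theta>' ` {l..u})"
    by (intro compact_imp_bounded compact_continuous_image C1_with_deriv_cont[OF \<theta>] compact_Icc)+
  then obtain B1 B2 where B: "\<forall>y\<in>\<theta> ` {l..u}. \<bar>y\<bar> \<le> B1" "\<forall>y\<in>\<theta>' ` {l..u}. \<bar>y\<bar> \<le> B2"
    unfolding bounded_real by blast
  show ?thesis
  proof (rule that[of "\<bar>B1\<bar> + \<bar>B2\<bar> + 1"])
    fix t
    have "\<bar>\<theta> t\<bar> \<le> \<bar>B1\<bar> \<and> \<bar>\<theta>' t\<bar> \<le> \<bar>B2\<bar>"
    proof (cases "t \<in> {l..u}")
      case True
      then have "\<bar>\<theta> t\<bar> \<le> B1" "\<bar>\<theta>' t\<bar> \<le> B2" using B by blast+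
      then show ?thesis by linarith
    next
      case False
      then have "t < l \<or> u < t" by auto
      then show ?thesis using z z' by simp
    qed
    then show "\<bar>\<theta> t\<bar> \<le> \<bar>B1\<bar> + \<bar>B2\<bar> + 1" "\<bar>\<theta>' t\<bar> \<le> \<bar>B1\<bar> + \<bar>B2\<bar> + 1" by linarith+
  qed simp
qed

context transport_pair
begin

lemma kruzkov_ineq_remove_set:
  assumes "finite R" "R \<subseteq> P" "\<forall>a\<in>R. \<tau> a = \<sigma> a" "kruzkov_ineq (R \<union> Q) (\<lambda>a. max (\<tau> a) (\<sigma> a))"
  shows "kruzkov_ineq Q (\<lambda>a. max (\<tau> a) (\<sigma> a))"
  using assms
proof (induction R rule: finite_induct)
  case (insert a R)
  have "kruzkov_ineq (R \<union> Q) (\<lambda>a. max (\<tau> a) (\<sigma> a))"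
    by (rule kruzkov_ineq_remove[of a]) (use insert.prems in auto)
  then show ?case using insert by auto
qed simp

text \<open>The extinction time can be read off from the mass, positive before it and zero after it:
  between two different times one mass would be positive and the other zero.\<close>

lemma tau_eq:
  assumes a: "a \<in> P" and eq: "AE t in lborel. c a t = d a t"
  shows "\<tau> a = \<sigma> a"
proof (rule ccontr)
  assume ne: "\<tau> a \<noteq> \<sigma> a"
  have ae: "AE t in lborel. c a t = d a t \<and> (0 < t \<and> t < \<tau> a \<longrightarrow> 0 < c a t) \<and> (\<tau> a < t \<longrightarrow> c a t = 0)
      \<and> (0 < t \<and> t < \<sigma> a \<longrightarrow> 0 < d a t) \<and> (\<sigma> a < t \<longrightarrow> d a t = 0)"
    using eq U.c_pos[OF a] U.c_zero[OF a] V.c_pos[OF a] V.c_zero[OF a] by eventually_elim auto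
  have "min (\<tau> a) (\<sigma> a) < max (\<tau> a) (\<sigma> a)" using ne by auto
  from AE_lborel_interval_obtain[OF ae this] obtain t where t: "min (\<tau> a) (\<sigma> a) < t" "t < max (\<tau> a) (\<sigma> a)"
    and cd: "c a t = d a t \<and> (0 < t \<and> t < \<tau> a \<longrightarrow> 0 < c a t) \<and> (\<tau> a < t \<longrightarrow> c a t = 0)
      \<and> (0 < t \<and> t < \<sigma> a \<longrightarrow> 0 < d a t) \<and> (\<sigma> a < t \<longrightarrow> d a t = 0)" .
  have "0 < t" using t(1) U.tau_bounds[OF a] V.tau_bounds[OF a] by linarith
  show False
  proof (cases "\<tau> a < \<sigma> a")
    case True
    then have "\<tau> a < t" "t < \<sigma> a" using t by auto
    then show False using cd \<open>0 < t\<close> by auto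
  next
    case False
    then have "\<sigma> a < t" "t < \<tau> a" using t ne by auto
    then show False using cd \<open>0 < t\<close> by auto
  qed
qed

text \<open>A cutoff that is nonincreasing in space gives the flux term a sign; this is why the points beyond
  \<open>\<beta>\<close> do not matter.\<close>

lemma coincide_left_of:
  assumes good: "\<And>a. a \<in> P \<Longrightarrow> a < \<beta> \<Longrightarrow> AE t in lborel. c a t = d a t"
  shows "AE p in lborel. fst p < \<beta> \<longrightarrow> U p = V p"
proof -
  define Q where "Q = {a\<in>P. \<beta> \<le> a}"
  have PQ: "{a\<in>P. a < \<beta>} \<union> Q = P" by (auto simp: Q_def)
  \<comment> \<open>To the left of \<open>\<beta>\<close> the atoms agree, hence so do their
    extinction times, and their lines can be removed; the points of \<open>Q\<close> remain
    blocked.\<close>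
  have kr: "kruzkov_ineq Q (\<lambda>a. max (\<tau> a) (\<sigma> a))"
  proof (rule kruzkov_ineq_remove_set[of "{a\<in>P. a < \<beta>}"])
    show "finite {a\<in>P. a < \<beta>}" using U.P_finite by simp
    show "\<forall>a\<in>{a\<in>P. a < \<beta>}. \<tau> a = \<sigma> a" using tau_eq good by blast
    show "kruzkov_ineq ({a\<in>P. a < \<beta>} \<union> Q) (\<lambda>a. max (\<tau> a) (\<sigma> a))"
      unfolding PQ by (rule kruzkov_ineq_all)
  qed blast
  obtain B' where B': "B' > 0" "\<And>x. bump x \<le> B'" using bump_bounded by metis
  let ?D = "\<lambda>p. \<bar>U p - V p\<bar>" and ?E = "\<lambda>p. \<bar>\<psi> (U p) - \<psi> (V p)\<bar>"
  have local_eq: "AE p in lborel. fst p \<le> \<beta> - 3 / m \<longrightarrow> U p = V p" if m: "m > 0" for m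
  proof -
    \<comment> \<open>Equal to 1 for \<open>x \<le> \<beta> - 3 / m\<close> and to 0 from
      \<open>\<beta> - 1 / m\<close> on, hence zero near all points of \<open>Q\<close>.\<close>
    define g where "g x = 1 - smooth_step (m * (x - \<beta>) + 2)" for x
    have g01: "0 \<le> g x" "g x \<le> 1" for x using smooth_step_bounds[of "m * (x - \<beta>) + 2"] by (auto simp: g_def)
    have [measurable]: "g \<in> borel_measurable borel" unfolding g_def[abs_def] by measurable
    have gm: "(\<lambda>p. g (fst p)) \<in> borel_measurable (borel :: (real \<times> real) measure)"
      by (rule measurable_snd_fun) simp
    have iDg: "integrable lborel (\<lambda>p. ?D p * g (fst p))"
      by (rule integrable_mult_bounded[OF D_integrable gm, of 1]) (use g01 in auto)
    define D where "D t = (\<integral>x. ?D (x, t) * g x \<partial>lborel)" for t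
    have iD: "integrable lborel D"
      using lborel_pair.integrable_snd[of "\<lambda>x t. ?D (x, t) * g x"] iDg
      by (simp add: D_def[abs_def] lborel_prod case_prod_beta')
    have D0: "0 \<le> D t" for t unfolding D_def using g01 by (intro Bochner_Integration.integral_nonneg) auto
    have "\<exists>N\<in>null_sets lborel. \<forall>s t. s \<notin> N \<longrightarrow> t \<notin> N \<longrightarrow> 0 < s \<longrightarrow> s < t \<longrightarrow> t < T \<longrightarrow> D t \<le> D s"
    proof (rule weakly_nonincreasing[OF iD])
      fix \<theta> \<theta>' :: "real \<Rightarrow> real" and l u assume \<theta>: "C1_with_deriv \<theta> \<theta>'" "\<And>t. 0 \<le> \<theta> t" and lu: "0 < l" "u < T"
        and z: "\<And>t. t < l \<or> u < t \<Longrightarrow> \<theta> t = 0"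
      obtain B where B: "B > 0" "\<And>t. \<bar>\<theta> t\<bar> \<le> B" "\<And>t. \<bar>\<theta>' t\<bar> \<le> B" using C1_compact_bounded[OF \<theta>(1) z] by metis
      have tm[measurable]: "\<theta> \<in> borel_measurable borel" "\<theta>' \<in> borel_measurable borel"
        by (intro borel_measurable_continuous_onI C1_with_deriv_cont[OF \<theta>(1)])+
      have [measurable]: "(\<lambda>p. \<theta> (snd p)) \<in> borel_measurable (borel :: (real \<times> real) measure)"
        "(\<lambda>p. \<theta>' (snd p)) \<in> borel_measurable (borel :: (real \<times> real) measure)"
        by (intro measurable_snd_fun tm)+
      \<comment> \<open>This is \<open>g\<close> cut off far to the left, where it rises from 0 at
        \<open>- 3 * R\<close> to 1 at \<open>- R\<close> with \<open>R = Suc n\<close>. The rise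
        has the wrong sign, but its slope is at most \<open>B' / R\<close> while the flux difference
        is integrable.\<close>
      define \<xi> where "\<xi> n x = smooth_step ((1 / real (Suc n)) * (x - 0) + 2) - smooth_step (m * (x - \<beta>) + 2)" for n x
      have \<xi>m[measurable]: "(\<lambda>p. \<xi> n (fst p)) \<in> borel_measurable (borel :: (real \<times> real) measure)" for n
        by (rule measurable_snd_fun) (simp add: \<xi>_def[abs_def])
      have \<xi>b: "\<bar>\<xi> n x\<bar> \<le> 1" for n x
        unfolding \<xi>_def using smooth_step_bounds[of "(1 / real (Suc n)) * (x - 0) + 2"] smooth_step_bounds[of "m * (x - \<beta>) + 2"] by linarith
      have i\<xi>: "integrable lborel (\<lambda>p. ?D p * (\<xi> n (fst p) * \<theta>' (snd p)))" for n
      proof (rule integrable_mult_bounded[OF D_integrable])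
        show "\<bar>\<xi> n (fst p) * \<theta>' (snd p)\<bar> \<le> 1 * B" for p :: "real \<times> real"
          unfolding abs_mult using \<xi>b B by (intro mult_mono) auto
      qed measurable
      define C where "C = (\<integral>p. ?E p * \<theta> (snd p) \<partial>lborel)"
      have iE: "integrable lborel (\<lambda>p. ?E p * \<theta> (snd p))"
        by (rule integrable_mult_bounded[OF E_integrable _, of _ B]) (use B in auto)
      \<comment> \<open>From \<open>n0\<close> on the rise ends before the fall begins, so that
        \<open>\<xi> n\<close> is nonnegative.\<close>
      obtain n0 :: nat where n0: "\<bar>\<beta>\<bar> + 3 / m \<le> real n0" using real_arch_simple by blast
      have ineq: "0 \<le> (\<integral>p. ?D p * (\<xi> n (fst p) * \<theta>' (snd p)) \<partial>lborel) + (B' / real (Suc n)) * C" if n: "n \<ge> n0" for n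
      proof -
        define R where "R = real (Suc n)"
        have R: "R > 0" "\<bar>\<beta>\<bar> + 3 / m < R" using n0 n by (auto simp: R_def)
        have m3: "3 / m > 0" "1 / m > 0" "3 / m = 3 * (1 / m)" using m by auto
        have R1: "1 / R > 0" using R by simp
        have st1: "smooth_step ((1 / R) * (x - 0) + 2) = 1" if "x \<ge> - R" for x
        proof (rule smooth_step_eq_1)
          have "(1 / R) * x \<ge> - 1" using that R(1) by (simp add: field_simps)
          then show "1 \<le> (1 / R) * (x - 0) + 2" by simp
        qed
        have st2: "smooth_step (m * (x - \<beta>) + 2) = 0" if "x \<le> \<beta> - 3 / m" for x
        proof (rule smooth_step_eq_0)
          have "m * (x - \<beta>) \<le> m * (- (3 / m))" using that m by (intro mult_left_mono) auto
          then show "m * (x - \<beta>) + 2 \<le> - 1" using m by simp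
        qed
        have st3: "m * (x - \<beta>) + 2 \<ge> 1" if "x \<ge> \<beta> - 1 / m" for x
        proof -
          have "m * (x - \<beta>) \<ge> m * (- (1 / m))" using that m by (intro mult_left_mono) auto
          then show ?thesis using m by simp
        qed
        have st4: "(1 / R) * (x - 0) + 2 \<le> -1" if "x \<le> - (3 * R)" for x
          using that R(1) by (simp add: field_simps)
        have c2: "C2_with_derivs (\<xi> n) (\<lambda>x. (1 / R) * bump ((1 / R) * (x - 0) + 2) - m * bump (m * (x - \<beta>) + 2))
           (\<lambda>x. (1 / R) * ((1 / R) * bump' ((1 / R) * (x - 0) + 2)) - m * (m * bump' (m * (x - \<beta>) + 2)))"
          using C2_with_derivs_diff[OF step_affine_C2[OF R1, of 0 2] step_affine_C2[OF m, of \<beta> 2]]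
          unfolding \<xi>_def[abs_def] R_def by simp
        have supp: "\<xi> n x = 0" if sx: "x \<le> - (3 * R) \<or> x \<ge> \<beta> - 1 / m" for x
        proof -
          consider "x \<le> - (3 * R)" | "x \<ge> \<beta> - 1 / m" using sx by blast
          then show ?thesis
          proof cases
            case 1
            then have "x \<le> \<beta> - 3 / m" using R by linarith
            then show ?thesis unfolding \<xi>_def R_def[symmetric] using st2[of x] smooth_step_eq_0[OF st4[OF 1]] by simp
          next
            case 2
            then have "x \<ge> - R" using R m3 by linarith
            then show ?thesis unfolding \<xi>_def R_def[symmetric] using st1[of x] smooth_step_eq_1[OF st3[OF 2]] by simp
          qed
        qed
        have \<xi>0: "0 \<le> \<xi> n x" for x
        proof (cases "x \<ge> - R")
          case True
          then show ?thesis unfolding \<xi>_def R_def[symmetric] using st1[of x] smooth_step_bounds[of "m * (x - \<beta>) + 2"] by simp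
        next
          case False
          then have "x \<le> \<beta> - 3 / m" using R by linarith
          then show ?thesis unfolding \<xi>_def R_def[symmetric] using st2[of x] smooth_step_bounds[of "(1 / R) * (x - 0) + 2"] by simp
        qed
        have tf: "test_fun (\<lambda>x t. \<xi> n x * \<theta> t) (\<lambda>x t. \<xi> n x * \<theta>' t)
           (\<lambda>x t. ((1 / R) * bump ((1 / R) * (x - 0) + 2) - m * bump (m * (x - \<beta>) + 2)) * \<theta> t)"
        proof (rule test_fun.prod[OF c2 _ \<theta>(1)], intro allI impI)
          fix x assume x: "3 * R + \<bar>\<beta>\<bar> \<le> \<bar>x\<bar>"
          consider "x \<le> - (3 * R)" | "x \<ge> \<beta>" "x \<ge> 3 * R" using x R by linarith
          then show "\<xi> n x = 0 \<and> (1 / R) * bump ((1 / R) * (x - 0) + 2) - m * bump (m * (x - \<beta>) + 2) = 0 \<and>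
            (1 / R) * ((1 / R) * bump' ((1 / R) * (x - 0) + 2)) - m * (m * bump' (m * (x - \<beta>) + 2)) = 0"
          proof cases
            case 1
            have "x \<le> \<beta> - 3 / m" using 1 R by linarith
            then have "m * (x - \<beta>) \<le> m * (- (3 / m))" using m by (intro mult_left_mono) auto
            then have "m * (x - \<beta>) + 2 \<le> - 1" using m by simp
            then have "\<bar>m * (x - \<beta>) + 2\<bar> \<ge> 1" "\<bar>(1 / R) * (x - 0) + 2\<bar> \<ge> 1" using st4[OF 1] by linarith+
            then show ?thesis using supp[of x] 1 by (simp only: bump_eq_0 bump'_eq_0) simp
          next
            case 2
            have "x \<ge> \<beta> - 1 / m" using 2 m3 by linarith
            note st3[OF this]
            moreover have "(1 / R) * (x - 0) + 2 \<ge> 1" using 2 R by simp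
            ultimately have "\<bar>m * (x - \<beta>) + 2\<bar> \<ge> 1" "\<bar>(1 / R) * (x - 0) + 2\<bar> \<ge> 1" by linarith+
            then show ?thesis using supp[of x] \<open>x \<ge> \<beta> - 1 / m\<close> by (simp only: bump_eq_0 bump'_eq_0) simp
          qed
        qed
        \<comment> \<open>A blocked point lies at or beyond \<open>\<beta>\<close> or has a time
          outside the open interval from 0 to \<open>T\<close>; within distance \<open>e\<close> of
          it the space factor or the time factor vanishes.\<close>
        define e where "e = min (1 / m) (min l (T - u))"
        have e: "e > 0" using m lu by (simp add: e_def)
        have "0 \<le> (\<integral>p. ?D p * (\<xi> n (fst p) * \<theta>' (snd p)) + ?E p * (((1 / R) * bump ((1 / R) * (fst p - 0) + 2) - m * bump (m * (fst p - \<beta>) + 2)) * \<theta> (snd p)) \<partial>lborel)"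
        proof (rule kr[unfolded kruzkov_ineq_def, rule_format, OF e tf])
          show "0 \<le> \<xi> n x * \<theta> t" for x t using \<xi>0 \<theta>(2) by simp
          show "\<xi> n x * \<theta> t = 0" if "(y, r) \<in> away_set T Q (\<lambda>a. max (\<tau> a) (\<sigma> a))" "\<bar>x - y\<bar> < e" "\<bar>t - r\<bar> < e" for x t y r
          proof -
            have "r \<le> 0 \<or> T \<le> r \<or> y \<ge> \<beta>" using that(1) by (auto simp: away_set_def Q_def)
            then have "t < l \<or> u < t \<or> x \<ge> \<beta> - 1 / m" using that(2,3) unfolding e_def by linarith
            then show ?thesis using z supp by fastforce
          qed
        qed
        also have "\<dots> \<le> (\<integral>p. ?D p * (\<xi> n (fst p) * \<theta>' (snd p)) + (B' / R) * (?E p * \<theta> (snd p)) \<partial>lborel)"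
        proof (rule integral_mono)
          show "integrable lborel (\<lambda>p. ?D p * (\<xi> n (fst p) * \<theta>' (snd p)) + (B' / R) * (?E p * \<theta> (snd p)))"
            using i\<xi> iE by simp
          have bm: "(\<lambda>p. (1 / R) * bump ((1 / R) * (fst p - 0) + 2) - m * bump (m * (fst p - \<beta>) + 2)) \<in> borel_measurable (borel :: (real \<times> real) measure)"
            by (rule measurable_snd_fun[where f = "\<lambda>x. (1 / R) * bump ((1 / R) * (x - 0) + 2) - m * bump (m * (x - \<beta>) + 2)"]) simp
          have "integrable lborel (\<lambda>p. ?E p * (((1 / R) * bump ((1 / R) * (fst p - 0) + 2) - m * bump (m * (fst p - \<beta>) + 2)) * \<theta> (snd p)))"
          proof (rule integrable_mult_bounded[OF E_integrable])
            show "(\<lambda>p. ((1 / R) * bump ((1 / R) * (fst p - 0) + 2) - m * bump (m * (fst p - \<beta>) + 2)) * \<theta> (snd p)) \<in> borel_measurable borel"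
              using bm by measurable
            fix p :: "real \<times> real"
            have "\<bar>(1 / R) * bump ((1 / R) * (fst p - 0) + 2)\<bar> \<le> (1 / R) * B'" "\<bar>m * bump (m * (fst p - \<beta>) + 2)\<bar> \<le> m * B'"
              using R1 m B' bump_nonneg by (auto simp: abs_mult intro!: divide_right_mono mult_left_mono)
            then have "\<bar>(1 / R) * bump ((1 / R) * (fst p - 0) + 2) - m * bump (m * (fst p - \<beta>) + 2)\<bar> \<le> (1 / R) * B' + m * B'"
              by linarith
            then show "\<bar>((1 / R) * bump ((1 / R) * (fst p - 0) + 2) - m * bump (m * (fst p - \<beta>) + 2)) * \<theta> (snd p)\<bar> \<le> ((1 / R) * B' + m * B') * B"
              unfolding abs_mult[of _ "\<theta> (snd p)"] using B by (intro mult_mono) auto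
          qed
          then show "integrable lborel (\<lambda>p. ?D p * (\<xi> n (fst p) * \<theta>' (snd p)) + ?E p * (((1 / R) * bump ((1 / R) * (fst p - 0) + 2) - m * bump (m * (fst p - \<beta>) + 2)) * \<theta> (snd p)))"
            by (intro Bochner_Integration.integrable_add i\<xi>)
          fix p :: "real \<times> real"
          \<comment> \<open>The fall of the cutoff is dropped because of its sign, its rise is
            estimated by the slope.\<close>
          have "(1 / R) * bump ((1 / R) * (fst p - 0) + 2) \<le> (1 / R) * B'" using R1 B' by (intro mult_left_mono) auto
          moreover have "0 \<le> m * bump (m * (fst p - \<beta>) + 2)" using m bump_nonneg by simp
          ultimately have "(1 / R) * bump ((1 / R) * (fst p - 0) + 2) - m * bump (m * (fst p - \<beta>) + 2) \<le> B' / R" by simp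
          then have "((1 / R) * bump ((1 / R) * (fst p - 0) + 2) - m * bump (m * (fst p - \<beta>) + 2)) * (?E p * \<theta> (snd p)) \<le> (B' / R) * (?E p * \<theta> (snd p))"
            using \<theta>(2) by (intro mult_right_mono) auto
          then show "?D p * (\<xi> n (fst p) * \<theta>' (snd p)) + ?E p * (((1 / R) * bump ((1 / R) * (fst p - 0) + 2) - m * bump (m * (fst p - \<beta>) + 2)) * \<theta> (snd p))
            \<le> ?D p * (\<xi> n (fst p) * \<theta>' (snd p)) + (B' / R) * (?E p * \<theta> (snd p))"
            by (simp only: mult_ac add_le_cancel_left)
        qed
        also have "\<dots> = (\<integral>p. ?D p * (\<xi> n (fst p) * \<theta>' (snd p)) \<partial>lborel) + (B' / R) * C"
          unfolding C_def using i\<xi> iE by simp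
        finally show ?thesis by (simp add: R_def)
      qed
      have ig: "integrable lborel (\<lambda>p. ?D p * (g (fst p) * \<theta>' (snd p)))"
      proof (rule integrable_mult_bounded[OF D_integrable])
        show "(\<lambda>p. g (fst p) * \<theta>' (snd p)) \<in> borel_measurable borel" using gm by measurable
        show "\<bar>g (fst p) * \<theta>' (snd p)\<bar> \<le> 1 * B" for p :: "real \<times> real"
          unfolding abs_mult using g01 B by (intro mult_mono) auto
      qed
      define J where "J = (\<integral>p. ?D p * (g (fst p) * \<theta>' (snd p)) \<partial>lborel)"
      have "(\<lambda>n. \<integral>p. ?D p * ((\<xi> n (fst p) - g (fst p)) * \<theta>' (snd p)) \<partial>lborel) \<longlonglongrightarrow> 0"
      proof (rule integral_mult_tendsto_0[OF D_integrable])
        show "(\<lambda>p. (\<xi> n (fst p) - g (fst p)) * \<theta>' (snd p)) \<in> borel_measurable borel" for n using gm by measurable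
        show "\<bar>(\<xi> n (fst p) - g (fst p)) * \<theta>' (snd p)\<bar> \<le> 2 * B" for n and p :: "real \<times> real"
        proof -
          have "\<bar>\<xi> n (fst p) - g (fst p)\<bar> \<le> 2" using \<xi>b[of n "fst p"] g01[of "fst p"] by linarith
          then show ?thesis unfolding abs_mult using B by (intro mult_mono) auto
        qed
        show "AE p in lborel. (\<lambda>n. (\<xi> n (fst p) - g (fst p)) * \<theta>' (snd p)) \<longlonglongrightarrow> 0"
        proof (intro AE_I2 tendsto_eventually)
          fix p :: "real \<times> real"
          obtain k :: nat where k: "- fst p \<le> real k" using real_arch_simple by blast
          have "\<xi> n (fst p) = g (fst p)" if "n \<ge> k" for n
          proof -
            have "fst p \<ge> - real (Suc n)" using k that by (simp add: order_trans)
            then have "1 \<le> (1 / real (Suc n)) * (fst p - 0) + 2" by (simp add: field_simps)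
            then show ?thesis unfolding \<xi>_def g_def using smooth_step_eq_1 by simp
          qed
          then show "\<forall>\<^sub>F n in sequentially. (\<xi> n (fst p) - g (fst p)) * \<theta>' (snd p) = 0"
            unfolding eventually_sequentially by auto
        qed
      qed
      moreover have "(\<integral>p. ?D p * ((\<xi> n (fst p) - g (fst p)) * \<theta>' (snd p)) \<partial>lborel) = (\<integral>p. ?D p * (\<xi> n (fst p) * \<theta>' (snd p)) \<partial>lborel) - J" for n
        unfolding J_def by (subst Bochner_Integration.integral_diff[OF i\<xi> ig, symmetric]) (simp add: algebra_simps)
      ultimately have "(\<lambda>n. (\<integral>p. ?D p * (\<xi> n (fst p) * \<theta>' (snd p)) \<partial>lborel) - J) \<longlonglongrightarrow> 0" by simp
      then have l1: "(\<lambda>n. \<integral>p. ?D p * (\<xi> n (fst p) * \<theta>' (snd p)) \<partial>lborel) \<longlonglongrightarrow> J" by (simp add: LIM_zero_iff)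
      have l2: "(\<lambda>n. (B' / real (Suc n)) * C) \<longlonglongrightarrow> 0"
        using tendsto_mult[OF tendsto_mult[OF tendsto_const[of B'] LIMSEQ_inverse_real_of_nat] tendsto_const[of C]]
        by (simp add: divide_inverse)
      have "0 \<le> J + 0"
        by (rule LIMSEQ_le_const[OF tendsto_add[OF l1 l2]]) (use ineq in blast)
      also have "J + 0 = (\<integral>t. (\<integral>x. ?D (x, t) * (g x * \<theta>' t) \<partial>lborel) \<partial>lborel)"
        using lborel_pair.integral_snd[of "\<lambda>x t. ?D (x, t) * (g x * \<theta>' t)"] ig by (simp add: J_def lborel_prod case_prod_beta')
      also have "\<dots> = (\<integral>t. D t * \<theta>' t \<partial>lborel)" by (simp add: D_def mult.assoc[symmetric])
      finally show "0 \<le> (\<integral>t. D t * \<theta>' t \<partial>lborel)" .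
    qed
    then obtain N where N: "N \<in> null_sets lborel" "\<And>s t. s \<notin> N \<Longrightarrow> t \<notin> N \<Longrightarrow> 0 < s \<Longrightarrow> s < t \<Longrightarrow> t < T \<Longrightarrow> D t \<le> D s"
      by blast
    have [measurable]: "w \<in> borel_measurable borel" by (rule U.w_borel)
    let ?F = "\<lambda>U t. \<integral>\<^sup>+x. ennreal \<bar>U (x, t) - w x\<bar> \<partial>lborel"
    have small: "\<exists>\<delta>>0. AE s in lborel. 0 < s \<and> s < \<delta> \<longrightarrow> ?F W s < ennreal \<epsilon>"
      if init: "ess_filterlim (?F W) (nhds 0) 0 {0<..}" and \<epsilon>: "0 < \<epsilon>" for W \<epsilon>
    proof -
      obtain N1 where N1: "negligible N1" "filterlim (?F W) (nhds 0) (at 0 within ({0<..} - N1))"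
        by (rule ess_filterlimE[OF init])
      have "\<forall>\<^sub>F s in at 0 within ({0<..} - N1). ?F W s < ennreal \<epsilon>"
        using order_tendstoD(2)[OF N1(2), of "ennreal \<epsilon>"] \<epsilon> by simp
      then obtain \<delta> where \<delta>: "\<delta> > 0" "\<forall>s\<in>{0<..} - N1. s \<noteq> 0 \<and> dist s 0 < \<delta> \<longrightarrow> ?F W s < ennreal \<epsilon>"
        by (auto simp only: eventually_at)
      have "AE s in lborel. 0 < s \<and> s < \<delta> \<longrightarrow> ?F W s < ennreal \<epsilon>"
        using AE_lborel_negligible[OF N1(1)] by eventually_elim (use \<delta>(2) in auto)
      then show ?thesis using \<delta>(1) by blast
    qed
    have D_le: "D s \<le> 2 * \<epsilon>" if "?F U s < ennreal \<epsilon>" "?F V s < ennreal \<epsilon>" "\<epsilon> > 0" for s \<epsilon>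
    proof -
      have Ds: "D s = enn2real (\<integral>\<^sup>+x. ennreal (?D (x, s) * g x) \<partial>lborel)"
        unfolding D_def by (rule integral_eq_nn_integral) (use g01 in auto)
      have "(\<integral>\<^sup>+x. ennreal (?D (x, s) * g x) \<partial>lborel) \<le> (\<integral>\<^sup>+x. ennreal \<bar>U (x, s) - w x\<bar> + ennreal \<bar>V (x, s) - w x\<bar> \<partial>lborel)"
      proof (rule nn_integral_mono)
        fix x
        have "?D (x, s) * g x \<le> ?D (x, s) * 1" using g01 by (intro mult_left_mono) auto
        also have "\<dots> \<le> \<bar>U (x, s) - w x\<bar> + \<bar>V (x, s) - w x\<bar>"
          using abs_triangle_ineq4[of "U (x, s) - w x" "V (x, s) - w x"] by simp
        finally have "ennreal (?D (x, s) * g x) \<le> ennreal (\<bar>U (x, s) - w x\<bar> + \<bar>V (x, s) - w x\<bar>)"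
          by (rule ennreal_leI)
        then show "ennreal (?D (x, s) * g x) \<le> ennreal \<bar>U (x, s) - w x\<bar> + ennreal \<bar>V (x, s) - w x\<bar>"
          by (simp only: ennreal_plus abs_ge_zero)
      qed
      also have "\<dots> = ?F U s + ?F V s" by (rule nn_integral_add) auto
      also have "\<dots> \<le> ennreal \<epsilon> + ennreal \<epsilon>" using that by (intro add_mono less_imp_le)
      also have "\<dots> = ennreal (2 * \<epsilon>)" using that(3) by (simp add: ennreal_plus[symmetric] del: ennreal_plus)
      finally have "(\<integral>\<^sup>+x. ennreal (?D (x, s) * g x) \<partial>lborel) \<le> ennreal (2 * \<epsilon>)" .
      with Ds show ?thesis using that(3) by (simp add: enn2real_leI)
    qed
    \<comment> \<open>\<open>D\<close> is nonincreasing off \<open>N\<close>, and since both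
      solutions attain the same initial density in \<open>L1\<close> it takes arbitrarily small
      values at times close to 0.\<close>
    have Dz: "D t = 0" if t: "t \<notin> N" for t
    proof (cases "0 < t \<and> t < T")
      case False
      then have "t \<le> 0 \<or> T \<le> t" by auto
      then have "U (x, t) = 0" "V (x, t) = 0" for x using U.U_outside V.U_outside by blast+
      then show ?thesis by (simp add: D_def)
    next
      case True
      have "D t \<le> 0 + \<epsilon>" if \<epsilon>: "\<epsilon> > 0" for \<epsilon>
      proof -
        obtain \<delta>1 \<delta>2 where \<delta>: "\<delta>1 > 0" "AE s in lborel. 0 < s \<and> s < \<delta>1 \<longrightarrow> ?F U s < ennreal (\<epsilon> / 2)"
            "\<delta>2 > 0" "AE s in lborel. 0 < s \<and> s < \<delta>2 \<longrightarrow> ?F V s < ennreal (\<epsilon> / 2)"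
          using small[OF U.initial, of "\<epsilon> / 2"] small[OF V.initial, of "\<epsilon> / 2"] \<epsilon> by auto
        have ae: "AE s in lborel. s \<notin> N \<and> (0 < s \<and> s < \<delta>1 \<longrightarrow> ?F U s < ennreal (\<epsilon> / 2)) \<and> (0 < s \<and> s < \<delta>2 \<longrightarrow> ?F V s < ennreal (\<epsilon> / 2))"
          using AE_not_in[OF N(1)] \<delta>(2,4) by eventually_elim blast
        have "0 < min t (min \<delta>1 \<delta>2)" using \<delta> True by simp
        from AE_lborel_interval_obtain[OF ae this] obtain s where s: "0 < s" "s < min t (min \<delta>1 \<delta>2)"
          "s \<notin> N \<and> (0 < s \<and> s < \<delta>1 \<longrightarrow> ?F U s < ennreal (\<epsilon> / 2)) \<and> (0 < s \<and> s < \<delta>2 \<longrightarrow> ?F V s < ennreal (\<epsilon> / 2))" .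
        have "D t \<le> D s" using N(2)[of s t] s t True by auto
        also have "D s \<le> 2 * (\<epsilon> / 2)" by (rule D_le) (use s \<epsilon> in auto)
        finally show ?thesis by simp
      qed
      then have "D t \<le> 0" by (rule field_le_epsilon)
      then show ?thesis using D0[of t] by simp
    qed
    have "AE t in lborel. D t = 0" using AE_not_in[OF N(1)] by eventually_elim (rule Dz)
    then have "(\<integral>t. D t \<partial>lborel) = 0" by (rule integral_eq_zero_AE)
    then have "(\<integral>p. ?D p * g (fst p) \<partial>lborel) = 0"
      using lborel_pair.integral_snd[of "\<lambda>x t. ?D (x, t) * g x"] iDg by (simp add: D_def lborel_prod case_prod_beta')
    then have "AE p in lborel. ?D p * g (fst p) = 0"
      by (subst (asm) integral_nonneg_eq_0_iff_AE[OF iDg]) (use g01 in auto)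
    then show ?thesis
    proof eventually_elim
      case (elim p)
      show ?case
      proof
        assume "fst p \<le> \<beta> - 3 / m"
        then have "m * (fst p - \<beta>) \<le> m * (- (3 / m))" using m by (intro mult_left_mono) auto
        then have "m * (fst p - \<beta>) + 2 \<le> - 1" using m by simp
        then have "g (fst p) = 1" by (simp add: g_def smooth_step_eq_0)
        then show "U p = V p" using elim by simp
      qed
    qed
  qed
  have "AE p in lborel. \<forall>k. fst p \<le> \<beta> - 3 / real (Suc k) \<longrightarrow> U p = V p"
    by (subst AE_all_countable) (intro allI local_eq, simp)
  then show ?thesis
  proof eventually_elim
    case (elim p)
    show ?case
    proof
      assume "fst p < \<beta>"
      then obtain k where "1 / real (Suc k) < (\<beta> - fst p) / 3" using nat_approx_posE[of "(\<beta> - fst p) / 3"] by auto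
      then have "fst p \<le> \<beta> - 3 / real (Suc k)" by simp
      then show "U p = V p" using elim by blast
    qed
  qed
qed

text \<open>Localize the difference of the two weak formulations at \<open>a\<close>: the left fluxes cancel, and on the right
  \<open>\<psi> U \<rightarrow> M \<ge> \<psi> V\<close> as long as \<open>c a\<close> is positive, so that \<open>c a - d a\<close> does not increase from its initial value
  \<open>0\<close>.\<close>

lemma atoms_le:
  assumes a: "a \<in> P" and left: "AE p in lborel. fst p < a \<longrightarrow> U p = V p"
  shows "AE t in lborel. c a t \<le> d a t"
proof -
  have psiU: "integrable lborel (\<lambda>p. \<psi> (W p))" if W: "integrable lborel W" for W :: "real \<times> real \<Rightarrow> real"
  proof (rule Bochner_Integration.integrable_bound)
    show "integrable lborel (\<lambda>p. L * W p)" using W by simp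
    show "AE p in lborel. norm (\<psi> (W p)) \<le> norm (L * W p)"
      using U.psi_lipschitz[of _ 0] U.psi_0 U.L_nonneg by (intro AE_I2) (simp add: abs_mult)
    show "(\<lambda>p. \<psi> (W p)) \<in> borel_measurable lborel" using W by measurable
  qed
  obtain \<delta> where \<delta>: "\<delta> > 0" "\<forall>b\<in>P. b \<noteq> a \<longrightarrow> \<delta> \<le> dist a b"
    using finite_set_avoid[OF U.P_finite, of a] by blast
  obtain n0 where n0: "1 / real (Suc n0) < \<delta> / 4" using nat_approx_posE[of "\<delta> / 4"] \<delta>(1) by auto
  define g where "g t = c a t - d a t" for t
  \<comment> \<open>The interval starts before time 0 in order to admit
    \<open>\<theta> 0 \<noteq> 0\<close>: both solutions share the functional
    \<open>\<Lambda>\<close>, so the initial terms cancel. It ends at \<open>\<tau> a\<close>, up to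
    which the trace of \<open>U\<close> is known.\<close>
  have "\<exists>N\<in>null_sets lborel. \<forall>s t. s \<notin> N \<longrightarrow> t \<notin> N \<longrightarrow> -1 < s \<longrightarrow> s < t \<longrightarrow> t < \<tau> a \<longrightarrow> g t \<le> g s"
  proof (rule weakly_nonincreasing)
    show "integrable lborel g" unfolding g_def[abs_def] using U.c_integrable[OF a] V.c_integrable[OF a] by simp
    fix \<theta> \<theta>' :: "real \<Rightarrow> real" and l u assume \<theta>: "C1_with_deriv \<theta> \<theta>'" "\<And>t. 0 \<le> \<theta> t" and lu: "-1 < l" "u < \<tau> a"
      and z: "\<And>t. t < l \<or> u < t \<Longrightarrow> \<theta> t = 0"
    obtain B where B: "B > 0" "\<And>t. \<bar>\<theta> t\<bar> \<le> B" "\<And>t. \<bar>\<theta>' t\<bar> \<le> B" using C1_compact_bounded[OF \<theta>(1) z] by metis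
    have tm: "\<theta> \<in> borel_measurable borel" "\<theta>' \<in> borel_measurable borel"
      by (intro borel_measurable_continuous_onI C1_with_deriv_cont[OF \<theta>(1)])+
    have [measurable]: "(\<lambda>p. \<theta> (snd p)) \<in> borel_measurable (borel :: (real \<times> real) measure)"
      "(\<lambda>p. \<theta>' (snd p)) \<in> borel_measurable (borel :: (real \<times> real) measure)"
      by (intro measurable_snd_fun tm)+
    have c\<theta>: "integrable lborel (\<lambda>t. h t * \<theta>' t)" if h: "integrable lborel h" for h :: "real \<Rightarrow> real"
    proof (rule Bochner_Integration.integrable_bound)
      show "integrable lborel (\<lambda>t. h t * B)" using h by simp
      show "AE t in lborel. norm (h t * \<theta>' t) \<le> norm (h t * B)"
        using B by (intro AE_I2) (simp add: abs_mult mult_left_mono)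
      show "(\<lambda>t. h t * \<theta>' t) \<in> borel_measurable lborel" using h tm by measurable
    qed
    define A where "A n = (\<integral>p. (U p - V p) * (plateau a (real (Suc n)) (fst p) * \<theta>' (snd p)) \<partial>lborel)" for n
    have iD: "integrable lborel (\<lambda>p. U p - V p)" using U.U_integrable V.U_integrable by simp
    have pm[measurable]: "(\<lambda>p. plateau a (real (Suc n)) (fst p)) \<in> borel_measurable (borel :: (real \<times> real) measure)"
       "(\<lambda>p. plateau_left a (real (Suc n)) (fst p)) \<in> borel_measurable (borel :: (real \<times> real) measure)"
       "(\<lambda>p. plateau_right a (real (Suc n)) (fst p)) \<in> borel_measurable (borel :: (real \<times> real) measure)" for n
      by (rule plateau_fst_measurable; simp)+
    have pb: "\<bar>plateau a (real (Suc n)) x * \<theta>' t\<bar> \<le> 1 * B" for n x t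
      unfolding abs_mult using plateau_bounds[of "real (Suc n)" a x] B by (intro mult_mono) auto
    have A_lim: "A \<longlonglongrightarrow> 0"
      unfolding A_def[abs_def]
    proof (rule integral_mult_tendsto_0[OF iD _ pb])
      show "(\<lambda>p. plateau a (real (Suc n)) (fst p) * \<theta>' (snd p)) \<in> borel_measurable borel" for n by measurable
      show "AE p in lborel. (\<lambda>n. plateau a (real (Suc n)) (fst p) * \<theta>' (snd p)) \<longlonglongrightarrow> 0"
        using AE_lborel_fst_neq[of a] by eventually_elim (metis mult_zero_left tendsto_mult_right plateau_tendsto_0)
    qed
    have step: "- A n - B * U.trace_defect a n \<le> (\<integral>t. g t * \<theta>' t \<partial>lborel)" if n: "n \<ge> n0" for n
    proof -
      let ?m = "real (Suc n)"
      have m: "?m > 0" by simp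
      obtain B' where B': "B' > 0" "\<And>x. bump x \<le> B'" using bump_bounded by metis
      let ?k = "\<lambda>p. (plateau_left a ?m (fst p) - plateau_right a ?m (fst p)) * \<theta> (snd p)"
      have kb: "\<bar>?k p\<bar> \<le> (2 * (?m * B')) * B" for p
      proof -
        have "\<bar>plateau_left a ?m (fst p)\<bar> \<le> ?m * B'" "\<bar>plateau_right a ?m (fst p)\<bar> \<le> ?m * B'"
          unfolding plateau_left_def plateau_right_def abs_mult using B' bump_nonneg by (auto intro!: mult_left_mono)
        then have "\<bar>plateau_left a ?m (fst p) - plateau_right a ?m (fst p)\<bar> \<le> 2 * (?m * B')" by linarith
        then show ?thesis unfolding abs_mult[of _ "\<theta> (snd p)"] using B B' by (intro mult_mono) auto
      qed
      have km: "?k \<in> borel_measurable borel" by measurable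
      have tf: "test_fun (\<lambda>x t. plateau a ?m x * \<theta> t) (\<lambda>x t. plateau a ?m x * \<theta>' t)
        (\<lambda>x t. (plateau_left a ?m x - plateau_right a ?m x) * \<theta> t)"
        by (rule test_fun_plateau[OF m \<theta>(1)])
      have "u < T" using lu U.tau_bounds[OF a] by linarith
      then have zT: "plateau a ?m x * \<theta> T = 0" for x using z[of T] by simp
      have hm: "(\<lambda>p. plateau a ?m (fst p) * \<theta>' (snd p)) \<in> borel_measurable borel" by measurable
      have i1: "integrable lborel (\<lambda>p. U p * (plateau a ?m (fst p) * \<theta>' (snd p)))" "integrable lborel (\<lambda>p. V p * (plateau a ?m (fst p) * \<theta>' (snd p)))"
        by (rule integrable_mult_bounded[OF _ hm pb], rule U.U_integrable V.U_integrable)+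
      have i2: "integrable lborel (\<lambda>p. \<psi> (U p) * ?k p)" "integrable lborel (\<lambda>p. \<psi> (V p) * ?k p)"
        by (rule integrable_mult_bounded[OF _ km kb], rule psiU, rule U.U_integrable V.U_integrable)+
      \<comment> \<open>For \<open>n \<ge> n0\<close> the plateau is so narrow that it sees no other
        atom.\<close>
      have pz: "plateau a ?m b = 0" if "b \<in> P" "b \<noteq> a" for b
      proof (rule plateau_eq_0(1)[OF m])
        have "1 / ?m \<le> 1 / real (Suc n0)" using n by (simp add: frac_le)
        then have "4 / ?m < \<delta>" using n0 by simp
        then show "4 / ?m \<le> \<bar>b - a\<bar>" using \<delta>(2) that by (force simp: dist_real_def)
      qed
      have pa: "plateau a ?m a = 1" by (rule plateau_eq_1[OF m]) simp
      have sum_eq: "(\<Sum>b\<in>P. \<integral>t. h b t * (plateau a ?m b * \<theta>' t) \<partial>lborel) = (\<integral>t. h a t * \<theta>' t \<partial>lborel)" for h :: "real \<Rightarrow> real \<Rightarrow> real"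
      proof -
        have "(\<Sum>b\<in>P. \<integral>t. h b t * (plateau a ?m b * \<theta>' t) \<partial>lborel) = (\<Sum>b\<in>P. if b = a then (\<integral>t. h a t * \<theta>' t \<partial>lborel) else 0)"
          by (intro sum.cong) (auto simp: pa pz simp del: of_nat_Suc)
        then show ?thesis using a U.P_finite by simp
      qed
      have eU: "(\<integral>p. U p * (plateau a ?m (fst p) * \<theta>' (snd p)) \<partial>lborel) + (\<integral>p. \<psi> (U p) * ?k p \<partial>lborel) + (\<integral>t. c a t * \<theta>' t \<partial>lborel) = \<Lambda> (\<lambda>x. plateau a ?m x * \<theta> 0)"
        using U.weak[OF tf zT] i1 i2 by (simp only: sum_eq Bochner_Integration.integral_add)
      have eV: "(\<integral>p. V p * (plateau a ?m (fst p) * \<theta>' (snd p)) \<partial>lborel) + (\<integral>p. \<psi> (V p) * ?k p \<partial>lborel) + (\<integral>t. d a t * \<theta>' t \<partial>lborel) = \<Lambda> (\<lambda>x. plateau a ?m x * \<theta> 0)"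
        using V.weak[OF tf zT] i1 i2 by (simp only: sum_eq Bochner_Integration.integral_add)
      have "A n = (\<integral>p. U p * (plateau a ?m (fst p) * \<theta>' (snd p)) - V p * (plateau a ?m (fst p) * \<theta>' (snd p)) \<partial>lborel)"
        unfolding A_def by (simp only: left_diff_distrib)
      also have "\<dots> = (\<integral>p. U p * (plateau a ?m (fst p) * \<theta>' (snd p)) \<partial>lborel) - (\<integral>p. V p * (plateau a ?m (fst p) * \<theta>' (snd p)) \<partial>lborel)"
        by (rule Bochner_Integration.integral_diff[OF i1])
      finally have A_eq: "A n = (\<integral>p. U p * (plateau a ?m (fst p) * \<theta>' (snd p)) \<partial>lborel) - (\<integral>p. V p * (plateau a ?m (fst p) * \<theta>' (snd p)) \<partial>lborel)" .
      have "(\<integral>t. g t * \<theta>' t \<partial>lborel) = (\<integral>t. c a t * \<theta>' t - d a t * \<theta>' t \<partial>lborel)"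
        unfolding g_def by (simp only: left_diff_distrib)
      also have "\<dots> = (\<integral>t. c a t * \<theta>' t \<partial>lborel) - (\<integral>t. d a t * \<theta>' t \<partial>lborel)"
        by (rule Bochner_Integration.integral_diff[OF c\<theta>[OF U.c_integrable[OF a]] c\<theta>[OF V.c_integrable[OF a]]])
      finally have g_eq: "(\<integral>t. g t * \<theta>' t \<partial>lborel) = - A n - ((\<integral>p. \<psi> (U p) * ?k p \<partial>lborel) - (\<integral>p. \<psi> (V p) * ?k p \<partial>lborel))"
        using eU eV A_eq by linarith
      have "(\<integral>p. \<psi> (U p) * ?k p \<partial>lborel) - (\<integral>p. \<psi> (V p) * ?k p \<partial>lborel) = (\<integral>p. \<psi> (U p) * ?k p - \<psi> (V p) * ?k p \<partial>lborel)"
        by (rule Bochner_Integration.integral_diff[OF i2, symmetric])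
      also have "\<dots> \<le> (\<integral>p. B * ((M - \<psi> (U p)) * (plateau_right a ?m (fst p) * indicator {0<..<\<tau> a} (snd p))) \<partial>lborel)"
      proof (rule integral_mono_AE)
        show "integrable lborel (\<lambda>p. \<psi> (U p) * ?k p - \<psi> (V p) * ?k p)" using i2 by simp
        show "integrable lborel (\<lambda>p. B * ((M - \<psi> (U p)) * (plateau_right a ?m (fst p) * indicator {0<..<\<tau> a} (snd p))))"
          by (intro integrable_mult_right U.integrable_trace_defect[OF a])
        show "AE p in lborel. \<psi> (U p) * ?k p - \<psi> (V p) * ?k p \<le> B * ((M - \<psi> (U p)) * (plateau_right a ?m (fst p) * indicator {0<..<\<tau> a} (snd p)))"
          using left
        proof eventually_elim
          case (elim p)
          obtain x t where p: "p = (x, t)" by (cases p)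
          have r0: "0 \<le> plateau_right a ?m x" by (rule plateau_right_nonneg[OF m])
          have rhs0: "0 \<le> B * ((M - \<psi> (U p)) * (plateau_right a ?m x * indicator {0<..<\<tau> a} t))"
            using B r0 U.psi_defect_bounds(1)[of p] by simp
          show ?case
          proof (cases "x < a \<or> t \<le> 0 \<or> \<tau> a \<le> t")
            case True
            \<comment> \<open>To the left of \<open>a\<close> the solutions agree; outside the
              lifetime either both vanish, at times up to 0, or \<open>\<theta>\<close> does, from
              \<open>\<tau> a\<close> on.\<close>
            have z0: "\<psi> (U p) * ?k p - \<psi> (V p) * ?k p = 0"
            proof -
              have "U p = V p \<or> \<theta> t = 0"
                using True elim U.U_outside[of t x] V.U_outside[of t x] z[of t] lu by (auto simp: p)
              then show ?thesis by (auto simp: p)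
            qed
            show ?thesis unfolding z0 using rhs0 by (simp add: p)
          next
            case False
            then have "plateau_left a ?m x = 0" by (intro plateau_left_eq_0[OF m]) auto
            then have "\<psi> (U p) * ?k p - \<psi> (V p) * ?k p = (\<psi> (V p) - \<psi> (U p)) * (plateau_right a ?m x * \<theta> t)"
              by (simp add: p algebra_simps)
            \<comment> \<open>For \<open>V\<close> the bound \<open>\<psi> (V p) \<le> M\<close>
              does, which makes the argument available before the extinction times are known to
              agree.\<close>
            also have "\<dots> \<le> (M - \<psi> (U p)) * (plateau_right a ?m x * \<theta> t)"
              using r0 \<theta>(2)[of t] V.psi_U_bounds(2)[of p] by (intro mult_right_mono) auto
            also have "\<dots> \<le> (M - \<psi> (U p)) * (plateau_right a ?m x * B)"
              using r0 B(2)[of t] U.psi_defect_bounds(1)[of p] by (intro mult_left_mono) auto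
            finally show ?thesis using False by (simp add: p algebra_simps)
          qed
        qed
      qed
      also have "\<dots> = B * U.trace_defect a n" unfolding U.trace_defect_def by simp
      finally show ?thesis using g_eq by linarith
    qed
    have "(\<lambda>n. - A n - B * U.trace_defect a n) \<longlonglongrightarrow> - 0 - B * 0"
      by (intro tendsto_intros A_lim U.trace_defect_tendsto_0[OF a])
    then have "- 0 - B * 0 \<le> (\<integral>t. g t * \<theta>' t \<partial>lborel)"
      by (rule LIMSEQ_le_const2) (use step in blast)
    then show "0 \<le> (\<integral>t. g t * \<theta>' t \<partial>lborel)" by simp
  qed
  then obtain N where N: "N \<in> null_sets lborel" "\<And>s t. s \<notin> N \<Longrightarrow> t \<notin> N \<Longrightarrow> -1 < s \<Longrightarrow> s < t \<Longrightarrow> t < \<tau> a \<Longrightarrow> g t \<le> g s"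
    by blast
  \<comment> \<open>A good negative time is picked: both masses are zero there, so that
    \<open>g\<close> is at most 0 from then on until \<open>\<tau> a\<close>.\<close>
  have "(-1::real) < 0" by simp
  from AE_lborel_interval_obtain[OF AE_not_in[OF N(1)] this] obtain s where s: "-1 < s" "s < 0" "s \<notin> N" .
  show ?thesis
    using AE_not_in[OF N(1)] U.c_zero[OF a] AE_lborel_singleton[of "\<tau> a"]
  proof eventually_elim
    case (elim t)
    consider "t \<le> 0" | "0 < t" "t < \<tau> a" | "\<tau> a < t" using elim by linarith
    then show ?case
    proof cases
      case 1
      then show ?thesis using U.c_outside[of t a] V.c_outside[of t a] by simp
    next
      case 2
      have "g t \<le> g s" using N(2)[OF s(3) elim(1) s(1) _ 2(2)] s 2 by simp
      also have "g s = 0" unfolding g_def using U.c_outside[of s a] V.c_outside[of s a] s by simp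
      finally show ?thesis by (simp add: g_def)
    next
      case 3
      then show ?thesis using elim V.c_nonneg[of a t] by simp
    qed
  qed
qed

lemma transport_pair_swap: "transport_pair \<psi> M L T P \<Lambda> w V d \<sigma> U c \<tau>"
  by intro_locales

lemma atoms_eq:
  assumes a: "a \<in> P" and left: "AE p in lborel. fst p < a \<longrightarrow> U p = V p"
  shows "AE t in lborel. c a t = d a t"
proof -
  interpret sw: transport_pair \<psi> M L T P \<Lambda> w V d \<sigma> U c \<tau> by (rule transport_pair_swap)
  have "AE p in lborel. fst p < a \<longrightarrow> V p = U p" using left by eventually_elim auto
  from sw.atoms_le[OF a this] atoms_le[OF a left] show ?thesis by eventually_elim simp
qed

lemma all_atoms_eq:
  assumes "a \<in> P"
  shows "AE t in lborel. c a t = d a t"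
proof (rule ccontr)
  define R where "R = {a\<in>P. \<not> (AE t in lborel. c a t = d a t)}"
  assume "\<not> (AE t in lborel. c a t = d a t)"
  then have R: "finite R" "R \<noteq> {}" using assms U.P_finite by (auto simp: R_def)
  have "AE p in lborel. fst p < Min R \<longrightarrow> U p = V p"
  proof (rule coincide_left_of)
    fix b assume "b \<in> P" "b < Min R"
    then show "AE t in lborel. c b t = d b t" using Min_le[OF R(1), of b] by (auto simp: R_def)
  qed
  moreover have "Min R \<in> R" using R by simp
  ultimately show False using atoms_eq[of "Min R"] by (simp add: R_def)
qed

theorem transport_uniqueness: "AE p in lborel. U p = V p"
proof -
  have "AE p in lborel. fst p < real n \<longrightarrow> U p = V p" for n :: nat
    by (rule coincide_left_of) (rule all_atoms_eq)
  then have "AE p in lborel. \<forall>n. fst p < real n \<longrightarrow> U p = V p"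
    by (subst AE_all_countable) blast
  then show ?thesis
  proof eventually_elim
    case (elim p)
    obtain n where "fst p < real n" using reals_Archimedean2 by blast
    then show ?case using elim by blast
  qed
qed

end

section \<open>Time sections\<close>

abbreviation "time_measure T \<equiv> lebesgue_on {0<..<T::real}"

text \<open>Sections are tested by continuous functions only, so indicators have to be reached from
  below: products of two tents increase to the indicator of an open box.\<close>

definition tent :: "real \<Rightarrow> real \<Rightarrow> nat \<Rightarrow> real \<Rightarrow> real" where
  "tent a b n x = min 1 (real n * max 0 (min (x - a) (b - x)))"

lemma tent_cont: "continuous_on A (tent a b n)"
  unfolding tent_def by (intro continuous_intros)

lemma tent_bounds: "0 \<le> tent a b n x" "tent a b n x \<le> 1"
  by (auto simp: tent_def)

lemma tent_eq_0: "x \<notin> {a<..<b} \<Longrightarrow> tent a b n x = 0"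
  by (auto simp: tent_def)

lemma tent_mono: "m \<le> n \<Longrightarrow> tent a b m x \<le> tent a b n x"
  unfolding tent_def by (intro min.mono mult_right_mono) auto

lemma tent_borel[measurable]: "tent a b n \<in> borel_measurable borel"
  by (rule borel_measurable_continuous_onI[OF tent_cont])

lemma tent_SUP: "(SUP n. ennreal (tent a b n x * tent c d n t)) = indicator (box (a, c) (b, d)) (x, t)"
proof (cases "a < x \<and> x < b \<and> c < t \<and> t < d")
  case True
  \<comment> \<open>The smallest distance of the point to a face of the box; once
    \<open>n \<ge> 1 / r\<close>, both tents equal 1.\<close>
  define r where "r = min (min (x - a) (b - x)) (min (t - c) (d - t))"
  have "r > 0" using True by (simp add: r_def)
  then obtain n where n: "inverse r \<le> real n" using real_arch_simple by blast
  have nr: "real n * r \<ge> 1" using n \<open>r > 0\<close> by (simp add: field_simps)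
  have "r \<le> max 0 (min (x - a) (b - x))" "r \<le> max 0 (min (t - c) (d - t))" by (auto simp: r_def)
  then have "real n * r \<le> real n * max 0 (min (x - a) (b - x))" "real n * r \<le> real n * max 0 (min (t - c) (d - t))"
    by (auto intro: mult_left_mono)
  then have 1: "tent a b n x = 1" "tent c d n t = 1" using nr unfolding tent_def by linarith+
  have "(SUP n. ennreal (tent a b n x * tent c d n t)) = 1"
  proof (rule antisym)
    show "(SUP n. ennreal (tent a b n x * tent c d n t)) \<le> 1"
    proof (rule SUP_least)
      fix n
      have "tent a b n x * tent c d n t \<le> 1 * 1" by (intro mult_mono tent_bounds) auto
      then show "ennreal (tent a b n x * tent c d n t) \<le> 1" by (simp add: ennreal_leI ennreal_le_1)
    qed
    show "1 \<le> (SUP n. ennreal (tent a b n x * tent c d n t))"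
      by (rule SUP_upper2[of n]) (auto simp: 1)
  qed
  then show ?thesis using True by (simp add: box_prod)
next
  case False
  then have z: "tent a b n x * tent c d n t = 0" for n using tent_eq_0[of x a b n] tent_eq_0[of t c d n] by auto
  have s0: "(SUP n. ennreal (tent a b n x * tent c d n t)) = 0"
    by (simp only: z ennreal_0) simp
  have "indicator (box (a, c) (b, d)) (x, t) = (0 :: ennreal)"
    using False by (auto simp: box_prod)
  then show ?thesis by (simp only: s0)
qed

lemma C_Cc_tent: "C_Cc T (\<lambda>x t. tent a b n x * tent c d n t)"
  unfolding C_Cc_def
proof (intro conjI ballI exI[of _ "{a..b}"] allI impI)
  show "tent a b n x * tent c d n t = 0" if "x \<notin> {a..b}" for x t using that tent_eq_0[of x a b n] by auto
  show "continuous_on UNIV (\<lambda>x. tent a b n x * tent c d n t)" for t by (intro continuous_intros tent_cont)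
  fix t assume t: "t \<in> {0..T}"
  have "((\<lambda>s. tent c d n s) \<longlongrightarrow> tent c d n t) (at t within {0..T})"
    using tent_cont[of "{0..T}" c d n] t by (simp add: continuous_on_def)
  then have lim: "uniform_limit UNIV (\<lambda>s (x::real). tent c d n s) (\<lambda>x. tent c d n t) (at t within {0..T})"
    unfolding uniform_limit_iff tendsto_iff by (auto simp: dist_commute)
  show "uniform_limit UNIV (\<lambda>s x. tent a b n x * tent c d n s) (\<lambda>x. tent a b n x * tent c d n t) (at t within {0..T})"
  proof (rule uniform_lim_mult[OF uniform_limit_const lim])
    show "bounded (range (tent a b n))" "bounded (range (\<lambda>x::real. tent c d n t))"
      using tent_bounds by (auto intro!: boundedI[of _ 1])
  qed
qed simp

text \<open>A version of the time sections that is a finite Borel measure for every time.\<close>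

locale strip_kernel =
  fixes T :: real and u :: "(real \<times> real) measure" and v :: "real \<Rightarrow> real measure"
  assumes u: "sets u = sets (restrict_space borel (strip T))" "finite_measure u"
    and v: "\<And>t. finite_radon (v t)"
    and test: "\<And>z. C_Cc T z \<Longrightarrow> integrable (time_measure T) (\<lambda>t. \<integral>x. z x t \<partial>v t) \<and>
        (\<integral>p. z (fst p) (snd p) \<partial>u) = (\<integral>t. (\<integral>x. z x t \<partial>v t) \<partial>time_measure T)"
begin

lemma v_sets[measurable_cong, simp]: "sets (v t) = sets borel" and v_finite: "finite_measure (v t)"
  using v[of t] by (auto simp: finite_radon_def)

lemma v_space[simp]: "space (v t) = UNIV"
  using sets_eq_imp_space_eq[OF v_sets] by simp

lemma v_fin: "emeasure (v t) A \<noteq> \<infinity>"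
  using finite_measure.emeasure_finite[OF v_finite] by simp

lemma strip_sets: "strip T \<in> sets borel" "strip T \<in> sets (borel \<Otimes>\<^sub>M borel)"
  unfolding strip_def borel_prod[symmetric] by auto

lemma sets_u: "A \<in> sets u \<longleftrightarrow> A \<in> sets borel \<and> A \<subseteq> strip T"
  unfolding u(1) using sets_restrict_space_iff[of "strip T" borel A] strip_sets by auto

lemma space_u: "space u = strip T"
  using sets_eq_imp_space_eq[OF u(1)] by (simp add: space_restrict_space)

lemma u_measurable: "f \<in> borel_measurable borel \<Longrightarrow> f \<in> borel_measurable u"
  unfolding measurable_cong_sets[OF u(1) refl] by (rule measurable_restrict_space1)

lemma slice_sets: "B \<in> sets borel \<Longrightarrow> {x. (x, t) \<in> B} \<in> sets borel" for B :: "(real \<times> real) set"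
proof -
  assume B: "B \<in> sets borel"
  have "B \<in> sets ((borel :: real measure) \<Otimes>\<^sub>M (borel :: real measure))" by (subst borel_prod) (rule B)
  from sets_Pair2[OF this, of t] show ?thesis by (simp add: vimage_def)
qed

text \<open>Monotone convergence along the tents, once under the time integral and once under
  \<open>u\<close>. Measurability in time is with respect to the completed measure and is inherited
  from the pairings with the tents.\<close>

lemma section_box:
  shows "(\<lambda>t. emeasure (v t) {x. (x, t) \<in> box (a, c) (b, d)}) \<in> borel_measurable (time_measure T)"
    and "(\<integral>\<^sup>+t. emeasure (v t) {x. (x, t) \<in> box (a, c) (b, d)} \<partial>time_measure T) = emeasure u (box (a, c) (b, d) \<inter> strip T)"
proof -
  let ?z = "\<lambda>n x t. tent a b n x * tent c d n t"
  have zb: "0 \<le> ?z n x t" "?z n x t \<le> 1" for n x t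
    using tent_bounds[of a b n x] tent_bounds[of c d n t] mult_mono[of "tent a b n x" 1 "tent c d n t" 1] by auto
  have zi: "integrable (v t) (\<lambda>x. ?z n x t)" for n t
    by (rule finite_measure.integrable_const_bound[OF v_finite, of _ 1])
       (use zb in \<open>auto intro!: AE_I2 simp: measurable_cong_sets[OF v_sets refl]\<close>)
  have nz: "(\<integral>\<^sup>+x. ennreal (?z n x t) \<partial>v t) = ennreal (\<integral>x. ?z n x t \<partial>v t)" for n t
    by (rule nn_integral_eq_integral[OF zi]) (use zb in auto)
  have zm: "(\<lambda>t. \<integral>\<^sup>+x. ennreal (?z n x t) \<partial>v t) \<in> borel_measurable (time_measure T)" for n
    unfolding nz using test[OF C_Cc_tent[of T a b n c d]] by auto
  have inc: "incseq (\<lambda>n. ennreal (?z n x t))" for x t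
    by (intro monoI ennreal_leI mult_mono tent_mono tent_bounds)
  have slice: "emeasure (v t) {x. (x, t) \<in> box (a, c) (b, d)} = (SUP n. \<integral>\<^sup>+x. ennreal (?z n x t) \<partial>v t)" for t
  proof -
    have "emeasure (v t) {x. (x, t) \<in> box (a, c) (b, d)} = (\<integral>\<^sup>+x. indicator {x. (x, t) \<in> box (a, c) (b, d)} x \<partial>v t)"
      by (rule nn_integral_indicator[symmetric]) (simp add: slice_sets)
    also have "\<dots> = (\<integral>\<^sup>+x. (SUP n. ennreal (?z n x t)) \<partial>v t)"
      by (intro nn_integral_cong) (simp add: tent_SUP indicator_def)
    also have "\<dots> = (SUP n. \<integral>\<^sup>+x. ennreal (?z n x t) \<partial>v t)"
      by (rule nn_integral_monotone_convergence_SUP)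
         (use inc in \<open>auto simp: incseq_def le_fun_def measurable_cong_sets[OF v_sets refl]\<close>)
    finally show ?thesis .
  qed
  show "(\<lambda>t. emeasure (v t) {x. (x, t) \<in> box (a, c) (b, d)}) \<in> borel_measurable (time_measure T)"
    unfolding slice by (intro borel_measurable_SUP zm) auto
  have inc2: "incseq (\<lambda>n t. \<integral>\<^sup>+x. ennreal (?z n x t) \<partial>v t)"
    using inc by (auto simp: incseq_def le_fun_def intro!: nn_integral_mono)
  have zu: "integrable u (\<lambda>p. ?z n (fst p) (snd p))" for n
  proof (rule finite_measure.integrable_const_bound[OF u(2), of _ 1])
    have "(\<lambda>p. ?z n (fst p) (snd p)) \<in> borel_measurable borel"
      unfolding borel_prod[symmetric] by measurable
    then show "(\<lambda>p. ?z n (fst p) (snd p)) \<in> borel_measurable u" by (rule u_measurable)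
  qed (use zb in auto)
  have "(\<integral>\<^sup>+t. emeasure (v t) {x. (x, t) \<in> box (a, c) (b, d)} \<partial>time_measure T)
     = (SUP n. \<integral>\<^sup>+t. (\<integral>\<^sup>+x. ennreal (?z n x t) \<partial>v t) \<partial>time_measure T)"
    unfolding slice by (rule nn_integral_monotone_convergence_SUP[OF inc2 zm])
  also have "\<dots> = (SUP n. \<integral>\<^sup>+p. ennreal (?z n (fst p) (snd p)) \<partial>u)"
  proof (rule SUP_cong[OF refl])
    fix n
    have "(\<integral>\<^sup>+t. (\<integral>\<^sup>+x. ennreal (?z n x t) \<partial>v t) \<partial>time_measure T) = ennreal (\<integral>t. (\<integral>x. ?z n x t \<partial>v t) \<partial>time_measure T)"
      unfolding nz using test[OF C_Cc_tent[of T a b n c d]] zb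
      by (intro nn_integral_eq_integral AE_I2 Bochner_Integration.integral_nonneg) auto
    also have "\<dots> = ennreal (\<integral>p. ?z n (fst p) (snd p) \<partial>u)"
      using test[OF C_Cc_tent[of T a b n c d]] by simp
    also have "\<dots> = (\<integral>\<^sup>+p. ennreal (?z n (fst p) (snd p)) \<partial>u)"
      by (rule nn_integral_eq_integral[OF zu, symmetric]) (use zb in auto)
    finally show "(\<integral>\<^sup>+t. (\<integral>\<^sup>+x. ennreal (?z n x t) \<partial>v t) \<partial>time_measure T) = (\<integral>\<^sup>+p. ennreal (?z n (fst p) (snd p)) \<partial>u)" .
  qed
  also have "\<dots> = (\<integral>\<^sup>+p. (SUP n. ennreal (?z n (fst p) (snd p))) \<partial>u)"
    by (rule nn_integral_monotone_convergence_SUP[symmetric])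
       (use inc zu in \<open>auto simp: incseq_def le_fun_def dest: borel_measurable_integrable intro!: measurable_compose[OF _ measurable_ennreal]\<close>)
  also have "\<dots> = (\<integral>\<^sup>+p. indicator (box (a, c) (b, d) \<inter> strip T) p \<partial>u)"
    by (intro nn_integral_cong) (simp add: tent_SUP indicator_def space_u)
  also have "\<dots> = emeasure u (box (a, c) (b, d) \<inter> strip T)"
    by (rule nn_integral_indicator) (use strip_sets in \<open>auto simp: sets_u\<close>)
  finally show "(\<integral>\<^sup>+t. emeasure (v t) {x. (x, t) \<in> box (a, c) (b, d)} \<partial>time_measure T) = emeasure u (box (a, c) (b, d) \<inter> strip T)" .
qed

text \<open>The disintegration formula for one set, together with the measurability it
  presupposes.\<close>

definition sliceable :: "(real \<times> real) set \<Rightarrow> bool" where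
  "sliceable B \<longleftrightarrow> (\<lambda>t. emeasure (v t) {x. (x, t) \<in> B}) \<in> borel_measurable (time_measure T) \<and>
     (\<integral>\<^sup>+t. emeasure (v t) {x. (x, t) \<in> B} \<partial>time_measure T) = emeasure u (B \<inter> strip T)"

lemma sliceable_UN:
  assumes B: "\<And>n. B n \<in> sets borel" "\<And>n. sliceable (B n)" and inc: "incseq B"
  shows "sliceable (\<Union>n::nat. B n)"
proof -
  have inc': "incseq (\<lambda>n. {x. (x, t) \<in> B n})" for t using inc by (auto simp: incseq_def)
  have eq: "emeasure (v t) {x. (x, t) \<in> (\<Union>n. B n)} = (SUP n. emeasure (v t) {x. (x, t) \<in> B n})" for t
  proof -
    have "{x. (x, t) \<in> (\<Union>n. B n)} = (\<Union>n. {x. (x, t) \<in> B n})" by auto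
    moreover have "(SUP n. emeasure (v t) {x. (x, t) \<in> B n}) = emeasure (v t) (\<Union>n. {x. (x, t) \<in> B n})"
      by (rule SUP_emeasure_incseq) (use inc' B slice_sets in auto)
    ultimately show ?thesis by simp
  qed
  have m: "(\<lambda>t. emeasure (v t) {x. (x, t) \<in> B n}) \<in> borel_measurable (time_measure T)" for n
    using B(2)[of n] by (simp add: sliceable_def)
  have "(\<integral>\<^sup>+t. (SUP n. emeasure (v t) {x. (x, t) \<in> B n}) \<partial>time_measure T) = (SUP n. \<integral>\<^sup>+t. emeasure (v t) {x. (x, t) \<in> B n} \<partial>time_measure T)"
  proof (rule nn_integral_monotone_convergence_SUP[OF _ m])
    show "incseq (\<lambda>n t. emeasure (v t) {x. (x, t) \<in> B n})"
      using inc' by (auto simp: incseq_def le_fun_def intro!: emeasure_mono slice_sets B)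
  qed
  also have "\<dots> = (SUP n. emeasure u (B n \<inter> strip T))"
    using B(2) by (simp add: sliceable_def)
  also have "\<dots> = emeasure u (\<Union>n. B n \<inter> strip T)"
  proof (rule SUP_emeasure_incseq)
    show "range (\<lambda>n. B n \<inter> strip T) \<subseteq> sets u" using B strip_sets by (auto simp: sets_u)
    show "incseq (\<lambda>n. B n \<inter> strip T)" using inc by (fastforce simp: incseq_def)
  qed
  also have "(\<Union>n. B n \<inter> strip T) = (\<Union>n. B n) \<inter> strip T" by auto
  finally show ?thesis unfolding sliceable_def eq using m by auto
qed

text \<open>Open boxes exhaust the plane. This case precedes the induction on Borel sets, because
  the complement step there subtracts from the total mass.\<close>

lemma sliceable_UNIV: "sliceable UNIV"
proof -
  let ?B = "\<lambda>n. box (- real n, - real n) (real n, real n) :: (real \<times> real) set"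
  have "(\<Union>n. ?B n) = UNIV"
  proof (intro set_eqI iffI UNIV_I)
    fix p :: "real \<times> real"
    obtain x t where p: "p = (x, t)" by (cases p)
    obtain n where "\<bar>x\<bar> + \<bar>t\<bar> < real n" using reals_Archimedean2 by blast
    then have "- real n < x \<and> x < real n \<and> - real n < t \<and> t < real n" by linarith
    then have "p \<in> ?B n" unfolding p by (simp add: box_prod)
    then show "p \<in> (\<Union>n. ?B n)" by blast
  qed
  moreover have "sliceable (\<Union>n. ?B n)"
  proof (rule sliceable_UN)
    show "sliceable (?B n)" for n unfolding sliceable_def using section_box by blast
    show "incseq ?B" by (auto simp: incseq_def box_prod)
  qed auto
  ultimately show ?thesis by simp
qed

text \<open>Open boxes are stable under intersection and generate the Borel sets; finiteness of
  \<open>u\<close> and of the sections justifies the subtraction for complements.\<close>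

lemma sliceable_borel:
  assumes "B \<in> sets borel"
  shows "sliceable B"
proof -
  have "Int_stable (range (\<lambda>(a, b). box a b :: (real \<times> real) set))"
    by (auto simp: Int_stable_def box_Int_box)
  moreover have "range (\<lambda>(a, b). box a b :: (real \<times> real) set) \<subseteq> Pow UNIV" by auto
  moreover have "B \<in> sigma_sets UNIV (range (\<lambda>(a, b). box a b))"
    using assms unfolding borel_eq_box by simp
  ultimately show ?thesis
  proof (induction rule: sigma_sets_induct_disjoint)
    case (basic A)
    then obtain a c b d where "A = box (a, c) (b, d)" by auto
    then show ?case unfolding sliceable_def using section_box by blast
  next
    case empty
    then show ?case by (simp add: sliceable_def)
  next
    case (compl A)
    then have A: "A \<in> sets borel" by (simp add: borel_eq_box)
    have m: "(\<lambda>t. emeasure (v t) {x. (x, t) \<in> A}) \<in> borel_measurable (time_measure T)"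
      and eA: "(\<integral>\<^sup>+t. emeasure (v t) {x. (x, t) \<in> A} \<partial>time_measure T) = emeasure u (A \<inter> strip T)"
      using compl(2) by (auto simp: sliceable_def)
    have mU: "(\<lambda>t. emeasure (v t) UNIV) \<in> borel_measurable (time_measure T)"
      and eU: "(\<integral>\<^sup>+t. emeasure (v t) UNIV \<partial>time_measure T) = emeasure u (strip T)"
      using sliceable_UNIV by (auto simp: sliceable_def)
    have slice: "emeasure (v t) {x. (x, t) \<in> UNIV - A} = emeasure (v t) UNIV - emeasure (v t) {x. (x, t) \<in> A}" for t
    proof -
      have "{x. (x, t) \<in> UNIV - A} = UNIV - {x. (x, t) \<in> A}" by auto
      moreover have "emeasure (v t) (UNIV - {x. (x, t) \<in> A}) = emeasure (v t) UNIV - emeasure (v t) {x. (x, t) \<in> A}"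
        by (rule emeasure_Diff[OF v_fin]) (use slice_sets[OF A, of t] in auto)
      ultimately show ?thesis by (simp only:)
    qed
    have fin: "emeasure u (A \<inter> strip T) \<noteq> \<infinity>" using finite_measure.emeasure_finite[OF u(2)] by simp
    have "(\<integral>\<^sup>+t. emeasure (v t) UNIV - emeasure (v t) {x. (x, t) \<in> A} \<partial>time_measure T)
        = emeasure u (strip T) - emeasure u (A \<inter> strip T)"
    proof (subst nn_integral_diff[OF mU m])
      show "(\<integral>\<^sup>+t. emeasure (v t) {x. (x, t) \<in> A} \<partial>time_measure T) \<noteq> \<infinity>" using eA fin by simp
      show "AE t in time_measure T. emeasure (v t) {x. (x, t) \<in> A} \<le> emeasure (v t) UNIV"
        by (intro AE_I2 emeasure_mono) auto
    qed (simp add: eA eU)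
    also have "\<dots> = emeasure u (strip T - A \<inter> strip T)"
      by (rule emeasure_Diff[OF fin, symmetric]) (use A strip_sets in \<open>auto simp: sets_u\<close>)
    also have "strip T - A \<inter> strip T = (UNIV - A) \<inter> strip T" by auto
    finally show ?case unfolding sliceable_def slice using m mU by auto
  next
    case (union A)
    then have A: "A i \<in> sets borel" for i by (auto simp: borel_eq_box)
    have m: "(\<lambda>t. emeasure (v t) {x. (x, t) \<in> A i}) \<in> borel_measurable (time_measure T)"
      and eA: "(\<integral>\<^sup>+t. emeasure (v t) {x. (x, t) \<in> A i} \<partial>time_measure T) = emeasure u (A i \<inter> strip T)" for i
      using union(3) by (auto simp: sliceable_def)
    have slice: "emeasure (v t) {x. (x, t) \<in> (\<Union>i. A i)} = (\<Sum>i. emeasure (v t) {x. (x, t) \<in> A i})" for t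
    proof -
      have "{x. (x, t) \<in> (\<Union>i. A i)} = (\<Union>i. {x. (x, t) \<in> A i})" by auto
      moreover have "(\<Sum>i. emeasure (v t) {x. (x, t) \<in> A i}) = emeasure (v t) (\<Union>i. {x. (x, t) \<in> A i})"
        by (rule suminf_emeasure) (use A slice_sets union(1) in \<open>auto simp: disjoint_family_on_def\<close>)
      ultimately show ?thesis by simp
    qed
    have "(\<integral>\<^sup>+t. (\<Sum>i. emeasure (v t) {x. (x, t) \<in> A i}) \<partial>time_measure T) = (\<Sum>i. emeasure u (A i \<inter> strip T))"
      using nn_integral_suminf[OF m] eA by simp
    also have "\<dots> = emeasure u (\<Union>i. A i \<inter> strip T)"
      by (rule suminf_emeasure) (use A union(1) strip_sets in \<open>auto simp: sets_u disjoint_family_on_def\<close>)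
    also have "(\<Union>i. A i \<inter> strip T) = (\<Union>i. A i) \<inter> strip T" by auto
    finally show ?case unfolding sliceable_def slice using m by auto
  qed
qed

section \<open>Lebesgue decomposition of the strip measure against that of its sections\<close>

lemma nn_integral_time:
  assumes [measurable]: "f \<in> borel_measurable borel"
  shows "(\<integral>\<^sup>+t. f t \<partial>time_measure T) = (\<integral>\<^sup>+t. f t * indicator {0<..<T} t \<partial>lborel)"
    and "f \<in> borel_measurable (time_measure T)"
proof -
  have "(\<integral>\<^sup>+t. f t \<partial>time_measure T) = (\<integral>\<^sup>+t. f t * indicator {0<..<T} t \<partial>lebesgue)"
    by (rule nn_integral_restrict_space) auto
  also have "\<dots> = (\<integral>\<^sup>+t. f t * indicator {0<..<T} t \<partial>lborel)"
    by (rule nn_integral_completion) measurable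
  finally show "(\<integral>\<^sup>+t. f t \<partial>time_measure T) = (\<integral>\<^sup>+t. f t * indicator {0<..<T} t \<partial>lborel)" .
  show "f \<in> borel_measurable (time_measure T)"
    by (intro measurable_restrict_space1 measurable_completion) simp
qed

lemma AE_time_iff: "(AE t in time_measure T. Q t) \<longleftrightarrow> (AE t in lborel. 0 < t \<and> t < T \<longrightarrow> Q t)"
  by (subst AE_restrict_space_iff) (auto simp: AE_completion_iff)

lemma sets_u_lborel: "sets u = sets (lborel_strip T)"
  unfolding u(1) by (simp add: sets_restrict_space)

lemma space_lborel_strip: "space (lborel_strip T) = strip T"
  by (simp add: space_restrict_space)

lemma sigma_finite_lborel_strip: "sigma_finite_measure (lborel_strip T)"
  using strip_sets by (intro sigma_finite_measure_restrict_space lborel.sigma_finite_measure_axioms) auto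

text \<open>The density with values in \<open>ennreal\<close>, set to zero off the strip in order to
  be Borel on the whole plane.\<close>

definition ac_density :: "real \<times> real \<Rightarrow> ennreal" where
  "ac_density p = RN_deriv (lborel_strip T) (ac_part (lborel_strip T) u) p * indicator (strip T) p"

lemma decomposition: "lebesgue_decomposition (lborel_strip T) u (ac_part (lborel_strip T) u) (sing_part (lborel_strip T) u)"
  by (rule lebesgue_decomposition_parts[OF u(2) sets_u_lborel])

lemma sets_ac: "sets (ac_part (lborel_strip T) u) = sets (lborel_strip T)"
  and ac_ac: "absolutely_continuous (lborel_strip T) (ac_part (lborel_strip T) u)"
  and ac_sing_sum: "X \<in> sets u \<Longrightarrow> emeasure u X = emeasure (ac_part (lborel_strip T) u) X + emeasure (sing_part (lborel_strip T) u) X"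
  using decomposition sets_u_lborel by (auto simp: lebesgue_decomposition_def)

lemma ac_density_borel[measurable]: "ac_density \<in> borel_measurable borel"
  unfolding ac_density_def[abs_def]
  using borel_measurable_restrict_space_iff_ennreal[of "strip T" lborel "RN_deriv (lborel_strip T) (ac_part (lborel_strip T) u)"] strip_sets
  by simp

lemma emeasure_ac:
  assumes B: "B \<in> sets borel" "B \<subseteq> strip T"
  shows "emeasure (ac_part (lborel_strip T) u) B = (\<integral>\<^sup>+p. ac_density p * indicator B p \<partial>lborel)"
proof -
  interpret S: sigma_finite_measure "lborel_strip T" by (rule sigma_finite_lborel_strip)
  have BL: "B \<in> sets (lborel_strip T)" using B sets_u sets_u_lborel by auto
  have "emeasure (ac_part (lborel_strip T) u) B = emeasure (density (lborel_strip T) (RN_deriv (lborel_strip T) (ac_part (lborel_strip T) u))) B"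
    by (simp only: S.density_RN_deriv[OF ac_ac sets_ac])
  also have "\<dots> = (\<integral>\<^sup>+p. RN_deriv (lborel_strip T) (ac_part (lborel_strip T) u) p * indicator B p \<partial>lborel_strip T)"
    by (rule emeasure_density) (use BL in auto)
  also have "\<dots> = (\<integral>\<^sup>+p. RN_deriv (lborel_strip T) (ac_part (lborel_strip T) u) p * indicator B p * indicator (strip T) p \<partial>lborel)"
    by (rule nn_integral_restrict_space) (use strip_sets in auto)
  also have "\<dots> = (\<integral>\<^sup>+p. ac_density p * indicator B p \<partial>lborel)"
    by (simp add: ac_density_def mult_ac)
  finally show ?thesis .
qed

lemma ac_finite: "finite_measure (ac_part (lborel_strip T) u)"
proof (rule finite_measureI)
  have sp: "space (ac_part (lborel_strip T) u) = strip T"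
    using sets_eq_imp_space_eq[OF sets_ac] space_lborel_strip by simp
  have "emeasure (ac_part (lborel_strip T) u) (strip T) \<le> emeasure u (strip T)"
    using ac_sing_sum[of "strip T"] strip_sets by (simp add: sets_u)
  then show "emeasure (ac_part (lborel_strip T) u) (space (ac_part (lborel_strip T) u)) \<noteq> \<infinity>"
    unfolding sp using finite_measure.emeasure_finite[OF u(2), of "strip T"] by (auto simp: top_unique)
qed

text \<open>The density of a finite measure is finite almost everywhere, so the passage to reals in
  \<open>u_reg\<close> loses nothing.\<close>

lemma ac_density_real: "AE p in lborel. ac_density p = ennreal (u_reg T u (fst p) (snd p)) * indicator (strip T) p"
proof -
  interpret S: sigma_finite_measure "lborel_strip T" by (rule sigma_finite_lborel_strip)
  interpret A: finite_measure "ac_part (lborel_strip T) u" by (rule ac_finite)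
  have "AE p in lborel_strip T. RN_deriv (lborel_strip T) (ac_part (lborel_strip T) u) p \<noteq> \<infinity>"
    by (rule S.RN_deriv_finite[OF A.sigma_finite_measure_axioms ac_ac sets_ac])
  then have "AE p in lborel. p \<in> strip T \<longrightarrow> RN_deriv (lborel_strip T) (ac_part (lborel_strip T) u) p \<noteq> \<infinity>"
    by (subst (asm) AE_restrict_space_iff) (use strip_sets in auto)
  then show ?thesis
    by eventually_elim (auto simp: ac_density_def u_reg_def reg_part_def indicator_def less_top)
qed

lemma u_reg_nonneg: "0 \<le> u_reg T u x t"
  by (simp add: u_reg_def reg_part_def)

lemma u_reg_measurable: "(\<lambda>p. u_reg T u (fst p) (snd p) * indicator (strip T) p) \<in> borel_measurable borel"
proof -
  have "(\<lambda>p. u_reg T u (fst p) (snd p) * indicator (strip T) p) = (\<lambda>p. enn2real (ac_density p))"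
    by (auto simp: ac_density_def u_reg_def reg_part_def indicator_def)
  then show ?thesis by simp
qed

lemma u_reg_integrable: "integrable lborel (\<lambda>p. u_reg T u (fst p) (snd p) * indicator (strip T) p)"
proof (rule integrableI_nonneg)
  have "(\<integral>\<^sup>+p. ennreal (u_reg T u (fst p) (snd p) * indicator (strip T) p) \<partial>lborel) = (\<integral>\<^sup>+p. ac_density p * indicator (strip T) p \<partial>lborel)"
    using ac_density_real by (intro nn_integral_cong_AE) (auto simp: indicator_def elim!: eventually_mono)
  also have "\<dots> = emeasure (ac_part (lborel_strip T) u) (strip T)"
    by (rule emeasure_ac[symmetric]) (use strip_sets in auto)
  also have "\<dots> < \<infinity>" using finite_measure.emeasure_finite[OF ac_finite] by (simp add: less_top)
  finally show "(\<integral>\<^sup>+p. ennreal (u_reg T u (fst p) (snd p) * indicator (strip T) p) \<partial>lborel) < \<infinity>" .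
qed (use u_reg_measurable u_reg_nonneg in \<open>auto simp: indicator_def\<close>)

text \<open>Countably many generators are wanted: an identity valid for each of them at almost every
  time is valid for all of them together at almost every time.\<close>

lemma rational_rays_borel: "sets (borel :: real measure) = sigma_sets UNIV ((\<lambda>q. {q<..}) ` \<rat>)"
proof -
  have "borel = sigma UNIV ((\<lambda>q::real. {q<..}) ` \<rat>)"
  proof (rule borel_eq_sigmaI1[OF borel_Ioi])
    fix x :: "real set" assume "x \<in> range greaterThan"
    then obtain a where x: "x = {a<..}" by auto
    have "{a<..} = (\<Union>q\<in>{q\<in>\<rat>. a < q}. {q<..})"
    proof (intro set_eqI iffI)
      fix y assume "y \<in> {a<..}"
      then obtain q where "q \<in> \<rat>" "a < q" "q < y" using Rats_dense_in_real[of a y] by auto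
      then show "y \<in> (\<Union>q\<in>{q\<in>\<rat>. a < q}. {q<..})" by auto
    qed auto
    moreover have "(\<Union>q\<in>{q\<in>\<rat>. a < q}. {q<..}) \<in> sets (sigma UNIV ((\<lambda>q::real. {q<..}) ` \<rat>))"
      by (rule sets.countable_UN') (auto intro: countable_subset[OF _ countable_rat])
    ultimately show "x \<in> sets (sigma UNIV ((\<lambda>q::real. {q<..}) ` \<rat>))" unfolding x by simp
  qed auto
  then show ?thesis by (metis sets_measure_of_conv subset_UNIV Pow_UNIV top_greatest)
qed

lemma finite_measure_eq_on_rational_rays:
  fixes M N :: "real measure"
  assumes "sets M = sets borel" "sets N = sets borel" "finite_measure M"
    and eq: "\<And>q. q \<in> \<rat> \<Longrightarrow> emeasure M {q<..} = emeasure N {q<..}"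
  shows "M = N"
proof (rule measure_eqI_generator_eq[where \<Omega> = UNIV and E = "(\<lambda>q. {q<..}) ` \<rat>" and A = "\<lambda>n. {- real n<..}"])
  show "Int_stable ((\<lambda>q::real. {q<..}) ` \<rat>)"
  proof (rule Int_stableI)
    fix a b assume "a \<in> (\<lambda>q::real. {q<..}) ` \<rat>" "b \<in> (\<lambda>q::real. {q<..}) ` \<rat>"
    then obtain q r where "a = {q<..}" "b = {r<..}" "q \<in> \<rat>" "r \<in> \<rat>" by auto
    moreover have "{q<..} \<inter> {r<..} = {max q r<..}" by auto
    moreover have "max q r \<in> \<rat>" using \<open>q \<in> \<rat>\<close> \<open>r \<in> \<rat>\<close> by (simp add: max_def)
    ultimately show "a \<inter> b \<in> (\<lambda>q::real. {q<..}) ` \<rat>" by blast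
  qed
  show "sets M = sigma_sets UNIV ((\<lambda>q. {q<..}) ` \<rat>)" "sets N = sigma_sets UNIV ((\<lambda>q. {q<..}) ` \<rat>)"
    using assms rational_rays_borel by auto
  show "(\<Union>n. {- real n<..}) = UNIV"
  proof (intro set_eqI iffI UNIV_I)
    fix x :: real
    obtain n where "- x < real n" using reals_Archimedean2 by blast
    then have "x \<in> {- real n<..}" by simp
    then show "x \<in> (\<Union>n. {- real n<..})" by blast
  qed
  show "emeasure M {- real n<..} \<noteq> \<infinity>" for n using finite_measure.emeasure_finite[OF assms(3)] by simp
qed (use eq in auto)

text \<open>\<open>Z\<close> is a null set carrying the singular part of \<open>u\<close>. For fixed
  \<open>C\<close> both sides are densities in time of one finite measure, which sends
  \<open>J\<close> to the mass of \<open>C \<times> J - Z\<close> within the strip, and such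
  densities agree almost everywhere.\<close>

lemma emeasure_section_off_singular:
  assumes Z: "Z \<in> null_sets (lborel_strip T)" "emeasure (sing_part (lborel_strip T) u) (strip T - Z) = 0"
    and C: "C \<in> sets borel"
  shows "AE t in time_measure T. emeasure (v t) (C - {x. (x, t) \<in> Z}) = (\<integral>\<^sup>+x. ac_density (x, t) * indicator C x \<partial>lborel)"
proof -
  define g where "g t = emeasure (v t) (C - {x. (x, t) \<in> Z})" for t
  define h where "h t = (\<integral>\<^sup>+x. ac_density (x, t) * indicator C x \<partial>lborel)" for t
  have Zs: "Z \<in> sets u" using Z(1) sets_u_lborel by auto
  then have Zb: "Z \<in> sets borel" "Z \<subseteq> strip T" by (auto simp: sets_u)
  have prod_sets: "C \<times> J \<in> sets borel" if "J \<in> sets borel" for J :: "real set"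
    using C that by (subst borel_prod[symmetric]) auto
  have mac: "(\<lambda>p. ac_density p) \<in> borel_measurable (borel \<Otimes>\<^sub>M borel)" by (simp add: borel_prod)
  have hm: "h \<in> borel_measurable borel"
  proof -
    have "(\<lambda>(t, x). ac_density (x, t) * indicator C x) \<in> borel_measurable (borel \<Otimes>\<^sub>M lborel)"
      using mac C by measurable
    from lborel.borel_measurable_nn_integral_fst[OF this] show ?thesis by (simp add: h_def[abs_def])
  qed
  have slices: "emeasure (v t) {x. (x, t) \<in> C \<times> J - Z} = g t * indicator J t" for J t
  proof (cases "t \<in> J")
    case True
    then have "{x. (x, t) \<in> C \<times> J - Z} = C - {x. (x, t) \<in> Z}" by auto
    then show ?thesis using True by (simp add: g_def)
  next
    case False
    then have "{x. (x, t) \<in> C \<times> J - Z} = {}" by auto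
    then show ?thesis using False by simp
  qed
  have gm: "g \<in> borel_measurable (time_measure T)"
  proof -
    have "sliceable (C \<times> UNIV - Z)" using prod_sets[of UNIV] Zb by (intro sliceable_borel) auto
    then show ?thesis unfolding sliceable_def slices by simp
  qed
  have borel_eq: "(\<integral>\<^sup>+t. g t * indicator J t \<partial>time_measure T) = (\<integral>\<^sup>+t. h t * indicator J t \<partial>time_measure T)"
    if J: "J \<in> sets borel" for J
  proof -
    have "sliceable (C \<times> J - Z)" using prod_sets[OF J] Zb by (intro sliceable_borel) auto
    then have "(\<integral>\<^sup>+t. g t * indicator J t \<partial>time_measure T) = emeasure u ((C \<times> J - Z) \<inter> strip T)"
      unfolding sliceable_def slices by simp
    also have "\<dots> = emeasure (ac_part (lborel_strip T) u) ((C \<times> J - Z) \<inter> strip T) + emeasure (sing_part (lborel_strip T) u) ((C \<times> J - Z) \<inter> strip T)"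
      by (rule ac_sing_sum) (use prod_sets[OF J] Zb strip_sets in \<open>auto simp: sets_u\<close>)
    also have "emeasure (sing_part (lborel_strip T) u) ((C \<times> J - Z) \<inter> strip T) = 0"
    proof -
      have ss: "sets (sing_part (lborel_strip T) u) = sets u" using decomposition by (simp add: lebesgue_decomposition_def)
      have "emeasure (sing_part (lborel_strip T) u) ((C \<times> J - Z) \<inter> strip T) \<le> emeasure (sing_part (lborel_strip T) u) (strip T - Z)"
        using Zb strip_sets by (intro emeasure_mono) (auto simp: ss sets_u)
      then show ?thesis using Z(2) by simp
    qed
    also have "emeasure (ac_part (lborel_strip T) u) ((C \<times> J - Z) \<inter> strip T) = emeasure (ac_part (lborel_strip T) u) (C \<times> J \<inter> strip T)"
    proof -
      have "Z \<in> null_sets (ac_part (lborel_strip T) u)" using ac_ac Z(1) by (auto simp: absolutely_continuous_def)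
      moreover have "C \<times> J \<inter> strip T \<in> sets (ac_part (lborel_strip T) u)"
        using prod_sets[OF J] strip_sets by (simp add: sets_ac sets_u_lborel[symmetric] sets_u)
      ultimately have "emeasure (ac_part (lborel_strip T) u) (C \<times> J \<inter> strip T - Z) = emeasure (ac_part (lborel_strip T) u) (C \<times> J \<inter> strip T)"
        by (intro emeasure_Diff_null_set)
      moreover have "(C \<times> J - Z) \<inter> strip T = C \<times> J \<inter> strip T - Z" by auto
      ultimately show ?thesis by simp
    qed
    also have "\<dots> = (\<integral>\<^sup>+p. ac_density p * indicator (C \<times> J \<inter> strip T) p \<partial>lborel)"
      by (rule emeasure_ac) (use prod_sets[OF J] strip_sets in auto)
    also have "\<dots> = (\<integral>\<^sup>+t. (\<integral>\<^sup>+x. ac_density (x, t) * indicator (C \<times> J \<inter> strip T) (x, t) \<partial>lborel) \<partial>lborel)"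
    proof -
      have "(\<lambda>p. ac_density p * indicator (C \<times> J \<inter> strip T) p) \<in> borel_measurable (lborel \<Otimes>\<^sub>M lborel)"
        using prod_sets[OF J] strip_sets by (simp add: lborel_prod)
      from lborel_pair.nn_integral_snd[OF this] show ?thesis by (simp add: lborel_prod)
    qed
    also have "\<dots> = (\<integral>\<^sup>+t. (h t * indicator J t) * indicator {0<..<T} t \<partial>lborel)"
    proof (rule nn_integral_cong)
      fix t
      have "(\<integral>\<^sup>+x. ac_density (x, t) * indicator (C \<times> J \<inter> strip T) (x, t) \<partial>lborel)
        = (\<integral>\<^sup>+x. (ac_density (x, t) * indicator C x) * (indicator J t * indicator {0<..<T} t) \<partial>lborel)"
        by (intro nn_integral_cong) (auto simp: indicator_def strip_def)
      also have "\<dots> = h t * (indicator J t * indicator {0<..<T} t)"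
        unfolding h_def
      proof (rule nn_integral_multc)
        have "(\<lambda>x. ac_density (x, t)) \<in> borel_measurable borel" using measurable_compose[OF measurable_Pair2'[of t borel borel] mac] by simp
        then show "(\<lambda>x. ac_density (x, t) * indicator C x) \<in> borel_measurable lborel" using C by simp
      qed
      finally show "(\<integral>\<^sup>+x. ac_density (x, t) * indicator (C \<times> J \<inter> strip T) (x, t) \<partial>lborel) = (h t * indicator J t) * indicator {0<..<T} t"
        by (simp add: mult.assoc)
    qed
    also have "\<dots> = (\<integral>\<^sup>+t. h t * indicator J t \<partial>time_measure T)"
      by (rule nn_integral_time(1)[symmetric]) (use hm J in simp)
    finally show ?thesis by simp
  qed
  have hm': "h \<in> borel_measurable (time_measure T)" by (rule nn_integral_time(2)[OF hm])
  have "density (time_measure T) g = density (time_measure T) h"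
  proof (rule measure_eqI)
    fix J assume "J \<in> sets (density (time_measure T) g)"
    then have J: "J \<in> sets (time_measure T)" by simp
    \<comment> \<open>Uniqueness of densities ranges over Lebesgue measurable sets, while the
      disintegration is known for Borel sets; \<open>S\<close> is a Borel set equal to
      \<open>J\<close> up to a null set.\<close>
    then have "J \<in> sets (completion lborel)" by (simp add: sets_restrict_space_iff)
    then obtain S N N' where SN: "J = S \<union> N" "N \<subseteq> N'" "N' \<in> null_sets lborel" "S \<in> sets lborel"
      by (rule sets_completionE)
    have "AE t in lborel. indicator J t = (indicator S t :: ennreal)"
      using AE_not_in[OF SN(3)] by eventually_elim (use SN in \<open>auto simp: indicator_def\<close>)
    then have ae: "AE t in time_measure T. indicator J t = (indicator S t :: ennreal)"
      by (subst AE_time_iff) auto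
    have "emeasure (density (time_measure T) g) J = (\<integral>\<^sup>+t. g t * indicator J t \<partial>time_measure T)"
      by (rule emeasure_density[OF gm J])
    also have "\<dots> = (\<integral>\<^sup>+t. g t * indicator S t \<partial>time_measure T)"
      using ae by (intro nn_integral_cong_AE) auto
    also have "\<dots> = (\<integral>\<^sup>+t. h t * indicator S t \<partial>time_measure T)" by (rule borel_eq) (use SN in simp)
    also have "\<dots> = (\<integral>\<^sup>+t. h t * indicator J t \<partial>time_measure T)"
      using ae by (intro nn_integral_cong_AE) auto
    also have "\<dots> = emeasure (density (time_measure T) h) J"
      by (rule emeasure_density[OF hm' J, symmetric])
    finally show "emeasure (density (time_measure T) g) J = emeasure (density (time_measure T) h) J" .
  qed simp
  moreover have "finite_measure (density (time_measure T) g)"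
  proof (rule finite_measureI)
    have "emeasure (density (time_measure T) g) (space (density (time_measure T) g)) = (\<integral>\<^sup>+t. g t * indicator {0<..<T} t \<partial>time_measure T)"
      using emeasure_density[OF gm, of "{0<..<T}"] sets.top[of "time_measure T"] by simp
    also have "\<dots> \<le> (\<integral>\<^sup>+t. emeasure (v t) {x. (x, t) \<in> UNIV} \<partial>time_measure T)"
      unfolding g_def by (intro nn_integral_mono) (auto simp: indicator_def intro!: emeasure_mono)
    also have "\<dots> = emeasure u (strip T)" using sliceable_UNIV by (simp add: sliceable_def)
    also have "\<dots> < \<infinity>" using finite_measure.emeasure_finite[OF u(2)] by (simp add: less_top)
    finally show "emeasure (density (time_measure T) g) (space (density (time_measure T) g)) \<noteq> \<infinity>" by simp
  qed
  ultimately have "AE t in time_measure T. g t = h t"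
    using sigma_finite_density_unique[OF gm hm'] finite_measure.axioms(1) by blast
  then show ?thesis by (simp add: g_def h_def)
qed

text \<open>At almost every time the slice of \<open>Z\<close> is null and carries everything in the
  section that is not absolutely continuous, so slicing the decomposition of \<open>u\<close> gives
  the decomposition of the section. This joins \<open>u_reg\<close>, defined on the strip, to the
  singular part, defined through sections.\<close>

theorem section_decomposition:
  "AE t in lborel. 0 < t \<and> t < T \<longrightarrow>
     (\<forall>X\<in>sets borel. emeasure (v t) X = (\<integral>\<^sup>+x. ennreal (u_reg T u x t) * indicator X x \<partial>lborel) + emeasure (sing_part lborel (v t)) X)"
proof -
  obtain Z where Z: "Z \<in> null_sets (lborel_strip T)" "emeasure (sing_part (lborel_strip T) u) (strip T - Z) = 0"
    using decomposition space_lborel_strip by (auto simp: lebesgue_decomposition_def mutually_singular_def)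
  have Zs: "Z \<in> sets u" using Z(1) sets_u_lborel by auto
  then have Zb: "Z \<in> sets borel" "Z \<subseteq> strip T" by (auto simp: sets_u)
  have Z0: "Z \<in> null_sets lborel"
    using Z(1) Zb strip_sets by (auto simp: null_sets_def emeasure_restrict_space)
  have mac: "(\<lambda>p. ac_density p) \<in> borel_measurable (borel \<Otimes>\<^sub>M borel)" by (simp add: borel_prod)
  have acm: "(\<lambda>x. ac_density (x, t)) \<in> borel_measurable borel" for t
    using measurable_compose[OF measurable_Pair2'[of t borel borel] mac] by simp
  define Zt where "Zt t = {x. (x, t) \<in> Z}" for t
  have Ztb[measurable]: "Zt t \<in> sets borel" for t unfolding Zt_def by (rule slice_sets[OF Zb(1)])
  have ae1: "AE t in lborel. AE x in lborel. (x, t) \<notin> Z" using AE_lborel_swap[OF AE_not_in[OF Z0]] .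
  have ae2: "AE t in lborel. AE x in lborel. ac_density (x, t) = ennreal (u_reg T u x t) * indicator (strip T) (x, t)"
    using AE_lborel_swap[OF ac_density_real] by simp
  have "AE t in time_measure T. \<forall>q\<in>\<rat>. emeasure (v t) ({q<..} - Zt t) = (\<integral>\<^sup>+x. ac_density (x, t) * indicator {q<..} x \<partial>lborel)"
    unfolding Zt_def by (subst AE_ball_countable[OF countable_rat]) (intro ballI emeasure_section_off_singular[OF Z]; simp)
  then have ae3: "AE t in lborel. 0 < t \<and> t < T \<longrightarrow> (\<forall>q\<in>\<rat>. emeasure (v t) ({q<..} - Zt t) = (\<integral>\<^sup>+x. ac_density (x, t) * indicator {q<..} x \<partial>lborel))"
    by (simp only: AE_time_iff)
  show ?thesis
    using ae1 ae2 ae3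
  proof eventually_elim
    case (elim t)
    show ?case
    proof (intro impI)
      assume t: "0 < t \<and> t < T"
      let ?\<rho> = "density (v t) (indicator (UNIV - Zt t))" and ?\<kappa> = "density lborel (\<lambda>x. ac_density (x, t))"
      let ?s = "density (v t) (indicator (Zt t))"
      have e\<rho>: "emeasure ?\<rho> X = emeasure (v t) (X - Zt t)" if "X \<in> sets borel" for X
        using emeasure_restricted[of "UNIV - Zt t" "v t" X] that by (simp add: Int_Diff Int_commute Diff_eq)
      have es: "emeasure ?s X = emeasure (v t) (X \<inter> Zt t)" if "X \<in> sets borel" for X
        using emeasure_restricted[of "Zt t" "v t" X] that by (simp add: Int_commute)
      have e\<kappa>: "emeasure ?\<kappa> X = (\<integral>\<^sup>+x. ac_density (x, t) * indicator X x \<partial>lborel)" if "X \<in> sets borel" for X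
        by (rule emeasure_density) (use acm that in auto)
      \<comment> \<open>At the chosen time all rational rays are available together, and they
        determine a finite measure.\<close>
      have eq: "?\<rho> = ?\<kappa>"
      proof (rule finite_measure_eq_on_rational_rays)
        show "finite_measure ?\<rho>" by (rule finite_measureI) (use e\<rho>[of UNIV] v_fin in simp)
        show "emeasure ?\<rho> {q<..} = emeasure ?\<kappa> {q<..}" if "q \<in> \<rat>" for q
          using elim(3) t that by (simp add: e\<rho> e\<kappa>)
      qed auto
      have sum: "emeasure (v t) X = emeasure ?\<kappa> X + emeasure ?s X" if X: "X \<in> sets borel" for X
      proof -
        have "emeasure (v t) X = emeasure (v t) ((X - Zt t) \<union> (X \<inter> Zt t))" by (rule arg_cong[of _ _ "emeasure (v t)"]) auto
        also have "\<dots> = emeasure (v t) (X - Zt t) + emeasure (v t) (X \<inter> Zt t)"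
          using X by (intro plus_emeasure[symmetric]) auto
        also have "\<dots> = emeasure ?\<kappa> X + emeasure ?s X" using X by (simp only: e\<rho>[symmetric] es eq)
        finally show ?thesis .
      qed
      have "lebesgue_decomposition lborel (v t) ?\<kappa> ?s"
        unfolding lebesgue_decomposition_def mutually_singular_def
      proof (intro conjI ballI)
        show "absolutely_continuous lborel ?\<kappa>" by (rule absolutely_continuousI_density) (use acm in simp)
        have "Zt t \<in> null_sets lborel" using elim(1) AE_iff_null_sets[of "Zt t" lborel] Ztb[of t] by (simp add: Zt_def)
        moreover have "(UNIV - Zt t) \<inter> Zt t = {}" by auto
        then have "emeasure ?s (space lborel - Zt t) = 0" using es[of "UNIV - Zt t"] by simp
        ultimately show "\<exists>A\<in>null_sets lborel. emeasure ?s (space lborel - A) = 0" by blast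
      qed (use sum in auto)
      then have s: "sing_part lborel (v t) = ?s"
        using lebesgue_decomposition_unique(2)[OF lebesgue_decomposition_parts[OF v_finite, of t lborel]] by simp
      show "\<forall>X\<in>sets borel. emeasure (v t) X = (\<integral>\<^sup>+x. ennreal (u_reg T u x t) * indicator X x \<partial>lborel) + emeasure (sing_part lborel (v t)) X"
      proof
        fix X :: "real set" assume X: "X \<in> sets borel"
        have "emeasure ?\<kappa> X = (\<integral>\<^sup>+x. ennreal (u_reg T u x t) * indicator X x \<partial>lborel)"
          unfolding e\<kappa>[OF X] using elim(2) by (intro nn_integral_cong_AE) (auto simp: strip_def t elim!: eventually_mono)
        then show "emeasure (v t) X = (\<integral>\<^sup>+x. ennreal (u_reg T u x t) * indicator X x \<partial>lborel) + emeasure (sing_part lborel (v t)) X"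
          using sum[OF X] s by simp
      qed
    qed
  qed
qed

end

section \<open>Moving frames and entropies\<close>

lemma equicontinuous_in_time:
  fixes f :: "real \<Rightarrow> real \<Rightarrow> real"
  assumes c: "continuous_on UNIV (\<lambda>p. f (fst p) (snd p))" and R: "\<And>x t. t \<in> {0..T} \<Longrightarrow> \<bar>x\<bar> \<ge> R \<Longrightarrow> f x t = 0" and e: "e > 0"
  obtains d where "d > 0" "\<And>x s t. s \<in> {0..T} \<Longrightarrow> t \<in> {0..T} \<Longrightarrow> \<bar>s - t\<bar> < d \<Longrightarrow> \<bar>f x s - f x t\<bar> < e"
proof -
  have "compact ({-R..R} \<times> {0..T})" by (intro compact_Times compact_Icc)
  then have "uniformly_continuous_on ({-R..R} \<times> {0..T}) (\<lambda>p. f (fst p) (snd p))"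
    by (rule compact_uniformly_continuous[rotated]) (rule continuous_on_subset[OF c], simp)
  then obtain d where d: "d > 0" "\<And>p q. p \<in> {-R..R} \<times> {0..T} \<Longrightarrow> q \<in> {-R..R} \<times> {0..T} \<Longrightarrow> dist q p < d \<Longrightarrow>
      dist (f (fst q) (snd q)) (f (fst p) (snd p)) < e"
    using e unfolding uniformly_continuous_on_def by metis
  show ?thesis
  proof (rule that[OF d(1)])
    fix x s t assume st: "s \<in> {0..T}" "t \<in> {0..T}" "\<bar>s - t\<bar> < d"
    show "\<bar>f x s - f x t\<bar> < e"
    proof (cases "\<bar>x\<bar> \<ge> R")
      case True
      then show ?thesis using R[OF st(1) True] R[OF st(2) True] e by simp
    next
      case False
      then have "(x, t) \<in> {-R..R} \<times> {0..T}" "(x, s) \<in> {-R..R} \<times> {0..T}" using st by auto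
      moreover have "dist (x, s) (x, t) < d" using st(3) by (simp add: dist_Pair_Pair dist_real_def)
      ultimately show ?thesis using d(2)[of "(x, t)" "(x, s)"] by (simp add: dist_real_def)
    qed
  qed
qed

text \<open>On a compact rectangle joint continuity is uniform, which yields continuity in time for
  the sup norm.\<close>

lemma C_CcI:
  fixes f :: "real \<Rightarrow> real \<Rightarrow> real"
  assumes c: "continuous_on UNIV (\<lambda>p. f (fst p) (snd p))" and R: "\<And>x t. t \<in> {0..T} \<Longrightarrow> \<bar>x\<bar> \<ge> R \<Longrightarrow> f x t = 0"
  shows "C_Cc T f"
  unfolding C_Cc_def
proof (intro conjI ballI exI[of _ "{-R..R}"] allI impI)
  show "f x t = 0" if "t \<in> {0..T}" "x \<notin> {-R..R}" for t x using that by (intro R) auto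
  show "continuous_on UNIV (\<lambda>x. f x t)" for t
    using continuous_on_compose2[OF c, of UNIV "\<lambda>x. (x, t)"] by (simp add: continuous_on_Pair)
  fix t assume t: "t \<in> {0..T}"
  show "uniform_limit UNIV (\<lambda>s x. f x s) (\<lambda>x. f x t) (at t within {0..T})"
  proof (rule uniform_limitI)
    fix e :: real assume e: "e > 0"
    obtain d where d: "d > 0" "\<And>x s t. s \<in> {0..T} \<Longrightarrow> t \<in> {0..T} \<Longrightarrow> \<bar>s - t\<bar> < d \<Longrightarrow> \<bar>f x s - f x t\<bar> < e"
      using equicontinuous_in_time[OF c R e] by blast
    show "\<forall>\<^sub>F s in at t within {0..T}. \<forall>x\<in>UNIV. dist (f x s) (f x t) < e"
      unfolding eventually_at using d t by (intro exI[of _ d]) (auto simp: dist_real_def)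
  qed
qed (rule compact_Icc)

text \<open>By the mean value theorem a difference quotient is a value of the derivative at an
  intermediate time, and this value varies uniformly little in space.\<close>

lemma uniform_difference_quotient:
  fixes f f' :: "real \<Rightarrow> real \<Rightarrow> real"
  assumes d: "\<And>x t. (f x has_real_derivative f' x t) (at t)"
    and c: "continuous_on UNIV (\<lambda>p. f' (fst p) (snd p))" and R: "\<And>x t. t \<in> {0..T} \<Longrightarrow> \<bar>x\<bar> \<ge> R \<Longrightarrow> f' x t = 0"
    and t: "t \<in> {0..T}"
  shows "uniform_limit UNIV (\<lambda>s x. (f x s - f x t) / (s - t)) (\<lambda>x. f' x t) (at t within {0..T})"
proof (rule uniform_limitI)
  fix e :: real assume e: "e > 0"
  obtain \<delta> where \<delta>: "\<delta> > 0" "\<And>x s t. s \<in> {0..T} \<Longrightarrow> t \<in> {0..T} \<Longrightarrow> \<bar>s - t\<bar> < \<delta> \<Longrightarrow> \<bar>f' x s - f' x t\<bar> < e"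
    using equicontinuous_in_time[OF c R e] by blast
  have "dist ((f x s - f x t) / (s - t)) (f' x t) < e" if s: "s \<in> {0..T}" "s \<noteq> t" "\<bar>s - t\<bar> < \<delta>" for s x
  proof -
    have "\<exists>r. min s t < r \<and> r < max s t \<and> f x (max s t) - f x (min s t) = (max s t - min s t) * f' x r"
      using MVT2[of "min s t" "max s t" "f x" "f' x"] s(2) d by auto
    then obtain r where r: "min s t < r" "r < max s t" "f x (max s t) - f x (min s t) = (max s t - min s t) * f' x r"
      by blast
    have "f x s - f x t = (s - t) * f' x r" using r(3) by (cases "s \<le> t") (auto simp: max_def min_def algebra_simps)
    then have q: "(f x s - f x t) / (s - t) = f' x r" using s(2) by simp
    have "r \<in> {0..T}" "\<bar>r - t\<bar> < \<delta>" using r s t by (auto simp: max_def min_def split: if_splits)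
    then show ?thesis unfolding q using \<delta>(2)[OF _ t] by (simp add: dist_real_def)
  qed
  then show "\<forall>\<^sub>F s in at t within {0..T}. \<forall>x\<in>UNIV. dist ((f x s - f x t) / (s - t)) (f' x t) < e"
    unfolding eventually_at using \<delta>(1) by (intro exI[of _ \<delta>]) (auto simp: dist_real_def)
qed

text \<open>A sufficient condition for \<open>C1_C1c\<close> in terms of pointwise derivatives and
  joint continuity. The mixed derivative \<open>ztx\<close> serves twice, as the space derivative of
  \<open>zt\<close> and as the time derivative of \<open>zx\<close>.\<close>

definition smooth_test where
  "smooth_test T z zt zx ztx \<longleftrightarrow>
     continuous_on UNIV (\<lambda>p. z (fst p) (snd p)) \<and> continuous_on UNIV (\<lambda>p. zt (fst p) (snd p)) \<and>
     continuous_on UNIV (\<lambda>p. zx (fst p) (snd p)) \<and> continuous_on UNIV (\<lambda>p. ztx (fst p) (snd p)) \<and>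
     (\<exists>R. \<forall>t\<in>{0..T}. \<forall>x. \<bar>x\<bar> \<ge> R \<longrightarrow> z x t = 0 \<and> zt x t = 0 \<and> zx x t = 0 \<and> ztx x t = 0) \<and>
     (\<forall>x t. ((\<lambda>y. z y t) has_real_derivative zx x t) (at x)) \<and> (\<forall>x t. ((\<lambda>y. zt y t) has_real_derivative ztx x t) (at x)) \<and>
     (\<forall>x t. (z x has_real_derivative zt x t) (at t)) \<and> (\<forall>x t. (zx x has_real_derivative ztx x t) (at (t::real)))"

lemma smooth_test_C1_C1c:
  assumes "smooth_test T z zt zx ztx"
  shows "C1_C1c T z zt zx"
proof -
  have "\<exists>R. \<forall>t\<in>{0..T}. \<forall>x. \<bar>x\<bar> \<ge> R \<longrightarrow> z x t = 0 \<and> zt x t = 0 \<and> zx x t = 0 \<and> ztx x t = 0"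
    using assms unfolding smooth_test_def by (elim conjE)
  then obtain R where R: "\<forall>t\<in>{0..T}. \<forall>x. \<bar>x\<bar> \<ge> R \<longrightarrow> z x t = 0 \<and> zt x t = 0 \<and> zx x t = 0 \<and> ztx x t = 0"
    by (rule exE)
  have c: "continuous_on UNIV (\<lambda>p. z (fst p) (snd p))" "continuous_on UNIV (\<lambda>p. zt (fst p) (snd p))"
     "continuous_on UNIV (\<lambda>p. zx (fst p) (snd p))" "continuous_on UNIV (\<lambda>p. ztx (fst p) (snd p))"
    and d: "\<And>x t. ((\<lambda>y. z y t) has_real_derivative zx x t) (at x)" "\<And>x t. ((\<lambda>y. zt y t) has_real_derivative ztx x t) (at x)"
     "\<And>x t. (z x has_real_derivative zt x t) (at t)" "\<And>x t. (zx x has_real_derivative ztx x t) (at t)"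
    using assms unfolding smooth_test_def by auto
  have CC: "C_Cc T z" "C_Cc T zt" "C_Cc T zx" "C_Cc T ztx"
    using R by (auto intro: C_CcI[OF c(1), of T R] C_CcI[OF c(2), of T R] C_CcI[OF c(3), of T R] C_CcI[OF c(4), of T R])
  have "uniform_limit UNIV (\<lambda>s x. (z x s - z x t) / (s - t)) (\<lambda>x. zt x t) (at t within {0..T})" if "t \<in> {0..T}" for t
    by (rule uniform_difference_quotient[OF d(3) c(2) _ that, of R]) (use R in auto)
  moreover have "uniform_limit UNIV (\<lambda>s x. (zx x s - zx x t) / (s - t)) (\<lambda>x. ztx x t) (at t within {0..T})" if "t \<in> {0..T}" for t
    by (rule uniform_difference_quotient[OF d(4) c(4) _ that, of R]) (use R in auto)
  ultimately show ?thesis unfolding C1_C1c_def using CC d by blast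
qed

lemma smooth_test_add:
  assumes "smooth_test T a a1 a2 a3" "smooth_test T b b1 b2 b3"
  shows "smooth_test T (\<lambda>x t. a x t + b x t) (\<lambda>x t. a1 x t + b1 x t) (\<lambda>x t. a2 x t + b2 x t) (\<lambda>x t. a3 x t + b3 x t)"
proof -
  obtain R R' where "\<forall>t\<in>{0..T}. \<forall>x. \<bar>x\<bar> \<ge> R \<longrightarrow> a x t = 0 \<and> a1 x t = 0 \<and> a2 x t = 0 \<and> a3 x t = 0"
    "\<forall>t\<in>{0..T}. \<forall>x. \<bar>x\<bar> \<ge> R' \<longrightarrow> b x t = 0 \<and> b1 x t = 0 \<and> b2 x t = 0 \<and> b3 x t = 0"
    using assms unfolding smooth_test_def by auto
  then have "\<exists>R. \<forall>t\<in>{0..T}. \<forall>x. \<bar>x\<bar> \<ge> R \<longrightarrow> a x t + b x t = 0 \<and> a1 x t + b1 x t = 0 \<and> a2 x t + b2 x t = 0 \<and> a3 x t + b3 x t = 0"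
    by (intro exI[of _ "max R R'"]) auto
  then show ?thesis
    using assms unfolding smooth_test_def by (simp add: DERIV_add continuous_on_add)
qed

text \<open>Over the time interval the support drifts by at most \<open>\<bar>C\<bar> * T\<close>,
  so one compact set serves all times.\<close>

lemma moving_frame_smooth:
  assumes tf: "test_fun \<eta> \<eta>1 \<eta>2" and g: "g * g = (1::real)"
  shows "\<exists>ztx. smooth_test T (\<lambda>x t. \<eta> (g * (x - C * t)) t) (\<lambda>x t. \<eta>1 (g * (x - C * t)) t - g * C * \<eta>2 (g * (x - C * t)) t)
     (\<lambda>x t. g * \<eta>2 (g * (x - C * t)) t) ztx"
  using tf
proof induction
  case (prod f f' f'' R k k')
  have d: "(f has_real_derivative f' x) (at x)" "(f' has_real_derivative f'' x) (at x)" "(k has_real_derivative k' x) (at x)" for x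
    using prod by (auto simp: C2_with_derivs_def C1_with_deriv_def)
  have c: "continuous_on A f" "continuous_on A f'" "continuous_on A f''" "continuous_on A k" "continuous_on A k'" for A
    using C2_with_derivs_cont[OF prod(1)] C1_with_deriv_cont[OF prod(3)] by auto
  have cx: "continuous_on UNIV (\<lambda>p. h (g * (fst p - C * snd p)))" if "\<And>A. continuous_on A h" for h :: "real \<Rightarrow> real"
    by (rule continuous_on_compose2[OF that[of UNIV]]) (auto intro!: continuous_intros)
  have ct: "continuous_on UNIV (\<lambda>p::real \<times> real. h (snd p))" if "\<And>A. continuous_on A h" for h :: "real \<Rightarrow> real"
    by (rule continuous_on_compose2[OF that[of UNIV]]) (auto intro!: continuous_intros)
  have abs_g: "\<bar>g\<bar> = 1" using g by (metis abs_1 abs_mult abs_mult_self_eq abs_ge_zero power2_eq_square real_sqrt_abs real_sqrt_one)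
  have supp: "R \<le> \<bar>g * (x - C * t)\<bar>" if "\<bar>x\<bar> \<ge> R + \<bar>C\<bar> * T" "t \<in> {0..T}" for x t
  proof -
    have "\<bar>C * t\<bar> \<le> \<bar>C\<bar> * T" using that(2) by (auto simp: abs_mult intro: mult_left_mono)
    then have "R \<le> \<bar>x - C * t\<bar>" using that(1) by linarith
    then show ?thesis by (simp add: abs_mult abs_g)
  qed
  have ix: "((\<lambda>y. g * (y - C * t)) has_real_derivative g) (at x)" for x t by (auto intro!: derivative_eq_intros)
  have it: "((\<lambda>s. g * (x - C * s)) has_real_derivative - (g * C)) (at t)" for x t by (auto intro!: derivative_eq_intros)
  have dfx: "((\<lambda>y. f (g * (y - C * t))) has_real_derivative f' (g * (x - C * t)) * g) (at x)"
     "((\<lambda>y. f' (g * (y - C * t))) has_real_derivative f'' (g * (x - C * t)) * g) (at x)" for x t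
    by (rule DERIV_chain2[OF d(1) ix] DERIV_chain2[OF d(2) ix])+
  have dft: "((\<lambda>s. f (g * (x - C * s))) has_real_derivative f' (g * (x - C * t)) * - (g * C)) (at t)"
     "((\<lambda>s. f' (g * (x - C * s))) has_real_derivative f'' (g * (x - C * t)) * - (g * C)) (at t)" for x t
    by (rule DERIV_chain2[OF d(1) it] DERIV_chain2[OF d(2) it])+
  \<comment> \<open>In the second order term the reflection occurs squared and disappears by
    \<open>g * g = 1\<close>.\<close>
  let ?ztx = "\<lambda>x t. g * f' (g * (x - C * t)) * k' t - C * f'' (g * (x - C * t)) * k t"
  have "smooth_test T (\<lambda>x t. f (g * (x - C * t)) * k t) (\<lambda>x t. f (g * (x - C * t)) * k' t - g * C * (f' (g * (x - C * t)) * k t))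
     (\<lambda>x t. g * (f' (g * (x - C * t)) * k t)) ?ztx"
    unfolding smooth_test_def
  proof (intro conjI allI)
    show "continuous_on UNIV (\<lambda>p. f (g * (fst p - C * snd p)) * k (snd p))"
      "continuous_on UNIV (\<lambda>p. f (g * (fst p - C * snd p)) * k' (snd p) - g * C * (f' (g * (fst p - C * snd p)) * k (snd p)))"
      "continuous_on UNIV (\<lambda>p. g * (f' (g * (fst p - C * snd p)) * k (snd p)))"
      "continuous_on UNIV (\<lambda>p. g * f' (g * (fst p - C * snd p)) * k' (snd p) - C * f'' (g * (fst p - C * snd p)) * k (snd p))"
      by (intro continuous_on_mult continuous_on_diff continuous_on_const cx ct c)+
    show "\<exists>R. \<forall>t\<in>{0..T}. \<forall>x. R \<le> \<bar>x\<bar> \<longrightarrow> f (g * (x - C * t)) * k t = 0 \<and>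
        f (g * (x - C * t)) * k' t - g * C * (f' (g * (x - C * t)) * k t) = 0 \<and>
        g * (f' (g * (x - C * t)) * k t) = 0 \<and> g * f' (g * (x - C * t)) * k' t - C * f'' (g * (x - C * t)) * k t = 0"
      using prod(2) supp by (intro exI[of _ "R + \<bar>C\<bar> * T"]) auto
    fix x t
    show "((\<lambda>y. f (g * (y - C * t)) * k t) has_real_derivative g * (f' (g * (x - C * t)) * k t)) (at x)"
      by (rule DERIV_cong[OF DERIV_cmult_right[OF dfx(1)]]) (simp add: mult_ac)
    have "((\<lambda>y. f (g * (y - C * t)) * k' t - g * C * (f' (g * (y - C * t)) * k t)) has_real_derivative
       f' (g * (x - C * t)) * g * k' t - g * C * (f'' (g * (x - C * t)) * g * k t)) (at x)"
      by (intro DERIV_diff DERIV_cmult_right[OF dfx(1)] DERIV_cmult[OF DERIV_cmult_right[OF dfx(2)]])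
    moreover have "f' (g * (x - C * t)) * g * k' t - g * C * (f'' (g * (x - C * t)) * g * k t) = ?ztx x t"
    proof -
      have "g * C * (f'' (g * (x - C * t)) * g * k t) = (g * g) * (C * f'' (g * (x - C * t)) * k t)" by (simp only: mult_ac)
      then show ?thesis unfolding g by (simp add: mult_ac)
    qed
    ultimately show "((\<lambda>y. f (g * (y - C * t)) * k' t - g * C * (f' (g * (y - C * t)) * k t)) has_real_derivative ?ztx x t) (at x)"
      by simp
    show "((\<lambda>t. f (g * (x - C * t)) * k t) has_real_derivative f (g * (x - C * t)) * k' t - g * C * (f' (g * (x - C * t)) * k t)) (at t)"
      by (rule DERIV_cong[OF DERIV_mult'[OF dft(1) d(3)]]) (simp add: algebra_simps)
    have "((\<lambda>t. g * (f' (g * (x - C * t)) * k t)) has_real_derivative g * (f' (g * (x - C * t)) * k' t + f'' (g * (x - C * t)) * - (g * C) * k t)) (at t)"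
      by (intro DERIV_cmult DERIV_mult' dft d)
    moreover have "g * (f' (g * (x - C * t)) * k' t + f'' (g * (x - C * t)) * - (g * C) * k t) = ?ztx x t"
    proof -
      have "g * (f'' (g * (x - C * t)) * - (g * C) * k t) = - ((g * g) * (C * f'' (g * (x - C * t)) * k t))" by (simp add: mult_ac)
      then show ?thesis unfolding g distrib_left by (simp add: mult_ac)
    qed
    ultimately show "((\<lambda>t. g * (f' (g * (x - C * t)) * k t)) has_real_derivative ?ztx x t) (at t)" by simp
  qed
  then show ?case by (intro exI[of _ ?ztx]) (simp add: mult_ac)
next
  case (add a a1 a2 b b1 b2)
  then obtain za zb where "smooth_test T (\<lambda>x t. a (g * (x - C * t)) t) (\<lambda>x t. a1 (g * (x - C * t)) t - g * C * a2 (g * (x - C * t)) t) (\<lambda>x t. g * a2 (g * (x - C * t)) t) za"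
    "smooth_test T (\<lambda>x t. b (g * (x - C * t)) t) (\<lambda>x t. b1 (g * (x - C * t)) t - g * C * b2 (g * (x - C * t)) t) (\<lambda>x t. g * b2 (g * (x - C * t)) t) zb"
    by blast
  from smooth_test_add[OF this] show ?case by (intro exI) (simp add: algebra_simps)
qed

theorem moving_frame_C1_C1c:
  assumes "test_fun \<eta> \<eta>1 \<eta>2" "g * g = (1::real)"
  shows "C1_C1c T (\<lambda>x t. \<eta> (g * (x - C * t)) t) (\<lambda>x t. \<eta>1 (g * (x - C * t)) t - g * C * \<eta>2 (g * (x - C * t)) t)
     (\<lambda>x t. g * \<eta>2 (g * (x - C * t)) t)"
  using moving_frame_smooth[OF assms] smooth_test_C1_C1c by blast

text \<open>For monotone \<open>f\<close> the value at \<open>\<alpha> = -1\<close> is Kruzkov's \<open>\<bar>f s - f k\<bar>\<close>, and \<open>f = id\<close>, \<open>\<alpha> = 0\<close> gives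
  \<open>(s - k)\<^sup>+\<close>.\<close>

definition kink :: "real \<Rightarrow> real \<Rightarrow> (real \<Rightarrow> real) \<Rightarrow> real \<Rightarrow> real" where
  "kink \<alpha> k f s = (f (max s k) - f k) + \<alpha> * (f (min s k) - f k)"

lemma has_L_infty_deriv_diff_bound:
  assumes "has_L_infty_deriv f g"
  obtains B where "0 \<le> B" "\<And>a b. 0 \<le> a \<Longrightarrow> 0 \<le> b \<Longrightarrow> \<bar>f a - f b\<bar> \<le> B * \<bar>a - b\<bar>"
proof -
  obtain B where m: "g \<in> borel_measurable (lebesgue_on {0<..})" and B: "AE x in lebesgue_on {0<..}. \<bar>g x\<bar> \<le> B"
    and I: "\<And>a b. 0 \<le> a \<Longrightarrow> a \<le> b \<Longrightarrow> f b - f a = (\<integral>x. g x \<partial>lebesgue_on {a<..<b})"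
    using assms unfolding has_L_infty_deriv_def L_infty_def by blast
  have le: "\<bar>f b - f a\<bar> \<le> \<bar>B\<bar> * \<bar>b - a\<bar>" if ab: "0 \<le> a" "a \<le> b" for a b
  proof -
    have sub: "{a<..<b} \<subseteq> {0<..}" using ab by auto
    have m': "g \<in> borel_measurable (lebesgue_on {a<..<b})"
      by (rule measurable_restrict_mono[OF m sub])
    have "AE x in lebesgue. x \<in> {0<..} \<longrightarrow> \<bar>g x\<bar> \<le> B" using B by (subst (asm) AE_restrict_space_iff) auto
    then have ae: "AE x in lebesgue_on {a<..<b}. \<bar>g x\<bar> \<le> \<bar>B\<bar>"
      using sub by (subst AE_restrict_space_iff) (auto elim!: eventually_mono)
    have fin: "finite_measure (lebesgue_on {a<..<b})"
      by (rule finite_measureI) (use emeasure_bounded_finite[of "{a<..<b}"] in \<open>simp add: emeasure_restrict_space\<close>)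
    have i: "integrable (lebesgue_on {a<..<b}) g"
      by (rule finite_measure.integrable_const_bound[OF fin _ m']) (use ae in simp)
    have "\<bar>\<integral>x. g x \<partial>lebesgue_on {a<..<b}\<bar> \<le> (\<integral>x. \<bar>g x\<bar> \<partial>lebesgue_on {a<..<b})"
      by (rule integral_abs_bound)
    also have "\<dots> \<le> (\<integral>x. \<bar>B\<bar> \<partial>lebesgue_on {a<..<b})"
      using i ae finite_measure.integrable_const[OF fin, of "\<bar>B\<bar>"] by (intro integral_mono_AE) auto
    also have "\<dots> = \<bar>B\<bar> * (b - a)"
      using ab by (simp add: measure_restrict_space)
    finally show ?thesis using I[OF ab] ab by simp
  qed
  show ?thesis
  proof (rule that[of "\<bar>B\<bar>"])
    fix a b :: real assume "0 \<le> a" "0 \<le> b"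
    then show "\<bar>f a - f b\<bar> \<le> \<bar>B\<bar> * \<bar>a - b\<bar>"
      using le[of a b] le[of b a] by (cases "a \<le> b") (auto simp: abs_minus_commute)
  qed simp
qed

lemma has_L_infty_deriv_ident: "has_L_infty_deriv (\<lambda>s. s) (\<lambda>s. 1)"
  unfolding has_L_infty_deriv_def L_infty_def
  by (auto simp: measure_restrict_space intro!: exI[of _ 1])

lemma has_L_infty_deriv_kink:
  assumes f: "has_L_infty_deriv f g" and k: "0 \<le> k"
  shows "has_L_infty_deriv (kink \<alpha> k f) (\<lambda>s. (if s > k then 1 else \<alpha>) * g s)"
proof -
  obtain B where m: "g \<in> borel_measurable (lebesgue_on {0<..})" and B: "AE x in lebesgue_on {0<..}. \<bar>g x\<bar> \<le> B"
    and I: "\<And>a b. 0 \<le> a \<Longrightarrow> a \<le> b \<Longrightarrow> f b - f a = (\<integral>x. g x \<partial>lebesgue_on {a<..<b})"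
    using f unfolding has_L_infty_deriv_def L_infty_def by blast
  have mk: "(\<lambda>s::real. if s > k then 1 else \<alpha>) \<in> borel_measurable (lebesgue_on {0<..})"
    by (intro measurable_restrict_space1 measurable_completion) measurable
  have "AE x in lebesgue_on {0<..}. \<bar>(if x > k then 1 else \<alpha>) * g x\<bar> \<le> (1 + \<bar>\<alpha>\<bar>) * \<bar>B\<bar>"
    using B
  proof eventually_elim
    case (elim x)
    have "\<bar>if x > k then 1 else \<alpha>\<bar> * \<bar>g x\<bar> \<le> (1 + \<bar>\<alpha>\<bar>) * \<bar>B\<bar>"
      using elim by (intro mult_mono) auto
    then show ?case by (simp add: abs_mult)
  qed
  then have L: "L_infty (lebesgue_on {0<..}) (\<lambda>s. (if s > k then 1 else \<alpha>) * g s)"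
    unfolding L_infty_def by (intro conjI exI borel_measurable_times m mk)
  have "kink \<alpha> k f b - kink \<alpha> k f a = (\<integral>s. (if s > k then 1 else \<alpha>) * g s \<partial>lebesgue_on {a<..<b})"
    if ab: "0 \<le> a" "a \<le> b" for a b
  proof -
    have int: "integrable lebesgue (\<lambda>s. indicator {c<..<d} s * g s)" if cd: "0 \<le> c" for c d :: real
    proof -
      have sub: "{c<..<d} \<subseteq> {0<..}" using cd by auto
      have m': "g \<in> borel_measurable (lebesgue_on {c<..<d})" by (rule measurable_restrict_mono[OF m sub])
      have "AE x in lebesgue. x \<in> {0<..} \<longrightarrow> \<bar>g x\<bar> \<le> B" using B by (subst (asm) AE_restrict_space_iff) auto
      then have ae: "AE x in lebesgue_on {c<..<d}. \<bar>g x\<bar> \<le> \<bar>B\<bar>"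
        using sub by (subst AE_restrict_space_iff) (auto elim!: eventually_mono)
      have fin: "finite_measure (lebesgue_on {c<..<d})"
        by (rule finite_measureI) (use emeasure_bounded_finite[of "{c<..<d}"] in \<open>simp add: emeasure_restrict_space\<close>)
      have "integrable (lebesgue_on {c<..<d}) g"
        by (rule finite_measure.integrable_const_bound[OF fin _ m']) (use ae in simp)
      then show ?thesis by (subst (asm) integrable_restrict_space) auto
    qed
    have If: "f d - f c = (\<integral>s. indicator {c<..<d} s * g s \<partial>lebesgue)" if "0 \<le> c" "c \<le> d" for c d
      using I[OF that] by (simp add: integral_restrict_space)
    \<comment> \<open>Up to the point \<open>k\<close>, the interval from \<open>a\<close> to
      \<open>b\<close> is the union of its parts above and below \<open>k\<close>; written with
      \<open>max\<close> and \<open>min\<close>, either part may be empty and all positions of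
      \<open>k\<close> are covered at once.\<close>
    have ae: "AE s in lebesgue. indicator {a<..<b} s * ((if s > k then 1 else \<alpha>) * g s)
       = indicator {max a k<..<max b k} s * g s + \<alpha> * (indicator {min a k<..<min b k} s * g s)"
    proof -
      have "AE s in lebesgue. s \<noteq> k" by (rule AE_completion) (rule AE_lborel_singleton)
      then show ?thesis by eventually_elim (auto simp: indicator_def max_def min_def)
    qed
    have "(\<integral>s. (if s > k then 1 else \<alpha>) * g s \<partial>lebesgue_on {a<..<b}) = (\<integral>s. indicator {a<..<b} s * ((if s > k then 1 else \<alpha>) * g s) \<partial>lebesgue)"
      by (subst integral_restrict_space) auto
    also have "\<dots> = (\<integral>s. indicator {max a k<..<max b k} s * g s + \<alpha> * (indicator {min a k<..<min b k} s * g s) \<partial>lebesgue)"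
    proof (rule integral_cong_AE[OF _ _ ae])
      show 2: "(\<lambda>s. indicator {max a k<..<max b k} s * g s + \<alpha> * (indicator {min a k<..<min b k} s * g s)) \<in> borel_measurable lebesgue"
        using int[of "max a k" "max b k"] int[of "min a k" "min b k"] ab k by auto
      have km: "(\<lambda>s::real. if s > k then 1 else \<alpha>) \<in> borel_measurable lebesgue"
        by (intro measurable_completion) measurable
      have "(\<lambda>s. (if s > k then 1 else \<alpha>) * (indicator {a<..<b} s * g s)) \<in> borel_measurable lebesgue"
        by (rule borel_measurable_times[OF km borel_measurable_integrable[OF int[OF ab(1)]]])
      then show "(\<lambda>s. indicator {a<..<b} s * ((if s > k then 1 else \<alpha>) * g s)) \<in> borel_measurable lebesgue"
        by (simp only: mult.left_commute)
    qed
    also have "\<dots> = (\<integral>s. indicator {max a k<..<max b k} s * g s \<partial>lebesgue) + \<alpha> * (\<integral>s. indicator {min a k<..<min b k} s * g s \<partial>lebesgue)"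
      using int[of "max a k" "max b k"] int[of "min a k" "min b k"] ab k by simp
    also have "\<dots> = (f (max b k) - f (max a k)) + \<alpha> * (f (min b k) - f (min a k))"
      using If[of "max a k" "max b k"] If[of "min a k" "min b k"] ab k by (simp add: max.coboundedI1 min.coboundedI1)
    also have "\<dots> = kink \<alpha> k f b - kink \<alpha> k f a" by (simp add: kink_def algebra_simps)
    finally show ?thesis ..
  qed
  then show ?thesis unfolding has_L_infty_deriv_def using L by blast
qed

text \<open>For \<open>\<alpha> \<le> 1\<close> this kink is the maximum of two affine
  functions.\<close>

lemma kink_ident_convex:
  assumes "\<alpha> \<le> 1"
  shows "convex_on {0..} (kink \<alpha> k (\<lambda>s. s))"
proof -
  have eq: "kink \<alpha> k (\<lambda>s. s) s = max (s - k) (\<alpha> * (s - k))" for s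
  proof (cases "s \<ge> k")
    case True
    then have "\<alpha> * (s - k) \<le> 1 * (s - k)" using assms by (intro mult_right_mono) auto
    then show ?thesis using True by (simp add: kink_def max_def min_def)
  next
    case False
    then have "1 * (s - k) \<le> \<alpha> * (s - k)" using assms by (intro mult_right_mono_neg) auto
    then show ?thesis using False by (simp add: kink_def max_def min_def)
  qed
  show ?thesis
  proof (rule convex_onI)
    fix t x y :: real assume t: "0 < t" "t < 1"
    define X Y where "X = x - k" and "Y = y - k"
    have lin: "(1 - t) *\<^sub>R x + t *\<^sub>R y - k = (1 - t) * X + t * Y" by (simp add: X_def Y_def algebra_simps)
    have "(1 - t) * X \<le> (1 - t) * max X (\<alpha> * X)" "t * Y \<le> t * max Y (\<alpha> * Y)"
      "(1 - t) * (\<alpha> * X) \<le> (1 - t) * max X (\<alpha> * X)" "t * (\<alpha> * Y) \<le> t * max Y (\<alpha> * Y)"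
      using t by (auto intro: mult_left_mono)
    moreover have "\<alpha> * ((1 - t) * X + t * Y) = (1 - t) * (\<alpha> * X) + t * (\<alpha> * Y)" by (simp add: algebra_simps)
    ultimately have "max ((1 - t) * X + t * Y) (\<alpha> * ((1 - t) * X + t * Y)) \<le> (1 - t) * max X (\<alpha> * X) + t * max Y (\<alpha> * Y)"
      by linarith
    then show "kink \<alpha> k (\<lambda>s. s) ((1 - t) *\<^sub>R x + t *\<^sub>R y) \<le> (1 - t) * kink \<alpha> k (\<lambda>s. s) x + t * kink \<alpha> k (\<lambda>s. s) y"
      unfolding eq lin by (simp add: X_def Y_def)
  qed simp
qed

text \<open>Beyond \<open>k\<close> the kink differs from \<open>f\<close> by a constant. All
  entropies in use therefore have slope 1 at infinity and fluxes of slope \<open>C\<close>, and they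
  meet the singular part in the same way.\<close>

lemma kink_slope_at_top:
  assumes "((\<lambda>s. f s / s) \<longlongrightarrow> C) at_top"
  shows "((\<lambda>s. kink \<alpha> k f s / s) \<longlongrightarrow> C) at_top"
proof -
  have "((\<lambda>s. f s / s - f k / s) \<longlongrightarrow> C - 0) at_top"
    by (intro tendsto_diff assms tendsto_divide_0[OF tendsto_const] filterlim_at_top_imp_at_infinity filterlim_ident)
  moreover have "\<forall>\<^sub>F s in at_top. f s / s - f k / s = kink \<alpha> k f s / s"
    using eventually_ge_at_top[of k] by eventually_elim (simp add: kink_def max_absorb1 min_absorb2 diff_divide_distrib)
  ultimately show ?thesis using tendsto_cong by fastforce
qed

lemma kink_0_bound:
  assumes "0 \<le> s" "0 \<le> k" "0 \<le> L" and f: "\<And>a b. \<bar>f a - f b\<bar> \<le> L * \<bar>a - b\<bar>"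
  shows "\<bar>kink 0 k f s\<bar> \<le> L * s"
proof -
  have "\<bar>kink 0 k f s\<bar> \<le> L * \<bar>max s k - k\<bar>" using f[of "max s k" k] by (simp add: kink_def)
  also have "\<dots> \<le> L * s" using assms by (intro mult_left_mono) auto
  finally show ?thesis .
qed

lemma kink_0_eq_0: "s \<le> k \<Longrightarrow> kink 0 k f s = 0"
  by (simp add: kink_def max_absorb2)

section \<open>Integrals against sums of measures and over completed time\<close>

lemma nn_integral_measure_sum:
  assumes sets: "sets A = sets M" "sets B = sets M"
    and sum: "\<And>X. X \<in> sets M \<Longrightarrow> emeasure M X = emeasure A X + emeasure B X"
    and f: "f \<in> borel_measurable M"
  shows "(\<integral>\<^sup>+x. f x \<partial>M) = (\<integral>\<^sup>+x. f x \<partial>A) + (\<integral>\<^sup>+x. f x \<partial>B)"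
proof -
  have m: "h \<in> borel_measurable M \<Longrightarrow> h \<in> borel_measurable A" "h \<in> borel_measurable M \<Longrightarrow> h \<in> borel_measurable B" for h :: "'a \<Rightarrow> ennreal"
    using measurable_cong_sets[OF sets(1) refl] measurable_cong_sets[OF sets(2) refl] by auto
  have sp: "space A = space M" "space B = space M" using sets by (auto dest: sets_eq_imp_space_eq)
  show ?thesis
    using f
  proof (induction rule: borel_measurable_induct)
    case (cong f g)
    have "nn_integral M f = nn_integral M g" "nn_integral A f = nn_integral A g" "nn_integral B f = nn_integral B g"
      using cong(3) sp by (auto intro!: nn_integral_cong)
    then show ?case using cong(4) by simp
  next
    case (set X)
    have "X \<in> sets A" "X \<in> sets B" using set sets by blast+
    then show ?case using sum[OF set] set by (simp only: nn_integral_indicator)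
  next
    case (mult f c)
    note mm = mult.hyps(2) m(1)[OF mult.hyps(2)] m(2)[OF mult.hyps(2)]
    show ?case unfolding nn_integral_cmult[OF mm(1)] nn_integral_cmult[OF mm(2)] nn_integral_cmult[OF mm(3)] mult.IH
      by (rule distrib_left)
  next
    case (add f g)
    note mf = add.hyps(1) m(1)[OF add.hyps(1)] m(2)[OF add.hyps(1)]
    note mg = add.hyps(3) m(1)[OF add.hyps(3)] m(2)[OF add.hyps(3)]
    show ?case
      unfolding nn_integral_add[OF mg(1) mf(1)] nn_integral_add[OF mg(2) mf(2)] nn_integral_add[OF mg(3) mf(3)] add.IH
      by (simp only: ac_simps)
  next
    case (seq F)
    have inc: "incseq F" by fact
    have 1: "(\<integral>\<^sup>+x. (SUP i. F i) x \<partial>N) = (SUP i. \<integral>\<^sup>+x. F i x \<partial>N)" if "\<And>i. F i \<in> borel_measurable N" for N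
      unfolding SUP_apply by (rule nn_integral_monotone_convergence_SUP[OF inc that])
    have "(SUP i. (\<integral>\<^sup>+x. F i x \<partial>A) + (\<integral>\<^sup>+x. F i x \<partial>B)) = (SUP i. \<integral>\<^sup>+x. F i x \<partial>A) + (SUP i. \<integral>\<^sup>+x. F i x \<partial>B)"
      using inc by (intro ennreal_SUP_add) (auto simp: incseq_def le_fun_def intro!: nn_integral_mono)
    then show ?case
      unfolding 1[OF seq.hyps(1)] 1[OF m(1)[OF seq.hyps(1)]] 1[OF m(2)[OF seq.hyps(1)]] seq.IH by (simp only:)
  qed
qed

lemma integral_measure_sum:
  fixes f :: "'a \<Rightarrow> real"
  assumes sets: "sets A = sets M" "sets B = sets M"
    and sum: "\<And>X. X \<in> sets M \<Longrightarrow> emeasure M X = emeasure A X + emeasure B X"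
    and f: "integrable A f" "integrable B f"
  shows "(\<integral>x. f x \<partial>M) = (\<integral>x. f x \<partial>A) + (\<integral>x. f x \<partial>B)"
proof -
  have fM: "f \<in> borel_measurable M" using borel_measurable_integrable[OF f(1)] measurable_cong_sets[OF sets(1) refl] by auto
  have nn: "(\<integral>\<^sup>+x. ennreal (h x) \<partial>M) = (\<integral>\<^sup>+x. ennreal (h x) \<partial>A) + (\<integral>\<^sup>+x. ennreal (h x) \<partial>B)" if "h \<in> borel_measurable M" for h :: "'a \<Rightarrow> real"
    by (rule nn_integral_measure_sum[OF sets sum]) (use that in auto)
  have fin: "(\<integral>\<^sup>+x. ennreal (norm (f x)) \<partial>A) < \<infinity>" "(\<integral>\<^sup>+x. ennreal (norm (f x)) \<partial>B) < \<infinity>"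
    using f by (auto simp: integrable_iff_bounded)
  have "(\<integral>\<^sup>+x. ennreal (norm (f x)) \<partial>M) < \<infinity>"
    using nn[of "\<lambda>x. norm (f x)"] fM fin by simp
  then have fi: "integrable M f" using fM by (simp add: integrable_iff_bounded)
  have lt: "(\<integral>\<^sup>+x. ennreal (f x) \<partial>N) < top" "(\<integral>\<^sup>+x. ennreal (- f x) \<partial>N) < top" if "integrable N f" for N
    using that real_integrable_def[of N f] by (auto simp: less_top)
  show ?thesis
    unfolding real_lebesgue_integral_def[OF fi] real_lebesgue_integral_def[OF f(1)] real_lebesgue_integral_def[OF f(2)]
    using nn[of f] nn[of "\<lambda>x. - f x"] fM lt[OF f(1)] lt[OF f(2)]
    by (simp add: enn2real_plus)
qed

text \<open>Completeness of Lebesgue measure on the interval: an arbitrary change on a null set of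
  times preserves measurability.\<close>

lemma time_measure_AE_measurable:
  fixes f h :: "real \<Rightarrow> real"
  assumes h: "h \<in> borel_measurable (time_measure T)" and ae: "AE t in time_measure T. f t = h t"
  shows "f \<in> borel_measurable (time_measure T)"
proof (rule measurableI)
  fix S :: "real set" assume S: "S \<in> sets borel"
  have "AE t in lebesgue. t \<in> {0<..<T} \<longrightarrow> f t = h t" using ae by (subst (asm) AE_restrict_space_iff) auto
  then obtain N where N: "{t \<in> space lebesgue. \<not> (t \<in> {0<..<T} \<longrightarrow> f t = h t)} \<subseteq> N" "N \<in> null_sets lebesgue"
    by (auto elim!: AE_E simp: null_sets_def)
  have "h -` S \<inter> {0<..<T} \<in> sets (time_measure T)" using measurable_sets[OF h S] by simp
  then have 1: "h -` S \<inter> {0<..<T} \<in> sets lebesgue" by (simp add: sets_restrict_space_iff)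
  have "(f -` S \<inter> {0<..<T}) \<inter> N \<in> null_sets lebesgue"
    by (rule null_sets_completion_subset[OF _ N(2)]) auto
  then have 2: "(f -` S \<inter> {0<..<T}) \<inter> N \<in> sets lebesgue" by auto
  have "f -` S \<inter> {0<..<T} = ((h -` S \<inter> {0<..<T}) - N) \<union> ((f -` S \<inter> {0<..<T}) \<inter> N)"
    using N(1) by auto
  moreover have "((h -` S \<inter> {0<..<T}) - N) \<union> ((f -` S \<inter> {0<..<T}) \<inter> N) \<in> sets lebesgue"
    using 1 2 N(2) by auto
  ultimately have "f -` S \<inter> {0<..<T} \<in> sets lebesgue" by simp
  then show "f -` S \<inter> space (time_measure T) \<in> sets (time_measure T)" by (simp add: sets_restrict_space_iff)
qed simp

lemma integrable_time_iff:
  fixes f :: "real \<Rightarrow> real"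
  assumes "f \<in> borel_measurable borel"
  shows "integrable (time_measure T) f \<longleftrightarrow> integrable lborel (\<lambda>t. indicator {0<..<T} t * f t)"
    and "(\<integral>t. f t \<partial>time_measure T) = (\<integral>t. indicator {0<..<T} t * f t \<partial>lborel)"
proof -
  have m: "(\<lambda>t. indicator {0<..<T} t * f t) \<in> borel_measurable lborel" using assms by simp
  show "integrable (time_measure T) f \<longleftrightarrow> integrable lborel (\<lambda>t. indicator {0<..<T} t * f t)"
    by (subst integrable_restrict_space) (auto simp: integrable_completion[OF m])
  show "(\<integral>t. f t \<partial>time_measure T) = (\<integral>t. indicator {0<..<T} t * f t \<partial>lborel)"
    by (subst integral_restrict_space) (auto simp: integral_completion[OF m])
qed

text \<open>The Galilean frame \<open>y = g (x - C t)\<close> with \<open>g = \<plusminus>1\<close>; the reflection reduces the nonincreasing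
  case to the nondecreasing one.\<close>

definition from_frame :: "real \<Rightarrow> real \<Rightarrow> real \<times> real \<Rightarrow> real \<times> real" where
  "from_frame g C q = (g * fst q + C * snd q, snd q)"

lemma from_frame_measurable[measurable]: "from_frame g C \<in> borel_measurable borel"
  unfolding from_frame_def[abs_def] borel_prod[symmetric] by measurable

lemma abs_eq_1: "g * g = (1::real) \<Longrightarrow> \<bar>g\<bar> = 1"
  by (metis abs_1 abs_mult abs_mult_self_eq abs_ge_zero power2_eq_square real_sqrt_abs real_sqrt_one)

text \<open>At each fixed time the map is a translation combined with the factor \<open>g\<close> of
  modulus 1, so it preserves the length of every slice.\<close>

lemma distr_from_frame:
  assumes g: "g * g = (1::real)"
  shows "distr lborel borel (from_frame g C) = lborel"
proof (rule measure_eqI)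
  fix A assume "A \<in> sets (distr lborel borel (from_frame g C))"
  then have A: "A \<in> sets borel" by simp
  have A': "A \<in> sets (lborel \<Otimes>\<^sub>M lborel)" by (subst lborel_prod) (use A in simp)
  have B: "from_frame g C -` A \<in> sets borel" using measurable_sets[OF from_frame_measurable A] by simp
  then have B': "from_frame g C -` A \<in> sets (lborel \<Otimes>\<^sub>M lborel)" by (subst lborel_prod) simp
  have g0: "g \<noteq> 0" using g by auto
  have slice: "emeasure lborel ((\<lambda>x. (x, t)) -` (from_frame g C -` A)) = emeasure lborel ((\<lambda>x. (x, t)) -` A)" for t
  proof -
    have sA: "(\<lambda>x. (x, t)) -` A \<in> sets borel" using sets_Pair2[OF A'] by simp
    have sB: "(\<lambda>x. (x, t)) -` (from_frame g C -` A) \<in> sets borel" using sets_Pair2[OF B'] by simp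
    have "emeasure lborel ((\<lambda>x. (x, t)) -` A) = (\<integral>\<^sup>+x. indicator ((\<lambda>x. (x, t)) -` A) x \<partial>lborel)"
      using sA by simp
    also have "\<dots> = ennreal \<bar>g\<bar> * (\<integral>\<^sup>+y. indicator ((\<lambda>x. (x, t)) -` A) (C * t + g * y) \<partial>lborel)"
      by (rule nn_integral_real_affine) (use sA g0 in auto)
    also have "\<dots> = (\<integral>\<^sup>+y. indicator ((\<lambda>x. (x, t)) -` (from_frame g C -` A)) y \<partial>lborel)"
      by (auto simp: abs_eq_1[OF g] from_frame_def indicator_def add.commute intro!: nn_integral_cong)
    also have "\<dots> = emeasure lborel ((\<lambda>x. (x, t)) -` (from_frame g C -` A))"
      using sB by simp
    finally show ?thesis by simp
  qed
  have "emeasure (distr lborel borel (from_frame g C)) A = emeasure lborel (from_frame g C -` A)"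
    using A by (subst emeasure_distr) auto
  also have "\<dots> = emeasure (lborel \<Otimes>\<^sub>M lborel) (from_frame g C -` A)" by (simp add: lborel_prod)
  also have "\<dots> = (\<integral>\<^sup>+t. emeasure lborel ((\<lambda>x. (x, t)) -` (from_frame g C -` A)) \<partial>lborel)"
    by (rule lborel_pair.emeasure_pair_measure_alt2[OF B'])
  also have "\<dots> = emeasure (lborel \<Otimes>\<^sub>M lborel) A"
    unfolding slice by (rule lborel_pair.emeasure_pair_measure_alt2[OF A', symmetric])
  finally show "emeasure (distr lborel borel (from_frame g C)) A = emeasure lborel A" by (simp add: lborel_prod)
qed simp

lemma
  fixes f :: "real \<times> real \<Rightarrow> real"
  assumes g: "g * g = (1::real)" and f: "f \<in> borel_measurable borel"
  shows integral_from_frame: "(\<integral>q. f (from_frame g C q) \<partial>lborel) = (\<integral>p. f p \<partial>lborel)"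
    and integrable_from_frame: "integrable lborel (\<lambda>q. f (from_frame g C q)) \<longleftrightarrow> integrable lborel f"
proof -
  have "(\<integral>p. f p \<partial>distr lborel borel (from_frame g C)) = (\<integral>q. f (from_frame g C q) \<partial>lborel)"
    by (rule integral_distr) (use f in auto)
  then show "(\<integral>q. f (from_frame g C q) \<partial>lborel) = (\<integral>p. f p \<partial>lborel)" by (simp add: distr_from_frame[OF g])
  have "integrable (distr lborel borel (from_frame g C)) f \<longleftrightarrow> integrable lborel (\<lambda>q. f (from_frame g C q))"
    by (rule integrable_distr_eq) (use f in auto)
  then show "integrable lborel (\<lambda>q. f (from_frame g C q)) \<longleftrightarrow> integrable lborel f" by (simp add: distr_from_frame[OF g])
qed

lemma AE_from_frame:
  assumes g: "g * g = (1::real)" and "{p. Q p} \<in> sets borel"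
  shows "(AE q in lborel. Q (from_frame g C q)) \<longleftrightarrow> (AE p in lborel. Q p)"
proof -
  have "(AE p in distr lborel borel (from_frame g C). Q p) \<longleftrightarrow> (AE q in lborel. Q (from_frame g C q))"
    by (rule AE_distr_iff) (use assms in auto)
  then show ?thesis unfolding distr_from_frame[OF g] by (rule sym)
qed

lemma moving_frame_C_Cc:
  fixes h :: "real \<Rightarrow> real \<Rightarrow> real"
  assumes c: "continuous_on UNIV (\<lambda>p. h (fst p) (snd p))" and R: "\<And>x t. \<bar>x\<bar> \<ge> R \<Longrightarrow> h x t = 0" and g: "g * g = (1::real)"
  shows "C_Cc T (\<lambda>x t. h (g * (x - C * t)) t)"
    and "continuous_on UNIV (\<lambda>p. h (g * (fst p - C * snd p)) (snd p))"
proof -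
  show c': "continuous_on UNIV (\<lambda>p. h (g * (fst p - C * snd p)) (snd p))"
    using continuous_on_compose2[OF c, of UNIV "\<lambda>p. (g * (fst p - C * snd p), snd p)"]
    by (simp add: continuous_on_Pair continuous_on_mult continuous_on_diff continuous_on_fst continuous_on_snd continuous_on_id)
  show "C_Cc T (\<lambda>x t. h (g * (x - C * t)) t)"
  proof (rule C_CcI[OF c', of T "R + \<bar>C\<bar> * T"])
    fix x t assume t: "t \<in> {0..T}" and x: "R + \<bar>C\<bar> * T \<le> \<bar>x\<bar>"
    have "\<bar>C * t\<bar> \<le> \<bar>C\<bar> * T" using t by (auto simp: abs_mult intro: mult_left_mono)
    then have "R \<le> \<bar>x - C * t\<bar>" using x by linarith
    then have "R \<le> \<bar>g * (x - C * t)\<bar>" by (simp add: abs_mult abs_eq_1[OF g])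
    then show "h (g * (x - C * t)) t = 0" by (rule R)
  qed
qed

section \<open>The flux relative to the moving frame\<close>

locale flux_frame =
  fixes T C g :: real and \<phi> \<phi>' :: "real \<Rightarrow> real"
  assumes T_pos: "0 < T" and g_sq: "g * g = 1" and phi_0: "\<phi> 0 = 0" and phi_deriv: "has_L_infty_deriv \<phi> \<phi>'"
    and phi_slope: "((\<lambda>s. \<phi> s / s) \<longlongrightarrow> C) at_top" and phi_bounded: "bounded ((\<lambda>s. \<phi> s - C * s) ` {0<..})"
    and phi_mono: "mono_on {0<..} (\<lambda>s. g * (\<phi> s - C * s))"
begin

text \<open>Oriented by \<open>g\<close> so as to be nondecreasing, and continued to negative
  arguments by the value at 0, since \<open>monotone_flux\<close> makes its demands on the whole
  line.\<close>

definition \<psi> :: "real \<Rightarrow> real" where "\<psi> s = g * (\<phi> (max 0 s) - C * max 0 s)"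

definition psi_sup :: real where "psi_sup = Sup (range \<psi>)"

lemma psi_lipschitz_ex: "\<exists>L\<ge>0. \<forall>s r. \<bar>\<psi> s - \<psi> r\<bar> \<le> L * \<bar>s - r\<bar>"
proof -
  obtain B where B: "0 \<le> B" "\<And>a b. 0 \<le> a \<Longrightarrow> 0 \<le> b \<Longrightarrow> \<bar>\<phi> a - \<phi> b\<bar> \<le> B * \<bar>a - b\<bar>"
    using has_L_infty_deriv_diff_bound[OF phi_deriv] by blast
  have "\<bar>\<psi> s - \<psi> r\<bar> \<le> (B + \<bar>C\<bar>) * \<bar>s - r\<bar>" for s r
  proof -
    define a b where "a = max 0 s" and "b = max 0 r"
    have ab: "0 \<le> a" "0 \<le> b" "\<bar>a - b\<bar> \<le> \<bar>s - r\<bar>" by (auto simp: a_def b_def)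
    have "\<bar>\<psi> s - \<psi> r\<bar> = \<bar>g\<bar> * \<bar>(\<phi> a - \<phi> b) - C * (a - b)\<bar>"
      unfolding \<psi>_def a_def[symmetric] b_def[symmetric] by (simp add: abs_mult[symmetric] algebra_simps)
    also have "\<dots> \<le> B * \<bar>a - b\<bar> + \<bar>C\<bar> * \<bar>a - b\<bar>"
      unfolding abs_eq_1[OF g_sq] using B(2)[OF ab(1,2)] abs_triangle_ineq4[of "\<phi> a - \<phi> b" "C * (a - b)"]
      by (simp add: abs_mult)
    also have "\<dots> \<le> (B + \<bar>C\<bar>) * \<bar>s - r\<bar>" using ab(3) B(1) by (simp add: distrib_right[symmetric] mult_left_mono)
    finally show ?thesis .
  qed
  then show ?thesis using B(1) by (intro exI[of _ "B + \<bar>C\<bar>"]) auto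
qed

lemma psi_at_0: "\<psi> 0 = 0"
  by (simp add: \<psi>_def phi_0)

text \<open>Monotonicity is assumed on the open half-line only; the value at 0 is reached by
  Lipschitz continuity.\<close>

lemma psi_mono: "mono \<psi>"
proof -
  obtain L where L: "0 \<le> L" "\<And>s r. \<bar>\<psi> s - \<psi> r\<bar> \<le> L * \<bar>s - r\<bar>" using psi_lipschitz_ex by blast
  have pos: "\<psi> r \<le> \<psi> s" if "0 < r" "r \<le> s" for r s
    using mono_onD[OF phi_mono, of r s] that by (simp add: \<psi>_def)
  have nn: "0 \<le> \<psi> s" if s: "0 < s" for s
  proof (rule field_le_epsilon)
    fix e :: real assume e: "0 < e"
    define r where "r = min s (e / (L + 1))"
    have r: "0 < r" "r \<le> s" "r \<le> e / (L + 1)" using s e L(1) by (auto simp: r_def)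
    have "L * r \<le> L * (e / (L + 1))" using r(3) L(1) by (rule mult_left_mono)
    also have "\<dots> \<le> e" using L(1) e by (simp add: field_simps)
    finally have "- e \<le> \<psi> r" using L(2)[of r 0] r(1) psi_at_0 by simp
    then show "0 \<le> \<psi> s + e" using pos[OF r(1,2)] by simp
  qed
  show ?thesis
  proof (rule monoI)
    fix r s :: real assume rs: "r \<le> s"
    show "\<psi> r \<le> \<psi> s"
    proof (cases "0 < r")
      case True
      then show ?thesis using pos rs by blast
    next
      case False
      then have "\<psi> r = 0" using psi_at_0 by (simp add: \<psi>_def max_absorb1)
      moreover have "0 \<le> \<psi> s"
      proof (cases "0 < s")
        case False
        then have "\<psi> s = \<psi> 0" by (simp add: \<psi>_def max_absorb1)
        then show ?thesis using psi_at_0 by simp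
      qed (rule nn)
      ultimately show ?thesis by simp
    qed
  qed
qed

lemma psi_bdd: "bdd_above (range \<psi>)"
proof -
  obtain B where B: "\<And>s. 0 < s \<Longrightarrow> \<bar>\<phi> s - C * s\<bar> \<le> B"
    using phi_bounded unfolding bounded_real by auto
  have "\<psi> s \<le> \<bar>B\<bar>" for s
  proof (cases "0 < s")
    case True
    have "\<bar>\<psi> s\<bar> = \<bar>\<phi> s - C * s\<bar>" using True by (simp add: \<psi>_def abs_mult abs_eq_1[OF g_sq])
    then show ?thesis using B[OF True] by linarith
  next
    case False
    then show ?thesis by (simp add: \<psi>_def max_absorb1 phi_0)
  qed
  then show ?thesis by (auto simp: bdd_above_def)
qed

lemma monotone_flux_ex: "\<exists>L. monotone_flux \<psi> psi_sup L"
proof -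
  obtain L where L: "0 \<le> L" "\<And>s r. \<bar>\<psi> s - \<psi> r\<bar> \<le> L * \<bar>s - r\<bar>" using psi_lipschitz_ex by blast
  have up: "\<psi> s \<le> psi_sup" for s unfolding psi_sup_def by (rule cSUP_upper[OF UNIV_I psi_bdd])
  have "(\<psi> \<longlongrightarrow> psi_sup) at_top"
  proof (rule order_tendstoI)
    fix y assume "y < psi_sup"
    then obtain s0 where s0: "y < \<psi> s0"
      unfolding psi_sup_def using less_cSUP_iff[OF _ psi_bdd] by auto
    show "\<forall>\<^sub>F s in at_top. y < \<psi> s"
      using eventually_ge_at_top[of s0] by eventually_elim (use s0 monoD[OF psi_mono] in \<open>auto intro: less_le_trans\<close>)
  next
    fix y assume "psi_sup < y"
    then have "\<psi> s < y" for s using up[of s] by linarith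
    then show "\<forall>\<^sub>F s in at_top. \<psi> s < y" by simp
  qed
  then have "monotone_flux \<psi> psi_sup L"
    using psi_mono psi_at_0 up L by unfold_locales auto
  then show ?thesis by blast
qed

text \<open>In the frame an entropy \<open>E\<close> with flux \<open>F\<close> has the flux
  \<open>g * (F - C * E)\<close>; for kinks this is the same kink with \<open>\<psi>\<close> in
  place of \<open>\<phi>\<close>.\<close>

lemma kink_psi:
  assumes "0 \<le> s" "0 \<le> k"
  shows "g * (kink \<alpha> k \<phi> s - C * kink \<alpha> k (\<lambda>s. s) s) = kink \<alpha> k \<psi> s"
  using assms by (simp add: kink_def \<psi>_def max_absorb2 max.coboundedI1 min_def max_def algebra_simps)

end

section \<open>Entropy solutions in the moving frame\<close>

text \<open>Functions of time are given up to Lebesgue null sets on the interval, while the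
  arguments with distributions want Borel functions on the line; hence a Borel version, extended by
  zero.\<close>

lemma borel_version_time:
  fixes s :: "real \<Rightarrow> real"
  assumes s: "integrable (time_measure T) s"
  obtains s' where "integrable lborel s'" "\<And>t. t \<le> 0 \<or> T \<le> t \<Longrightarrow> s' t = 0"
    "AE t in lborel. 0 < t \<and> t < T \<longrightarrow> s' t = s t"
    "\<And>w. w \<in> borel_measurable borel \<Longrightarrow> (\<integral>t. s t * w t \<partial>time_measure T) = (\<integral>t. s' t * w t \<partial>lborel)"
proof -
  have sm: "s \<in> borel_measurable (time_measure T)" using s by auto
  have "(\<lambda>t. indicator {0<..<T} t *\<^sub>R s t) \<in> borel_measurable lebesgue"
    using sm by (subst (asm) borel_measurable_restrict_space_iff) auto
  then obtain r where r: "r \<in> borel_measurable lborel" "AE t in lborel. indicator {0<..<T} t *\<^sub>R s t = r t"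
    using completion_ex_borel_measurable_real by blast
  define s' where "s' t = indicator {0<..<T} t * r t" for t
  have s'm: "s' \<in> borel_measurable borel" using r(1) unfolding s'_def[abs_def] by measurable
  have ae: "AE t in lborel. 0 < t \<and> t < T \<longrightarrow> s' t = s t"
    using r(2) by eventually_elim (auto simp: s'_def)
  then have ae': "AE t in time_measure T. s' t = s t"
    by (subst AE_restrict_space_iff) (auto simp: AE_completion_iff elim!: eventually_mono)
  have s'mt: "w \<in> borel_measurable borel \<Longrightarrow> w \<in> borel_measurable (time_measure T)" for w :: "real \<Rightarrow> real"
    by (intro measurable_restrict_space1 measurable_completion) simp
  have ii: "indicator {0<..<T} t * s' t = s' t" for t by (simp add: s'_def indicator_def)
  have "integrable (time_measure T) s'"
    by (rule integrable_cong_AE_imp[OF s s'mt[OF s'm]]) (use ae' in \<open>auto elim!: eventually_mono\<close>)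
  then have i: "integrable lborel s'" using integrable_time_iff(1)[OF s'm] by (simp add: ii)
  have "(\<integral>t. s t * w t \<partial>time_measure T) = (\<integral>t. s' t * w t \<partial>lborel)" if w: "w \<in> borel_measurable borel" for w
  proof -
    have "(\<integral>t. s t * w t \<partial>time_measure T) = (\<integral>t. s' t * w t \<partial>time_measure T)"
      using ae' by (intro integral_cong_AE borel_measurable_times sm s'mt s'm w) (auto elim!: eventually_mono)
    also have "\<dots> = (\<integral>t. indicator {0<..<T} t * (s' t * w t) \<partial>lborel)"
      by (rule integrable_time_iff(2)) (use s'm w in measurable)
    also have "\<dots> = (\<integral>t. s' t * w t \<partial>lborel)" by (simp only: mult.assoc[symmetric] ii)
    finally show ?thesis .
  qed
  note w_eq = this
  show ?thesis
  proof (rule that[OF i _ ae])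
    show "s' t = 0" if "t \<le> 0 \<or> T \<le> t" for t using that by (auto simp: s'_def)
  qed (rule w_eq)
qed

text \<open>The threshold is the supremum of the good times at which \<open>f\<close> is positive.
  Inserting 0 keeps this set nonempty and gives an atom that is never present the extinction time
  0.\<close>

lemma nonincreasing_threshold:
  fixes f :: "real \<Rightarrow> real"
  assumes N: "N \<in> null_sets lborel" and mono: "\<And>s t. s \<notin> N \<Longrightarrow> t \<notin> N \<Longrightarrow> 0 < s \<Longrightarrow> s < t \<Longrightarrow> t < T \<Longrightarrow> f t \<le> f s"
    and nn: "\<And>t. 0 \<le> f t" and out: "\<And>t. t \<le> 0 \<or> T \<le> t \<Longrightarrow> f t = 0" and T: "0 < T"
  obtains \<tau> where "0 \<le> \<tau>" "\<tau> \<le> T" "AE t in lborel. 0 < t \<and> t < \<tau> \<longrightarrow> 0 < f t" "AE t in lborel. \<tau> < t \<longrightarrow> f t = 0"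
proof -
  define A where "A = insert 0 {t. 0 < t \<and> t < T \<and> t \<notin> N \<and> 0 < f t}"
  have bdd: "bdd_above A" using T by (auto simp: A_def bdd_above_def intro!: exI[of _ T])
  show ?thesis
  proof (rule that[of "Sup A"])
    show "0 \<le> Sup A" by (rule cSup_upper[OF _ bdd]) (simp add: A_def)
    show "Sup A \<le> T" by (rule cSup_least) (use T in \<open>auto simp: A_def\<close>)
    show "AE t in lborel. 0 < t \<and> t < Sup A \<longrightarrow> 0 < f t"
      using AE_not_in[OF N]
    proof eventually_elim
      case (elim t)
      show ?case
      proof
        assume t: "0 < t \<and> t < Sup A"
        then obtain s where "s \<in> A" "t < s" using less_cSup_iff[OF _ bdd, of t] by (auto simp: A_def)
        then have s: "t < s" "s < T" "s \<notin> N" "0 < f s" using t by (auto simp: A_def)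
        have "f s \<le> f t" by (rule mono[OF elim s(3)]) (use t s in auto)
        then show "0 < f t" using s(4) by simp
      qed
    qed
    show "AE t in lborel. Sup A < t \<longrightarrow> f t = 0"
      using AE_not_in[OF N]
    proof eventually_elim
      case (elim t)
      show ?case
      proof
        assume t: "Sup A < t"
        have "0 \<le> Sup A" by (rule cSup_upper[OF _ bdd]) (simp add: A_def)
        then have "0 < t" using t by simp
        show "f t = 0"
        proof (rule ccontr)
          assume "f t \<noteq> 0"
          then have "0 < f t" using nn[of t] by simp
          moreover have "t < T" using out[of t] \<open>f t \<noteq> 0\<close> by (auto simp: not_le[symmetric])
          ultimately have "t \<in> A" using \<open>0 < t\<close> elim by (simp add: A_def)
          then have "t \<le> Sup A" by (rule cSup_upper[OF _ bdd])
          then show False using t by simp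
        qed
      qed
    qed
  qed
qed

text \<open>\<open>P\<close> holds positions in frame coordinates, i.e. images of initial points
  under \<open>g\<close>. Likewise \<open>trace_frame\<close> is the compatibility condition read in
  the variable \<open>y\<close>, where it concerns the right side for either sign of
  \<open>g\<close>.\<close>

locale frame_solution = flux_frame T C g \<phi> \<phi>' for T C g \<phi> \<phi>' +
  fixes P :: "real set" and u0 :: "real measure" and u :: "(real \<times> real) measure"
  assumes P_finite: "finite P" and u0: "finite_radon u0"
    and u0_sing: "AE x in sing_part lborel u0. g * x \<in> P"
    and sol: "entropy_solution T \<phi> \<phi>' C u0 u"
    and trace_frame: "AE t in time_measure T. \<forall>x0\<in>supp_measure (translate (- C * t) (u_sing T u t)).
        ess_filterlim (\<lambda>y. u_reg T u (g * y + C * t) t) at_top (g * x0) {g * x0<..}"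
    and init: "initial_trace T u0 u"
begin

lemma L_meas: "L_infty_meas T u"
  using sol by (simp add: entropy_solution_def solution_def)

lemma sections: "time_sections T u (section_at T u)"
  using L_meas unfolding L_infty_meas_def section_at_def by (metis someI_ex)

text \<open>The selected sections are finite Borel measures only for almost every time; the
  exceptional ones are replaced by the zero measure.\<close>

definition v :: "real \<Rightarrow> real measure" where
  "v t = (if finite_radon (section_at T u t) then section_at T u t else null_measure borel)"

lemma v_eq: "AE t in time_measure T. v t = section_at T u t"
proof -
  have "AE t in time_measure T. finite_radon (section_at T u t)" using sections by (simp add: time_sections_def)
  then show ?thesis by eventually_elim (simp add: v_def)
qed

sublocale strip_kernel T u v
proof (rule strip_kernel.intro)
  show "sets u = sets (restrict_space borel (strip T))" "finite_measure u"
    using L_meas by (auto simp: L_infty_meas_def)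
  show "finite_radon (v t)" for t
    by (auto simp: v_def finite_radon_def intro!: finite_measureI)
  fix z assume z: "C_Cc T z"
  have i: "integrable (time_measure T) (\<lambda>t. \<integral>x. z x t \<partial>section_at T u t)"
    and e: "(\<integral>p. z (fst p) (snd p) \<partial>u) = (\<integral>t. (\<integral>x. z x t \<partial>section_at T u t) \<partial>time_measure T)"
    using sections z by (auto simp: time_sections_def)
  have ae: "AE t in time_measure T. (\<integral>x. z x t \<partial>v t) = (\<integral>x. z x t \<partial>section_at T u t)"
    using v_eq by eventually_elim simp
  have m: "(\<lambda>t. \<integral>x. z x t \<partial>v t) \<in> borel_measurable (time_measure T)"
    by (rule time_measure_AE_measurable[OF borel_measurable_integrable[OF i] ae])
  have "integrable (time_measure T) (\<lambda>t. \<integral>x. z x t \<partial>v t)"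
    by (rule integrable_cong_AE_imp[OF i m]) (use ae in \<open>auto elim!: eventually_mono\<close>)
  moreover have "(\<integral>t. (\<integral>x. z x t \<partial>v t) \<partial>time_measure T) = (\<integral>t. (\<integral>x. z x t \<partial>section_at T u t) \<partial>time_measure T)"
    by (rule integral_cong_AE[OF m borel_measurable_integrable[OF i] ae])
  ultimately show "integrable (time_measure T) (\<lambda>t. \<integral>x. z x t \<partial>v t) \<and>
      (\<integral>p. z (fst p) (snd p) \<partial>u) = (\<integral>t. (\<integral>x. z x t \<partial>v t) \<partial>time_measure T)"
    using e by simp
qed

text \<open>All exceptional times are gathered in one predicate: at a good time the section is the
  one selected from \<open>u\<close>, and it splits into the density \<open>u_reg\<close> and the
  measure \<open>u_sing\<close>.\<close>

definition good :: "real \<Rightarrow> bool" where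
  "good t \<longleftrightarrow> 0 < t \<and> t < T \<and> section_at T u t = v t \<and>
     (\<forall>X\<in>sets borel. emeasure (v t) X = (\<integral>\<^sup>+x. ennreal (u_reg T u x t) * indicator X x \<partial>lborel) + emeasure (u_sing T u t) X)"

lemma AE_good: "AE t in time_measure T. good t"
proof -
  have "AE t in time_measure T. (\<forall>X\<in>sets borel. emeasure (v t) X = (\<integral>\<^sup>+x. ennreal (u_reg T u x t) * indicator X x \<partial>lborel) + emeasure (sing_part lborel (v t)) X)"
    using section_decomposition by (subst AE_time_iff)
  moreover have "AE t in time_measure T. 0 < t \<and> t < T"
    by (subst AE_time_iff) simp
  ultimately show ?thesis
    using v_eq by eventually_elim (auto simp: good_def u_sing_def)
qed

lemma good_sing:
  assumes "good t"
  shows "sets (u_sing T u t) = sets borel" "finite_measure (u_sing T u t)"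
proof -
  have e: "u_sing T u t = sing_part lborel (v t)" using assms by (simp add: good_def u_sing_def)
  have D: "lebesgue_decomposition lborel (v t) (ac_part lborel (v t)) (sing_part lborel (v t))"
    by (rule lebesgue_decomposition_parts[OF v_finite]) simp
  then show s: "sets (u_sing T u t) = sets borel" by (simp add: e lebesgue_decomposition_def)
  have "emeasure (v t) UNIV = emeasure (ac_part lborel (v t)) UNIV + emeasure (sing_part lborel (v t)) UNIV"
    using D by (simp add: lebesgue_decomposition_def)
  then have "emeasure (u_sing T u t) UNIV \<noteq> \<infinity>" using v_fin[of t UNIV] by (auto simp: e)
  then show "finite_measure (u_sing T u t)"
    using sets_eq_imp_space_eq[OF s] by (intro finite_measureI) simp
qed

section \<open>The regular and the singular part in frame coordinates\<close>

definition ur :: "real \<times> real \<Rightarrow> real" where "ur p = u_reg T u (fst p) (snd p) * indicator (strip T) p"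

lemma ur_borel[measurable]: "ur \<in> borel_measurable borel"
  unfolding ur_def[abs_def] by (rule u_reg_measurable)

lemma ur_integrable: "integrable lborel ur"
  unfolding ur_def[abs_def] by (rule u_reg_integrable)

lemma ur_nonneg: "0 \<le> ur p"
  using u_reg_nonneg by (simp add: ur_def indicator_def)

lemma ur_eq: "0 < t \<Longrightarrow> t < T \<Longrightarrow> ur (x, t) = u_reg T u x t"
  by (simp add: ur_def strip_def)

lemma ur_slice: "(\<lambda>x. ur (x, t)) \<in> borel_measurable borel"
proof -
  have "ur \<in> borel_measurable (borel \<Otimes>\<^sub>M borel)" using ur_borel by (simp add: borel_prod)
  from measurable_compose[OF measurable_Pair2'[of t borel borel] this] show ?thesis by simp
qed

definition S :: "(real \<Rightarrow> real \<Rightarrow> real) \<Rightarrow> real \<Rightarrow> real" where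
  "S h t = (\<integral>x. h (g * (x - C * t)) t \<partial>u_sing T u t)"

lemma bounded_on_strip:
  fixes h :: "real \<Rightarrow> real \<Rightarrow> real"
  assumes c: "continuous_on UNIV (\<lambda>p. h (fst p) (snd p))" and R: "\<And>x t. \<bar>x\<bar> \<ge> R \<Longrightarrow> h x t = 0"
  obtains B where "0 \<le> B" "\<And>x t. 0 \<le> t \<Longrightarrow> t \<le> T \<Longrightarrow> \<bar>h x t\<bar> \<le> B"
proof -
  have "compact ({-R..R} \<times> {0..T})" by (intro compact_Times compact_Icc)
  then have "bounded ((\<lambda>p. h (fst p) (snd p)) ` ({-R..R} \<times> {0..T}))"
    by (intro compact_imp_bounded compact_continuous_image continuous_on_subset[OF c]) auto
  then obtain B where B: "\<forall>y\<in>(\<lambda>p. h (fst p) (snd p)) ` ({-R..R} \<times> {0..T}). \<bar>y\<bar> \<le> B"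
    unfolding bounded_real by blast
  show ?thesis
  proof (rule that[of "\<bar>B\<bar>"])
    fix x t :: real assume t: "0 \<le> t" "t \<le> T"
    show "\<bar>h x t\<bar> \<le> \<bar>B\<bar>"
    proof (cases "\<bar>x\<bar> \<ge> R")
      case False
      then have "(x, t) \<in> {-R..R} \<times> {0..T}" using t by auto
      then have "\<bar>h x t\<bar> \<le> B" using B by force
      then show ?thesis by linarith
    qed (simp add: R)
  qed simp
qed

text \<open>The singular part is formed separately at each time, which says nothing about
  measurability in time. Its pairing is, however, the difference of two measurable ones: that with
  the whole section, by the definition of \<open>u\<close>, and that with the density, by
  Fubini.\<close>

lemma S_integrable:
  assumes c: "continuous_on UNIV (\<lambda>p. h (fst p) (snd p))" and R: "\<And>x t. \<bar>x\<bar> \<ge> R \<Longrightarrow> h x t = 0"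
  shows "integrable (time_measure T) (S h)"
proof -
  define z where "z x t = h (g * (x - C * t)) t" for x t
  have zC: "C_Cc T z" and zc: "continuous_on UNIV (\<lambda>p. z (fst p) (snd p))"
    using moving_frame_C_Cc[OF c R g_sq] unfolding z_def by auto
  obtain B where B: "0 \<le> B" "\<And>x t. 0 \<le> t \<Longrightarrow> t \<le> T \<Longrightarrow> \<bar>h x t\<bar> \<le> B" using bounded_on_strip[OF c R] by metis
  have zB: "\<bar>z x t\<bar> \<le> B" if "0 < t" "t < T" for x t using B(2)[of t] that by (simp add: z_def)
  have zm: "(\<lambda>p. z (fst p) (snd p)) \<in> borel_measurable borel" by (rule borel_measurable_continuous_onI[OF zc])
  have zs: "(\<lambda>x. z x t) \<in> borel_measurable borel" for t
    using continuous_on_compose2[OF zc, of UNIV "\<lambda>x. (x, t)"]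
    by (intro borel_measurable_continuous_onI) (simp add: continuous_on_Pair)
  define b where "b t = (\<integral>x. ur (x, t) * z x t \<partial>lborel)" for t
  have "integrable lborel (\<lambda>p. ur p * z (fst p) (snd p))"
  proof (rule Bochner_Integration.integrable_bound)
    show "integrable lborel (\<lambda>p. ur p * B)" using ur_integrable by simp
    show "(\<lambda>p. ur p * z (fst p) (snd p)) \<in> borel_measurable lborel" using zm by simp
    show "AE p in lborel. norm (ur p * z (fst p) (snd p)) \<le> norm (ur p * B)"
    proof (rule AE_I2)
      fix p :: "real \<times> real"
      show "norm (ur p * z (fst p) (snd p)) \<le> norm (ur p * B)"
      proof (cases "p \<in> strip T")
        case True
        then have "\<bar>z (fst p) (snd p)\<bar> \<le> B" by (intro zB) (auto simp: strip_def)
        then show ?thesis using B(1) by (simp add: abs_mult mult_left_mono)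
      qed (simp add: ur_def)
    qed
  qed
  then have ib: "integrable lborel b"
    using lborel_pair.integrable_snd[of "\<lambda>x t. ur (x, t) * z x t"] by (simp add: b_def[abs_def] lborel_prod case_prod_beta')
  then have ibt: "integrable (time_measure T) b"
    using integrable_time_iff(1)[of b T] integrable_mult_indicator[of "{0<..<T}" lborel b] by simp
  have iat: "integrable (time_measure T) (\<lambda>t. \<integral>x. z x t \<partial>v t)" using test[OF zC] by simp
  have ae: "AE t in time_measure T. S h t = (\<integral>x. z x t \<partial>v t) - b t"
    using AE_good
  proof eventually_elim
    case (elim t)
    then have t: "0 < t" "t < T" by (auto simp: good_def)
    let ?\<kappa> = "density lborel (\<lambda>x. ennreal (ur (x, t)))"
    have \<kappa>: "emeasure ?\<kappa> X = (\<integral>\<^sup>+x. ennreal (u_reg T u x t) * indicator X x \<partial>lborel)" if "X \<in> sets borel" for X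
      using emeasure_density[of "\<lambda>x. ennreal (ur (x, t))" lborel X] ur_slice[of t] that t by (simp add: ur_eq)
    have sum: "emeasure (v t) X = emeasure ?\<kappa> X + emeasure (u_sing T u t) X" if "X \<in> sets (v t)" for X
      using elim that \<kappa>[of X] by (simp add: good_def)
    have fin: "finite_measure ?\<kappa>"
    proof (rule finite_measureI)
      have "emeasure ?\<kappa> UNIV \<noteq> \<infinity>" using sum[of UNIV] v_fin[of t UNIV] by auto
      then show "emeasure ?\<kappa> (space ?\<kappa>) \<noteq> \<infinity>" by simp
    qed
    have i1: "integrable ?\<kappa> (\<lambda>x. z x t)"
      by (rule finite_measure.integrable_const_bound[OF fin, of _ B]) (use zB t zs in auto)
    have i2: "integrable (u_sing T u t) (\<lambda>x. z x t)"
    proof (rule finite_measure.integrable_const_bound[OF good_sing(2)[OF elim], of _ B])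
      show "(\<lambda>x. z x t) \<in> borel_measurable (u_sing T u t)"
        unfolding measurable_cong_sets[OF good_sing(1)[OF elim] refl] by (rule zs)
    qed (use zB t in auto)
    have "(\<integral>x. z x t \<partial>v t) = (\<integral>x. z x t \<partial>?\<kappa>) + (\<integral>x. z x t \<partial>u_sing T u t)"
      by (rule integral_measure_sum[OF _ _ sum i1 i2]) (use good_sing(1)[OF elim] in auto)
    also have "(\<integral>x. z x t \<partial>?\<kappa>) = b t"
      unfolding b_def by (subst integral_density) (use ur_nonneg ur_slice zs in auto)
    finally show ?case by (simp add: S_def z_def)
  qed
  have i: "integrable (time_measure T) (\<lambda>t. (\<integral>x. z x t \<partial>v t) - b t)" using iat ibt by simp
  have m: "S h \<in> borel_measurable (time_measure T)"
    by (rule time_measure_AE_measurable[OF borel_measurable_integrable[OF i] ae])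
  have "AE t in time_measure T. (\<integral>x. z x t \<partial>v t) - b t = S h t" using ae by eventually_elim simp
  then show ?thesis by (rule integrable_cong_AE_imp[OF i m])
qed

lemma S_test_integrable:
  assumes "test_fun \<eta> \<eta>1 \<eta>2"
  shows "integrable (time_measure T) (S \<eta>1)"
proof -
  obtain R where "R > 0" "\<And>x t. \<bar>x\<bar> \<ge> R \<Longrightarrow> \<eta> x t = 0 \<and> \<eta>1 x t = 0 \<and> \<eta>2 x t = 0"
    using test_fun_support[OF assms] by metis
  then show ?thesis by (intro S_integrable[OF test_fun_cont(2)[OF assms], of R]) auto
qed

definition U :: "real \<times> real \<Rightarrow> real" where "U q = ur (from_frame g C q)"

lemma U_borel[measurable]: "U \<in> borel_measurable borel"
  unfolding U_def[abs_def] by measurable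

lemma U_nonneg: "0 \<le> U q"
  by (simp add: U_def ur_nonneg)

lemma U_integrable: "integrable lborel U"
  unfolding U_def[abs_def] using integrable_from_frame[OF g_sq ur_borel, of C] ur_integrable by simp

lemma U_outside: "t \<le> 0 \<or> T \<le> t \<Longrightarrow> U (y, t) = 0"
  by (auto simp: U_def ur_def from_frame_def strip_def)

lemma U_inside: "0 < t \<Longrightarrow> t < T \<Longrightarrow> U (y, t) = u_reg T u (g * y + C * t) t"
  by (simp add: U_def ur_def from_frame_def strip_def)

text \<open>\<open>A\<close> and \<open>B\<close> stand for an entropy and its flux. The motion of
  the frame adds \<open>- g * C * \<eta>2\<close> to the time derivative, and collecting the factors
  of \<open>\<eta>2\<close> gives the flux \<open>g * (B - C * A)\<close>.\<close>

lemma frame_integral: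
  fixes A B :: "real \<Rightarrow> real"
  assumes [measurable]: "A \<in> borel_measurable borel" "B \<in> borel_measurable borel" and tf: "test_fun \<eta> \<eta>1 \<eta>2"
  shows "(\<integral>(x, t). A (u_reg T u x t) * (\<eta>1 (g * (x - C * t)) t - g * C * \<eta>2 (g * (x - C * t)) t) + B (u_reg T u x t) * (g * \<eta>2 (g * (x - C * t)) t) \<partial>lborel_strip T)
    = (\<integral>q. indicator {0<..<T} (snd q) * (A (U q) * \<eta>1 (fst q) (snd q) + (g * (B (U q) - C * A (U q))) * \<eta>2 (fst q) (snd q)) \<partial>lborel)"
proof -
  obtain R where R: "\<And>x t. \<bar>x\<bar> \<ge> R \<Longrightarrow> \<eta>1 x t = 0" "\<And>x t. \<bar>x\<bar> \<ge> R \<Longrightarrow> \<eta>2 x t = 0"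
    using test_fun_support[OF tf] by metis
  have [measurable]: "(\<lambda>p. \<eta>1 (g * (fst p - C * snd p)) (snd p)) \<in> borel_measurable borel"
    by (rule borel_measurable_continuous_onI[OF moving_frame_C_Cc(2)[OF test_fun_cont(2)[OF tf] R(1) g_sq]])
  have [measurable]: "(\<lambda>p. \<eta>2 (g * (fst p - C * snd p)) (snd p)) \<in> borel_measurable borel"
    by (rule borel_measurable_continuous_onI[OF moving_frame_C_Cc(2)[OF test_fun_cont(3)[OF tf] R(2) g_sq]])
  define K where "K p = indicator (strip T) p * (A (ur p) * (\<eta>1 (g * (fst p - C * snd p)) (snd p) - g * C * \<eta>2 (g * (fst p - C * snd p)) (snd p)) + B (ur p) * (g * \<eta>2 (g * (fst p - C * snd p)) (snd p)))" for p
  have Km: "K \<in> borel_measurable borel"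
    unfolding K_def[abs_def] using strip_sets(1) by measurable
  have "(\<integral>(x, t). A (u_reg T u x t) * (\<eta>1 (g * (x - C * t)) t - g * C * \<eta>2 (g * (x - C * t)) t) + B (u_reg T u x t) * (g * \<eta>2 (g * (x - C * t)) t) \<partial>lborel_strip T)
     = (\<integral>p. K p \<partial>lborel)"
    by (subst integral_restrict_space) (use strip_sets in \<open>auto simp: K_def ur_def indicator_def case_prod_beta' intro!: Bochner_Integration.integral_cong\<close>)
  also have "\<dots> = (\<integral>q. K (from_frame g C q) \<partial>lborel)" by (rule integral_from_frame[OF g_sq Km, symmetric])
  also have "\<dots> = (\<integral>q. indicator {0<..<T} (snd q) * (A (U q) * \<eta>1 (fst q) (snd q) + (g * (B (U q) - C * A (U q))) * \<eta>2 (fst q) (snd q)) \<partial>lborel)"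
  proof (rule Bochner_Integration.integral_cong[OF refl])
    fix q :: "real \<times> real"
    have i: "indicator (strip T) (from_frame g C q) = (indicator {0<..<T} (snd q) :: real)"
      by (simp add: strip_def from_frame_def indicator_def)
    have "g * (g * fst q + C * snd q - C * snd q) = (g * g) * fst q" by simp
    then have y: "snd (from_frame g C q) = snd q" "g * (fst (from_frame g C q) - C * snd q) = fst q"
      by (simp_all add: from_frame_def g_sq)
    show "K (from_frame g C q) = indicator {0<..<T} (snd q) * (A (U q) * \<eta>1 (fst q) (snd q) + (g * (B (U q) - C * A (U q))) * \<eta>2 (fst q) (snd q))"
      unfolding K_def i y(1) unfolding y(2) U_def by (simp add: algebra_simps)
  qed
  finally show ?thesis .
qed

lemma phi_max_borel: "(\<lambda>s. \<phi> (max 0 s)) \<in> borel_measurable borel"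
proof -
  obtain B where B: "0 \<le> B" "\<And>a b. 0 \<le> a \<Longrightarrow> 0 \<le> b \<Longrightarrow> \<bar>\<phi> a - \<phi> b\<bar> \<le> B * \<bar>a - b\<bar>"
    using has_L_infty_deriv_diff_bound[OF phi_deriv] by blast
  have "B-lipschitz_on UNIV (\<lambda>s. \<phi> (max 0 s))"
    unfolding lipschitz_on_def dist_real_def
  proof (intro conjI ballI B(1))
    fix x y :: real
    have "\<bar>\<phi> (max 0 x) - \<phi> (max 0 y)\<bar> \<le> B * \<bar>max 0 x - max 0 y\<bar>" by (rule B(2)) auto
    also have "\<dots> \<le> B * \<bar>x - y\<bar>" by (rule mult_left_mono[OF _ B(1)]) auto
    finally show "\<bar>\<phi> (max 0 x) - \<phi> (max 0 y)\<bar> \<le> B * \<bar>x - y\<bar>" .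
  qed
  then show ?thesis by (intro borel_measurable_continuous_onI lipschitz_on_continuous_on)
qed

lemma psi_borel: "\<psi> \<in> borel_measurable borel"
  unfolding \<psi>_def[abs_def] using phi_max_borel by measurable

text \<open>In the singular term the derivative \<open>zt + C * zx\<close> along the characteristic
  reduces to \<open>\<eta>1\<close>: in the frame the atoms are at rest.\<close>

lemma frame_weak:
  assumes tf: "test_fun \<eta> \<eta>1 \<eta>2" and T: "\<And>x. \<eta> x T = 0"
  shows "(\<integral>q. U q * \<eta>1 (fst q) (snd q) + \<psi> (U q) * \<eta>2 (fst q) (snd q) \<partial>lborel) + (\<integral>t. S \<eta>1 t \<partial>time_measure T)
     = - (\<integral>x. \<eta> (g * x) 0 \<partial>u0)"
proof -
  have c: "C1_C1c T (\<lambda>x t. \<eta> (g * (x - C * t)) t) (\<lambda>x t. \<eta>1 (g * (x - C * t)) t - g * C * \<eta>2 (g * (x - C * t)) t)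
     (\<lambda>x t. g * \<eta>2 (g * (x - C * t)) t)"
    by (rule moving_frame_C1_C1c[OF tf g_sq])
  have "(\<integral>(x, t). u_reg T u x t * (\<eta>1 (g * (x - C * t)) t - g * C * \<eta>2 (g * (x - C * t)) t) + \<phi> (u_reg T u x t) * (g * \<eta>2 (g * (x - C * t)) t) \<partial>lborel_strip T)
     + (\<integral>t. (\<integral>x. (\<eta>1 (g * (x - C * t)) t - g * C * \<eta>2 (g * (x - C * t)) t) + C * (g * \<eta>2 (g * (x - C * t)) t) \<partial>u_sing T u t) \<partial>time_measure T)
     = - (\<integral>x. \<eta> (g * (x - C * 0)) 0 \<partial>u0)"
    using sol c T unfolding entropy_solution_def solution_def by blast
  moreover have "(\<integral>(x, t). u_reg T u x t * (\<eta>1 (g * (x - C * t)) t - g * C * \<eta>2 (g * (x - C * t)) t) + \<phi> (u_reg T u x t) * (g * \<eta>2 (g * (x - C * t)) t) \<partial>lborel_strip T)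
     = (\<integral>q. U q * \<eta>1 (fst q) (snd q) + \<psi> (U q) * \<eta>2 (fst q) (snd q) \<partial>lborel)"
  proof -
    \<comment> \<open>The bounds on \<open>\<phi>\<close> concern nonnegative arguments. Inserting
      \<open>max 0\<close> gives a Borel function on the line with the same value at
      \<open>u_reg\<close>.\<close>
    have "(\<integral>(x, t). u_reg T u x t * (\<eta>1 (g * (x - C * t)) t - g * C * \<eta>2 (g * (x - C * t)) t) + \<phi> (u_reg T u x t) * (g * \<eta>2 (g * (x - C * t)) t) \<partial>lborel_strip T)
      = (\<integral>(x, t). u_reg T u x t * (\<eta>1 (g * (x - C * t)) t - g * C * \<eta>2 (g * (x - C * t)) t) + \<phi> (max 0 (u_reg T u x t)) * (g * \<eta>2 (g * (x - C * t)) t) \<partial>lborel_strip T)"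
      by (simp only: max_absorb2 u_reg_nonneg)
    also have "\<dots> = (\<integral>q. indicator {0<..<T} (snd q) * (U q * \<eta>1 (fst q) (snd q) + (g * (\<phi> (max 0 (U q)) - C * U q)) * \<eta>2 (fst q) (snd q)) \<partial>lborel)"
      by (rule frame_integral[OF _ phi_max_borel tf]) simp
    also have "\<dots> = (\<integral>q. U q * \<eta>1 (fst q) (snd q) + \<psi> (U q) * \<eta>2 (fst q) (snd q) \<partial>lborel)"
    proof (rule Bochner_Integration.integral_cong[OF refl])
      fix q :: "real \<times> real"
      obtain y t where q: "q = (y, t)" by (cases q)
      show "indicator {0<..<T} (snd q) * (U q * \<eta>1 (fst q) (snd q) + (g * (\<phi> (max 0 (U q)) - C * U q)) * \<eta>2 (fst q) (snd q)) = U q * \<eta>1 (fst q) (snd q) + \<psi> (U q) * \<eta>2 (fst q) (snd q)"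
      proof (cases "0 < t \<and> t < T")
        case True
        then show ?thesis using U_nonneg[of q] by (simp add: q \<psi>_def max_absorb2)
      next
        case False
        then have "U q = 0" using U_outside[of t y] by (auto simp: q)
        then show ?thesis using False psi_at_0 by (auto simp: q)
      qed
    qed
    finally show ?thesis .
  qed
  ultimately show ?thesis by (simp add: S_def[abs_def])
qed

text \<open>The slopes 1 and \<open>C\<close> at infinity turn the singular term into that of the
  weak formulation, whatever \<open>k\<close> and \<open>\<alpha>\<close> are.\<close>

lemma frame_entropy:
  assumes tf: "test_fun \<eta> \<eta>1 \<eta>2" and nn: "\<And>x t. 0 \<le> \<eta> x t" and T: "\<And>x. \<eta> x T = 0" and k: "0 \<le> k" and \<alpha>: "\<alpha> \<le> 1"
  shows "0 \<le> (\<integral>q. indicator {0<..<T} (snd q) * (kink \<alpha> k (\<lambda>s. s) (U q) * \<eta>1 (fst q) (snd q) + kink \<alpha> k \<psi> (U q) * \<eta>2 (fst q) (snd q)) \<partial>lborel)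
     + (\<integral>t. S \<eta>1 t \<partial>time_measure T) + (\<integral>x. kink \<alpha> k (\<lambda>s. s) (reg_part lborel u0 x) * \<eta> (g * x) 0 \<partial>lborel)
     + (\<integral>x. \<eta> (g * x) 0 \<partial>sing_part lborel u0)"
proof -
  let ?z = "\<lambda>x t. \<eta> (g * (x - C * t)) t" and ?zt = "\<lambda>x t. \<eta>1 (g * (x - C * t)) t - g * C * \<eta>2 (g * (x - C * t)) t"
    and ?zx = "\<lambda>x t. g * \<eta>2 (g * (x - C * t)) t"
  have c: "C1_C1c T ?z ?zt ?zx" by (rule moving_frame_C1_C1c[OF tf g_sq])
  have one: "((\<lambda>s::real. s / s) \<longlongrightarrow> 1) at_top"
    by (rule tendsto_eventually) (use eventually_gt_at_top[of "0::real"] in \<open>auto elim!: eventually_mono\<close>)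
  have "(\<integral>(x, t). kink \<alpha> k (\<lambda>s. s) (u_reg T u x t) * ?zt x t + kink \<alpha> k \<phi> (u_reg T u x t) * ?zx x t \<partial>lborel_strip T)
     + (\<integral>t. (\<integral>x. 1 * ?zt x t + C * ?zx x t \<partial>u_sing T u t) \<partial>time_measure T)
     \<ge> - (\<integral>x. kink \<alpha> k (\<lambda>s. s) (reg_part lborel u0 x) * ?z x 0 \<partial>lborel) - 1 * (\<integral>x. ?z x 0 \<partial>sing_part lborel u0)"
    using sol unfolding entropy_solution_def
  proof (elim conjE allE impE)
    show "C1_C1c T ?z ?zt ?zx \<and> (\<forall>x. ?z x T = 0) \<and> (\<forall>x. \<forall>t\<in>{0..T}. 0 \<le> ?z x t) \<and>
        convex_on {0..} (kink \<alpha> k (\<lambda>s. s)) \<and> has_L_infty_deriv (kink \<alpha> k (\<lambda>s. s)) (\<lambda>s. (if s > k then 1 else \<alpha>) * 1) \<and>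
        has_L_infty_deriv (kink \<alpha> k \<phi>) (\<lambda>s. (if s > k then 1 else \<alpha>) * \<phi>' s) \<and>
        (AE s in lebesgue_on {0<..}. (if s > k then 1 else \<alpha>) * \<phi>' s = ((if s > k then 1 else \<alpha>) * 1) * \<phi>' s) \<and>
        ((\<lambda>s. kink \<alpha> k (\<lambda>s. s) s / s) \<longlongrightarrow> 1) at_top \<and> ((\<lambda>s. kink \<alpha> k \<phi> s / s) \<longlongrightarrow> C) at_top"
      using c T nn kink_ident_convex[OF \<alpha>] has_L_infty_deriv_kink[OF has_L_infty_deriv_ident k] has_L_infty_deriv_kink[OF phi_deriv k]
        kink_slope_at_top[OF one] kink_slope_at_top[OF phi_slope] by (intro conjI) auto
  qed assumption
  moreover have "(\<integral>(x, t). kink \<alpha> k (\<lambda>s. s) (u_reg T u x t) * ?zt x t + kink \<alpha> k \<phi> (u_reg T u x t) * ?zx x t \<partial>lborel_strip T)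
    = (\<integral>q. indicator {0<..<T} (snd q) * (kink \<alpha> k (\<lambda>s. s) (U q) * \<eta>1 (fst q) (snd q) + kink \<alpha> k \<psi> (U q) * \<eta>2 (fst q) (snd q)) \<partial>lborel)"
  proof -
    have kp: "kink \<alpha> k \<phi> s = kink \<alpha> k (\<lambda>s. \<phi> (max 0 s)) s" if "0 \<le> s" for s
      using that k by (simp add: kink_def max_absorb2 max.coboundedI1)
    have "(\<integral>(x, t). kink \<alpha> k (\<lambda>s. s) (u_reg T u x t) * ?zt x t + kink \<alpha> k \<phi> (u_reg T u x t) * ?zx x t \<partial>lborel_strip T)
      = (\<integral>(x, t). kink \<alpha> k (\<lambda>s. s) (u_reg T u x t) * ?zt x t + kink \<alpha> k (\<lambda>s. \<phi> (max 0 s)) (u_reg T u x t) * ?zx x t \<partial>lborel_strip T)"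
      by (simp only: kp[OF u_reg_nonneg])
    also have "\<dots> = (\<integral>q. indicator {0<..<T} (snd q) * (kink \<alpha> k (\<lambda>s. s) (U q) * \<eta>1 (fst q) (snd q) + (g * (kink \<alpha> k (\<lambda>s. \<phi> (max 0 s)) (U q) - C * kink \<alpha> k (\<lambda>s. s) (U q))) * \<eta>2 (fst q) (snd q)) \<partial>lborel)"
    proof (rule frame_integral[OF _ _ tf])
      show "kink \<alpha> k (\<lambda>s. s) \<in> borel_measurable borel" unfolding kink_def[abs_def] by measurable
      have "(\<lambda>s. \<phi> (max 0 (max s k))) \<in> borel_measurable borel" "(\<lambda>s. \<phi> (max 0 (min s k))) \<in> borel_measurable borel"
        by (rule measurable_compose[OF _ phi_max_borel], measurable)+
      then show "kink \<alpha> k (\<lambda>s. \<phi> (max 0 s)) \<in> borel_measurable borel"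
        unfolding kink_def[abs_def] by (intro borel_measurable_add borel_measurable_times borel_measurable_diff borel_measurable_const)
    qed
    also have "\<dots> = (\<integral>q. indicator {0<..<T} (snd q) * (kink \<alpha> k (\<lambda>s. s) (U q) * \<eta>1 (fst q) (snd q) + kink \<alpha> k \<psi> (U q) * \<eta>2 (fst q) (snd q)) \<partial>lborel)"
      by (simp only: kp[OF U_nonneg, symmetric] kink_psi[OF U_nonneg k])
    finally show ?thesis .
  qed
  ultimately show ?thesis by (simp add: S_def[abs_def])
qed

section \<open>Concentration of the singular part at the initial points\<close>

lemma u0_parts:
  "sets (ac_part lborel u0) = sets borel" "sets (sing_part lborel u0) = sets borel"
  "absolutely_continuous lborel (ac_part lborel u0)" "finite_measure (ac_part lborel u0)" "finite_measure (sing_part lborel u0)"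
proof -
  have s: "sets u0 = sets borel" and f: "finite_measure u0" using u0 by (auto simp: finite_radon_def)
  have D: "lebesgue_decomposition lborel u0 (ac_part lborel u0) (sing_part lborel u0)"
    by (rule lebesgue_decomposition_parts[OF f]) (simp add: s)
  show 1: "sets (ac_part lborel u0) = sets borel" "sets (sing_part lborel u0) = sets borel"
    and "absolutely_continuous lborel (ac_part lborel u0)"
    using D s by (auto simp: lebesgue_decomposition_def)
  have "emeasure u0 UNIV = emeasure (ac_part lborel u0) UNIV + emeasure (sing_part lborel u0) UNIV"
    using D s by (simp add: lebesgue_decomposition_def)
  then have "emeasure (ac_part lborel u0) UNIV \<noteq> \<infinity>" "emeasure (sing_part lborel u0) UNIV \<noteq> \<infinity>"
    using finite_measure.emeasure_finite[OF f, of UNIV] by auto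
  then show "finite_measure (ac_part lborel u0)" "finite_measure (sing_part lborel u0)"
    using sets_eq_imp_space_eq[OF 1(1)] sets_eq_imp_space_eq[OF 1(2)] by (auto intro!: finite_measureI)
qed

lemma u0r_nonneg: "0 \<le> reg_part lborel u0 x"
  by (simp add: reg_part_def)

lemma u0r_borel[measurable]: "reg_part lborel u0 \<in> borel_measurable borel"
proof -
  have "RN_deriv lborel (ac_part lborel u0) \<in> borel_measurable borel"
    using borel_measurable_RN_deriv[of lborel "ac_part lborel u0"] by simp
  then show ?thesis unfolding reg_part_def[abs_def] by measurable
qed

lemma u0r_integrable: "integrable lborel (reg_part lborel u0)"
proof (rule integrableI_nonneg)
  have "(\<integral>\<^sup>+x. ennreal (reg_part lborel u0 x) \<partial>lborel) \<le> (\<integral>\<^sup>+x. RN_deriv lborel (ac_part lborel u0) x \<partial>lborel)"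
  proof (rule nn_integral_mono)
    fix x
    show "ennreal (reg_part lborel u0 x) \<le> RN_deriv lborel (ac_part lborel u0) x"
      unfolding reg_part_def by (cases "RN_deriv lborel (ac_part lborel u0) x") auto
  qed
  also have "\<dots> = emeasure (density lborel (RN_deriv lborel (ac_part lborel u0))) UNIV"
    using emeasure_density[of "RN_deriv lborel (ac_part lborel u0)" lborel UNIV] by simp
  also have "\<dots> = emeasure (ac_part lborel u0) UNIV"
    using sigma_finite_measure.density_RN_deriv[OF lborel.sigma_finite_measure_axioms u0_parts(3)] u0_parts(1) by simp
  also have "\<dots> < \<infinity>" using finite_measure.emeasure_finite[OF u0_parts(4), of UNIV] by (simp add: less_top)
  finally show "(\<integral>\<^sup>+x. ennreal (reg_part lborel u0 x) \<partial>lborel) < \<infinity>" .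
qed (use u0r_nonneg in auto)

text \<open>The entropies \<open>(s - k)\<^sup>+\<close> see only the singular part in the limit \<open>k \<rightarrow> \<infinity>\<close>.\<close>

lemma singular_ineq:
  assumes tf: "test_fun \<eta> \<eta>1 \<eta>2" and nn: "\<And>x t. 0 \<le> \<eta> x t" and T: "\<And>x. \<eta> x T = 0"
  shows "0 \<le> (\<integral>t. S \<eta>1 t \<partial>time_measure T) + (\<integral>x. \<eta> (g * x) 0 \<partial>sing_part lborel u0)"
proof -
  obtain L where "monotone_flux \<psi> psi_sup L" using monotone_flux_ex by blast
  then interpret F: monotone_flux \<psi> psi_sup L .
  obtain B where B: "B > 0" "\<And>x t. t \<in> {0..T} \<Longrightarrow> \<bar>\<eta> x t\<bar> \<le> B \<and> \<bar>\<eta>1 x t\<bar> \<le> B \<and> \<bar>\<eta>2 x t\<bar> \<le> B"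
    using test_fun_bounded[OF tf, of 0 T] by metis
  note [measurable] = test_fun_borel[OF tf]
  have [measurable]: "(\<lambda>q. indicator {0<..<T} (snd q) :: real) \<in> borel_measurable (borel :: (real \<times> real) measure)"
    unfolding borel_prod[symmetric] by measurable
  have [measurable]: "kink 0 k (\<lambda>s. s) \<in> borel_measurable borel" "kink 0 k \<psi> \<in> borel_measurable borel" for k
    unfolding kink_def[abs_def] by measurable
  have [measurable]: "(\<lambda>x. \<eta> (g * x) 0) \<in> borel_measurable borel"
    using measurable_compose[OF _ borel_measurable_continuous_onI[OF test_fun_slice_cont(1)[OF tf]], of "\<lambda>x. g * x" borel] by simp
  let ?X = "\<lambda>n. \<integral>q. indicator {0<..<T} (snd q) * (kink 0 (real n) (\<lambda>s. s) (U q) * \<eta>1 (fst q) (snd q) + kink 0 (real n) \<psi> (U q) * \<eta>2 (fst q) (snd q)) \<partial>lborel"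
  let ?Y = "\<lambda>n. \<integral>x. kink 0 (real n) (\<lambda>s. s) (reg_part lborel u0 x) * \<eta> (g * x) 0 \<partial>lborel"
  \<comment> \<open>At a fixed point the integrand is zero as soon as \<open>n \<ge> U q\<close>;
    the Lipschitz bound of \<open>\<psi>\<close> supplies an integrable majorant independent of
    \<open>n\<close>.\<close>
  have X: "?X \<longlonglongrightarrow> (\<integral>q. 0 \<partial>(lborel :: (real \<times> real) measure))"
  proof (rule integral_dominated_convergence[where w = "\<lambda>q. U q * B + (L * U q) * B"])
    show "integrable lborel (\<lambda>q. U q * B + (L * U q) * B)" using U_integrable by simp
    show "AE q in lborel. (\<lambda>n. indicator {0<..<T} (snd q) * (kink 0 (real n) (\<lambda>s. s) (U q) * \<eta>1 (fst q) (snd q) + kink 0 (real n) \<psi> (U q) * \<eta>2 (fst q) (snd q))) \<longlonglongrightarrow> 0"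
    proof (intro AE_I2 tendsto_eventually)
      fix q :: "real \<times> real"
      obtain n0 :: nat where n0: "U q \<le> real n0" using real_arch_simple by blast
      show "\<forall>\<^sub>F n in sequentially. indicator {0<..<T} (snd q) * (kink 0 (real n) (\<lambda>s. s) (U q) * \<eta>1 (fst q) (snd q) + kink 0 (real n) \<psi> (U q) * \<eta>2 (fst q) (snd q)) = 0"
        unfolding eventually_sequentially
      proof (intro exI[of _ n0] allI impI)
        fix n assume "n0 \<le> n"
        then have "U q \<le> real n" using n0 by linarith
        then show "indicator {0<..<T} (snd q) * (kink 0 (real n) (\<lambda>s. s) (U q) * \<eta>1 (fst q) (snd q) + kink 0 (real n) \<psi> (U q) * \<eta>2 (fst q) (snd q)) = 0"
          by (simp add: kink_0_eq_0)
      qed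
    qed
    show "AE q in lborel. norm (indicator {0<..<T} (snd q) * (kink 0 (real n) (\<lambda>s. s) (U q) * \<eta>1 (fst q) (snd q) + kink 0 (real n) \<psi> (U q) * \<eta>2 (fst q) (snd q))) \<le> U q * B + (L * U q) * B" for n
    proof (rule AE_I2)
      fix q :: "real \<times> real"
      have rhs: "0 \<le> U q * B + (L * U q) * B" using U_nonneg[of q] B(1) F.L_nonneg by simp
      show "norm (indicator {0<..<T} (snd q) * (kink 0 (real n) (\<lambda>s. s) (U q) * \<eta>1 (fst q) (snd q) + kink 0 (real n) \<psi> (U q) * \<eta>2 (fst q) (snd q))) \<le> U q * B + (L * U q) * B"
      proof (cases "snd q \<in> {0<..<T}")
        case True
        then have t: "snd q \<in> {0..T}" by auto
        have "\<bar>kink 0 (real n) (\<lambda>s. s) (U q)\<bar> \<le> 1 * U q" by (rule kink_0_bound) (use U_nonneg in auto)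
        then have "\<bar>kink 0 (real n) (\<lambda>s. s) (U q) * \<eta>1 (fst q) (snd q)\<bar> \<le> U q * B"
          unfolding abs_mult using B(2)[OF t] by (intro mult_mono) auto
        moreover have "\<bar>kink 0 (real n) \<psi> (U q)\<bar> \<le> L * U q"
          by (rule kink_0_bound) (use U_nonneg F.L_nonneg F.psi_lipschitz in auto)
        then have "\<bar>kink 0 (real n) \<psi> (U q) * \<eta>2 (fst q) (snd q)\<bar> \<le> (L * U q) * B"
          unfolding abs_mult using B(2)[OF t] by (intro mult_mono) auto
        ultimately show ?thesis using True by simp
      qed (use rhs in simp)
    qed
  qed measurable
  have Y: "?Y \<longlonglongrightarrow> (\<integral>x. 0 \<partial>(lborel :: real measure))"
  proof (rule integral_dominated_convergence[where w = "\<lambda>x. reg_part lborel u0 x * B"])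
    show "integrable lborel (\<lambda>x. reg_part lborel u0 x * B)" using u0r_integrable by simp
    show "AE x in lborel. (\<lambda>n. kink 0 (real n) (\<lambda>s. s) (reg_part lborel u0 x) * \<eta> (g * x) 0) \<longlonglongrightarrow> 0"
    proof (intro AE_I2 tendsto_eventually)
      fix x :: real
      obtain n0 :: nat where n0: "reg_part lborel u0 x \<le> real n0" using real_arch_simple by blast
      show "\<forall>\<^sub>F n in sequentially. kink 0 (real n) (\<lambda>s. s) (reg_part lborel u0 x) * \<eta> (g * x) 0 = 0"
        unfolding eventually_sequentially
      proof (intro exI[of _ n0] allI impI)
        fix n assume "n0 \<le> n"
        then have "reg_part lborel u0 x \<le> real n" using n0 by linarith
        then show "kink 0 (real n) (\<lambda>s. s) (reg_part lborel u0 x) * \<eta> (g * x) 0 = 0" by (simp add: kink_0_eq_0)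
      qed
    qed
    show "AE x in lborel. norm (kink 0 (real n) (\<lambda>s. s) (reg_part lborel u0 x) * \<eta> (g * x) 0) \<le> reg_part lborel u0 x * B" for n
    proof (rule AE_I2)
      fix x
      have "\<bar>kink 0 (real n) (\<lambda>s. s) (reg_part lborel u0 x)\<bar> \<le> 1 * reg_part lborel u0 x" by (rule kink_0_bound) (use u0r_nonneg in auto)
      then have "\<bar>kink 0 (real n) (\<lambda>s. s) (reg_part lborel u0 x)\<bar> * \<bar>\<eta> (g * x) 0\<bar> \<le> reg_part lborel u0 x * B"
        using B(2)[of 0] T_pos u0r_nonneg by (intro mult_mono) auto
      then show "norm (kink 0 (real n) (\<lambda>s. s) (reg_part lborel u0 x) * \<eta> (g * x) 0) \<le> reg_part lborel u0 x * B" by (simp add: abs_mult)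
    qed
  qed measurable
  have "0 \<le> ?X n + (\<integral>t. S \<eta>1 t \<partial>time_measure T) + ?Y n + (\<integral>x. \<eta> (g * x) 0 \<partial>sing_part lborel u0)" for n
    by (rule frame_entropy[OF tf nn T]) auto
  moreover have "(\<lambda>n. ?X n + (\<integral>t. S \<eta>1 t \<partial>time_measure T) + ?Y n + (\<integral>x. \<eta> (g * x) 0 \<partial>sing_part lborel u0))
      \<longlonglongrightarrow> 0 + (\<integral>t. S \<eta>1 t \<partial>time_measure T) + 0 + (\<integral>x. \<eta> (g * x) 0 \<partial>sing_part lborel u0)"
    using X Y by (intro tendsto_intros) auto
  ultimately have "0 \<le> 0 + (\<integral>t. S \<eta>1 t \<partial>time_measure T) + 0 + (\<integral>x. \<eta> (g * x) 0 \<partial>sing_part lborel u0)"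
    by (intro LIMSEQ_le_const) auto
  then show ?thesis by simp
qed

text \<open>A product is inserted into \<open>singular_ineq\<close>. The initial singular mass sits
  on \<open>P\<close>, so its term disappears if \<open>\<theta>\<close> vanishes at time 0 or
  \<open>f\<close> vanishes on \<open>P\<close>.\<close>

lemma frame_time_ineq:
  assumes f: "C2_with_derivs f f' f''" "\<And>x. \<bar>x\<bar> \<ge> R \<Longrightarrow> f x = 0 \<and> f' x = 0 \<and> f'' x = 0" and nn: "\<And>x. 0 \<le> f x"
    and \<theta>: "C1_with_deriv \<theta> \<theta>'" "\<And>t. 0 \<le> \<theta> t" "\<theta> T = 0" and init: "\<theta> 0 = 0 \<or> (\<forall>a\<in>P. f a = 0)"
  shows "0 \<le> (\<integral>t. S (\<lambda>x _. f x) t * \<theta>' t \<partial>time_measure T)"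
proof -
  have tf: "test_fun (\<lambda>x t. f x * \<theta> t) (\<lambda>x t. f x * \<theta>' t) (\<lambda>x t. f' x * \<theta> t)"
    by (rule test_fun.prod[OF f(1) _ \<theta>(1), of R]) (use f(2) in auto)
  have "0 \<le> (\<integral>t. S (\<lambda>x t. f x * \<theta>' t) t \<partial>time_measure T) + (\<integral>x. f (g * x) * \<theta> 0 \<partial>sing_part lborel u0)"
    by (rule singular_ineq[OF tf]) (use nn \<theta> in auto)
  moreover have "(\<integral>x. f (g * x) * \<theta> 0 \<partial>sing_part lborel u0) = 0"
    using init
  proof
    assume z: "\<forall>a\<in>P. f a = 0"
    show ?thesis by (rule integral_eq_zero_AE) (use u0_sing z in \<open>auto elim!: eventually_mono\<close>)
  qed simp
  ultimately show ?thesis by (auto simp: S_def)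
qed

lemma S_const_integrable:
  assumes f: "C2_with_derivs f f' f''" "\<And>x. \<bar>x\<bar> \<ge> R \<Longrightarrow> f x = 0 \<and> f' x = 0 \<and> f'' x = 0"
  shows "integrable (time_measure T) (S (\<lambda>x _. f x))"
proof (rule S_integrable)
  show "continuous_on UNIV (\<lambda>p::real \<times> real. f (fst p))"
    by (rule continuous_on_compose2[OF C2_with_derivs_cont(1)[OF f(1), of UNIV]]) (auto intro: continuous_intros)
qed (use f(2) in blast)

text \<open>Away from \<open>P\<close> there is no initial singular mass: the pairing is nonnegative
  and nonincreasing and, extended by zero to times before 0, it starts from zero.\<close>

lemma singular_vanishes:
  assumes f: "C2_with_derivs f f' f''" "\<And>x. \<bar>x\<bar> \<ge> R \<Longrightarrow> f x = 0 \<and> f' x = 0 \<and> f'' x = 0" and nn: "\<And>x. 0 \<le> f x"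
    and z: "\<And>a. a \<in> P \<Longrightarrow> f a = 0"
  shows "AE t in time_measure T. S (\<lambda>x _. f x) t = 0"
proof -
  obtain s where s: "integrable lborel s" "\<And>t. t \<le> 0 \<or> T \<le> t \<Longrightarrow> s t = 0"
    "AE t in lborel. 0 < t \<and> t < T \<longrightarrow> s t = S (\<lambda>x _. f x) t"
    "\<And>w. w \<in> borel_measurable borel \<Longrightarrow> (\<integral>t. S (\<lambda>x _. f x) t * w t \<partial>time_measure T) = (\<integral>t. s t * w t \<partial>lborel)"
    by (rule borel_version_time[OF S_const_integrable[OF f]]) (auto intro: that)
  have "\<exists>N\<in>null_sets lborel. \<forall>r t. r \<notin> N \<longrightarrow> t \<notin> N \<longrightarrow> - 1 < r \<longrightarrow> r < t \<longrightarrow> t < T \<longrightarrow> s t \<le> s r"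
  proof (rule weakly_nonincreasing[OF s(1)])
    fix \<theta> \<theta>' :: "real \<Rightarrow> real" and l u assume \<theta>: "C1_with_deriv \<theta> \<theta>'" "\<And>t. 0 \<le> \<theta> t" and "-1 < l" "u < T"
      and zz: "\<And>t. t < l \<or> u < t \<Longrightarrow> \<theta> t = 0"
    have "0 \<le> (\<integral>t. S (\<lambda>x _. f x) t * \<theta>' t \<partial>time_measure T)"
      by (rule frame_time_ineq[OF f nn \<theta>]) (use zz \<open>u < T\<close> z in auto)
    also have "\<dots> = (\<integral>t. s t * \<theta>' t \<partial>lborel)"
      by (rule s(4)) (intro borel_measurable_continuous_onI C1_with_deriv_cont[OF \<theta>(1)])
    finally show "0 \<le> (\<integral>t. s t * \<theta>' t \<partial>lborel)" .
  qed
  then obtain N where N: "N \<in> null_sets lborel" "\<And>r t. r \<notin> N \<Longrightarrow> t \<notin> N \<Longrightarrow> - 1 < r \<Longrightarrow> r < t \<Longrightarrow> t < T \<Longrightarrow> s t \<le> s r"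
    by blast
  have "(-1::real) < 0" by simp
  from AE_lborel_interval_obtain[OF AE_not_in[OF N(1)] this] obtain r where r: "-1 < r" "r < 0" "r \<notin> N" .
  have "AE t in lborel. 0 < t \<and> t < T \<longrightarrow> S (\<lambda>x _. f x) t = 0"
    using AE_not_in[OF N(1)] s(3)
  proof eventually_elim
    case (elim t)
    show ?case
    proof
      assume t: "0 < t \<and> t < T"
      have "s t \<le> s r" by (rule N(2)[OF r(3) elim(1) r(1)]) (use r t in auto)
      then have "S (\<lambda>x _. f x) t \<le> 0" using s(2)[of r] r elim(2) t by simp
      moreover have "0 \<le> S (\<lambda>x _. f x) t" unfolding S_def by (rule Bochner_Integration.integral_nonneg) (rule nn)
      ultimately show "S (\<lambda>x _. f x) t = 0" by simp
    qed
  qed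
  then show ?thesis by (subst AE_time_iff)
qed

lemma frame_point_iff: "g * (x - C * t) = a \<longleftrightarrow> x = g * a + C * t"
proof
  assume "g * (x - C * t) = a"
  then have "g * a = (g * g) * (x - C * t)" by auto
  then show "x = g * a + C * t" using g_sq by simp
next
  assume "x = g * a + C * t"
  then have "g * (x - C * t) = (g * g) * a" by simp
  then show "g * (x - C * t) = a" using g_sq by simp
qed

text \<open>Countably many bumps with rational centres cover the complement of \<open>P\<close> and
  vanish on \<open>P\<close>. Being countable, they share one null set of exceptional times.\<close>

lemma singular_support: "AE t in time_measure T. good t \<and> (AE x in u_sing T u t. g * (x - C * t) \<in> P)"
proof -
  \<comment> \<open>The pairs for which the bump of radius \<open>1 / Suc n\<close> about
    \<open>q\<close> vanishes at all points of \<open>P\<close>.\<close>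
  define A where "A = {(n, q). q \<in> \<rat> \<and> (\<forall>a\<in>P. 1 / real (Suc n) \<le> \<bar>a - q\<bar>)}"
  have A: "countable A"
  proof (rule countable_subset)
    show "A \<subseteq> UNIV \<times> \<rat>" by (auto simp: A_def)
    show "countable ((UNIV :: nat set) \<times> (\<rat> :: real set))" by (intro countable_SIGMA countable_rat) auto
  qed
  define F where "F = (\<lambda>(n, q) x. bump (real (Suc n) * (x - q)))"
  have F_zero: "F nq x = 0" if "nq = (n, q)" "1 / real (Suc n) \<le> \<bar>x - q\<bar>" for nq n q x
  proof -
    have "1 \<le> real (Suc n) * \<bar>x - q\<bar>" using that(2) by (simp add: field_simps)
    then have "1 \<le> \<bar>real (Suc n) * (x - q)\<bar>" by (simp only: abs_mult abs_of_nat)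
    then show ?thesis unfolding F_def that(1) by (simp add: bump_eq_0 del: of_nat_Suc)
  qed
  have "AE t in time_measure T. \<forall>nq\<in>A. S (\<lambda>x _. F nq x) t = 0"
  proof (subst AE_ball_countable[OF A], intro ballI)
    fix nq assume nqA: "nq \<in> A"
    obtain n q where nq: "nq = (n, q)" by (cases nq)
    define m where "m = real (Suc n)"
    have m: "m > 0" by (simp add: m_def)
    have d: "((\<lambda>x. m * (x - q)) has_real_derivative m) (at x)" for x by (auto intro!: derivative_eq_intros)
    have c2: "C2_with_derivs (F nq) (\<lambda>x. bump' (m * (x - q)) * m) (\<lambda>x. (bump'' (m * (x - q)) * m) * m)"
      unfolding C2_with_derivs_def F_def nq prod.case m_def[symmetric]
      by (intro conjI allI DERIV_chain2[OF DERIV_bump d] DERIV_cmult_right[OF DERIV_chain2[OF DERIV_bump' d]]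
          continuous_intros continuous_on_compose2[OF bump''_cont[of UNIV]]) auto
    show "AE t in time_measure T. S (\<lambda>x _. F nq x) t = 0"
    proof (rule singular_vanishes[OF c2])
      show "F nq x = 0 \<and> bump' (m * (x - q)) * m = 0 \<and> bump'' (m * (x - q)) * m * m = 0" if x: "\<bar>q\<bar> + 1 / m \<le> \<bar>x\<bar>" for x
      proof -
        have le: "1 / m \<le> \<bar>x - q\<bar>" using x by linarith
        then have "1 \<le> m * \<bar>x - q\<bar>" using m by (simp add: field_simps)
        then have "1 \<le> \<bar>m * (x - q)\<bar>" using m by (simp only: abs_mult abs_of_pos)
        then show ?thesis using F_zero[OF nq, of x] le by (simp add: bump'_eq_0 bump''_eq_0 m_def del: of_nat_Suc)
      qed
      show "0 \<le> F nq x" for x by (simp add: F_def nq bump_nonneg)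
      show "F nq a = 0" if "a \<in> P" for a using nqA that by (intro F_zero[OF nq]) (auto simp: A_def nq)
    qed
  qed
  then show ?thesis
    using AE_good
  proof eventually_elim
    case (elim t)
    note sg = good_sing[OF elim(2)]
    have "AE x in u_sing T u t. \<forall>nq\<in>A. F nq (g * (x - C * t)) = 0"
    proof (subst AE_ball_countable[OF A], intro ballI)
      fix nq assume nq: "nq \<in> A"
      obtain B where B: "B > 0" "\<And>x. bump x \<le> B" using bump_bounded by metis
      have Fm: "(\<lambda>x. F nq (g * (x - C * t))) \<in> borel_measurable borel"
        unfolding F_def case_prod_beta' by measurable
      have Fb: "0 \<le> F nq x" "\<bar>F nq x\<bar> \<le> B" for x unfolding F_def case_prod_beta' using B bump_nonneg by auto
      have i: "integrable (u_sing T u t) (\<lambda>x. F nq (g * (x - C * t)))"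
      proof (rule finite_measure.integrable_const_bound[OF sg(2), of _ B])
        show "(\<lambda>x. F nq (g * (x - C * t))) \<in> borel_measurable (u_sing T u t)"
          unfolding measurable_cong_sets[OF sg(1) refl] by (rule Fm)
      qed (use Fb in auto)
      have "(\<integral>x. F nq (g * (x - C * t)) \<partial>u_sing T u t) = 0" using elim(1) nq by (simp add: S_def)
      then show "AE x in u_sing T u t. F nq (g * (x - C * t)) = 0"
        by (subst (asm) integral_nonneg_eq_0_iff_AE[OF i]) (use Fb in auto)
    qed
    then have "AE x in u_sing T u t. g * (x - C * t) \<in> P"
    proof eventually_elim
      case (elim x)
      show ?case
      proof (rule ccontr)
        define y where "y = g * (x - C * t)"
        assume "g * (x - C * t) \<notin> P"
        then have yP: "y \<notin> P" by (simp add: y_def)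
        obtain \<delta> where \<delta>: "\<delta> > 0" "\<forall>b\<in>P. b \<noteq> y \<longrightarrow> \<delta> \<le> dist y b" using finite_set_avoid[OF P_finite, of y] by blast
        \<comment> \<open>\<open>y\<close> has distance at least \<open>\<delta>\<close> from
          \<open>P\<close>. A radius below \<open>\<delta> / 2\<close> and a centre within that
          radius of \<open>y\<close> keep the bump off \<open>P\<close>, while it is positive at
          \<open>y\<close>.\<close>
        obtain n where n: "1 / real (Suc n) < \<delta> / 2" using nat_approx_posE[of "\<delta> / 2"] \<delta>(1) by auto
        obtain q where q: "q \<in> \<rat>" "y < q" "q < y + 1 / real (Suc n)"
          using Rats_dense_in_real[of y "y + 1 / real (Suc n)"] by auto
        have "1 / real (Suc n) \<le> \<bar>a - q\<bar>" if "a \<in> P" for a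
        proof -
          have "\<delta> \<le> \<bar>y - a\<bar>" using \<delta>(2) that yP by (auto simp: dist_real_def)
          then show ?thesis using q n by linarith
        qed
        then have "(n, q) \<in> A" using q by (simp add: A_def)
        then have "F (n, q) y = 0" using elim by (simp add: y_def)
        moreover have "\<bar>real (Suc n) * (y - q)\<bar> < 1"
        proof -
          have "\<bar>y - q\<bar> < 1 / real (Suc n)" using q by linarith
          then have "real (Suc n) * \<bar>y - q\<bar> < 1" by (simp add: field_simps)
          then show ?thesis by (simp only: abs_mult abs_of_nat)
        qed
        ultimately show False using bump_pos[of "real (Suc n) * (y - q)"] by (simp add: F_def del: of_nat_Suc)
      qed
    qed
    then show ?case using elim(2) by simp
  qed
qed

definition atom :: "real \<Rightarrow> real \<Rightarrow> real" where
  "atom a t = measure (u_sing T u t) {g * a + C * t}"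

text \<open>The null set of times does not depend on \<open>h\<close>: the formula is applied to
  test functions, to plateaus and to indicators of arbitrary Borel sets.\<close>

lemma S_eq_atoms:
  "AE t in time_measure T. \<forall>h. (\<forall>t. (\<lambda>x. h x t) \<in> borel_measurable borel) \<longrightarrow> S h t = (\<Sum>a\<in>P. atom a t * h a t)"
  using singular_support
proof eventually_elim
  case (elim t)
  then have sg: "sets (u_sing T u t) = sets borel" "finite_measure (u_sing T u t)" using good_sing by auto
  show ?case
  proof (intro allI impI)
    fix h :: "real \<Rightarrow> real \<Rightarrow> real" assume hm: "\<forall>t. (\<lambda>x. h x t) \<in> borel_measurable borel"
    have i: "integrable (u_sing T u t) (\<lambda>x. h a t * indicator {g * a + C * t} x)" for a
      using sg finite_measure.emeasure_finite[OF sg(2)] by (auto simp: less_top intro!: integrable_mult_right integrable_real_indicator)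
    have "S h t = (\<integral>x. (\<Sum>a\<in>P. h a t * indicator {g * a + C * t} x) \<partial>u_sing T u t)"
      unfolding S_def
    proof (rule integral_cong_AE)
      have "(\<lambda>x. h (g * (x - C * t)) t) \<in> borel_measurable borel"
        using measurable_compose[OF _ hm[rule_format, of t], of "\<lambda>x. g * (x - C * t)" borel] by simp
      then show "(\<lambda>x. h (g * (x - C * t)) t) \<in> borel_measurable (u_sing T u t)"
        unfolding measurable_cong_sets[OF sg(1) refl] .
      show "(\<lambda>x. \<Sum>a\<in>P. h a t * indicator {g * a + C * t} x) \<in> borel_measurable (u_sing T u t)"
        unfolding measurable_cong_sets[OF sg(1) refl] by measurable
      have "AE x in u_sing T u t. g * (x - C * t) \<in> P" using elim by simp
      then show "AE x in u_sing T u t. h (g * (x - C * t)) t = (\<Sum>a\<in>P. h a t * indicator {g * a + C * t} x)"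
      proof eventually_elim
        case (elim x)
        \<comment> \<open>At most one summand is nonzero, the one whose point is the frame
          coordinate of \<open>x\<close>.\<close>
        have "(\<Sum>a\<in>P. h a t * indicator {g * a + C * t} x) = (\<Sum>a\<in>P. if a = g * (x - C * t) then h a t else 0)"
          by (intro sum.cong) (auto simp: indicator_def frame_point_iff[symmetric])
        then show ?case using elim P_finite by simp
      qed
    qed
    also have "\<dots> = (\<Sum>a\<in>P. h a t * measure (u_sing T u t) {g * a + C * t})"
      using i sg by (subst Bochner_Integration.integral_sum) auto
    finally show "S h t = (\<Sum>a\<in>P. atom a t * h a t)" by (simp add: atom_def mult.commute)
  qed
qed

text \<open>A plateau around \<open>a\<close> that misses the other points of \<open>P\<close>
  expresses the mass of the atom as a pairing, from which it inherits integrability and monotonicity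
  in time.\<close>

lemma atom_test_function:
  assumes a: "a \<in> P"
  obtains m where "m > 0" "AE t in time_measure T. S (\<lambda>x _. plateau a m x) t = atom a t"
proof -
  obtain \<delta> where \<delta>: "\<delta> > 0" "\<forall>b\<in>P. b \<noteq> a \<longrightarrow> \<delta> \<le> dist a b" using finite_set_avoid[OF P_finite, of a] by blast
  define m where "m = 4 / \<delta>"
  have m: "m > 0" "4 / m = \<delta>" using \<delta>(1) by (auto simp: m_def)
  have pa: "plateau a m a = 1" by (rule plateau_eq_1[OF m(1)]) (use m in simp)
  have pb: "plateau a m b = 0" if "b \<in> P" "b \<noteq> a" for b
    by (rule plateau_eq_0(1)[OF m(1)]) (use \<delta>(2) that m(2) in \<open>auto simp: dist_real_def abs_minus_commute\<close>)
  have "AE t in time_measure T. S (\<lambda>x _. plateau a m x) t = atom a t"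
    using S_eq_atoms
  proof eventually_elim
    case (elim t)
    have "S (\<lambda>x _. plateau a m x) t = (\<Sum>b\<in>P. atom b t * plateau a m b)"
      using elim plateau_borel(1)[OF m(1)] by simp
    also have "\<dots> = (\<Sum>b\<in>P. if b = a then atom a t else 0)"
      by (intro sum.cong) (auto simp: pa pb)
    finally show ?case using a P_finite by simp
  qed
  then show ?thesis using that m(1) by blast
qed

lemma atom_integrable:
  assumes a: "a \<in> P"
  shows "integrable (time_measure T) (atom a)"
proof -
  obtain m where m: "m > 0" "AE t in time_measure T. S (\<lambda>x _. plateau a m x) t = atom a t"
    by (rule atom_test_function[OF a])
  have i: "integrable (time_measure T) (S (\<lambda>x _. plateau a m x))"
    by (rule S_const_integrable[OF plateau_C2[OF m(1)] plateau_compact[OF m(1)]])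
  have ae: "AE t in time_measure T. atom a t = S (\<lambda>x _. plateau a m x) t" using m(2) by eventually_elim simp
  show ?thesis
    by (rule integrable_cong_AE_imp[OF i time_measure_AE_measurable[OF borel_measurable_integrable[OF i] ae] m(2)])
qed

text \<open>In contrast to the region away from \<open>P\<close>, \<open>\<theta>\<close> has to
  vanish at time 0, because the initial mass at \<open>a\<close> may be positive.\<close>

lemma atom_weakly_nonincreasing:
  assumes a: "a \<in> P" and \<theta>: "C1_with_deriv \<theta> \<theta>'" "\<And>t. 0 \<le> \<theta> t" "\<theta> T = 0" "\<theta> 0 = 0"
  shows "0 \<le> (\<integral>t. atom a t * \<theta>' t \<partial>time_measure T)"
proof -
  obtain m where m: "m > 0" "AE t in time_measure T. S (\<lambda>x _. plateau a m x) t = atom a t"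
    by (rule atom_test_function[OF a])
  have i: "integrable (time_measure T) (S (\<lambda>x _. plateau a m x))"
    by (rule S_const_integrable[OF plateau_C2[OF m(1)] plateau_compact[OF m(1)]])
  have \<theta>m: "\<theta>' \<in> borel_measurable (time_measure T)"
    by (intro measurable_restrict_space1 measurable_completion) (simp add: borel_measurable_continuous_onI C1_with_deriv_cont[OF \<theta>(1)])
  have "0 \<le> (\<integral>t. S (\<lambda>x _. plateau a m x) t * \<theta>' t \<partial>time_measure T)"
    by (rule frame_time_ineq[OF plateau_C2[OF m(1)] plateau_compact[OF m(1)] _ \<theta>(1-3)])
       (use plateau_bounds[OF m(1)] \<theta>(4) in auto)
  also have "\<dots> = (\<integral>t. atom a t * \<theta>' t \<partial>time_measure T)"
    by (rule integral_cong_AE)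
       (use m(2) borel_measurable_integrable[OF i] borel_measurable_integrable[OF atom_integrable[OF a]] \<theta>m in \<open>auto elim!: eventually_mono\<close>)
  finally show ?thesis .
qed

lemma S_sum_atoms:
  assumes tf: "test_fun \<eta> \<eta>1 \<eta>2"
  shows "(\<integral>t. S \<eta>1 t \<partial>time_measure T) = (\<Sum>a\<in>P. \<integral>t. atom a t * \<eta>1 a t \<partial>time_measure T)"
proof -
  obtain B where B: "B > 0" "\<And>x t. t \<in> {0..T} \<Longrightarrow> \<bar>\<eta> x t\<bar> \<le> B \<and> \<bar>\<eta>1 x t\<bar> \<le> B \<and> \<bar>\<eta>2 x t\<bar> \<le> B"
    using test_fun_bounded[OF tf, of 0 T] by metis
  have \<eta>m: "(\<lambda>t. \<eta>1 a t) \<in> borel_measurable (time_measure T)" for a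
    by (intro measurable_restrict_space1 measurable_completion)
       (simp add: borel_measurable_continuous_onI test_fun_slice_cont(2)[OF tf])
  have \<eta>x: "(\<lambda>x. \<eta>1 x t) \<in> borel_measurable borel" for t
  proof (rule borel_measurable_continuous_onI)
    show "continuous_on UNIV (\<lambda>x. \<eta>1 x t)"
      using continuous_on_compose2[OF test_fun_cont(2)[OF tf, of UNIV], of UNIV "\<lambda>x. (x, t)"]
      by (simp add: continuous_on_Pair)
  qed
  have i: "integrable (time_measure T) (\<lambda>t. atom a t * \<eta>1 a t)" if a: "a \<in> P" for a
  proof (rule Bochner_Integration.integrable_bound)
    show "integrable (time_measure T) (\<lambda>t. atom a t * B)" using atom_integrable[OF a] by simp
    show "(\<lambda>t. atom a t * \<eta>1 a t) \<in> borel_measurable (time_measure T)"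
      by (rule borel_measurable_times[OF borel_measurable_integrable[OF atom_integrable[OF a]] \<eta>m])
    show "AE t in time_measure T. norm (atom a t * \<eta>1 a t) \<le> norm (atom a t * B)"
      using B by (intro AE_I2) (auto simp: abs_mult intro!: mult_left_mono)
  qed
  have "(\<integral>t. S \<eta>1 t \<partial>time_measure T) = (\<integral>t. (\<Sum>a\<in>P. atom a t * \<eta>1 a t) \<partial>time_measure T)"
  proof (rule integral_cong_AE)
    show "S \<eta>1 \<in> borel_measurable (time_measure T)" using S_test_integrable[OF tf] by auto
    show "(\<lambda>t. \<Sum>a\<in>P. atom a t * \<eta>1 a t) \<in> borel_measurable (time_measure T)"
      by (intro borel_measurable_sum borel_measurable_integrable i)
    show "AE t in time_measure T. S \<eta>1 t = (\<Sum>a\<in>P. atom a t * \<eta>1 a t)"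
      using S_eq_atoms by eventually_elim (use \<eta>x in auto)
  qed
  also have "\<dots> = (\<Sum>a\<in>P. \<integral>t. atom a t * \<eta>1 a t \<partial>time_measure T)"
    by (rule Bochner_Integration.integral_sum[OF i])
  finally show ?thesis .
qed

lemma atom_version:
  assumes a: "a \<in> P"
  shows "\<exists>c \<tau>. integrable lborel c \<and> (\<forall>t. 0 \<le> c t) \<and> (\<forall>t. t \<le> 0 \<or> T \<le> t \<longrightarrow> c t = 0) \<and>
    (AE t in lborel. 0 < t \<and> t < T \<longrightarrow> c t = atom a t) \<and>
    (\<forall>w. w \<in> borel_measurable borel \<longrightarrow> (\<integral>t. atom a t * w t \<partial>time_measure T) = (\<integral>t. c t * w t \<partial>lborel)) \<and>
    0 \<le> \<tau> \<and> \<tau> \<le> T \<and> (AE t in lborel. 0 < t \<and> t < \<tau> \<longrightarrow> 0 < c t) \<and> (AE t in lborel. \<tau> < t \<longrightarrow> c t = 0)"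
proof -
  obtain s where s: "integrable lborel s" "\<And>t. t \<le> 0 \<or> T \<le> t \<Longrightarrow> s t = 0"
    "AE t in lborel. 0 < t \<and> t < T \<longrightarrow> s t = atom a t"
    "\<And>w. w \<in> borel_measurable borel \<Longrightarrow> (\<integral>t. atom a t * w t \<partial>time_measure T) = (\<integral>t. s t * w t \<partial>lborel)"
    by (rule borel_version_time[OF atom_integrable[OF a]]) (auto intro: that)
  \<comment> \<open>The Borel version is corrected on a null set so as to be nonnegative at every
    time, as \<open>nonincreasing_threshold\<close> demands.\<close>
  define c where "c t = max 0 (s t)" for t
  have ae: "AE t in lborel. s t = c t"
    using s(3)
  proof eventually_elim
    case (elim t)
    have "0 \<le> atom a t" by (simp add: atom_def)
    then show ?case using elim s(2)[of t] by (cases "0 < t \<and> t < T") (auto simp: c_def)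
  qed
  have ci: "integrable lborel c" unfolding c_def[abs_def] using s(1) by simp
  have cw: "(\<integral>t. atom a t * w t \<partial>time_measure T) = (\<integral>t. c t * w t \<partial>lborel)" if "w \<in> borel_measurable borel" for w
    unfolding s(4)[OF that] by (rule integral_cong_AE) (use s(1) ci that ae in \<open>auto elim!: eventually_mono\<close>)
  have "\<exists>N\<in>null_sets lborel. \<forall>r t. r \<notin> N \<longrightarrow> t \<notin> N \<longrightarrow> 0 < r \<longrightarrow> r < t \<longrightarrow> t < T \<longrightarrow> c t \<le> c r"
  proof (rule weakly_nonincreasing[OF ci])
    fix \<theta> \<theta>' :: "real \<Rightarrow> real" and l u assume \<theta>: "C1_with_deriv \<theta> \<theta>'" "\<And>t. 0 \<le> \<theta> t" and lu: "0 < l" "u < T"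
      and zz: "\<And>t. t < l \<or> u < t \<Longrightarrow> \<theta> t = 0"
    have "0 \<le> (\<integral>t. atom a t * \<theta>' t \<partial>time_measure T)"
      by (rule atom_weakly_nonincreasing[OF a \<theta>]) (use zz lu in auto)
    also have "\<dots> = (\<integral>t. c t * \<theta>' t \<partial>lborel)"
      by (rule cw) (intro borel_measurable_continuous_onI C1_with_deriv_cont[OF \<theta>(1)])
    finally show "0 \<le> (\<integral>t. c t * \<theta>' t \<partial>lborel)" .
  qed
  then obtain N where N: "N \<in> null_sets lborel" "\<And>r t. r \<notin> N \<Longrightarrow> t \<notin> N \<Longrightarrow> 0 < r \<Longrightarrow> r < t \<Longrightarrow> t < T \<Longrightarrow> c t \<le> c r"
    by blast
  have c0: "0 \<le> c t" for t by (simp add: c_def)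
  have cout: "c t = 0" if "t \<le> 0 \<or> T \<le> t" for t using s(2)[OF that] by (simp add: c_def)
  obtain \<tau> where \<tau>: "0 \<le> \<tau>" "\<tau> \<le> T" "AE t in lborel. 0 < t \<and> t < \<tau> \<longrightarrow> 0 < c t" "AE t in lborel. \<tau> < t \<longrightarrow> c t = 0"
    by (rule nonincreasing_threshold[OF N(1) N(2) c0 cout T_pos]) (auto intro: that)
  have "AE t in lborel. 0 < t \<and> t < T \<longrightarrow> c t = atom a t" using ae s(3) by eventually_elim auto
  then show ?thesis using ci c0 cout cw \<tau> by (intro exI[of _ c] exI[of _ \<tau>]) auto
qed

text \<open>A positive atom lies in the support of the translated singular part, so the
  compatibility condition applies at \<open>g * a\<close>; by \<open>g * g = 1\<close> the limit
  point in frame coordinates is \<open>a\<close> again.\<close>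

lemma trace_at_atom:
  assumes a: "a \<in> P"
  shows "AE t in lborel. 0 < t \<and> t < T \<and> 0 < atom a t \<longrightarrow> ess_filterlim (\<lambda>y. U (y, t)) at_top a {a<..}"
proof -
  have "AE t in time_measure T. 0 < atom a t \<longrightarrow> ess_filterlim (\<lambda>y. U (y, t)) at_top a {a<..}"
    using trace_frame AE_good
  proof eventually_elim
    case (elim t)
    note sg = good_sing[OF elim(2)]
    have t: "0 < t" "t < T" using elim(2) by (auto simp: good_def)
    show ?case
    proof
      assume pos: "0 < atom a t"
      have "g * a \<in> supp_measure (translate (- C * t) (u_sing T u t))"
        unfolding supp_measure_def
      proof (intro CollectI allI impI)
        fix O' :: "real set" assume O': "open O' \<and> g * a \<in> O'"
        have m: "(\<lambda>x. x + - C * t) \<in> measurable (u_sing T u t) borel"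
          unfolding measurable_cong_sets[OF sg(1) refl] by measurable
        have "emeasure (translate (- C * t) (u_sing T u t)) O' = emeasure (u_sing T u t) ((\<lambda>x. x + - C * t) -` O' \<inter> space (u_sing T u t))"
          unfolding translate_def by (rule emeasure_distr[OF m]) (use O' in auto)
        also have "\<dots> \<ge> emeasure (u_sing T u t) {g * a + C * t}"
        proof (rule emeasure_mono)
          show "{g * a + C * t} \<subseteq> (\<lambda>x. x + - C * t) -` O' \<inter> space (u_sing T u t)"
            using O' sets_eq_imp_space_eq[OF sg(1)] by simp
          show "(\<lambda>x. x + - C * t) -` O' \<inter> space (u_sing T u t) \<in> sets (u_sing T u t)"
            by (rule measurable_sets[OF m]) (use O' in auto)
        qed
        moreover have "emeasure (u_sing T u t) {g * a + C * t} \<noteq> 0"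
          using pos by (auto simp: atom_def measure_def)
        ultimately show "emeasure (translate (- C * t) (u_sing T u t)) O' \<noteq> 0" by auto
      qed
      with elim(1) have "ess_filterlim (\<lambda>y. u_reg T u (g * y + C * t) t) at_top (g * (g * a)) {g * (g * a)<..}" by blast
      moreover have "g * (g * a) = a" using g_sq by (simp add: mult.assoc[symmetric])
      moreover have "(\<lambda>y. u_reg T u (g * y + C * t) t) = (\<lambda>y. U (y, t))" using U_inside[OF t] by simp
      ultimately show "ess_filterlim (\<lambda>y. U (y, t)) at_top a {a<..}" by simp
    qed
  qed
  then have "AE t in lborel. 0 < t \<and> t < T \<longrightarrow> (0 < atom a t \<longrightarrow> ess_filterlim (\<lambda>y. U (y, t)) at_top a {a<..})"
    by (simp only: AE_time_iff)
  then show ?thesis by eventually_elim blast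
qed

section \<open>Initial trace and assembly of the transport problem\<close>

lemma nn_integral_reflect:
  assumes [measurable]: "f \<in> borel_measurable borel"
  shows "(\<integral>\<^sup>+y. f (b + g * y) \<partial>lborel) = (\<integral>\<^sup>+x. f x \<partial>lborel)"
proof -
  have "g \<noteq> 0" using g_sq by auto
  then show ?thesis
    using nn_integral_real_affine[OF assms, of g b] by (simp add: abs_eq_1[OF g_sq])
qed

text \<open>Read in the frame, the regular part at time \<open>t\<close> is close to the initial
  density shifted by \<open>C * t\<close>; the shift tends to zero and translations are continuous
  in \<open>L1\<close>.\<close>

lemma initial_frame:
  "ess_filterlim (\<lambda>t. \<integral>\<^sup>+y. ennreal \<bar>U (y, t) - reg_part lborel u0 (g * y)\<bar> \<partial>lborel) (nhds 0) 0 {0<..}"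
proof -
  let ?r = "reg_part lborel u0"
  obtain N where N: "negligible N" "filterlim (\<lambda>t. \<integral>\<^sup>+x. ennreal \<bar>u_reg T u x t - ?r x\<bar> \<partial>lborel) (nhds 0) (at 0 within ({0<..} - N))"
    using init unfolding initial_trace_def by (rule ess_filterlimE)
  have tr: "((\<lambda>t. \<integral>\<^sup>+x. ennreal \<bar>?r (x + C * t) - ?r x\<bar> \<partial>lborel) \<longlongrightarrow> 0) (at 0 within ({0<..} - N))"
  proof -
    have "((\<lambda>t. \<integral>x. \<bar>?r (x + C * t) - ?r x\<bar> \<partial>lborel) \<longlongrightarrow> 0) (at 0 within ({0<..} - N))"
    proof (rule tendstoI)
      fix e :: real assume "e > 0"
      then obtain d where d: "d > 0" "\<And>h. norm h < d \<Longrightarrow> (\<integral>x. \<bar>?r (x + h) - ?r x\<bar> \<partial>lborel) < e"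
        using L1_translation_continuous[OF u0r_integrable] by metis
      have "((\<lambda>t. C * t) \<longlongrightarrow> C * 0) (at 0 within ({0<..} - N))" by (intro tendsto_intros)
      then have "\<forall>\<^sub>F t in at 0 within ({0<..} - N). dist (C * t) (C * 0) < d" using d(1) by (rule tendstoD)
      then show "\<forall>\<^sub>F t in at 0 within ({0<..} - N). dist (\<integral>x. \<bar>?r (x + C * t) - ?r x\<bar> \<partial>lborel) 0 < e"
        by eventually_elim (use d(2) in \<open>simp add: dist_real_def\<close>)
    qed
    then have "((\<lambda>t. ennreal (\<integral>x. \<bar>?r (x + C * t) - ?r x\<bar> \<partial>lborel)) \<longlongrightarrow> ennreal 0) (at 0 within ({0<..} - N))"
      by (rule tendsto_ennrealI)
    moreover have "ennreal (\<integral>x. \<bar>?r (x + C * t) - ?r x\<bar> \<partial>lborel) = (\<integral>\<^sup>+x. ennreal \<bar>?r (x + C * t) - ?r x\<bar> \<partial>lborel)" for t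
      by (rule nn_integral_eq_integral[symmetric]) (use u0r_integrable integrable_lborel_translate[OF u0r_integrable] in auto)
    ultimately show ?thesis by simp
  qed
  have sum: "((\<lambda>t. (\<integral>\<^sup>+x. ennreal \<bar>u_reg T u x t - ?r x\<bar> \<partial>lborel) + (\<integral>\<^sup>+x. ennreal \<bar>?r (x + C * t) - ?r x\<bar> \<partial>lborel)) \<longlongrightarrow> 0 + 0) (at 0 within ({0<..} - N))"
    by (intro tendsto_add N(2) tr)
  have "((\<lambda>t. \<integral>\<^sup>+y. ennreal \<bar>U (y, t) - ?r (g * y)\<bar> \<partial>lborel) \<longlongrightarrow> 0) (at 0 within ({0<..} - N))"
  proof (rule tendsto_sandwich[OF _ _ tendsto_const])
    show "((\<lambda>t. (\<integral>\<^sup>+x. ennreal \<bar>u_reg T u x t - ?r x\<bar> \<partial>lborel) + (\<integral>\<^sup>+x. ennreal \<bar>?r (x + C * t) - ?r x\<bar> \<partial>lborel)) \<longlongrightarrow> 0) (at 0 within ({0<..} - N))"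
      using sum by simp
    have "\<forall>\<^sub>F t in at 0 within ({0<..} - N). 0 < t \<and> t < T"
      unfolding eventually_at using T_pos by (intro exI[of _ T]) (auto simp: dist_real_def)
    then show "\<forall>\<^sub>F t in at 0 within ({0<..} - N). (\<integral>\<^sup>+y. ennreal \<bar>U (y, t) - ?r (g * y)\<bar> \<partial>lborel)
      \<le> (\<integral>\<^sup>+x. ennreal \<bar>u_reg T u x t - ?r x\<bar> \<partial>lborel) + (\<integral>\<^sup>+x. ennreal \<bar>?r (x + C * t) - ?r x\<bar> \<partial>lborel)"
    proof eventually_elim
      case (elim t)
      then have t: "0 < t" "t < T" by auto
      have um[measurable]: "(\<lambda>x. u_reg T u x t) \<in> borel_measurable borel" using ur_slice[of t] by (simp add: ur_eq[OF t])
      have "(\<integral>\<^sup>+y. ennreal \<bar>U (y, t) - ?r (g * y)\<bar> \<partial>lborel)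
        \<le> (\<integral>\<^sup>+y. ennreal \<bar>u_reg T u (C * t + g * y) t - ?r (C * t + g * y)\<bar> + ennreal \<bar>?r ((0 + g * y) + C * t) - ?r (0 + g * y)\<bar> \<partial>lborel)"
      proof (rule nn_integral_mono)
        fix y
        have "\<bar>U (y, t) - ?r (g * y)\<bar> \<le> \<bar>u_reg T u (C * t + g * y) t - ?r (C * t + g * y)\<bar> + \<bar>?r ((0 + g * y) + C * t) - ?r (0 + g * y)\<bar>"
          using abs_triangle_ineq[of "u_reg T u (C * t + g * y) t - ?r (C * t + g * y)" "?r ((0 + g * y) + C * t) - ?r (0 + g * y)"]
          by (simp add: U_inside[OF t] add.commute)
        from ennreal_leI[OF this]
        show "ennreal \<bar>U (y, t) - ?r (g * y)\<bar> \<le> ennreal \<bar>u_reg T u (C * t + g * y) t - ?r (C * t + g * y)\<bar> + ennreal \<bar>?r ((0 + g * y) + C * t) - ?r (0 + g * y)\<bar>"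
          by (simp only: ennreal_plus abs_ge_zero)
      qed
      also have "\<dots> = (\<integral>\<^sup>+y. ennreal \<bar>u_reg T u (C * t + g * y) t - ?r (C * t + g * y)\<bar> \<partial>lborel) + (\<integral>\<^sup>+y. ennreal \<bar>?r ((0 + g * y) + C * t) - ?r (0 + g * y)\<bar> \<partial>lborel)"
      proof (rule nn_integral_add)
        have "(\<lambda>y. u_reg T u (C * t + g * y) t) \<in> borel_measurable borel"
          by (rule measurable_compose[OF _ um]) measurable
        then show "(\<lambda>y. ennreal \<bar>u_reg T u (C * t + g * y) t - ?r (C * t + g * y)\<bar>) \<in> borel_measurable lborel" by measurable
      qed measurable
      also have "(\<integral>\<^sup>+y. ennreal \<bar>u_reg T u (C * t + g * y) t - ?r (C * t + g * y)\<bar> \<partial>lborel) = (\<integral>\<^sup>+x. ennreal \<bar>u_reg T u x t - ?r x\<bar> \<partial>lborel)"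
        by (rule nn_integral_reflect[of "\<lambda>x. ennreal \<bar>u_reg T u x t - ?r x\<bar>" "C * t"]) measurable
      also have "(\<integral>\<^sup>+y. ennreal \<bar>?r ((0 + g * y) + C * t) - ?r (0 + g * y)\<bar> \<partial>lborel) = (\<integral>\<^sup>+x. ennreal \<bar>?r (x + C * t) - ?r x\<bar> \<partial>lborel)"
        by (rule nn_integral_reflect[of "\<lambda>x. ennreal \<bar>?r (x + C * t) - ?r x\<bar>" 0]) measurable
      finally show ?case .
    qed
  qed simp
  then show ?thesis unfolding ess_filterlim_def using N(1) by blast
qed

theorem transport_solution_exists:
  assumes L: "monotone_flux \<psi> psi_sup L"
  shows "\<exists>c \<tau>. transport_solution \<psi> psi_sup L T P (\<lambda>h. - (\<integral>x. h (g * x) \<partial>u0)) (\<lambda>y. reg_part lborel u0 (g * y)) U c \<tau> \<and>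
     (\<forall>a\<in>P. AE t in lborel. 0 < t \<and> t < T \<longrightarrow> c a t = atom a t)"
proof -
  interpret F: monotone_flux \<psi> psi_sup L by (rule L)
  obtain c0 \<tau> where c0: "\<forall>a\<in>P. integrable lborel (c0 a) \<and> (\<forall>t. 0 \<le> c0 a t) \<and> (\<forall>t. t \<le> 0 \<or> T \<le> t \<longrightarrow> c0 a t = 0) \<and>
    (AE t in lborel. 0 < t \<and> t < T \<longrightarrow> c0 a t = atom a t) \<and>
    (\<forall>w. w \<in> borel_measurable borel \<longrightarrow> (\<integral>t. atom a t * w t \<partial>time_measure T) = (\<integral>t. c0 a t * w t \<partial>lborel)) \<and>
    0 \<le> \<tau> a \<and> \<tau> a \<le> T \<and> (AE t in lborel. 0 < t \<and> t < \<tau> a \<longrightarrow> 0 < c0 a t) \<and> (AE t in lborel. \<tau> a < t \<longrightarrow> c0 a t = 0)"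
  proof -
    have "\<forall>a. \<exists>c \<tau>. a \<in> P \<longrightarrow> integrable lborel c \<and> (\<forall>t. 0 \<le> c t) \<and> (\<forall>t. t \<le> 0 \<or> T \<le> t \<longrightarrow> c t = 0) \<and>
      (AE t in lborel. 0 < t \<and> t < T \<longrightarrow> c t = atom a t) \<and>
      (\<forall>w. w \<in> borel_measurable borel \<longrightarrow> (\<integral>t. atom a t * w t \<partial>time_measure T) = (\<integral>t. c t * w t \<partial>lborel)) \<and>
      0 \<le> \<tau> \<and> \<tau> \<le> T \<and> (AE t in lborel. 0 < t \<and> t < \<tau> \<longrightarrow> 0 < c t) \<and> (AE t in lborel. \<tau> < t \<longrightarrow> c t = 0)"
      using atom_version by blast
    from choice[OF this] obtain c0 where "\<forall>a. \<exists>\<tau>. a \<in> P \<longrightarrow> integrable lborel (c0 a) \<and> (\<forall>t. 0 \<le> c0 a t) \<and> (\<forall>t. t \<le> 0 \<or> T \<le> t \<longrightarrow> c0 a t = 0) \<and>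
      (AE t in lborel. 0 < t \<and> t < T \<longrightarrow> c0 a t = atom a t) \<and>
      (\<forall>w. w \<in> borel_measurable borel \<longrightarrow> (\<integral>t. atom a t * w t \<partial>time_measure T) = (\<integral>t. c0 a t * w t \<partial>lborel)) \<and>
      0 \<le> \<tau> \<and> \<tau> \<le> T \<and> (AE t in lborel. 0 < t \<and> t < \<tau> \<longrightarrow> 0 < c0 a t) \<and> (AE t in lborel. \<tau> < t \<longrightarrow> c0 a t = 0)" ..
    from choice[OF this] show ?thesis using that by blast
  qed
  \<comment> \<open>Set to zero off \<open>P\<close>, since nonnegativity and vanishing outside the
    time interval are demanded for every \<open>a\<close>.\<close>
  define c where "c a t = (if a \<in> P then c0 a t else 0)" for a t
  have cP: "a \<in> P \<Longrightarrow> c a = c0 a" for a by (auto simp: c_def)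
  have sum_c: "(\<integral>t. S \<eta>1 t \<partial>time_measure T) = (\<Sum>a\<in>P. \<integral>t. c a t * \<eta>1 a t \<partial>lborel)" if tf: "test_fun \<eta> \<eta>1 \<eta>2" for \<eta> \<eta>1 \<eta>2
    unfolding S_sum_atoms[OF tf]
  proof (rule sum.cong[OF refl])
    fix a assume a: "a \<in> P"
    have "\<eta>1 a \<in> borel_measurable borel"
      by (rule borel_measurable_continuous_onI[OF test_fun_slice_cont(2)[OF tf, of a]])
    then show "(\<integral>t. atom a t * \<eta>1 a t \<partial>time_measure T) = (\<integral>t. c a t * \<eta>1 a t \<partial>lborel)"
      using c0 a cP[OF a] by simp
  qed
  have "transport_solution \<psi> psi_sup L T P (\<lambda>h. - (\<integral>x. h (g * x) \<partial>u0)) (\<lambda>y. reg_part lborel u0 (g * y)) U c \<tau>"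
  proof (intro transport_solution.intro L transport_solution_axioms.intro)
    show "0 < T" by (rule T_pos)
    show "finite P" by (rule P_finite)
    show "integrable lborel U" by (rule U_integrable)
    show "0 \<le> U p" for p by (rule U_nonneg)
    show "U (x, t) = 0" if "t \<le> 0 \<or> T \<le> t" for x t by (rule U_outside[OF that])
    show "integrable lborel (c a)" if "a \<in> P" for a using c0 that cP[OF that] by simp
    show "0 \<le> c a t" for a t using c0 by (simp add: c_def)
    show "c a t = 0" if "t \<le> 0 \<or> T \<le> t" for a t using c0 that by (auto simp: c_def)
    show "0 \<le> \<tau> a \<and> \<tau> a \<le> T" if "a \<in> P" for a using c0 that by simp
    show pos: "AE t in lborel. 0 < t \<and> t < \<tau> a \<longrightarrow> 0 < c a t" if "a \<in> P" for a using c0 that cP[OF that] by simp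
    show "AE t in lborel. \<tau> a < t \<longrightarrow> c a t = 0" if "a \<in> P" for a using c0 that cP[OF that] by simp
    show "(\<integral>p. U p * \<eta>1 (fst p) (snd p) + \<psi> (U p) * \<eta>2 (fst p) (snd p) \<partial>lborel) + (\<Sum>a\<in>P. \<integral>t. c a t * \<eta>1 a t \<partial>lborel) = - (\<integral>x. \<eta> (g * x) 0 \<partial>u0)"
      if tf: "test_fun \<eta> \<eta>1 \<eta>2" and "\<And>x. \<eta> x T = 0" for \<eta> \<eta>1 \<eta>2
      using frame_weak[OF tf] that(2) sum_c[OF tf] by simp
    show "0 \<le> (\<integral>p. \<bar>U p - k\<bar> * \<eta>1 (fst p) (snd p) + \<bar>\<psi> (U p) - \<psi> k\<bar> * \<eta>2 (fst p) (snd p) \<partial>lborel) + (\<Sum>a\<in>P. \<integral>t. c a t * \<eta>1 a t \<partial>lborel)"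
      if k: "0 \<le> k" and tf: "test_fun \<eta> \<eta>1 \<eta>2" and nn: "\<And>x t. 0 \<le> \<eta> x t" and z: "\<And>x t. t \<le> 0 \<or> T \<le> t \<Longrightarrow> \<eta> x t = 0" for k \<eta> \<eta>1 \<eta>2
    proof -
      have k1: "kink (-1) k (\<lambda>s. s) s = \<bar>s - k\<bar>" for s by (simp add: kink_def max_def min_def)
      \<comment> \<open>Monotonicity of \<open>\<psi>\<close> is what makes the entropy flux an
        absolute value.\<close>
      have k2: "kink (-1) k \<psi> s = \<bar>\<psi> s - \<psi> k\<bar>" for s
        using monoD[OF psi_mono, of s k] monoD[OF psi_mono, of k s] by (simp add: kink_def max_def min_def)
      note [measurable] = test_fun_borel[OF tf] psi_borel
      have im: "(\<lambda>q. indicator {0<..<T} (snd q) :: real) \<in> borel_measurable (borel :: (real \<times> real) measure)"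
        unfolding borel_prod[symmetric] by measurable
      have z0: "\<eta> (g * x) 0 = 0" "\<eta> x T = 0" for x using z by auto
      have "0 \<le> (\<integral>q. indicator {0<..<T} (snd q) * (\<bar>U q - k\<bar> * \<eta>1 (fst q) (snd q) + \<bar>\<psi> (U q) - \<psi> k\<bar> * \<eta>2 (fst q) (snd q)) \<partial>lborel)
         + (\<Sum>a\<in>P. \<integral>t. c a t * \<eta>1 a t \<partial>lborel)"
        using frame_entropy[OF tf nn z0(2) k, of "-1"] unfolding k1 k2 by (simp add: sum_c[OF tf] z0)
      also have "(\<integral>q. indicator {0<..<T} (snd q) * (\<bar>U q - k\<bar> * \<eta>1 (fst q) (snd q) + \<bar>\<psi> (U q) - \<psi> k\<bar> * \<eta>2 (fst q) (snd q)) \<partial>lborel)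
        = (\<integral>q. \<bar>U q - k\<bar> * \<eta>1 (fst q) (snd q) + \<bar>\<psi> (U q) - \<psi> k\<bar> * \<eta>2 (fst q) (snd q) \<partial>lborel)"
      proof (rule integral_cong_AE)
        show "(\<lambda>q. indicator {0<..<T} (snd q) * (\<bar>U q - k\<bar> * \<eta>1 (fst q) (snd q) + \<bar>\<psi> (U q) - \<psi> k\<bar> * \<eta>2 (fst q) (snd q))) \<in> borel_measurable lborel"
          using im by measurable
        \<comment> \<open>The test function is zero outside the strip, so its derivatives vanish
          before time 0 and after \<open>T\<close>; the two boundary times form a null set.\<close>
        show "AE q in lborel. indicator {0<..<T} (snd q) * (\<bar>U q - k\<bar> * \<eta>1 (fst q) (snd q) + \<bar>\<psi> (U q) - \<psi> k\<bar> * \<eta>2 (fst q) (snd q))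
          = \<bar>U q - k\<bar> * \<eta>1 (fst q) (snd q) + \<bar>\<psi> (U q) - \<psi> k\<bar> * \<eta>2 (fst q) (snd q)"
          using AE_lborel_snd_neq[of 0] AE_lborel_snd_neq[of T]
        proof eventually_elim
          case (elim q)
          show ?case
          proof (cases "snd q \<in> {0<..<T}")
            case False
            then have "snd q < 0 \<or> T < snd q" using elim by auto
            from F.test_fun_derivs_eq_0[OF tf z this] show ?thesis by simp
          qed simp
        qed
      qed measurable
      finally show ?thesis .
    qed
    show "AE t in lborel. 0 < t \<and> t < \<tau> a \<longrightarrow> ess_filterlim (\<lambda>x. U (x, t)) at_top a {a<..}" if a: "a \<in> P" for a
    proof -
      \<comment> \<open>Before the extinction time the mass is positive, so the trace known at
        positive atoms holds on that whole interval.\<close>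
      have "AE t in lborel. 0 < t \<and> t < T \<longrightarrow> c a t = atom a t" using c0 a cP[OF a] by simp
      then show ?thesis
        using pos[OF a] trace_at_atom[OF a]
      proof eventually_elim
        case (elim t)
        have "\<tau> a \<le> T" using c0 a by simp
        then show ?case using elim by auto
      qed
    qed
    show "(\<lambda>y. reg_part lborel u0 (g * y)) \<in> borel_measurable borel" by measurable
    show "ess_filterlim (\<lambda>t. \<integral>\<^sup>+x. ennreal \<bar>U (x, t) - reg_part lborel u0 (g * x)\<bar> \<partial>lborel) (nhds 0) 0 {0<..}"
      by (rule initial_frame)
  qed
  moreover have "\<forall>a\<in>P. AE t in lborel. 0 < t \<and> t < T \<longrightarrow> c a t = atom a t" using c0 cP by simp
  ultimately show ?thesis by blast
qed

lemma sing_eq_atoms: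
  "AE t in time_measure T. good t \<and> (\<forall>X\<in>sets borel. emeasure (u_sing T u t) X = ennreal (\<Sum>a\<in>P. atom a t * indicator X (g * a + C * t)))"
  using S_eq_atoms AE_good
proof eventually_elim
  case (elim t)
  note sg = good_sing[OF elim(2)]
  have "emeasure (u_sing T u t) X = ennreal (\<Sum>a\<in>P. atom a t * indicator X (g * a + C * t))" if X: "X \<in> sets borel" for X
  proof -
    have [measurable]: "X \<in> sets borel" by (rule X)
    have gg: "g * (g * z) = z" for z using g_sq by (simp add: mult.assoc[symmetric])
    have "S (\<lambda>y _. indicator X (g * y + C * t)) t = (\<Sum>a\<in>P. atom a t * indicator X (g * a + C * t))"
      by (rule elim(1)[rule_format]) measurable
    moreover have "S (\<lambda>y _. indicator X (g * y + C * t)) t = (\<integral>x. indicator X x \<partial>u_sing T u t)"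
      by (simp add: S_def gg)
    moreover have "\<dots> = measure (u_sing T u t) X"
      using X sg(1) sets_eq_imp_space_eq[OF sg(1)] by simp
    ultimately show ?thesis using finite_measure.emeasure_eq_measure[OF sg(2)] by simp
  qed
  then show ?case using elim(2) by blast
qed

end

section \<open>Uniqueness for both orientations of the frame\<close>

theorem frame_solution_unique:
  assumes "frame_solution T C g \<phi> \<phi>' P u0 u" "frame_solution T C g \<phi> \<phi>' P u0 u'"
  shows "u = u'"
proof -
  interpret A: frame_solution T C g \<phi> \<phi>' P u0 u by (rule assms(1))
  interpret B: frame_solution T C g \<phi> \<phi>' P u0 u' by (rule assms(2))
  obtain L where L: "monotone_flux A.\<psi> A.psi_sup L" using A.monotone_flux_ex by blast
  from A.transport_solution_exists[OF L] obtain c \<tau> where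
    c: "transport_solution A.\<psi> A.psi_sup L T P (\<lambda>h. - (\<integral>x. h (g * x) \<partial>u0)) (\<lambda>y. reg_part lborel u0 (g * y)) A.U c \<tau>"
      "\<forall>a\<in>P. AE t in lborel. 0 < t \<and> t < T \<longrightarrow> c a t = A.atom a t" by blast
  from B.transport_solution_exists[OF L] obtain d \<sigma> where
    d: "transport_solution A.\<psi> A.psi_sup L T P (\<lambda>h. - (\<integral>x. h (g * x) \<partial>u0)) (\<lambda>y. reg_part lborel u0 (g * y)) B.U d \<sigma>"
      "\<forall>a\<in>P. AE t in lborel. 0 < t \<and> t < T \<longrightarrow> d a t = B.atom a t" by blast
  interpret transport_pair A.\<psi> A.psi_sup L T P "\<lambda>h. - (\<integral>x. h (g * x) \<partial>u0)" "\<lambda>y. reg_part lborel u0 (g * y)" A.U c \<tau> B.U d \<sigma>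
    by (rule transport_pair.intro[OF c(1) d(1)])
  \<comment> \<open>Both solutions are read in the same frame, whose map preserves Lebesgue measure,
    so equality carries back to the original coordinates.\<close>
  have "AE q in lborel. A.ur (from_frame g C q) = B.ur (from_frame g C q)"
    using transport_uniqueness by (simp add: A.U_def B.U_def)
  moreover have "{p. A.ur p = B.ur p} \<in> sets borel"
    using A.ur_borel B.ur_borel by measurable
  ultimately have "AE p in lborel. A.ur p = B.ur p"
    using AE_from_frame[OF A.g_sq, of "\<lambda>p. A.ur p = B.ur p" C] by blast
  from AE_lborel_swap[OF this]
  have reg: "AE t in time_measure T. AE x in lborel. A.ur (x, t) = B.ur (x, t)"
    unfolding A.AE_time_iff by eventually_elim blast
  have "AE t in lborel. 0 < t \<and> t < T \<longrightarrow> (\<forall>a\<in>P. A.atom a t = B.atom a t)"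
  proof -
    have "AE t in lborel. 0 < t \<and> t < T \<longrightarrow> A.atom a t = B.atom a t" if a: "a \<in> P" for a
      using all_atoms_eq[OF a] c(2)[rule_format, OF a] d(2)[rule_format, OF a] by eventually_elim simp
    then have "AE t in lborel. \<forall>a\<in>P. 0 < t \<and> t < T \<longrightarrow> A.atom a t = B.atom a t"
      by (rule AE_finite_allI[OF A.P_finite])
    then show ?thesis by eventually_elim blast
  qed
  then have atoms: "AE t in time_measure T. \<forall>a\<in>P. A.atom a t = B.atom a t"
    by (simp only: A.AE_time_iff)
  \<comment> \<open>The regular density and the atoms determine the section at almost every
    time.\<close>
  have sections: "AE t in time_measure T. \<forall>X\<in>sets borel. emeasure (A.v t) X = emeasure (B.v t) X"
    using reg atoms A.sing_eq_atoms B.sing_eq_atoms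
  proof eventually_elim
    case (elim t)
    have t: "0 < t" "t < T" using elim(3) by (auto simp: A.good_def)
    show ?case
    proof
      fix X :: "real set" assume X: "X \<in> sets borel"
      have "(\<integral>\<^sup>+x. ennreal (u_reg T u x t) * indicator X x \<partial>lborel) = (\<integral>\<^sup>+x. ennreal (u_reg T u' x t) * indicator X x \<partial>lborel)"
        using elim(1) by (intro nn_integral_cong_AE) (auto simp: A.ur_eq[OF t] B.ur_eq[OF t] elim!: eventually_mono)
      moreover have "emeasure (u_sing T u t) X = emeasure (u_sing T u' t) X"
        using elim(2-4) X by simp
      ultimately show "emeasure (A.v t) X = emeasure (B.v t) X"
        using elim(3,4) X by (simp add: A.good_def B.good_def)
    qed
  qed
  show ?thesis
  proof (rule measure_eqI)
    show "sets u = sets u'" using A.u(1) B.u(1) by simp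
    fix B assume "B \<in> sets u"
    then have B: "B \<in> sets borel" "B \<subseteq> strip T" by (auto simp: A.sets_u)
    then have BT: "B \<inter> strip T = B" by blast
    \<comment> \<open>By the disintegration formula, sections that agree at almost every time give
      the same measure on the strip.\<close>
    have "emeasure u B = (\<integral>\<^sup>+t. emeasure (A.v t) {x. (x, t) \<in> B} \<partial>time_measure T)"
      using A.sliceable_borel[OF B(1)] by (simp add: A.sliceable_def BT)
    also have "\<dots> = (\<integral>\<^sup>+t. emeasure (B.v t) {x. (x, t) \<in> B} \<partial>time_measure T)"
      using sections by (intro nn_integral_cong_AE) (auto simp: A.slice_sets[OF B(1)] elim!: eventually_mono)
    also have "\<dots> = emeasure u' B"
      using B.sliceable_borel[OF B(1)] by (simp add: B.sliceable_def BT)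
    finally show "emeasure u B = emeasure u' B" .
  qed
qed

lemma ess_filterlim_reflect:
  assumes "ess_filterlim f G x0 {..<x0}"
  shows "ess_filterlim (\<lambda>y. f (- y)) G (- x0) {- x0<..}"
proof -
  obtain N where N: "negligible N" "filterlim f G (at x0 within ({..<x0} - N))"
    using assms by (rule ess_filterlimE)
  have "filterlim (\<lambda>y::real. - y) (at x0 within ({..<x0} - N)) (at (- x0) within ({- x0<..} - uminus ` N))"
    unfolding filterlim_at
  proof
    show "\<forall>\<^sub>F y in at (- x0) within ({- x0<..} - uminus ` N). - y \<in> {..<x0} - N \<and> - y \<noteq> x0"
      unfolding eventually_at_filter by (rule always_eventually) (force simp: image_iff)
    show "((\<lambda>y. - y) \<longlongrightarrow> x0) (at (- x0) within ({- x0<..} - uminus ` N))"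
      by (rule tendsto_eq_intros | simp)+
  qed
  from filterlim_compose[OF N(2) this]
  have "filterlim (\<lambda>y. f (- y)) G (at (- x0) within ({- x0<..} - uminus ` N))" .
  moreover have "negligible (uminus ` N)"
    by (rule negligible_differentiable_image_negligible[OF _ N(1)]) (auto simp: differentiable_on_def)
  ultimately show ?thesis unfolding ess_filterlim_def by blast
qed

lemma frame_solution_right:
  assumes "0 < T" "\<phi> 0 = 0" "has_L_infty_deriv \<phi> \<phi>'" "((\<lambda>s. \<phi> s / s) \<longlongrightarrow> C) at_top"
    "bounded ((\<lambda>s. \<phi> s - C * s) ` {0<..})" "mono_on {0<..} (\<lambda>s. \<phi> s - C * s)"
    "finite P" "finite_radon u0" "AE x in sing_part lborel u0. x \<in> P"
    "entropy_solution T \<phi> \<phi>' C u0 u" "right_compat T C u" "initial_trace T u0 u"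
  shows "frame_solution T C 1 \<phi> \<phi>' P u0 u"
  using assms
  by (intro frame_solution.intro flux_frame.intro frame_solution_axioms.intro)
     (auto simp: right_compat_def)

text \<open>With \<open>g = -1\<close> the relative flux becomes nondecreasing, the points are
  reflected, and left limits turn into right limits.\<close>

lemma frame_solution_left:
  assumes "0 < T" "\<phi> 0 = 0" "has_L_infty_deriv \<phi> \<phi>'" "((\<lambda>s. \<phi> s / s) \<longlongrightarrow> C) at_top"
    "bounded ((\<lambda>s. \<phi> s - C * s) ` {0<..})" "antimono_on {0<..} (\<lambda>s. \<phi> s - C * s)"
    "finite P" "finite_radon u0" "AE x in sing_part lborel u0. x \<in> P"
    "entropy_solution T \<phi> \<phi>' C u0 u" "left_compat T C u" "initial_trace T u0 u"
  shows "frame_solution T C (- 1) \<phi> \<phi>' (uminus ` P) u0 u"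
proof (intro frame_solution.intro flux_frame.intro frame_solution_axioms.intro assms)
  show "- 1 * - 1 = (1::real)" by simp
  show "mono_on {0<..} (\<lambda>s. - 1 * (\<phi> s - C * s))"
  proof (rule mono_onI)
    fix r s :: real assume "r \<in> {0<..}" "s \<in> {0<..}" "r \<le> s"
    with assms(6) have "\<phi> s - C * s \<le> \<phi> r - C * r" unfolding monotone_on_def by blast
    then show "- 1 * (\<phi> r - C * r) \<le> - 1 * (\<phi> s - C * s)" by (simp add: algebra_simps)
  qed
  show "finite (uminus ` P)" using assms(7) by simp
  show "AE x in sing_part lborel u0. - 1 * x \<in> uminus ` P"
    using assms(9) by eventually_elim auto
  show "AE t in time_measure T. \<forall>x0\<in>supp_measure (translate (- C * t) (u_sing T u t)).
      ess_filterlim (\<lambda>y. u_reg T u (- 1 * y + C * t) t) at_top (- 1 * x0) {- 1 * x0<..}"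
    using assms(11) unfolding left_compat_def
  proof eventually_elim
    case (elim t)
    show ?case
    proof
      fix x0 assume "x0 \<in> supp_measure (translate (- C * t) (u_sing T u t))"
      with elim have "ess_filterlim (\<lambda>x. u_reg T u (x + C * t) t) at_top x0 {..<x0}" by blast
      from ess_filterlim_reflect[OF this]
      show "ess_filterlim (\<lambda>y. u_reg T u (- 1 * y + C * t) t) at_top (- 1 * x0) {- 1 * x0<..}" by simp
    qed
  qed
qed

theorem theorem3p11:
  fixes T C :: real and \<phi> \<phi>' :: "real \<Rightarrow> real" and u0 :: "real measure"
    and N :: nat and c p :: "nat \<Rightarrow> real"
  assumes "T > 0"
    and "continuous_on {0..} \<phi>" and "\<phi> 0 = 0"
    and "has_L_infty_deriv \<phi> \<phi>'"
    and "((\<lambda>s. \<phi> s / s) \<longlongrightarrow> C) at_top"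
    and "bounded ((\<lambda>s. \<phi> s - C * s) ` {0<..})"
    and "mono_on {0<..} (\<lambda>s. \<phi> s - C * s) \<or> antimono_on {0<..} (\<lambda>s. \<phi> s - C * s)"
    and "finite_radon u0"
    and "\<And>l. l \<in> {1..N} \<Longrightarrow> c l \<ge> 0"
    and "\<And>A. A \<in> sets borel \<Longrightarrow> emeasure (sing_part lborel u0) A
           = (\<Sum>l = 1..N. ennreal (c l) * emeasure (return borel (p l)) A)"
  shows "(mono_on {0<..} (\<lambda>s. \<phi> s - C * s) \<longrightarrow>
            (\<exists>\<^sub>\<le>\<^sub>1 u. entropy_solution T \<phi> \<phi>' C u0 u \<and> right_compat T C u \<and> initial_trace T u0 u)) \<and>
         (antimono_on {0<..} (\<lambda>s. \<phi> s - C * s) \<longrightarrow>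
            (\<exists>\<^sub>\<le>\<^sub>1 u. entropy_solution T \<phi> \<phi>' C u0 u \<and> left_compat T C u \<and> initial_trace T u0 u))"
proof -
  \<comment> \<open>Points may coincide or carry no mass; what matters is that the set of locations
    is finite and carries the initial singular part.\<close>
  define P where "P = p ` {1..N}"
  have P: "finite P" by (simp add: P_def)
  have Pm: "UNIV - P \<in> sets borel"
    using borel_closed[OF finite_imp_closed[OF P]] by (intro sets.Diff) auto
  have "sets (sing_part lborel u0) = sets borel"
    using lebesgue_decomposition_parts[of u0 lborel] assms(8)
    by (auto simp: finite_radon_def lebesgue_decomposition_def)
  moreover have "emeasure (sing_part lborel u0) (UNIV - P) = 0"
    unfolding assms(10)[OF Pm] emeasure_return[OF Pm] by (intro sum.neutral ballI) (auto simp: P_def)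
  ultimately have "UNIV - P \<in> null_sets (sing_part lborel u0)" using Pm by (intro null_setsI) auto
  from AE_not_in[OF this] have AE_P: "AE x in sing_part lborel u0. x \<in> P" by simp
  note fs = assms(1) assms(3-6) _ P assms(8) AE_P
  show ?thesis
    using frame_solution_unique[OF frame_solution_right[OF fs] frame_solution_right[OF fs]]
      frame_solution_unique[OF frame_solution_left[OF fs] frame_solution_left[OF fs]]
    unfolding Uniq_def by blast
qed

end
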